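(* The groupoid of boundary braids decomposes as a semidirect product $$\mathrm{Braid}_n(\cdot,\cdot)\cong \mathrm{Fix}_n(\cdot)\rtimes\mathrm{Move}_n(\cdot,\cdot)$$ of the subgroupoid of fix braids and the subgroupoid of move braids. Specifically, for all $B,B'\subseteq[n]$ with $|B|=|B'|$: (1) every $\beta\in\mathrm{Braid}_n(B,B')$ decomposes uniquely as $\beta=\varphi\mu$ with $\varphi\in\mathrm{Fix}_n(B)$ and $\mu\in\mathrm{Move}_n(B,B')$; (2) if $\varphi\mu=\mu'\varphi'$ with $\mu,\mu'\in\mathrm{Move}_n(B,B')$, $\varphi\in\mathrm{Fix}_n(B)$ and $\varphi'\in\mathrm{Fix}_n(B')$, then $\mu=\mu'$.
   Context: Braids. Fix an integer $n\ge 3$ and write $[n]=\{1,\dots,n\}$; elements of $[n]$ are read modulo $n$ (so $n+1=1$). Let $p_j=e^{2\pi \sqrt{-1}\, j/n}\in\mathbb{C}$, $P=\{p_1,\dots,p_n\}$, $P_A=\{p_a: a\in A\}$ for $A\subseteq[n]$, and let $D$ be the convex hull of $P$. $\mathrm{UConf}_n(D)$ is the space of $n$-element subsets of $D$ (the quotient of the space of $n$-tuples of distinct points of $D$ by the symmetric group), and $\mathrm{Braid}_n=\pi_1(\mathrm{UConf}_n(D),P)$. A representative of a braid $\beta$ is a loop $f$ with $\beta=[f]$; the product $\alpha\beta$ is represented by first following $\alpha$, then $\beta$. The strand $f^i\colon[0,1]\to D$ of $f$ is the path followed by the point that starts at $p_i$. For $B,B'\subseteq[n]$ of equal size, $\beta$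 is a $(B,B')$-boundary braid if all its strands starting in $P_B$ end in $P_{B'}$ and it has a representative $f$ such that $f^b$ stays in $\partial D$ for all $b\in B$ simultaneously; it is a $(B,\cdot)$-boundary braid if this holds for some $B'$. The corresponding sets are $\mathrm{Braid}_n(B,B')$ and $\mathrm{Braid}_n(B,\cdot)$. $\mathrm{Fix}_n(B)$ is the subgroup of braids having a representative $f$ with $f^b$ constant for all $b\in B$. Groupoids. The groupoid of boundary braids $\mathrm{Braid}_n(\cdot,\cdot)$ has as objects the subsets of $[n]$; the morphisms from $B$ to $B'$ are $\mathrm{Braid}_n(B,B')$ if $|B|=|B'|$ and there are none otherwise; composition is the product of braids ($\mathrm{Braid}_n(B,B')\times\mathrm{Braid}_n(B',B'')\to\mathrm{Braid}_n(B,B'')$, $(\beta,\beta')\mapsto\beta\beta'$). The groupoid of fix braids $\mathrm{Fix}_n(\cdot)$ has the same objects; the morphisms from $B$ to $B'$ are $\mathrm{Fix}_n(B)$ if $B=B'$ and there are none otherwise. The groupoid of move braids $\mathrm{Move}_n(\cdot,\cdot)$ has the same objects and morphisms $\mathrm{Move}_n(B,B')=\mathrm{Move}_n(B,\cdot)\cap\mathrm{Braid}_n(B,B')$, with $\mathrm{Move}_n(B,\cdot)$ defined below. That a groupoid is the (internal) semidirect product of two subgroupoids with the same objects, the first having only morphisms from objects to themselves, means here that properties (1) and (2) of the claim hold. Dual simple braids. A partition $\pi$ of $[n]$ is noncrossing if the convex hulls of the sets $P_A$, $A$ a block of $\pi$, are pairwise disjoint. $\mathrm{NC}_n$ is the set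 of noncrossing partitions ordered by refinement; $\mathrm{NC}_n^*$ is $\mathrm{NC}_n$ without the discrete partition. For $A\subseteq[n]$ with $|A|\ge 2$ the rotation braid $\delta_A$ is represented by the loop fixing $p_i$ for $i\notin A$ and moving simultaneously every $p_i$, $i\in A$, counterclockwise along $\partial D_A$ to the next point of $P_A$, where $D_A$ is the convex hull of $P_A$ if $|A|\geq 3$ and a thin bigon around the segment joining the two points if $|A|=2$ (having the segment itself as one side if it lies in $\partial D$). $\delta_A=1$ if $|A|\le 1$. Put $\delta_\pi=\prod_{A\in\pi}\delta_A$ (the factors commute); $\pi\mapsto\delta_\pi$ is injective. Complex of boundary braids. $\mathrm{Cplx}(\mathrm{Braid}_n)$ is the flag complex of the right Cayley graph of $\mathrm{Braid}_n$ with respect to $\{\delta_\pi:\pi\in\mathrm{NC}_n^*\}$; the edge from $\beta$ to $\beta\delta_\pi$ is oriented this way and labeled $\pi$. $\mathrm{Cplx}(\mathrm{Braid}_n(B,\cdot))$ is its full subcomplex on the vertex set $\mathrm{Braid}_n(B,\cdot)$. For $B'\subseteq[n]$, $\mathrm{NC}_n(B',\cdot)$ is the set of $\pi\in\mathrm{NC}_n$ such that every $b\in B'$ either forms a singleton block of $\pi$ or shares a block with $b+1$ (equivalently $\delta_\pi$ is a $(B',\cdot)$-boundary braid). For $\pi\in\mathrm{NC}_n(B',\cdot)$ let $\mathrm{Fix}^{B'}(\pi)$ be obtained from $\pi$ by making every $b\in B'$ a singleton block, and let $\mathrm{Move}^{B'}(\pi)$ be the noncrossing partition $\pi'$ with $\delta_{\pi'}=\delta_{\mathrm{Fix}^{B'}(\pi)}^{-1}\delta_\pi$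 (it exists). Configuration space of a cycle. Let $1\le k\le n$. $\mathbb{R}^k$ is given the simplicial structure with vertex set $\mathbb{Z}^k$ and simplices $[x,x+\mathbf 1_{C_1},\dots,x+\mathbf 1_{C_\ell}]$ with $\emptyset\ne C_1\subsetneq\dots\subsetneq C_\ell\subseteq[k]$, where $\mathbf 1_C$ is the $0/1$ indicator vector of $C$. This induces a cell structure on $\mathbb{R}^k/(n\mathbb{Z})^k=(\Gamma_n)^k$, where $\Gamma_n=\mathbb{R}/n\mathbb{Z}$ is the oriented $n$-cycle. The subcomplex of simplices disjoint from the thick diagonal (tuples with two equal entries), modulo the symmetric group on $[k]$, is $\mathrm{UConf}_k(\Gamma_n)$ (orthoscheme version). Thus its vertices are the $k$-element subsets of $[n]$, and the edges out of a vertex $B'$ correspond to nonempty $C\subseteq B'$ with $(C+1)\cap(B'\setminus C)=\emptyset$, ending at $(B'\setminus C)\cup(C+1)$. Move braids. Let $B\ne\emptyset$. The map $\mathrm{bdry}^B\colon \mathrm{Cplx}(\mathrm{Braid}_n(B,\cdot))\to\mathrm{UConf}_{|B|}(\Gamma_n)$ sends $\beta\in\mathrm{Braid}_n(B,B')$ to $B'$ and an edge out of $\beta$ labeled $\pi$ to the edge out of $B'$ given by $C=\{b\in B':\{b\}\text{ is not a block of }\pi\}$ (to the vertex $B'$ if $C=\emptyset$). Let $\mathrm{cov}\colon\widetilde{\mathrm{UConf}}_{|B|}(\Gamma_n)\to\mathrm{UConf}_{|B|}(\Gamma_n)$ be the universal cover with a base vertex $V_0$ over $B$. There is a unique map of complexes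 $\mathrm{split}^B\colon\widetilde{\mathrm{UConf}}_{|B|}(\Gamma_n)\to\mathrm{Cplx}(\mathrm{Braid}_n(B,\cdot))$ with $\mathrm{bdry}^B\circ\mathrm{split}^B=\mathrm{cov}$, $\mathrm{split}^B(V_0)=1$, and such that every edge of its image starting in a vertex of $\mathrm{Braid}_n(B,B')$ has a label $\pi\in\mathrm{NC}_n(B',\cdot)$ with $\mathrm{Move}^{B'}(\pi)=\pi$. $\mathrm{Move}_n(B,\cdot)$ is the vertex set of its image. For $B=\emptyset$ the configuration space of $0$ points is a single vertex and $\mathrm{Move}_n(\emptyset,\cdot)=\{1\}$. *)

theory Defs
  imports "HOL-Analysis.Analysis" "HOL-Algebra.Group"
begin

section \<open>Configuration spaces of the polygon and the braid group\<close>

definition vtx :: "nat \<Rightarrow> nat \<Rightarrow> complex" where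
  "vtx n j = cis (2 * pi * real j / real n)"

definition polygon :: "nat \<Rightarrow> complex set" where
  "polygon n = convex hull (vtx n ` {1..n})"

definition nxt :: "nat \<Rightarrow> nat \<Rightarrow> nat" where
  "nxt n j = (if j = n then 1 else Suc j)"

definition quotient_topology :: "'a topology \<Rightarrow> ('a \<Rightarrow> 'b) \<Rightarrow> 'b topology" where
  "quotient_topology X q =
     topology (\<lambda>U. U \<subseteq> q ` topspace X \<and> openin X {x \<in> topspace X. q x \<in> U})"

lemma openin_quotient_topology:
  "openin (quotient_topology X q) U \<longleftrightarrow>
     U \<subseteq> q ` topspace X \<and> openin X {x \<in> topspace X. q x \<in> U}"
proof -
  have "istopology (\<lambda>U. U \<subseteq> q ` topspace X \<and> openin X {x \<in> topspace X. q x \<in> U})"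
    unfolding istopology_def
  proof (intro conjI allI impI)
    fix S T
    assume S: "S \<subseteq> q ` topspace X \<and> openin X {x \<in> topspace X. q x \<in> S}"
      and T: "T \<subseteq> q ` topspace X \<and> openin X {x \<in> topspace X. q x \<in> T}"
    have "{x \<in> topspace X. q x \<in> S \<inter> T}
        = {x \<in> topspace X. q x \<in> S} \<inter> {x \<in> topspace X. q x \<in> T}" by auto
    with S T show "openin X {x \<in> topspace X. q x \<in> S \<inter> T}" by auto
    from S show "S \<inter> T \<subseteq> q ` topspace X" by auto
  next
    fix K
    assume K: "\<forall>S\<in>K. S \<subseteq> q ` topspace X \<and> openin X {x \<in> topspace X. q x \<in> S}"
    have "{x \<in> topspace X. q x \<in> \<Union>K} = (\<Union>S\<in>K. {x \<in> topspace X. q x \<in> S})" by auto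
    with K show "openin X {x \<in> topspace X. q x \<in> \<Union>K}" by auto
    from K show "\<Union>K \<subseteq> q ` topspace X" by auto
  qed
  then show ?thesis
    by (simp add: quotient_topology_def topology_inverse')
qed

lemma topspace_quotient_topology [simp]:
  "topspace (quotient_topology X q) = q ` topspace X"
proof
  show "topspace (quotient_topology X q) \<subseteq> q ` topspace X"
    by (metis openin_quotient_topology openin_topspace)
  have "{x \<in> topspace X. q x \<in> q ` topspace X} = topspace X" by auto
  then have "openin (quotient_topology X q) (q ` topspace X)"
    by (simp add: openin_quotient_topology)
  then show "q ` topspace X \<subseteq> topspace (quotient_topology X q)"
    by (rule openin_subset)
qed

definition Conf :: "nat \<Rightarrow> (nat \<Rightarrow> complex) topology" where
  "Conf n = subtopology (product_topology (\<lambda>_. top_of_set (polygon n)) {1..n})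
              {x. inj_on x {1..n}}"

definition UConf :: "nat \<Rightarrow> complex set topology" where
  "UConf n = quotient_topology (Conf n) (\<lambda>x. x ` {1..n})"

definition braid_loops :: "nat \<Rightarrow> (real \<Rightarrow> complex set) set" where
  "braid_loops n = {f. pathin (UConf n) f \<and> f 0 = vtx n ` {1..n} \<and> f 1 = vtx n ` {1..n}}"

definition loop_homotopy :: "nat \<Rightarrow> ((real \<Rightarrow> complex set) \<times> (real \<Rightarrow> complex set)) set" where
  "loop_homotopy n = {(f, g). f \<in> braid_loops n \<and> g \<in> braid_loops n \<and>
     homotopic_with (\<lambda>h. h 0 = vtx n ` {1..n} \<and> h 1 = vtx n ` {1..n})
       (top_of_set {0..1}) (UConf n) f g}"

definition braid_class :: "nat \<Rightarrow> (real \<Rightarrow> complex set) \<Rightarrow> (real \<Rightarrow> complex set) set" where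
  "braid_class n f = loop_homotopy n `` {f}"

definition concat_loops :: "(real \<Rightarrow> 'a) \<Rightarrow> (real \<Rightarrow> 'a) \<Rightarrow> real \<Rightarrow> 'a" where
  "concat_loops f g = (\<lambda>t. if t \<le> 1/2 then f (2 * t) else g (2 * t - 1))"

definition Braid :: "nat \<Rightarrow> (real \<Rightarrow> complex set) set monoid" where
  "Braid n = \<lparr>carrier = braid_loops n // loop_homotopy n,
     mult = (\<lambda>\<alpha> \<beta>. \<Union>f\<in>\<alpha>. \<Union>g\<in>\<beta>. braid_class n (concat_loops f g)),
     one = braid_class n (\<lambda>_. vtx n ` {1..n})\<rparr>"


section \<open>Boundary braids and fix braids\<close>

text \<open>If \<open>F\<close> satisfies the following predicate then \<open>\<lambda>t. F t i\<close> is the strand of the loop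
  \<open>f\<close> starting in the \<open>i\<close>-th vertex.\<close>

definition strands :: "nat \<Rightarrow> (real \<Rightarrow> complex set) \<Rightarrow> (real \<Rightarrow> nat \<Rightarrow> complex) \<Rightarrow> bool" where
  "strands n f F \<longleftrightarrow> pathin (Conf n) F \<and> (\<forall>t\<in>{0..1}. F t ` {1..n} = f t) \<and>
     (\<forall>i\<in>{1..n}. F 0 i = vtx n i)"

definition boundary_braids :: "nat \<Rightarrow> nat set \<Rightarrow> nat set \<Rightarrow> (real \<Rightarrow> complex set) set set" where
  "boundary_braids n B B' = {\<beta> \<in> carrier (Braid n). card B = card B' \<and>
     (\<exists>f\<in>\<beta>. \<exists>F. strands n f F \<and> (\<forall>b\<in>B. F 1 b \<in> vtx n ` B') \<and>
        (\<forall>b\<in>B. \<forall>t\<in>{0..1}. F t b \<in> frontier (polygon n)))}"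

definition boundary_braids_from :: "nat \<Rightarrow> nat set \<Rightarrow> (real \<Rightarrow> complex set) set set" where
  "boundary_braids_from n B = (\<Union>B'\<in>Pow {1..n}. boundary_braids n B B')"

definition fix_braids :: "nat \<Rightarrow> nat set \<Rightarrow> (real \<Rightarrow> complex set) set set" where
  "fix_braids n B = {\<beta> \<in> carrier (Braid n).
     \<exists>f\<in>\<beta>. \<exists>F. strands n f F \<and> (\<forall>b\<in>B. \<forall>t\<in>{0..1}. F t b = vtx n b)}"


section \<open>Dual simple braids\<close>

definition noncrossing :: "nat \<Rightarrow> nat set set set" where
  "noncrossing n = {\<pi>. partition_on {1..n} \<pi> \<and>
     (\<forall>A\<in>\<pi>. \<forall>A'\<in>\<pi>. A \<noteq> A' \<longrightarrow> convex hull (vtx n ` A) \<inter> convex hull (vtx n ` A') = {})}"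

definition discrete_partition :: "nat \<Rightarrow> nat set set" where
  "discrete_partition n = (\<lambda>i. {i}) ` {1..n}"

definition next_in :: "nat \<Rightarrow> nat set \<Rightarrow> nat \<Rightarrow> nat" where
  "next_in n A a = (nxt n ^^ (LEAST m. 0 < m \<and> (nxt n ^^ m) a \<in> A)) a"

text \<open>For \<open>card A = 2\<close> the two points travel on the two sides of a bigon. A side is a parabolic
  arc bulging to the right of the direction of travel, so that the motion is counterclockwise,
  unless it is an edge of the polygon traversed counterclockwise (then the right-hand side is
  outside of the polygon, and the side is that edge). At its ends the arc makes the angle
  \<open>arctan (1 / n) < pi / n\<close> with the chord, and \<open>pi / n\<close> is the smallest
  angle between two chords of the polygon with a common endpoint. Hence the arc lies in the polygon
  and meets no further vertices.\<close>

definition rotation_strand :: "nat \<Rightarrow> nat set \<Rightarrow> real \<Rightarrow> nat \<Rightarrow> complex" where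
  "rotation_strand n A t a =
     (if a \<in> A then
        let b = next_in n A a; w = vtx n b - vtx n a in
          vtx n a + of_real t * w -
          (if card A = 2 \<and> b \<noteq> nxt n a then of_real (t * (1 - t) / real n) * \<i> * w else 0)
      else vtx n a)"

definition rotation_braid :: "nat \<Rightarrow> nat set \<Rightarrow> (real \<Rightarrow> complex set) set" where
  "rotation_braid n A =
     (if card A \<ge> 2 then braid_class n (\<lambda>t. rotation_strand n A t ` {1..n}) else \<one>\<^bsub>Braid n\<^esub>)"

text \<open>The rotation braids of the blocks of a noncrossing partition commute; the product is taken
  in the order of the minimal elements of the blocks.\<close>

definition dual_simple :: "nat \<Rightarrow> nat set set \<Rightarrow> (real \<Rightarrow> complex set) set" where
  "dual_simple n \<pi> =
     foldr (\<lambda>i \<beta>. rotation_braid n (THE A. A \<in> \<pi> \<and> Min A = i) \<otimes>\<^bsub>Braid n\<^esub> \<beta>)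
       (sorted_list_of_set (Min ` \<pi>)) \<one>\<^bsub>Braid n\<^esub>"

definition noncrossing_bdry :: "nat \<Rightarrow> nat set \<Rightarrow> nat set set set" where
  "noncrossing_bdry n B =
     {\<pi> \<in> noncrossing n. \<forall>b\<in>B. {b} \<in> \<pi> \<or> (\<exists>A\<in>\<pi>. b \<in> A \<and> nxt n b \<in> A)}"

definition fix_part :: "nat set \<Rightarrow> nat set set \<Rightarrow> nat set set" where
  "fix_part B \<pi> = ((\<lambda>A. A - B) ` \<pi> - {{}}) \<union> (\<lambda>b. {b}) ` B"

definition move_part :: "nat \<Rightarrow> nat set \<Rightarrow> nat set set \<Rightarrow> nat set set" where
  "move_part n B \<pi> = (THE \<pi>'. \<pi>' \<in> noncrossing n \<and>
     dual_simple n \<pi>' = inv\<^bsub>Braid n\<^esub> (dual_simple n (fix_part B \<pi>)) \<otimes>\<^bsub>Braid n\<^esub> dual_simple n \<pi>)"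

text \<open>\<open>cplx_edge n B \<beta> \<pi> \<beta>'\<close>: in the complex of \<open>(B,\<cdot>)\<close>-boundary braids there is an edge from
  \<open>\<beta>\<close> to \<open>\<beta>'\<close> labeled \<open>\<pi>\<close>. This is a flag complex, so it is determined by its edges.\<close>

definition cplx_edge ::
  "nat \<Rightarrow> nat set \<Rightarrow> (real \<Rightarrow> complex set) set \<Rightarrow> nat set set \<Rightarrow> (real \<Rightarrow> complex set) set \<Rightarrow> bool"
where
  "cplx_edge n B \<beta> \<pi> \<beta>' \<longleftrightarrow>
     \<beta> \<in> boundary_braids_from n B \<and> \<beta>' \<in> boundary_braids_from n B \<and>
     \<pi> \<in> noncrossing n - {discrete_partition n} \<and> \<beta>' = \<beta> \<otimes>\<^bsub>Braid n\<^esub> dual_simple n \<pi>"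


section \<open>The orthoscheme configuration space of the oriented cycle\<close>

definition ortho_simplex :: "(nat \<Rightarrow> int) \<Rightarrow> nat set list \<Rightarrow> (nat \<Rightarrow> real) set" where
  "ortho_simplex x Es =
     {y. \<exists>s. (\<forall>m<length Es. 0 \<le> s m) \<and> (\<Sum>m<length Es. s m) \<le> 1 \<and>
        y = (\<lambda>i. real_of_int (x i) + (\<Sum>m<length Es. s m * indicator (Es ! m) i))}"

text \<open>The preimage of the thick diagonal in the space of real \<open>k\<close>-tuples.\<close>

definition thick_diagonal :: "nat \<Rightarrow> nat \<Rightarrow> (nat \<Rightarrow> real) set" where
  "thick_diagonal n k = {y. \<exists>i\<in>{1..k}. \<exists>j\<in>{1..k}. i \<noteq> j \<and> (\<exists>z::int. y i - y j = real n * of_int z)}"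

definition cyc_residue :: "nat \<Rightarrow> int \<Rightarrow> nat" where
  "cyc_residue n z = Suc (nat ((z - 1) mod int n))"

text \<open>A simplex \<open>[x, x + 1\<^bsub>E\<^sub>1\<^esub>, \<dots>, x + 1\<^bsub>E\<^sub>l\<^esub>]\<close> that avoids the thick diagonal is
  determined, up to translation by multiples of \<open>n\<close> and permutation of the coordinates, by the set of
  residues of the \<open>x i\<close> and by the subsets corresponding to the \<open>E\<^sub>m\<close>. These data
  represent the simplices of the quotient complex.\<close>

definition cyc_simplex :: "nat \<Rightarrow> nat \<Rightarrow> nat set \<Rightarrow> nat set list \<Rightarrow> bool" where
  "cyc_simplex n k V Cs \<longleftrightarrow> (\<exists>x Es. sorted_wrt (\<subset>) Es \<and> (\<forall>E\<in>set Es. E \<noteq> {} \<and> E \<subseteq> {1..k}) \<and>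
     ortho_simplex x Es \<inter> thick_diagonal n k = {} \<and>
     V = (\<lambda>i. cyc_residue n (x i)) ` {1..k} \<and>
     Cs = map (\<lambda>E. (\<lambda>i. cyc_residue n (x i)) ` E) Es)"

lemma cyc_residue_eq_iff:
  assumes "n > 0"
  shows "cyc_residue n y = cyc_residue n z \<longleftrightarrow> (\<exists>w. y - z = int n * w)"
proof -
  have "cyc_residue n y = cyc_residue n z \<longleftrightarrow> (y - 1) mod int n = (z - 1) mod int n"
    using assms by (simp add: cyc_residue_def nat_eq_iff)
  also have "\<dots> \<longleftrightarrow> int n dvd y - z"
    by (simp add: mod_eq_dvd_iff)
  finally show ?thesis by (simp add: dvd_def)
qed

lemma cyc_residue_in: "n > 0 \<Longrightarrow> cyc_residue n z \<in> {1..n}"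
  by (simp add: cyc_residue_def Suc_le_eq nat_less_iff)

lemma cyc_residue_of_nat: "v \<in> {1..n} \<Longrightarrow> cyc_residue n (int v) = v"
  by (auto simp: cyc_residue_def of_nat_diff[symmetric] simp del: of_nat_diff)

lemma nxt_cyc_residue:
  assumes "n > 0"
  shows "nxt n (cyc_residue n z) = cyc_residue n (z + 1)"
proof -
  let ?r = "cyc_residue n z"
  have r: "?r \<in> {1..n}" using assms by (rule cyc_residue_in)
  have "cyc_residue n (int ?r) = ?r" using r by (rule cyc_residue_of_nat)
  then obtain w where w: "int ?r - z = int n * w"
    using cyc_residue_eq_iff[OF assms] by blast
  have nr: "nxt n ?r \<in> {1..n}" using r assms by (auto simp: nxt_def)
  have "\<exists>w'. int (nxt n ?r) - (z + 1) = int n * w'"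
  proof (cases "?r = n")
    case True
    then have "int (nxt n ?r) - (z + 1) = int n * (w - 1)"
      using w by (simp add: nxt_def algebra_simps)
    then show ?thesis ..
  next
    case False
    then have "int (nxt n ?r) - (z + 1) = int n * w"
      using w by (simp add: nxt_def)
    then show ?thesis ..
  qed
  then have "cyc_residue n (int (nxt n ?r)) = cyc_residue n (z + 1)"
    using cyc_residue_eq_iff[OF assms] by blast
  then show ?thesis using cyc_residue_of_nat[OF nr] by simp
qed

lemma cyc_simplex_edge:
  assumes n: "n \<ge> 3"
  shows "cyc_simplex n k V [C] \<longleftrightarrow>
    V \<subseteq> {1..n} \<and> card V = k \<and> C \<noteq> {} \<and> C \<subseteq> V \<and> nxt n ` C \<inter> (V - C) = {}"
proof
  assume "cyc_simplex n k V [C]"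
  then obtain x Es where E0: "\<forall>E\<in>set Es. E \<noteq> {} \<and> E \<subseteq> {1..k}"
    and dj: "ortho_simplex x Es \<inter> thick_diagonal n k = {}"
    and V: "V = (\<lambda>i. cyc_residue n (x i)) ` {1..k}"
    and C0: "[C] = map (\<lambda>E. (\<lambda>i. cyc_residue n (x i)) ` E) Es"
    unfolding cyc_simplex_def by (elim exE conjE) (rule that)
  from C0 obtain E where Es: "Es = [E]" and C: "C = (\<lambda>i. cyc_residue n (x i)) ` E" by auto
  have E: "E \<noteq> {}" "E \<subseteq> {1..k}" using E0 Es by auto
  have pt: "(\<lambda>i. real_of_int (x i) + s * indicator E i) \<in> ortho_simplex x Es"
    if "0 \<le> s" "s \<le> 1" for s
    unfolding ortho_simplex_def Es using that by (auto intro!: exI[of _ "\<lambda>_. s"])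
  have *: "real_of_int (x i) + s * indicator E i - (real_of_int (x j) + s * indicator E j) \<noteq> real n * of_int z"
    if "i \<in> {1..k}" "j \<in> {1..k}" "i \<noteq> j" "0 \<le> s" "s \<le> 1" for i j s z
  proof
    let ?y = "\<lambda>i. real_of_int (x i) + s * indicator E i"
    assume "?y i - ?y j = real n * of_int z"
    with that(1-3) have "?y \<in> thick_diagonal n k"
      unfolding thick_diagonal_def by blast
    with dj pt[OF that(4,5)] show False by blast
  qed
  have inj: "inj_on (\<lambda>i. cyc_residue n (x i)) {1..k}"
  proof (rule inj_onI, rule ccontr)
    fix i j assume ij: "i \<in> {1..k}" "j \<in> {1..k}" "cyc_residue n (x i) = cyc_residue n (x j)" "i \<noteq> j"
    then obtain z where "x i - x j = int n * z"
      using n cyc_residue_eq_iff[of n] by auto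
    then have "real_of_int (x i - x j) = real_of_int (int n * z)" by (rule arg_cong)
    then show False using *[OF ij(1,2,4), of 0 z] by simp
  qed
  have "nxt n c \<notin> V - C" if cC: "c \<in> C" for c
  proof
    assume a: "nxt n c \<in> V - C"
    from cC obtain i where i: "i \<in> E" "c = cyc_residue n (x i)" using C by auto
    from a obtain j where j: "j \<in> {1..k}" "nxt n c = cyc_residue n (x j)" using V by auto
    have jE: "j \<notin> E" using a j C by auto
    have "cyc_residue n (x i + 1) = cyc_residue n (x j)" using i j nxt_cyc_residue[of n] n by simp
    then obtain z where "x i + 1 - x j = int n * z"
      using n cyc_residue_eq_iff[of n] by auto
    then have "real_of_int (x i + 1 - x j) = real_of_int (int n * z)" by (rule arg_cong)
    moreover have "i \<in> {1..k}" "i \<noteq> j" using i jE E by auto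
    ultimately show False using *[of i j 1 z] i j jE by (simp add: algebra_simps)
  qed
  then have "nxt n ` C \<inter> (V - C) = {}" by blast
  moreover have "card V = k" using card_image[OF inj] unfolding V by simp
  moreover have "V \<subseteq> {1..n}" unfolding V using cyc_residue_in[of n] n by (intro image_subsetI) simp
  moreover have "C \<noteq> {}" "C \<subseteq> V" unfolding V C using E by (simp, intro image_mono)
  ultimately show "V \<subseteq> {1..n} \<and> card V = k \<and> C \<noteq> {} \<and> C \<subseteq> V \<and> nxt n ` C \<inter> (V - C) = {}"
    by (intro conjI)
next
  assume a: "V \<subseteq> {1..n} \<and> card V = k \<and> C \<noteq> {} \<and> C \<subseteq> V \<and> nxt n ` C \<inter> (V - C) = {}"
  then have "finite V" using finite_subset by blast
  then obtain h where h: "bij_betw h {1..k} V"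
    using a by (metis card_atLeastAtMost diff_Suc_1 finite_atLeastAtMost finite_same_card_bij)
  define x where "x = (\<lambda>i. int (h i))"
  define E where "E = {i \<in> {1..k}. h i \<in> C}"
  have hV: "h i \<in> V" if "i \<in> {1..k}" for i using h that by (auto simp: bij_betw_def)
  have res: "cyc_residue n (x i) = h i" if "i \<in> {1..k}" for i
    unfolding x_def using hV[OF that] a by (intro cyc_residue_of_nat) auto
  have imV: "V = (\<lambda>i. cyc_residue n (x i)) ` {1..k}"
    using h res by (auto simp: bij_betw_def image_iff)
  have imC: "C = (\<lambda>i. cyc_residue n (x i)) ` E"
  proof -
    have "(\<lambda>i. cyc_residue n (x i)) ` E = h ` E"
      using res by (intro image_cong) (auto simp: E_def)
    also have "\<dots> = C" using h a by (auto simp: E_def bij_betw_def)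
    finally show ?thesis by simp
  qed
  have neq: "cyc_residue n (x i) \<noteq> cyc_residue n (x j)"
    if "i \<in> {1..k}" "j \<in> {1..k}" "i \<noteq> j" for i j
    using res[OF that(1)] res[OF that(2)] that inj_onD[OF bij_betw_imp_inj_on[OF h]] by metis
  have neq0: "x i - x j \<noteq> int n * z" if "i \<in> {1..k}" "j \<in> {1..k}" "i \<noteq> j" for i j z
    using neq[OF that] cyc_residue_eq_iff[of n "x i" "x j"] n by simp
  have neq1: "x i + 1 - x j \<noteq> int n * z" if "i \<in> E" "j \<in> {1..k}" "j \<notin> E" for i j z
  proof
    assume "x i + 1 - x j = int n * z"
    then have "cyc_residue n (x i + 1) = cyc_residue n (x j)"
      using cyc_residue_eq_iff[of n] n by auto
    moreover have "i \<in> {1..k}" using that by (simp add: E_def)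
    ultimately have "nxt n (h i) = h j" using res that nxt_cyc_residue[of n "x i"] n by auto
    then show False using that a hV by (auto simp: E_def)
  qed
  have mixed: "real_of_int (x i) + s - real_of_int (x j) \<noteq> real n * of_int z"
    if "i \<in> E" "j \<in> {1..k}" "j \<notin> E" "0 \<le> s" "s \<le> 1" for i j s z
  proof
    assume e: "real_of_int (x i) + s - real_of_int (x j) = real n * of_int z"
    have i: "i \<in> {1..k}" "i \<noteq> j" using that by (auto simp: E_def)
    have s: "s = real_of_int (int n * z - x i + x j)" using e by simp
    then have "int n * z - x i + x j = 0 \<or> int n * z - x i + x j = 1"
      using that(4,5) by linarith
    then show False using neq0[OF i(1) that(2) i(2), of z] neq1[OF that(1-3), of z] by auto
  qed
  have "y \<notin> thick_diagonal n k" if "y \<in> ortho_simplex x [E]" for y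
  proof
    assume "y \<in> thick_diagonal n k"
    then obtain i j z where ij: "i \<in> {1..k}" "j \<in> {1..k}" "i \<noteq> j"
      and e: "y i - y j = real n * of_int z" unfolding thick_diagonal_def by blast
    from that obtain s where s: "0 \<le> s" "s \<le> 1"
      and y: "y = (\<lambda>i. real_of_int (x i) + s * indicator E i)"
      unfolding ortho_simplex_def by auto
    consider "i \<in> E" "j \<notin> E" | "i \<notin> E" "j \<in> E" | "i \<in> E \<longleftrightarrow> j \<in> E" by blast
    then show False
    proof cases
      case 1
      then show False using mixed[of i j s z] ij s e y by auto
    next
      case 2
      have "y j - y i = real n * of_int (- z)" using e by simp
      then show False using mixed[of j i s "- z"] 2 ij s y by auto
    next
      case 3
      then have "real_of_int (x i - x j) = real_of_int (int n * z)"
        using e y by (auto simp: indicator_def split: if_splits)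
      then show False using neq0[OF ij, of z] of_int_eq_iff by blast
    qed
  qed
  moreover have "E \<noteq> {}" "E \<subseteq> {1..k}" using imC a by (auto simp: E_def)
  ultimately show "cyc_simplex n k V [C]"
    unfolding cyc_simplex_def using imV imC
    by (intro exI[of _ x] exI[of _ "[E]"]) auto
qed

definition shift :: "nat \<Rightarrow> nat set \<Rightarrow> nat set \<Rightarrow> nat set" where
  "shift n V C = (V - C) \<union> nxt n ` C"


section \<open>Its universal cover, by edge paths\<close>

text \<open>\<open>(True, V, C)\<close> is the edge given by \<open>C\<close> out of \<open>V\<close>, \<open>(False, V, C)\<close> is its reverse.\<close>

type_synonym dart = "bool \<times> nat set \<times> nat set"

fun dart_src :: "nat \<Rightarrow> dart \<Rightarrow> nat set" where
  "dart_src n (s, V, C) = (if s then V else shift n V C)"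

fun dart_tgt :: "nat \<Rightarrow> dart \<Rightarrow> nat set" where
  "dart_tgt n (s, V, C) = (if s then shift n V C else V)"

fun edge_path :: "nat \<Rightarrow> nat \<Rightarrow> nat set \<Rightarrow> dart list \<Rightarrow> bool" where
  "edge_path n k V [] \<longleftrightarrow> cyc_simplex n k V []"
| "edge_path n k V (e # es) \<longleftrightarrow> dart_src n e = V \<and> cyc_simplex n k (fst (snd e)) [snd (snd e)] \<and>
     edge_path n k (dart_tgt n e) es"

definition path_end :: "nat \<Rightarrow> nat set \<Rightarrow> dart list \<Rightarrow> nat set" where
  "path_end n V es = (if es = [] then V else dart_tgt n (last es))"

text \<open>The boundary of the triangle \<open>[x, x + 1\<^bsub>C\<^sub>1\<^esub>, x + 1\<^bsub>C\<^sub>2\<^esub>]\<close> consists of the edges given by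
  \<open>C\<^sub>1\<close> and \<open>C\<^sub>2\<close> out of its first vertex and by \<open>C\<^sub>2 - C\<^sub>1\<close> out of its second vertex.\<close>

inductive elementary_homotopy :: "nat \<Rightarrow> nat \<Rightarrow> dart list \<Rightarrow> dart list \<Rightarrow> bool"
  for n k :: nat where
  cancel: "elementary_homotopy n k (p @ [(s, V, C), (\<not> s, V, C)] @ q) (p @ q)"
| triangle: "cyc_simplex n k V [C1, C2] \<Longrightarrow>
    elementary_homotopy n k (p @ [(True, V, C1), (True, shift n V C1, C2 - C1)] @ q)
      (p @ [(True, V, C2)] @ q)"

definition edge_paths :: "nat \<Rightarrow> nat set \<Rightarrow> dart list set" where
  "edge_paths n B = {p. edge_path n (card B) B p}"

definition path_homotopy :: "nat \<Rightarrow> nat set \<Rightarrow> (dart list \<times> dart list) set" where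
  "path_homotopy n B = {(p, q). p \<in> edge_paths n B \<and> q \<in> edge_paths n B \<and>
     equivclp (\<lambda>p q. p \<in> edge_paths n B \<and> q \<in> edge_paths n B \<and>
       elementary_homotopy n (card B) p q) p q}"

definition ucover :: "nat \<Rightarrow> nat set \<Rightarrow> dart list set set" where
  "ucover n B = edge_paths n B // path_homotopy n B"

definition ucover_base :: "nat \<Rightarrow> nat set \<Rightarrow> dart list set" where
  "ucover_base n B = path_homotopy n B `` {[]}"

definition cov :: "nat \<Rightarrow> nat set \<Rightarrow> dart list set \<Rightarrow> nat set" where
  "cov n B W = the_elem (path_end n B ` W)"

text \<open>The edge out of the vertex \<open>W\<close> that lies over the edge given by \<open>C\<close> ends in \<open>W'\<close>.\<close>

definition ucover_edge :: "nat \<Rightarrow> nat set \<Rightarrow> dart list set \<Rightarrow> nat set \<Rightarrow> dart list set \<Rightarrow> bool" where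
  "ucover_edge n B W C W' \<longleftrightarrow> W \<in> ucover n B \<and> cyc_simplex n (card B) (cov n B W) [C] \<and>
     (\<exists>p\<in>W. W' = path_homotopy n B `` {p @ [(True, cov n B W, C)]})"


section \<open>Move braids\<close>

definition bdry_vertex :: "nat \<Rightarrow> nat set \<Rightarrow> (real \<Rightarrow> complex set) set \<Rightarrow> nat set" where
  "bdry_vertex n B \<beta> = (THE B'. B' \<subseteq> {1..n} \<and> \<beta> \<in> boundary_braids n B B')"

definition bdry_edge :: "nat set \<Rightarrow> nat set set \<Rightarrow> nat set" where
  "bdry_edge B' \<pi> = {b \<in> B'. {b} \<notin> \<pi>}"

text \<open>Since the target is a flag complex, a map of complexes is given by a map on vertices that
  sends edges to edges. No edge is collapsed because the composition with the boundary map is the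
  covering map, which also determines the orientations.\<close>

definition is_split :: "nat \<Rightarrow> nat set \<Rightarrow> (dart list set \<Rightarrow> (real \<Rightarrow> complex set) set) \<Rightarrow> bool" where
  "is_split n B \<sigma> \<longleftrightarrow>
     \<sigma> \<in> extensional (ucover n B) \<and>
     \<sigma> (ucover_base n B) = \<one>\<^bsub>Braid n\<^esub> \<and>
     (\<forall>W\<in>ucover n B. \<sigma> W \<in> boundary_braids_from n B \<and> bdry_vertex n B (\<sigma> W) = cov n B W) \<and>
     (\<forall>W C W'. ucover_edge n B W C W' \<longrightarrow>
        (\<exists>\<pi>. cplx_edge n B (\<sigma> W) \<pi> (\<sigma> W') \<and>
             bdry_edge (cov n B W) \<pi> = C \<and>
             \<pi> \<in> noncrossing_bdry n (cov n B W) \<and>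
             move_part n (cov n B W) \<pi> = \<pi>))"

definition split_map :: "nat \<Rightarrow> nat set \<Rightarrow> dart list set \<Rightarrow> (real \<Rightarrow> complex set) set" where
  "split_map n B = (THE \<sigma>. is_split n B \<sigma>)"

definition move_braids_from :: "nat \<Rightarrow> nat set \<Rightarrow> (real \<Rightarrow> complex set) set set" where
  "move_braids_from n B = (if B = {} then {\<one>\<^bsub>Braid n\<^esub>} else split_map n B ` ucover n B)"

definition move_braids :: "nat \<Rightarrow> nat set \<Rightarrow> nat set \<Rightarrow> (real \<Rightarrow> complex set) set set" where
  "move_braids n B B' = move_braids_from n B \<inter> boundary_braids n B B'"


section \<open>Groupoids\<close>

text \<open>A groupoid with object set \<open>Obj\<close> and morphism sets \<open>H x y\<close> whose composition (in diagrammatic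
  order) and identities are the multiplication and the unit of \<open>G\<close>.\<close>

definition groupoid_in :: "('a, 'm) monoid_scheme \<Rightarrow> 'o set \<Rightarrow> ('o \<Rightarrow> 'o \<Rightarrow> 'a set) \<Rightarrow> bool" where
  "groupoid_in G Obj H \<longleftrightarrow>
     (\<forall>x\<in>Obj. \<forall>y\<in>Obj. H x y \<subseteq> carrier G) \<and>
     (\<forall>x\<in>Obj. \<one>\<^bsub>G\<^esub> \<in> H x x) \<and>
     (\<forall>x\<in>Obj. \<forall>y\<in>Obj. \<forall>z\<in>Obj. \<forall>g\<in>H x y. \<forall>h\<in>H y z. g \<otimes>\<^bsub>G\<^esub> h \<in> H x z) \<and>
     (\<forall>w\<in>Obj. \<forall>x\<in>Obj. \<forall>y\<in>Obj. \<forall>z\<in>Obj. \<forall>g\<in>H w x. \<forall>h\<in>H x y. \<forall>k\<in>H y z.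
        (g \<otimes>\<^bsub>G\<^esub> h) \<otimes>\<^bsub>G\<^esub> k = g \<otimes>\<^bsub>G\<^esub> (h \<otimes>\<^bsub>G\<^esub> k)) \<and>
     (\<forall>x\<in>Obj. \<forall>y\<in>Obj. \<forall>g\<in>H x y. \<one>\<^bsub>G\<^esub> \<otimes>\<^bsub>G\<^esub> g = g \<and> g \<otimes>\<^bsub>G\<^esub> \<one>\<^bsub>G\<^esub> = g) \<and>
     (\<forall>x\<in>Obj. \<forall>y\<in>Obj. \<forall>g\<in>H x y. \<exists>h\<in>H y x. g \<otimes>\<^bsub>G\<^esub> h = \<one>\<^bsub>G\<^esub> \<and> h \<otimes>\<^bsub>G\<^esub> g = \<one>\<^bsub>G\<^esub>)"

definition subgroupoid_in ::
  "('a, 'm) monoid_scheme \<Rightarrow> 'o set \<Rightarrow> ('o \<Rightarrow> 'o \<Rightarrow> 'a set) \<Rightarrow> ('o \<Rightarrow> 'o \<Rightarrow> 'a set) \<Rightarrow> bool" where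
  "subgroupoid_in G Obj K H \<longleftrightarrow>
     groupoid_in G Obj H \<and> groupoid_in G Obj K \<and> (\<forall>x\<in>Obj. \<forall>y\<in>Obj. K x y \<subseteq> H x y)"

definition fix_hom :: "nat \<Rightarrow> nat set \<Rightarrow> nat set \<Rightarrow> (real \<Rightarrow> complex set) set set" where
  "fix_hom n B B' = (if B = B' then fix_braids n B else {})"

end

theory Submission
  imports Defs
begin

text \<open>
  A braid is represented by the continuous families of its strands, so it can be recovered from them
  and homotopies of loops lift to strands. If a strand starting in a vertex stays in the boundary of
  the polygon, it lifts to a path in the universal cover of the boundary circle. The difference of the
  ends of the lift, its displacement, is an invariant of the braid: the angle of the vector from
  another strand to the boundary strand is a homotopy invariant which differs from the angle of the
  boundary strand by a bounded amount. Conversely, if all displacements vanish, the other strands can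
  be pushed into the interior and the boundary strands can be straightened, so the braid is a fix
  braid.

  A displacement that preserves the cyclic order extends uniquely to a normalised affine permutation
  \<open>w\<close>, and \<open>w\<close> is realised by a braid whose boundary strands move along the boundary while the other
  strands move on a parallel circle in the interior. These braids are multiplicative in \<open>w\<close>. Splitting off
  one boundary edge of a block at a time shows \<open>\<delta>\<^bsub>\<pi>\<^esub> = \<delta>\<^bsub>Fix(\<pi>)\<^esub> \<mu>\<close>, where \<open>\<mu>\<close> is the braid of the
  affine permutation that moves the points of the edge by one step; hence the move braids are
  exactly the braids of affine permutations. So every boundary braid is the product of a fix braid and
  of the unique move braid with the same displacement, and both claims follow by comparing
  displacements.
\<close>

section \<open>The braid group\<close>

text \<open>Move braids are defined indirectly: \<open>split_map\<close> is a definite description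
  over the universal cover, so existence and uniqueness of the split must be settled before any move
  braid is known. Both become arithmetic of integers. As \<open>layered_braid\<close> is
  multiplicative, a candidate on edge paths is the braid of the composed affine permutations, and
  its invariance under cancellations and triangles is an equality of functions on the integers
  instead of a homotopy of braids. Uniqueness holds because
  \<open>move_part n V \<pi> = \<pi>\<close> leaves a single label for each edge. The vanishing sum
  in \<open>affine_perm\<close> makes the extension of a displacement unique: otherwise the points
  outside of \<open>V\<close> could turn together by any number of places. It is natural since
  \<open>swap b\<close> moves one point forward and one back. Layered loops depend only on their
  ends because the order on each layer is given by linear inequalities between lifts
  (\<open>cyc_ord\<close>), which straight line homotopies respect.\<close>

abbreviation unit_square :: "(real \<times> real) set" where
  "unit_square \<equiv> {0..1} \<times> {0..1}"

abbreviation base_conf :: "nat \<Rightarrow> complex set" where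
  "base_conf n \<equiv> vtx n ` {1..n}"

text \<open>The form in which homotopies are built and lifted below: one map on the square, with the
  homotopy parameter as first coordinate and time as second.\<close>

lemma loop_homotopy_iff:
  "(f, g) \<in> loop_homotopy n \<longleftrightarrow>
     (\<exists>h. continuous_map (top_of_set unit_square) (UConf n) h \<and>
       (\<forall>t\<in>{0..1}. h (0, t) = f t) \<and> (\<forall>t\<in>{0..1}. h (1, t) = g t) \<and>
       (\<forall>s\<in>{0..1}. h (s, 0) = base_conf n \<and> h (s, 1) = base_conf n))" (is "?L \<longleftrightarrow> ?R")
proof -
  let ?P = "\<lambda>h. h (0::real) = base_conf n \<and> h (1::real) = base_conf n"
  have hw: "homotopic_with ?P (top_of_set {0..1}) (UConf n) f g \<longleftrightarrow> ?R"
    by (subst homotopic_with) (auto simp del: split_paired_Ex)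
  have "f \<in> braid_loops n \<and> g \<in> braid_loops n" if "homotopic_with ?P (top_of_set {0..1}) (UConf n) f g"
    using homotopic_with_imp_continuous_maps[OF that] homotopic_with_imp_property[OF that]
    by (simp add: braid_loops_def pathin_def)
  then show ?thesis
    unfolding hw[symmetric] by (auto simp: loop_homotopy_def)
qed

lemma equiv_loop_homotopy: "equiv (braid_loops n) (loop_homotopy n)"
proof (rule equivI)
  show "loop_homotopy n \<subseteq> braid_loops n \<times> braid_loops n"
    by (auto simp: loop_homotopy_def)
  show "refl_on (braid_loops n) (loop_homotopy n)"
    by (auto simp: refl_on_def loop_homotopy_def braid_loops_def pathin_def intro!: homotopic_with_equal)
  show "sym (loop_homotopy n)"
    by (auto simp: sym_def loop_homotopy_def intro: homotopic_with_symD)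
  show "trans (loop_homotopy n)"
    by (auto simp: trans_def loop_homotopy_def intro: homotopic_with_trans)
qed

lemma braid_class_eq_iff:
  "f \<in> braid_loops n \<Longrightarrow> g \<in> braid_loops n \<Longrightarrow>
    braid_class n f = braid_class n g \<longleftrightarrow> (f, g) \<in> loop_homotopy n"
  unfolding braid_class_def by (rule eq_equiv_class_iff[OF equiv_loop_homotopy])

lemma braid_class_eqI: "(f, g) \<in> loop_homotopy n \<Longrightarrow> braid_class n f = braid_class n g"
  unfolding braid_class_def by (rule equiv_class_eq[OF equiv_loop_homotopy])

lemma braid_class_carrier: "f \<in> braid_loops n \<Longrightarrow> braid_class n f \<in> carrier (Braid n)"
  by (simp add: Braid_def braid_class_def quotientI)

lemma carrier_BraidE:
  assumes "\<alpha> \<in> carrier (Braid n)"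
  obtains f where "f \<in> braid_loops n" "\<alpha> = braid_class n f"
  using assms by (auto simp: Braid_def braid_class_def elim: quotientE)

lemma carrier_Braid_mem:
  assumes "\<alpha> \<in> carrier (Braid n)" "f \<in> \<alpha>"
  shows "f \<in> braid_loops n \<and> \<alpha> = braid_class n f"
  using assms Image_singleton_iff equiv_class_eq[OF equiv_loop_homotopy]
  by (metis (no_types, lifting) braid_class_def carrier_BraidE equiv_class_eq_iff equiv_loop_homotopy)

text \<open>Loops are functions on all reals with arbitrary values outside of the unit interval.
  Agreement on the interval therefore gives equality of classes only, by the constant
  homotopy.\<close>

lemma braid_loops_cong:
  assumes "f \<in> braid_loops n" "\<And>t. t \<in> {0..1} \<Longrightarrow> g t = f t"
  shows "g \<in> braid_loops n \<and> (f, g) \<in> loop_homotopy n"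
proof -
  have "pathin (UConf n) g"
    using assms unfolding braid_loops_def pathin_def
    by (auto intro: continuous_map_eq)
  then have g: "g \<in> braid_loops n" using assms by (simp add: braid_loops_def)
  have "continuous_map (top_of_set unit_square) (UConf n) (\<lambda>x. f (snd x))"
    using assms(1) unfolding braid_loops_def pathin_def
    by (auto simp: image_subset_iff intro!: continuous_map_compose[where f=snd and g=f, unfolded o_def]
        continuous_intros)
  then have "(f, g) \<in> loop_homotopy n"
    unfolding loop_homotopy_iff using assms
    by (intro exI[of _ "\<lambda>x. f (snd x)"]) (auto simp: braid_loops_def)
  with g show ?thesis by blast
qed

text \<open>The unit interval is convex, so two reparametrisations with the same ends are joined by
  a straight line. All group laws of \<open>Braid n\<close> are instances of this.\<close>

lemma reparam_homotopy:
  fixes \<phi> \<psi> :: "real \<Rightarrow> real"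
  assumes f: "pathin (UConf n) f"
    and c: "continuous_on {0..1} \<phi>" "continuous_on {0..1} \<psi>"
    and r: "\<phi> ` {0..1} \<subseteq> {0..1}" "\<psi> ` {0..1} \<subseteq> {0..1}"
    and e: "\<phi> 0 = \<psi> 0" "\<phi> 1 = \<psi> 1" "f (\<phi> 0) = base_conf n" "f (\<phi> 1) = base_conf n"
  shows "(\<lambda>t. f (\<phi> t), \<lambda>t. f (\<psi> t)) \<in> loop_homotopy n"
proof -
  let ?k = "\<lambda>(s, t). (1 - s) * \<phi> t + s * \<psi> t"
  have "continuous_on unit_square ?k"
    unfolding case_prod_unfold
    by (intro continuous_intros continuous_on_compose2[OF c(1)] continuous_on_compose2[OF c(2)]) auto
  moreover have "?k ` unit_square \<subseteq> {0..1}"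
  proof (rule image_subsetI, clarify)
    fix s t :: real assume "s \<in> {0..1}" "t \<in> {0..1}"
    then have st: "0 \<le> s" "s \<le> 1" "0 \<le> t" "t \<le> 1" by auto
    then have "\<phi> t \<in> {0..1}" "\<psi> t \<in> {0..1}"
      using subsetD[OF r(1), of "\<phi> t"] subsetD[OF r(2), of "\<psi> t"] by simp_all
    then have "(1 - s) *\<^sub>R \<phi> t + s *\<^sub>R \<psi> t \<in> {0..1}"
      using st by (intro convexD_alt) auto
    then show "(1 - s) * \<phi> t + s * \<psi> t \<in> {0..1}" by simp
  qed
  ultimately have "continuous_map (top_of_set unit_square) (top_of_set {0..1}) ?k"
    by (simp add: continuous_map_in_subtopology image_subset_iff_funcset)
  from continuous_map_compose[OF this f[unfolded pathin_def]]
  have "continuous_map (top_of_set unit_square) (UConf n) (f \<circ> ?k)" .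
  then show ?thesis
    unfolding loop_homotopy_iff using e
    by (intro exI[of _ "f \<circ> ?k"]) (auto simp: algebra_simps)
qed

lemma continuous_map_concat_param:
  fixes f g :: "'a::topological_space \<Rightarrow> real \<Rightarrow> 'b"
  assumes f: "continuous_map (top_of_set (S \<times> {0..1})) X (\<lambda>(s, t). f s t)"
    and g: "continuous_map (top_of_set (S \<times> {0..1})) X (\<lambda>(s, t). g s t)"
    and e: "\<And>s. s \<in> S \<Longrightarrow> f s 1 = g s 0"
  shows "continuous_map (top_of_set (S \<times> {0..1})) X (\<lambda>(s, t). concat_loops (f s) (g s) t)"
proof -
  have "continuous_map (top_of_set (S \<times> {0..1})) X
    (\<lambda>x. if snd x \<le> 1/2 then (\<lambda>(s, t). f s t) (fst x, 2 * snd x) else (\<lambda>(s, t). g s t) (fst x, 2 * snd x - 1))"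
  proof (rule continuous_map_cases_le)
    show "continuous_map (subtopology (top_of_set (S \<times> {0..1}))
       {x \<in> topspace (top_of_set (S \<times> {0..1})). snd x \<le> 1/2}) X (\<lambda>x. (\<lambda>(s, t). f s t) (fst x, 2 * snd x))"
      unfolding subtopology_subtopology
      by (rule continuous_map_compose[OF _ f, unfolded o_def])
        (auto simp: continuous_map_in_subtopology intro!: continuous_intros)
    show "continuous_map (subtopology (top_of_set (S \<times> {0..1}))
       {x \<in> topspace (top_of_set (S \<times> {0..1})). 1/2 \<le> snd x}) X (\<lambda>x. (\<lambda>(s, t). g s t) (fst x, 2 * snd x - 1))"
      unfolding subtopology_subtopology
      by (rule continuous_map_compose[OF _ g, unfolded o_def])
        (auto simp: continuous_map_in_subtopology intro!: continuous_intros)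
  next
    fix x assume "x \<in> topspace (top_of_set (S \<times> {0..1::real}))" "snd x = 1/2"
    then show "(\<lambda>(s, t). f s t) (fst x, 2 * snd x) = (\<lambda>(s, t). g s t) (fst x, 2 * snd x - 1)"
    proof -
      have x: "fst x \<in> S" using \<open>x \<in> topspace _\<close> by (auto simp: mem_Times_iff)
      have "2 * snd x = 1" using \<open>snd x = 1/2\<close> by simp
      then show ?thesis using e[OF x] by (simp only: case_prod_conv) simp
    qed
  qed (auto intro!: continuous_intros)
  then show ?thesis
    by (rule continuous_map_eq) (auto simp: concat_loops_def)
qed

lemma concat_homotopy:
  assumes "(f, f') \<in> loop_homotopy n" "(g, g') \<in> loop_homotopy n"
  shows "(concat_loops f g, concat_loops f' g') \<in> loop_homotopy n"
proof -
  obtain h where h: "continuous_map (top_of_set unit_square) (UConf n) h"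
       "\<forall>t\<in>{0..1}. h (0, t) = f t" "\<forall>t\<in>{0..1}. h (1, t) = f' t"
       "\<forall>s\<in>{0..1}. h (s, 0) = base_conf n \<and> h (s, 1) = base_conf n"
    using assms(1) unfolding loop_homotopy_iff by (elim exE conjE) (rule that; assumption)
  obtain k where k: "continuous_map (top_of_set unit_square) (UConf n) k"
       "\<forall>t\<in>{0..1}. k (0, t) = g t" "\<forall>t\<in>{0..1}. k (1, t) = g' t"
       "\<forall>s\<in>{0..1}. k (s, 0) = base_conf n \<and> k (s, 1) = base_conf n"
    using assms(2) unfolding loop_homotopy_iff by (elim exE conjE) (rule that; assumption)
  have "continuous_map (top_of_set unit_square) (UConf n)
      (\<lambda>(s, t). concat_loops (\<lambda>t. h (s, t)) (\<lambda>t. k (s, t)) t)"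
    by (rule continuous_map_concat_param) (simp_all add: h k)
  then show ?thesis
    unfolding loop_homotopy_iff
    by (intro exI[of _ "\<lambda>(s, t). concat_loops (\<lambda>t. h (s, t)) (\<lambda>t. k (s, t)) t"] conjI ballI)
      (simp_all add: concat_loops_def h k)
qed

lemma braid_loops_refl: "f \<in> braid_loops n \<Longrightarrow> (f, f) \<in> loop_homotopy n"
  using braid_loops_cong by blast

lemma loop_homotopy_braid_loops: "(f, g) \<in> loop_homotopy n \<Longrightarrow> f \<in> braid_loops n \<and> g \<in> braid_loops n"
  by (simp add: loop_homotopy_def)

lemma concat_braid_loops:
  "f \<in> braid_loops n \<Longrightarrow> g \<in> braid_loops n \<Longrightarrow> concat_loops f g \<in> braid_loops n"
  using concat_homotopy braid_loops_refl loop_homotopy_braid_loops by blast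

text \<open>The product in \<open>Braid n\<close> is a union over all pairs of representatives; by
  \<open>concat_homotopy\<close> every member of this union is the same class.\<close>

lemma braid_class_mult:
  assumes f: "f \<in> braid_loops n" and g: "g \<in> braid_loops n"
  shows "braid_class n f \<otimes>\<^bsub>Braid n\<^esub> braid_class n g = braid_class n (concat_loops f g)"
proof -
  have "braid_class n (concat_loops f' g') = braid_class n (concat_loops f g)"
    if "f' \<in> braid_class n f" "g' \<in> braid_class n g" for f' g'
  proof -
    have "(f, f') \<in> loop_homotopy n" "(g, g') \<in> loop_homotopy n"
      using that by (simp_all add: braid_class_def)
    from braid_class_eqI[OF concat_homotopy[OF this]] show ?thesis by (rule sym)
  qed
  moreover have "f \<in> braid_class n f" "g \<in> braid_class n g"
    by (simp_all add: braid_class_def braid_loops_refl f g)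
  ultimately have "(\<Union>f\<in>braid_class n f. \<Union>g\<in>braid_class n g. braid_class n (concat_loops f g))
      = (\<Union>f'\<in>braid_class n f. \<Union>g'\<in>braid_class n g. braid_class n (concat_loops f g))"
    by (intro SUP_cong refl)
  also have "\<dots> = braid_class n (concat_loops f g)"
    using \<open>f \<in> braid_class n f\<close> \<open>g \<in> braid_class n g\<close> by (metis UN_constant empty_iff)
  finally have "(\<Union>f\<in>braid_class n f. \<Union>g\<in>braid_class n g. braid_class n (concat_loops f g))
      = braid_class n (concat_loops f g)" .
  then show ?thesis by (simp add: Braid_def)
qed

lemma topspace_Conf: "topspace (Conf n) = {x \<in> {1..n} \<rightarrow>\<^sub>E polygon n. inj_on x {1..n}}"
  by (auto simp: Conf_def)

lemma topspace_UConf: "topspace (UConf n) = (\<lambda>x. x ` {1..n}) ` topspace (Conf n)"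
  by (simp add: UConf_def)

lemma continuous_map_quotient: "continuous_map X (quotient_topology X q) q"
  by (auto simp: continuous_map_def openin_quotient_topology)

lemma vtx_inj: assumes "n > 0" shows "inj_on (vtx n) {1..n}"
proof (rule inj_onI)
  fix i j assume ij: "i \<in> {1..n}" "j \<in> {1..n}" "vtx n i = vtx n j"
  then obtain k :: int where "2 * pi * real i / real n - 2 * pi * real j / real n = 2 * pi * of_int k"
    unfolding vtx_def cis_conv_exp exp_eq by (auto simp: complex_eq_iff algebra_simps)
  then have "2 * pi * (real i - real j) = 2 * pi * (of_int k * real n)"
    using assms by (simp add: field_simps)
  then have k: "real i - real j = of_int k * real n"
    using pi_gt_zero by (metis mult_cancel_left mult_eq_0_iff pi_neq_zero zero_neq_numeral)
  moreover have "\<bar>real i - real j\<bar> < real n" using ij by auto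
  ultimately have "\<bar>of_int k * real n\<bar> < real n" by simp
  then have "\<bar>real_of_int k\<bar> < 1" using assms by (simp add: abs_mult)
  then have "k = 0" by linarith
  with k show "i = j" by simp
qed

lemma vtx_polygon: "i \<in> {1..n} \<Longrightarrow> vtx n i \<in> polygon n"
  unfolding polygon_def by (rule hull_inc) simp

lemma base_conf_UConf: assumes "n > 0" shows "base_conf n \<in> topspace (UConf n)"
proof -
  have "restrict (vtx n) {1..n} \<in> topspace (Conf n)"
    using vtx_inj[OF assms] vtx_polygon by (simp add: topspace_Conf inj_on_restrict_eq)
  moreover have "(restrict (vtx n) {1..n}) ` {1..n} = base_conf n" by auto
  ultimately show ?thesis unfolding topspace_UConf by (metis imageI)
qed

lemma const_braid_loop: "n > 0 \<Longrightarrow> (\<lambda>_. base_conf n) \<in> braid_loops n"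
  using base_conf_UConf by (simp add: braid_loops_def pathin_def)

lemma one_Braid: "\<one>\<^bsub>Braid n\<^esub> = braid_class n (\<lambda>_. base_conf n)"
  by (simp add: Braid_def)

theorem group_Braid:
  assumes n: "n > 0"
  shows "group (Braid n)"
proof (rule groupI)
  show "\<one>\<^bsub>Braid n\<^esub> \<in> carrier (Braid n)"
    unfolding one_Braid by (intro braid_class_carrier const_braid_loop n)
next
  fix x y assume xy: "x \<in> carrier (Braid n)" "y \<in> carrier (Braid n)"
  then obtain f g where fg: "f \<in> braid_loops n" "x = braid_class n f" "g \<in> braid_loops n" "y = braid_class n g"
    by (elim carrier_BraidE) blast
  then show "x \<otimes>\<^bsub>Braid n\<^esub> y \<in> carrier (Braid n)"
    by (simp add: braid_class_mult braid_class_carrier concat_braid_loops)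
next
  fix x y z assume "x \<in> carrier (Braid n)" "y \<in> carrier (Braid n)" "z \<in> carrier (Braid n)"
  then obtain f g h where f: "f \<in> braid_loops n" "x = braid_class n f"
    and g: "g \<in> braid_loops n" "y = braid_class n g" and h: "h \<in> braid_loops n" "z = braid_class n h"
    by (elim carrier_BraidE) blast
  define F where "F = concat_loops f (concat_loops g h)"
  \<comment> \<open>The minimum of three affine functions takes the break points 1/4 and 1/2 of
    (fg)h to the break points 1/2 and 3/4 of f(gh).\<close>
  define \<phi> :: "real \<Rightarrow> real" where "\<phi> t = min (2 * t) (min (t + 1/4) ((t + 1) / 2))" for t
  have F: "F \<in> braid_loops n" unfolding F_def using f g h concat_braid_loops by blast
  have F': "pathin (UConf n) F" "F 0 = base_conf n" "F 1 = base_conf n"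
    using F by (simp_all add: braid_loops_def)
  have \<phi>01: "\<phi> 0 = 0" "\<phi> 1 = 1" by (simp_all add: \<phi>_def)
  have "(\<lambda>t. F (\<phi> t), \<lambda>t. F t) \<in> loop_homotopy n"
  proof (rule reparam_homotopy[OF F'(1), where \<phi> = \<phi> and \<psi> = "\<lambda>t. t"])
    show "continuous_on {0..1} \<phi>" unfolding \<phi>_def by (intro continuous_intros) auto
    show "\<phi> ` {0..1} \<subseteq> {0..1}" by (auto simp: \<phi>_def min_def)
  qed (simp_all add: F' \<phi>01)
  moreover have "(\<lambda>t. F (\<phi> t)) = concat_loops (concat_loops f g) h"
  proof
    fix t :: real
    consider "t \<le> 1/4" | "1/4 < t" "t \<le> 1/2" | "1/2 < t" by linarith
    then show "F (\<phi> t) = concat_loops (concat_loops f g) h t"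
    proof cases
      case 1 then have "\<phi> t = 2 * t" by (auto simp: \<phi>_def min_def)
      with 1 show ?thesis by (simp add: F_def concat_loops_def)
    next
      case 2 then have "\<phi> t = t + 1/4" by (auto simp: \<phi>_def min_def)
      with 2 show ?thesis by (simp add: F_def concat_loops_def algebra_simps)
    next
      case 3 then have "\<phi> t = (t + 1) / 2" by (auto simp: \<phi>_def min_def)
      with 3 show ?thesis by (simp add: F_def concat_loops_def algebra_simps)
    qed
  qed
  ultimately have "braid_class n (concat_loops (concat_loops f g) h) = braid_class n F"
    using braid_class_eqI by metis
  then show "x \<otimes>\<^bsub>Braid n\<^esub> y \<otimes>\<^bsub>Braid n\<^esub> z = x \<otimes>\<^bsub>Braid n\<^esub> (y \<otimes>\<^bsub>Braid n\<^esub> z)"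
    unfolding f(2) g(2) h(2) F_def braid_class_mult[OF f(1) g(1)] braid_class_mult[OF g(1) h(1)]
      braid_class_mult[OF concat_braid_loops[OF f(1) g(1)] h(1)]
      braid_class_mult[OF f(1) concat_braid_loops[OF g(1) h(1)]] .
next
  fix x assume "x \<in> carrier (Braid n)"
  then obtain f where f: "f \<in> braid_loops n" "x = braid_class n f" by (elim carrier_BraidE)
  have f': "pathin (UConf n) f" "f 0 = base_conf n" "f 1 = base_conf n"
    using f(1) by (simp_all add: braid_loops_def)
  \<comment> \<open>The reparametrisation waits at 0 during the first half, where the constant loop
    is traversed.\<close>
  have "(\<lambda>t. f (max 0 (2 * t - 1)), \<lambda>t. f t) \<in> loop_homotopy n"
    by (rule reparam_homotopy[OF f'(1), where \<phi> = "\<lambda>t. max 0 (2 * t - 1)" and \<psi> = "\<lambda>t. t"])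
      (auto simp: f' intro!: continuous_intros)
  moreover have eq: "(\<lambda>t. f (max 0 (2 * t - 1))) = concat_loops (\<lambda>_. base_conf n) f"
  proof
    fix t :: real
    note f'(2)
    moreover have "t \<le> 1/2 \<Longrightarrow> max 0 (2 * t - 1) = 0" "\<not> t \<le> 1/2 \<Longrightarrow> max 0 (2 * t - 1) = 2 * t - 1"
      by (simp_all add: max_def)
    ultimately show "f (max 0 (2 * t - 1)) = concat_loops (\<lambda>_. base_conf n) f t"
      by (simp add: concat_loops_def)
  qed
  ultimately have "braid_class n (concat_loops (\<lambda>_. base_conf n) f) = braid_class n f"
    using braid_class_eqI by metis
  then show "\<one>\<^bsub>Braid n\<^esub> \<otimes>\<^bsub>Braid n\<^esub> x = x"
    unfolding one_Braid f(2) braid_class_mult[OF const_braid_loop[OF n] f(1)] .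
next
  fix x assume "x \<in> carrier (Braid n)"
  then obtain f where f: "f \<in> braid_loops n" "x = braid_class n f" by (elim carrier_BraidE)
  define g where "g t = f (1 - t)" for t
  have f': "pathin (UConf n) f" "f 0 = base_conf n" "f 1 = base_conf n"
    using f(1) by (simp_all add: braid_loops_def)
  have "((\<lambda>t. f (1 - t)), (\<lambda>t. f (1 - t))) \<in> loop_homotopy n"
    by (rule reparam_homotopy[OF f'(1), where \<phi> = "\<lambda>t. 1 - t" and \<psi> = "\<lambda>t. 1 - t"])
      (auto simp: f' intro!: continuous_intros)
  then have g: "g \<in> braid_loops n" unfolding g_def using loop_homotopy_braid_loops by blast
  \<comment> \<open>The parameter runs from 1 down to 0 and back to 1, which is the reversed loop
    followed by \<open>f\<close>; it is contracted to the constant parameter 1.\<close>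
  have "(\<lambda>t. f (max (1 - 2 * t) (2 * t - 1)), \<lambda>t. f 1) \<in> loop_homotopy n"
    by (rule reparam_homotopy[OF f'(1), where \<phi> = "\<lambda>t. max (1 - 2 * t) (2 * t - 1)" and \<psi> = "\<lambda>t. 1"])
      (auto simp: f' intro!: continuous_intros)
  moreover have "(\<lambda>t. f (max (1 - 2 * t) (2 * t - 1))) = concat_loops g f"
  proof
    fix t :: real
    have "t \<le> 1/2 \<Longrightarrow> max (1 - 2 * t) (2 * t - 1) = 1 - 2 * t"
      "\<not> t \<le> 1/2 \<Longrightarrow> max (1 - 2 * t) (2 * t - 1) = 2 * t - 1"
      by (simp_all add: max_def)
    then show "f (max (1 - 2 * t) (2 * t - 1)) = concat_loops g f t"
      by (simp add: concat_loops_def g_def)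
  qed
  ultimately have "braid_class n (concat_loops g f) = braid_class n (\<lambda>t. f 1)"
    by (intro braid_class_eqI) simp
  then have "braid_class n g \<otimes>\<^bsub>Braid n\<^esub> x = \<one>\<^bsub>Braid n\<^esub>"
    unfolding one_Braid f(2) braid_class_mult[OF g f(1)] f'(3) .
  then show "\<exists>y\<in>carrier (Braid n). y \<otimes>\<^bsub>Braid n\<^esub> x = \<one>\<^bsub>Braid n\<^esub>"
    using g braid_class_carrier by blast
qed

text \<open>Keeps the lower end of \<open>{1..n}\<close> as \<open>1\<close>; the simplifier would
  otherwise turn it into \<open>Suc 0\<close>.\<close>

declare One_nat_def [simp del]

section \<open>Strands\<close>

text \<open>Strands are handled as families whose values at indices outside of \<open>{1..n}\<close>
  are free. Points of \<open>Conf n\<close> are extensional functions, so \<open>restrict\<close>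
  appears only in passing to \<open>Conf n\<close>.\<close>

definition conf_map :: "nat \<Rightarrow> 'a::topological_space set \<Rightarrow> ('a \<Rightarrow> nat \<Rightarrow> complex) \<Rightarrow> bool" where
  "conf_map n S F \<longleftrightarrow> (\<forall>i\<in>{1..n}. continuous_on S (\<lambda>x. F x i)) \<and>
     (\<forall>x\<in>S. (\<forall>i\<in>{1..n}. F x i \<in> polygon n) \<and> inj_on (F x) {1..n})"

lemma conf_mapI:
  assumes "\<And>i. i \<in> {1..n} \<Longrightarrow> continuous_on S (\<lambda>x. F x i)"
    and "\<And>x i. x \<in> S \<Longrightarrow> i \<in> {1..n} \<Longrightarrow> F x i \<in> polygon n"
    and "\<And>x i j. x \<in> S \<Longrightarrow> i \<in> {1..n} \<Longrightarrow> j \<in> {1..n} \<Longrightarrow> i < j \<Longrightarrow> F x i \<noteq> F x j"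
  shows "conf_map n S F"
  unfolding conf_map_def inj_on_def using assms by (metis nat_neq_iff)

lemma conf_mapD:
  assumes "conf_map n S F"
  shows "i \<in> {1..n} \<Longrightarrow> continuous_on S (\<lambda>x. F x i)"
    and "x \<in> S \<Longrightarrow> i \<in> {1..n} \<Longrightarrow> F x i \<in> polygon n"
    and "x \<in> S \<Longrightarrow> inj_on (F x) {1..n}"
  using assms by (simp_all add: conf_map_def)

lemma conf_map_neq:
  assumes "conf_map n S F" "x \<in> S" "i \<in> {1..n}" "j \<in> {1..n}" "i \<noteq> j"
  shows "F x i \<noteq> F x j"
  using conf_mapD(3)[OF assms(1,2)] assms(3-5) by (auto dest: inj_onD)

lemma conf_map_compose:
  assumes F: "conf_map n S F" and g: "continuous_on T g" "g ` T \<subseteq> S"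
  shows "conf_map n T (\<lambda>x. F (g x))"
  unfolding conf_map_def using conf_mapD[OF F] g
  by (intro conjI ballI continuous_on_compose2[OF _ g(1)]) (simp_all add: image_subset_iff)

lemma conf_map_cong:
  assumes "conf_map n S F" "\<And>x i. x \<in> S \<Longrightarrow> i \<in> {1..n} \<Longrightarrow> G x i = F x i"
  shows "conf_map n S G"
  unfolding conf_map_def
proof (intro conjI ballI)
  fix i assume i: "i \<in> {1..n}"
  show "continuous_on S (\<lambda>x. G x i)"
    using continuous_on_cong[OF refl, of S "\<lambda>x. G x i" "\<lambda>x. F x i"] assms(2)[OF _ i]
      conf_mapD(1)[OF assms(1) i] by simp
next
  fix x assume x: "x \<in> S"
  show "G x i \<in> polygon n" if "i \<in> {1..n}" for i
    using assms(2)[OF x that] conf_mapD(2)[OF assms(1) x that] by simp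
  show "inj_on (G x) {1..n}"
    using inj_on_cong[of "{1..n}" "G x" "F x"] assms(2)[OF x] conf_mapD(3)[OF assms(1) x] by simp
qed

lemma conf_map_reindex:
  assumes F: "conf_map n S F" and g: "bij_betw \<sigma> {1..n} {1..n}"
  shows "conf_map n S (\<lambda>x i. F x (\<sigma> i))"
proof -
  have m: "\<sigma> i \<in> {1..n}" if "i \<in> {1..n}" for i using g that by (rule bij_betwE[rule_format])
  have "inj_on (F x \<circ> \<sigma>) {1..n}" if "x \<in> S" for x
    using g conf_mapD(3)[OF F that] by (metis bij_betw_def comp_inj_on)
  then show ?thesis
    unfolding conf_map_def using conf_mapD[OF F] m by (simp add: o_def)
qed

lemma conf_map_glue:
  assumes F: "conf_map n S F" and G: "conf_map n T G" and c: "closed S" "closed T"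
    and e: "\<And>x i. x \<in> S \<Longrightarrow> x \<in> T \<Longrightarrow> i \<in> {1..n} \<Longrightarrow> F x i = G x i"
  shows "conf_map n (S \<union> T) (\<lambda>x. if x \<in> S then F x else G x)"
  unfolding conf_map_def
proof (intro conjI ballI)
  fix i assume i: "i \<in> {1..n}"
  have "continuous_on (S \<union> T) (\<lambda>x. if x \<in> S then F x i else G x i)"
    by (rule continuous_on_cases[OF c conf_mapD(1)[OF F i] conf_mapD(1)[OF G i]]) (use e i in auto)
  then show "continuous_on (S \<union> T) (\<lambda>x. (if x \<in> S then F x else G x) i)"
    by (simp add: if_distribR)
next
  fix x assume "x \<in> S \<union> T"
  then show "(if x \<in> S then F x else G x) i \<in> polygon n" if "i \<in> {1..n}" for i
    using conf_mapD(2)[OF F _ that] conf_mapD(2)[OF G _ that] by auto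
  show "inj_on (if x \<in> S then F x else G x) {1..n}"
    using \<open>x \<in> S \<union> T\<close> conf_mapD(3)[OF F] conf_mapD(3)[OF G] by auto
qed

lemma continuous_map_Conf:
  assumes "conf_map n S F"
  shows "continuous_map (top_of_set S) (Conf n) (\<lambda>x. restrict (F x) {1..n})"
  using conf_mapD[OF assms] unfolding Conf_def continuous_map_in_subtopology
  by (simp add: continuous_map_componentwise inj_on_restrict_eq image_subset_iff_funcset
      continuous_map_in_subtopology Pi_iff)

lemma conf_map_Conf:
  assumes "continuous_map (top_of_set S) (Conf n) F"
  shows "conf_map n S F"
  using assms unfolding Conf_def continuous_map_in_subtopology conf_map_def
  by (simp add: continuous_map_componentwise continuous_map_in_subtopology Pi_iff)

lemma continuous_map_UConf:
  assumes "conf_map n S F"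
  shows "continuous_map (top_of_set S) (UConf n) (\<lambda>x. F x ` {1..n})"
  using continuous_map_compose[OF continuous_map_Conf[OF assms] continuous_map_quotient, of "\<lambda>x. x ` {1..n}"]
  by (simp add: UConf_def o_def)

definition strands_braid :: "nat \<Rightarrow> (real \<Rightarrow> nat \<Rightarrow> complex) \<Rightarrow> (real \<Rightarrow> complex set) set" where
  "strands_braid n F = braid_class n (\<lambda>t. F t ` {1..n})"

definition strand_loop :: "nat \<Rightarrow> (real \<Rightarrow> nat \<Rightarrow> complex) \<Rightarrow> bool" where
  "strand_loop n F \<longleftrightarrow> conf_map n {0..1} F \<and> (\<forall>i\<in>{1..n}. F 0 i = vtx n i) \<and>
     F 1 ` {1..n} = base_conf n"

lemma strand_loopD:
  assumes "strand_loop n F"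
  shows "conf_map n {0..1} F" "i \<in> {1..n} \<Longrightarrow> F 0 i = vtx n i" "F 1 ` {1..n} = base_conf n"
    "F 0 ` {1..n} = base_conf n"
  using assms by (simp_all add: strand_loop_def)

lemma conf_map_braid_loop:
  assumes "conf_map n {0..1} F" "F 0 ` {1..n} = base_conf n" "F 1 ` {1..n} = base_conf n"
  shows "(\<lambda>t. F t ` {1..n}) \<in> braid_loops n"
  using continuous_map_UConf[OF assms(1)] assms(2,3) by (simp add: braid_loops_def pathin_def)

lemma strand_loop_braid_loop: "strand_loop n F \<Longrightarrow> (\<lambda>t. F t ` {1..n}) \<in> braid_loops n"
  by (intro conf_map_braid_loop) (simp_all add: strand_loopD)

lemma strands_braid_carrier: "strand_loop n F \<Longrightarrow> strands_braid n F \<in> carrier (Braid n)"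
  unfolding strands_braid_def by (intro braid_class_carrier strand_loop_braid_loop)

lemma strands_braid_homotopy:
  assumes H: "conf_map n unit_square (\<lambda>(s, t). H s t)"
    and e: "\<And>s. s \<in> {0..1} \<Longrightarrow> H s 0 ` {1..n} = base_conf n"
      "\<And>s. s \<in> {0..1} \<Longrightarrow> H s 1 ` {1..n} = base_conf n"
  shows "strands_braid n (H 0) = strands_braid n (H 1)"
  unfolding strands_braid_def
proof (rule braid_class_eqI, unfold loop_homotopy_iff, intro exI conjI ballI)
  show "continuous_map (top_of_set unit_square) (UConf n) (\<lambda>x. (case x of (s, t) \<Rightarrow> H s t) ` {1..n})"
    by (rule continuous_map_UConf[OF H])
qed (use e in simp_all)

lemma strands_braid_cong:
  assumes "\<And>t i. t \<in> {0..1} \<Longrightarrow> i \<in> {1..n} \<Longrightarrow> F t i = G t i" "strand_loop n F"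
  shows "strands_braid n F = strands_braid n G"
proof -
  have "G t ` {1..n} = F t ` {1..n}" if "t \<in> {0..1}" for t
    by (rule image_cong[OF refl]) (use assms(1)[OF that] in simp)
  then show ?thesis
    unfolding strands_braid_def using braid_loops_cong[OF strand_loop_braid_loop[OF assms(2)], of "\<lambda>t. G t ` {1..n}"]
    by (intro braid_class_eqI) simp
qed

definition end_ix :: "nat \<Rightarrow> (real \<Rightarrow> nat \<Rightarrow> complex) \<Rightarrow> nat \<Rightarrow> nat" where
  "end_ix n F i = the_inv_into {1..n} (vtx n) (F 1 i)"

lemma vtx_eq_iff: "n > 0 \<Longrightarrow> i \<in> {1..n} \<Longrightarrow> j \<in> {1..n} \<Longrightarrow> vtx n i = vtx n j \<longleftrightarrow> i = j"
  using vtx_inj by (metis inj_on_eq_iff)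

lemma end_ix:
  assumes "n > 0" "strand_loop n F" "i \<in> {1..n}"
  shows "end_ix n F i \<in> {1..n}" "F 1 i = vtx n (end_ix n F i)"
proof -
  have "F 1 i \<in> base_conf n" using strand_loopD(3)[OF assms(2)] assms(3) by blast
  then show "end_ix n F i \<in> {1..n}" "F 1 i = vtx n (end_ix n F i)"
    unfolding end_ix_def using vtx_inj[OF assms(1)]
    by (metis f_the_inv_into_f the_inv_into_into subset_refl)+
qed

lemma end_ix_eq:
  assumes "n > 0" "j \<in> {1..n}" "F 1 i = vtx n j"
  shows "end_ix n F i = j"
  unfolding end_ix_def assms(3) using vtx_inj[OF assms(1)] assms(2) by (rule the_inv_into_f_f)

lemma end_ix_bij:
  assumes n: "n > 0" and F: "strand_loop n F"
  shows "bij_betw (end_ix n F) {1..n} {1..n}"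
  unfolding bij_betw_def
proof
  show inj: "inj_on (end_ix n F) {1..n}"
  proof (rule inj_onI)
    fix i j assume ij: "i \<in> {1..n}" "j \<in> {1..n}" "end_ix n F i = end_ix n F j"
    then have "F 1 i = F 1 j" using end_ix(2)[OF n F] by metis
    then show "i = j" using conf_map_neq[OF strand_loopD(1)[OF F], of 1 i j] ij by auto
  qed
  have "end_ix n F ` {1..n} \<subseteq> {1..n}" using end_ix(1)[OF n F] by blast
  then show "end_ix n F ` {1..n} = {1..n}"
    using inj by (meson endo_inj_surj finite_atLeastAtMost)
qed

text \<open>In the first half \<open>G\<close> rests at its start and the bracket is 0; in the
  second half \<open>F\<close> rests at the vertex that the bracket subtracts. The strand of
  \<open>G\<close> to continue with is the one that starts where strand \<open>i\<close> of
  \<open>F\<close> ends.\<close>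

definition sconcat ::
  "nat \<Rightarrow> (real \<Rightarrow> nat \<Rightarrow> complex) \<Rightarrow> (real \<Rightarrow> nat \<Rightarrow> complex) \<Rightarrow> real \<Rightarrow> nat \<Rightarrow> complex" where
  "sconcat n F G t i = F (min 1 (2 * t)) i + (G (max 0 (2 * t - 1)) (end_ix n F i) - vtx n (end_ix n F i))"

lemma sconcat_simps:
  assumes "n > 0" "strand_loop n F" "strand_loop n G" "i \<in> {1..n}"
  shows "t \<le> 1/2 \<Longrightarrow> sconcat n F G t i = F (2 * t) i"
    and "t \<ge> 1/2 \<Longrightarrow> sconcat n F G t i = G (2 * t - 1) (end_ix n F i)"
proof -
  note e = end_ix[OF assms(1,2,4)]
  show "t \<le> 1/2 \<Longrightarrow> sconcat n F G t i = F (2 * t) i"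
  proof -
    assume "t \<le> 1/2"
    then have "min 1 (2 * t) = 2 * t" "max 0 (2 * t - 1) = 0" by simp_all
    then show ?thesis using strand_loopD(2)[OF assms(3) e(1)] by (simp add: sconcat_def)
  qed
  show "t \<ge> 1/2 \<Longrightarrow> sconcat n F G t i = G (2 * t - 1) (end_ix n F i)"
  proof -
    assume "t \<ge> 1/2"
    then have "min 1 (2 * t) = 1" "max 0 (2 * t - 1) = 2 * t - 1" by simp_all
    then show ?thesis using e(2) by (simp add: sconcat_def)
  qed
qed

lemma sconcat_loop:
  assumes n: "n > 0" and F: "strand_loop n F" and G: "strand_loop n G"
  shows "strand_loop n (sconcat n F G)"
    and "strands_braid n F \<otimes>\<^bsub>Braid n\<^esub> strands_braid n G = strands_braid n (sconcat n F G)"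
    and "i \<in> {1..n} \<Longrightarrow> sconcat n F G 1 i = G 1 (end_ix n F i)"
proof -
  note s = sconcat_simps[OF n F G] and b = end_ix_bij[OF n F]
  have c1: "conf_map n {0..1/2} (\<lambda>t. F (2 * t))"
    by (rule conf_map_compose[OF strand_loopD(1)[OF F]]) (auto intro!: continuous_intros)
  have c2: "conf_map n {1/2..1} (\<lambda>t i. G (2 * t - 1) (end_ix n F i))"
    by (rule conf_map_reindex[OF conf_map_compose[OF strand_loopD(1)[OF G]] b])
      (auto intro!: continuous_intros)
  have c1': "conf_map n {0..1/2} (sconcat n F G)" by (rule conf_map_cong[OF c1]) (use s(1) in simp)
  have c2': "conf_map n {1/2..1} (sconcat n F G)" by (rule conf_map_cong[OF c2]) (use s(2) in simp)
  have un: "{0..1/2} \<union> {1/2..1::real} = {0..1}" by auto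
  have "conf_map n {0..1} (\<lambda>x. if x \<in> {0..1/2} then sconcat n F G x else sconcat n F G x)"
    using conf_map_glue[OF c1' c2'] unfolding un by blast
  then have cm: "conf_map n {0..1} (sconcat n F G)" by simp
  have im2: "G t ` end_ix n F ` {1..n} = G t ` {1..n}" for t using b by (simp add: bij_betw_def)
  have i1: "sconcat n F G t ` {1..n} = F (2 * t) ` {1..n}" if "t \<le> 1/2" for t
    by (rule image_cong[OF refl s(1)]) (use that in auto)
  have i2: "sconcat n F G t ` {1..n} = G (2 * t - 1) ` {1..n}" if "t \<ge> 1/2" for t
  proof -
    have "sconcat n F G t ` {1..n} = (\<lambda>i. G (2 * t - 1) (end_ix n F i)) ` {1..n}"
      by (rule image_cong[OF refl s(2)]) (use that in auto)
    then show ?thesis using im2[of "2 * t - 1"] by (simp add: image_image)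
  qed
  show sl: "strand_loop n (sconcat n F G)"
    unfolding strand_loop_def
    using cm s(1)[of _ 0] strand_loopD(2)[OF F] i2[of 1] strand_loopD(3)[OF G] by simp
  have "strands_braid n F \<otimes>\<^bsub>Braid n\<^esub> strands_braid n G = braid_class n (concat_loops (\<lambda>t. F t ` {1..n}) (\<lambda>t. G t ` {1..n}))"
    unfolding strands_braid_def by (intro braid_class_mult strand_loop_braid_loop F G)
  also have "\<dots> = strands_braid n (sconcat n F G)"
    unfolding strands_braid_def
  proof (rule braid_class_eqI[symmetric], rule conjunct2, rule braid_loops_cong)
    show "(\<lambda>t. sconcat n F G t ` {1..n}) \<in> braid_loops n" by (rule strand_loop_braid_loop[OF sl])
    show "concat_loops (\<lambda>t. F t ` {1..n}) (\<lambda>t. G t ` {1..n}) t = sconcat n F G t ` {1..n}" for t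
      using i1[of t] i2[of t] by (simp add: concat_loops_def)
  qed
  finally show "strands_braid n F \<otimes>\<^bsub>Braid n\<^esub> strands_braid n G = strands_braid n (sconcat n F G)" .
  show "i \<in> {1..n} \<Longrightarrow> sconcat n F G 1 i = G 1 (end_ix n F i)" using s(2)[of i 1] by simp
qed

lemma const_strand_loop:
  assumes "n > 0" shows "strand_loop n (\<lambda>_. vtx n)" "strands_braid n (\<lambda>_. vtx n) = \<one>\<^bsub>Braid n\<^esub>"
  using vtx_inj[OF assms] vtx_polygon by (simp_all add: strand_loop_def conf_map_def strands_braid_def one_Braid)

text \<open>The reversed loop starts in the end points, so its strands are renumbered by the inverse
  of the end permutation; then strand \<open>i\<close> starts in vertex \<open>i\<close>
  again.\<close>

definition srev :: "nat \<Rightarrow> (real \<Rightarrow> nat \<Rightarrow> complex) \<Rightarrow> real \<Rightarrow> nat \<Rightarrow> complex" where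
  "srev n F t i = F (1 - t) (the_inv_into {1..n} (end_ix n F) i)"

lemma srev_loop:
  assumes n: "n > 0" and F: "strand_loop n F"
  shows "strand_loop n (srev n F)"
    and "strands_braid n (srev n F) = inv\<^bsub>Braid n\<^esub> strands_braid n F"
proof -
  let ?\<sigma> = "the_inv_into {1..n} (end_ix n F)"
  have b: "bij_betw ?\<sigma> {1..n} {1..n}" by (intro bij_betw_the_inv_into end_ix_bij n F)
  have \<sigma>: "end_ix n F (?\<sigma> i) = i" "?\<sigma> i \<in> {1..n}" if "i \<in> {1..n}" for i
    using end_ix_bij[OF n F] that
    by (metis bij_betw_def f_the_inv_into_f, metis b bij_betwE)
  have cm: "conf_map n {0..1} (srev n F)"
    unfolding srev_def
    by (rule conf_map_reindex[OF conf_map_compose[OF strand_loopD(1)[OF F]] b])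
      (auto intro!: continuous_intros)
  have im: "srev n F t ` {1..n} = F (1 - t) ` {1..n}" for t
    using b unfolding srev_def bij_betw_def by (metis image_image)
  show sl: "strand_loop n (srev n F)"
    unfolding strand_loop_def
  proof (intro conjI ballI cm)
    show "srev n F 0 i = vtx n i" if "i \<in> {1..n}" for i
      using end_ix(2)[OF n F \<sigma>(2)[OF that]] \<sigma>(1)[OF that] by (simp add: srev_def)
    show "srev n F 1 ` {1..n} = base_conf n"
      using im[of 1] strand_loopD(4)[OF F] by simp
  qed
  let ?f = "\<lambda>t. F t ` {1..n}"
  have f: "pathin (UConf n) ?f" "?f 0 = base_conf n" "?f 1 = base_conf n"
    using strand_loop_braid_loop[OF F] by (simp_all add: braid_loops_def)
  have "(\<lambda>t. ?f (max (1 - 2 * t) (2 * t - 1)), \<lambda>t. ?f 1) \<in> loop_homotopy n"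
    by (rule reparam_homotopy[OF f(1), where \<phi> = "\<lambda>t. max (1 - 2 * t) (2 * t - 1)" and \<psi> = "\<lambda>t. 1"])
      (auto simp: f(2,3)[simplified] intro!: continuous_intros)
  moreover have "(\<lambda>t. ?f (max (1 - 2 * t) (2 * t - 1))) = concat_loops (\<lambda>t. srev n F t ` {1..n}) ?f"
  proof
    fix t :: real
    have "t \<le> 1/2 \<Longrightarrow> max (1 - 2 * t) (2 * t - 1) = 1 - 2 * t"
      "\<not> t \<le> 1/2 \<Longrightarrow> max (1 - 2 * t) (2 * t - 1) = 2 * t - 1"
      by (simp_all add: max_def)
    then show "?f (max (1 - 2 * t) (2 * t - 1)) = concat_loops (\<lambda>t. srev n F t ` {1..n}) ?f t"
      by (cases "t \<le> 1/2") (simp_all only: concat_loops_def im if_True if_False not_False_eq_True)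
  qed
  ultimately have "strands_braid n (srev n F) \<otimes>\<^bsub>Braid n\<^esub> strands_braid n F = braid_class n (\<lambda>t. ?f 1)"
    unfolding strands_braid_def using strand_loop_braid_loop[OF F] strand_loop_braid_loop[OF sl]
    by (simp only: braid_class_mult braid_class_eqI)
  then have "strands_braid n (srev n F) \<otimes>\<^bsub>Braid n\<^esub> strands_braid n F = \<one>\<^bsub>Braid n\<^esub>"
    by (simp only: one_Braid f(3))
  then show "strands_braid n (srev n F) = inv\<^bsub>Braid n\<^esub> strands_braid n F"
    using group.inv_equality[OF group_Braid[OF n]] strands_braid_carrier[OF F] strands_braid_carrier[OF sl] by metis
qed

lemma strands_strand_loop:
  assumes "f \<in> \<beta>" "\<beta> \<in> carrier (Braid n)" "strands n f F"
  shows "strand_loop n F" "\<beta> = strands_braid n F"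
proof -
  have f: "f \<in> braid_loops n" "\<beta> = braid_class n f" using carrier_Braid_mem assms(1,2) by auto
  have F: "continuous_map (top_of_set {0..1}) (Conf n) F" "\<And>t. t \<in> {0..1} \<Longrightarrow> F t ` {1..n} = f t"
    "\<And>i. i \<in> {1..n} \<Longrightarrow> F 0 i = vtx n i"
    using assms(3) by (simp_all add: strands_def pathin_def)
  show sl: "strand_loop n F"
    unfolding strand_loop_def using conf_map_Conf[OF F(1)] F(2)[of 1] F(3) f(1)
    by (simp add: braid_loops_def)
  have "(f, \<lambda>t. F t ` {1..n}) \<in> loop_homotopy n"
    using braid_loops_cong[OF f(1), of "\<lambda>t. F t ` {1..n}"] F(2) by simp
  then show "\<beta> = strands_braid n F" unfolding f(2) strands_braid_def by (rule braid_class_eqI)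
qed

lemma strand_loop_strands:
  assumes "strand_loop n F"
  shows "strands n (\<lambda>t. F t ` {1..n}) (\<lambda>t. restrict (F t) {1..n})"
    and "(\<lambda>t. F t ` {1..n}) \<in> strands_braid n F"
proof -
  show "strands n (\<lambda>t. F t ` {1..n}) (\<lambda>t. restrict (F t) {1..n})"
    unfolding strands_def pathin_def
    using continuous_map_Conf[OF strand_loopD(1)[OF assms]] strand_loopD(2)[OF assms] by simp
  show "(\<lambda>t. F t ` {1..n}) \<in> strands_braid n F"
    by (simp add: strands_braid_def braid_class_def braid_loops_refl strand_loop_braid_loop assms)
qed

text \<open>Eliminates the loop from the definition: the strands determine it on the unit interval,
  hence its class. From here on braids are treated through their strands only.\<close>

lemma boundary_braids_iff:
  assumes "B \<subseteq> {1..n}"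
  shows "\<beta> \<in> boundary_braids n B B' \<longleftrightarrow> card B = card B' \<and>
    (\<exists>F. strand_loop n F \<and> \<beta> = strands_braid n F \<and> (\<forall>b\<in>B. F 1 b \<in> vtx n ` B') \<and>
      (\<forall>b\<in>B. \<forall>t\<in>{0..1}. F t b \<in> frontier (polygon n)))" (is "?L \<longleftrightarrow> ?R")
proof
  assume ?L
  then obtain f F where f: "\<beta> \<in> carrier (Braid n)" "card B = card B'" "f \<in> \<beta>" "strands n f F"
    "\<forall>b\<in>B. F 1 b \<in> vtx n ` B'" "\<forall>b\<in>B. \<forall>t\<in>{0..1}. F t b \<in> frontier (polygon n)"
    unfolding boundary_braids_def by blast
  then show ?R using strands_strand_loop[OF f(3,1,4)] by metis
next
  assume ?R
  then obtain F where F: "card B = card B'" "strand_loop n F" "\<beta> = strands_braid n F"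
    "\<forall>b\<in>B. F 1 b \<in> vtx n ` B'" "\<forall>b\<in>B. \<forall>t\<in>{0..1}. F t b \<in> frontier (polygon n)" by metis
  have "\<forall>b\<in>B. restrict (F t) {1..n} b = F t b" for t using assms by auto
  then show ?L
    unfolding boundary_braids_def F(3) using F(1,4,5) strands_braid_carrier[OF F(2)] strand_loop_strands[OF F(2)]
    by (simp only: mem_Collect_eq, metis (no_types, lifting))
qed

lemma fix_braids_iff:
  assumes "B \<subseteq> {1..n}"
  shows "\<beta> \<in> fix_braids n B \<longleftrightarrow>
    (\<exists>F. strand_loop n F \<and> \<beta> = strands_braid n F \<and> (\<forall>b\<in>B. \<forall>t\<in>{0..1}. F t b = vtx n b))" (is "?L \<longleftrightarrow> ?R")
proof
  assume ?L
  then obtain f F where f: "\<beta> \<in> carrier (Braid n)" "f \<in> \<beta>" "strands n f F"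
    "\<forall>b\<in>B. \<forall>t\<in>{0..1}. F t b = vtx n b"
    unfolding fix_braids_def by blast
  then show ?R using strands_strand_loop[OF f(2,1,3)] by metis
next
  assume ?R
  then obtain F where F: "strand_loop n F" "\<beta> = strands_braid n F" "\<forall>b\<in>B. \<forall>t\<in>{0..1}. F t b = vtx n b" by metis
  have "\<forall>b\<in>B. restrict (F t) {1..n} b = F t b" for t using assms by auto
  then show ?L
    unfolding fix_braids_def F(2) using F(3) strands_braid_carrier[OF F(1)] strand_loop_strands[OF F(1)]
    by (simp only: mem_Collect_eq, metis (no_types, lifting))
qed

subsection \<open>Lifting homotopies to strands\<close>

text \<open>These sets replace the quotient topology in all lifting arguments. \<open>Z\<close> is a
  reference labelling, which may vary with a parameter; the witness \<open>x\<close> is any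
  labelling of the configuration.\<close>

definition conf_nbhd :: "nat \<Rightarrow> (nat \<Rightarrow> complex) \<Rightarrow> real \<Rightarrow> complex set set" where
  "conf_nbhd n Z d = {S \<in> topspace (UConf n). \<exists>x. S = x ` {1..n} \<and> (\<forall>i\<in>{1..n}. dist (x i) (Z i) < d)}"

lemma inj_on_same_image:
  fixes x y :: "nat \<Rightarrow> 'b"
  assumes "inj_on x {1..n}" "y ` {1..n} = x ` {1..n}"
  shows "inj_on y {1..n}" and "\<exists>\<sigma>. bij_betw \<sigma> {1..n} {1..n} \<and> (\<forall>i\<in>{1..n}. y i = x (\<sigma> i))"
proof -
  show y: "inj_on y {1..n}"
    using assms card_image[OF assms(1)] by (intro eq_card_imp_inj_on) simp_all
  define \<sigma> where "\<sigma> = the_inv_into {1..n} x \<circ> y"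
  have "bij_betw y {1..n} (x ` {1..n})" using y assms(2) by (simp add: bij_betw_def)
  moreover have "bij_betw (the_inv_into {1..n} x) (x ` {1..n}) {1..n}"
    using assms(1) by (intro bij_betw_the_inv_into) (simp add: bij_betw_def)
  ultimately have "bij_betw \<sigma> {1..n} {1..n}" unfolding \<sigma>_def by (rule bij_betw_trans)
  moreover have "y i = x (\<sigma> i)" if "i \<in> {1..n}" for i
  proof -
    have "y i \<in> x ` {1..n}" using that assms(2) by blast
    then show ?thesis by (simp add: \<sigma>_def f_the_inv_into_f assms(1))
  qed
  ultimately show "\<exists>\<sigma>. bij_betw \<sigma> {1..n} {1..n} \<and> (\<forall>i\<in>{1..n}. y i = x (\<sigma> i))" by blast
qed

text \<open>The preimage among ordered configurations is the union, over all permutations of the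
  labels, of finite intersections of open conditions on single coordinates.\<close>

lemma openin_conf_nbhd: "openin (UConf n) (conf_nbhd n Z d)"
proof -
  let ?C = "Conf n"
  let ?B = "{\<sigma>. bij_betw \<sigma> {1..n} {1..n}}"
  have eq: "{x \<in> topspace ?C. x ` {1..n} \<in> conf_nbhd n Z d} =
      (\<Union>\<sigma>\<in>?B. {x \<in> topspace ?C. \<forall>i\<in>{1..n}. x (\<sigma> i) \<in> ball (Z i) d})" (is "?L = ?R")
  proof (intro equalityI subsetI)
    fix x assume "x \<in> ?L"
    then obtain y where x: "x \<in> topspace ?C" and y: "x ` {1..n} = y ` {1..n}"
      "\<forall>i\<in>{1..n}. dist (y i) (Z i) < d" by (auto simp: conf_nbhd_def)
    from x have "inj_on x {1..n}" by (simp add: topspace_Conf)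
    from inj_on_same_image(2)[OF this y(1)[symmetric]]
    obtain \<sigma> where "bij_betw \<sigma> {1..n} {1..n}" "\<forall>i\<in>{1..n}. y i = x (\<sigma> i)" by blast
    then show "x \<in> ?R" using x y(2) by (auto simp: dist_commute)
  next
    fix x assume "x \<in> ?R"
    then obtain \<sigma> where \<sigma>: "bij_betw \<sigma> {1..n} {1..n}" and x: "x \<in> topspace ?C"
      "\<forall>i\<in>{1..n}. x (\<sigma> i) \<in> ball (Z i) d" by blast
    have "x ` {1..n} = (\<lambda>i. x (\<sigma> i)) ` {1..n}"
      using \<sigma> by (metis bij_betw_def image_image)
    moreover have "x ` {1..n} \<in> topspace (UConf n)" using x(1) by (simp add: topspace_UConf)
    ultimately show "x \<in> ?L"
      unfolding conf_nbhd_def using x by (auto simp: dist_commute)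
  qed
  have "openin ?C {x \<in> topspace ?C. \<forall>i\<in>{1..n}. x (\<sigma> i) \<in> ball (Z i) d}" if \<sigma>: "\<sigma> \<in> ?B" for \<sigma>
  proof -
    have "openin ?C {x \<in> topspace ?C. x (\<sigma> i) \<in> ball (Z i) d}" if "i \<in> {1..n}" for i
    proof -
      have "\<sigma> i \<in> {1..n}" using \<sigma> that bij_betwE by blast
      then have "continuous_map ?C (top_of_set (polygon n)) (\<lambda>x. x (\<sigma> i))"
        unfolding Conf_def by (intro continuous_map_from_subtopology continuous_map_product_projection)
      then have "continuous_map ?C euclidean (\<lambda>x. x (\<sigma> i))"
        by (rule continuous_map_into_fulltopology)
      then show ?thesis by (rule openin_continuous_map_preimage) simp
    qed
    then have "openin ?C (\<Inter>((\<lambda>i. {x \<in> topspace ?C. x (\<sigma> i) \<in> ball (Z i) d}) ` {1..n}) \<inter> topspace ?C)"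
      by (intro openin_INT) auto
    moreover have "\<Inter>((\<lambda>i. {x \<in> topspace ?C. x (\<sigma> i) \<in> ball (Z i) d}) ` {1..n}) \<inter> topspace ?C
       = {x \<in> topspace ?C. \<forall>i\<in>{1..n}. x (\<sigma> i) \<in> ball (Z i) d}" by auto
    ultimately show ?thesis by simp
  qed
  then have "openin ?C ?R" by (intro openin_Union) auto
  then show ?thesis
    unfolding UConf_def openin_quotient_topology eq[unfolded UConf_def]
    by (auto simp: conf_nbhd_def topspace_UConf)
qed

lemma conf_nbhd_refl:
  assumes "S \<in> topspace (UConf n)" "d > 0" "S = Z ` {1..n}"
  shows "S \<in> conf_nbhd n Z d"
  unfolding conf_nbhd_def using assms by auto

lemma eventually_conf_nbhd:
  assumes h: "continuous_map (top_of_set S) (UConf n) h" and x: "x \<in> S" "h x = Z ` {1..n}" and d: "d > 0"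
  shows "eventually (\<lambda>y. h y \<in> conf_nbhd n Z d) (at x within S)"
proof -
  have "openin (top_of_set S) {y \<in> topspace (top_of_set S). h y \<in> conf_nbhd n Z d}"
    by (rule openin_continuous_map_preimage[OF h openin_conf_nbhd])
  then obtain T where T: "open T" "{y \<in> topspace (top_of_set S). h y \<in> conf_nbhd n Z d} = S \<inter> T"
    by (auto simp: openin_open)
  have hx: "h x \<in> topspace (UConf n)" using h x(1) by (auto simp: continuous_map_def Pi_iff)
  have "h x \<in> conf_nbhd n Z d" by (rule conf_nbhd_refl[OF hx d x(2)])
  then have "x \<in> S \<inter> T" using x(1) unfolding T(2)[symmetric] by simp
  moreover have "h y \<in> conf_nbhd n Z d" if "y \<in> S \<inter> T" for y
    using that unfolding T(2)[symmetric] by simp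
  ultimately show ?thesis
    unfolding eventually_at_topological using T(1) by blast
qed

text \<open>The factor 2 makes the balls of radius \<open>\<epsilon>\<close> around the points
  disjoint, so that a point close to one of them determines its index.\<close>

definition separated_by :: "nat \<Rightarrow> real \<Rightarrow> (nat \<Rightarrow> complex) \<Rightarrow> bool" where
  "separated_by n \<epsilon> Z \<longleftrightarrow> (\<forall>i\<in>{1..n}. \<forall>j\<in>{1..n}. i \<noteq> j \<longrightarrow> 2 * \<epsilon> \<le> dist (Z i) (Z j))"

lemma separated_by_unique:
  assumes "separated_by n \<epsilon> Z" "i \<in> {1..n}" "j \<in> {1..n}" "dist w (Z i) < \<epsilon>" "dist w (Z j) < \<epsilon>"
  shows "i = j"
proof (rule ccontr)
  assume "i \<noteq> j"
  then have "2 * \<epsilon> \<le> dist (Z i) (Z j)" using assms by (simp add: separated_by_def)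
  also have "\<dots> \<le> dist w (Z i) + dist w (Z j)" by (rule dist_triangle3)
  finally show False using assms(4,5) by simp
qed

lemma conf_map_separated:
  assumes F: "conf_map n S F" and S: "compact S"
  obtains \<epsilon> where "\<epsilon> > 0" "\<And>x. x \<in> S \<Longrightarrow> separated_by n \<epsilon> (F x)"
proof -
  have ex: "\<exists>e>0. \<forall>x\<in>S. i \<noteq> j \<longrightarrow> e \<le> dist (F x i) (F x j)" if ij: "i \<in> {1..n}" "j \<in> {1..n}" for i j
  proof (cases "S = {} \<or> i = j")
    case True then show ?thesis by (intro exI[of _ 1]) auto
  next
    case False
    have "continuous_on S (\<lambda>x. dist (F x i) (F x j))"
      using conf_mapD(1)[OF F] ij by (intro continuous_intros) auto
    then obtain x where x: "x \<in> S" "\<forall>y\<in>S. dist (F x i) (F x j) \<le> dist (F y i) (F y j)"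
      using continuous_attains_inf[OF S] False by blast
    have "0 < dist (F x i) (F x j)" using conf_map_neq[OF F x(1) ij] False by simp
    then show ?thesis using x(2) by blast
  qed
  then obtain e where e: "\<And>i j. i \<in> {1..n} \<Longrightarrow> j \<in> {1..n} \<Longrightarrow> 0 < e i j \<and> (\<forall>x\<in>S. i \<noteq> j \<longrightarrow> e i j \<le> dist (F x i) (F x j))"
    by metis
  let ?E = "insert 1 ((\<lambda>(i, j). e i j) ` ({1..n} \<times> {1..n}))"
  have fin: "finite ?E" by simp
  have pos: "0 < Min ?E" using e by (subst Min_gr_iff) auto
  have "separated_by n (Min ?E / 2) (F x)" if "x \<in> S" for x
    unfolding separated_by_def
  proof (intro ballI impI)
    fix i j assume ij: "i \<in> {1..n}" "j \<in> {1..n}" "i \<noteq> j"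
    have "e i j \<in> ?E" using ij by auto
    then have "Min ?E \<le> e i j" by (rule Min_le[OF fin])
    then show "2 * (Min ?E / 2) \<le> dist (F x i) (F x j)" using e[OF ij(1,2)] ij(3) that by force
  qed
  then show ?thesis using pos that[of "Min ?E / 2"] by simp
qed

lemma conf_map_point:
  assumes "S \<in> topspace (UConf n)"
  obtains Z where "S = Z ` {1..n}" "\<forall>i\<in>{1..n}. Z i \<in> polygon n" "inj_on Z {1..n}"
  using assms unfolding topspace_UConf topspace_Conf by (auto simp: PiE_iff)

lemma continuous_map_UConf_point:
  assumes "continuous_map (top_of_set S) (UConf n) h" "x \<in> S"
  shows "h x \<in> topspace (UConf n)"
  using assms by (auto simp: continuous_map_def Pi_iff)

text \<open>Each point of \<open>h x\<close> receives the label of the one point of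
  \<open>Z x\<close> within distance \<open>\<epsilon>\<close>. This labelling is continuous: a
  point of \<open>h y\<close> close to \<open>K x i\<close> is still within
  \<open>\<epsilon>\<close> of \<open>Z y i\<close>, so it carries the label
  \<open>i\<close>.\<close>

lemma lift_near:
  fixes h :: "'a::topological_space \<Rightarrow> complex set"
  assumes h: "continuous_map (top_of_set S) (UConf n) h"
    and Z: "\<And>i. i \<in> {1..n} \<Longrightarrow> continuous_on S (\<lambda>x. Z x i)"
    and sep: "\<And>x. x \<in> S \<Longrightarrow> separated_by n \<epsilon> (Z x)"
    and near: "\<And>x. x \<in> S \<Longrightarrow> h x \<in> conf_nbhd n (Z x) \<epsilon>"
  obtains K where "conf_map n S K" "\<And>x. x \<in> S \<Longrightarrow> K x ` {1..n} = h x"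
    "\<And>x i. x \<in> S \<Longrightarrow> i \<in> {1..n} \<Longrightarrow> dist (K x i) (Z x i) < \<epsilon>"
proof -
  have "\<forall>x\<in>S. \<exists>y. h x = y ` {1..n} \<and> (\<forall>i\<in>{1..n}. dist (y i) (Z x i) < \<epsilon>)"
    using near unfolding conf_nbhd_def by blast
  then obtain K where K: "\<And>x. x \<in> S \<Longrightarrow> h x = K x ` {1..n}"
    "\<And>x i. x \<in> S \<Longrightarrow> i \<in> {1..n} \<Longrightarrow> dist (K x i) (Z x i) < \<epsilon>"
    by metis
  have cont: "continuous_on S (\<lambda>x. K x i)" if i: "i \<in> {1..n}" for i
    unfolding continuous_on
  proof (intro ballI tendstoI)
    fix x and e :: real assume x: "x \<in> S" and e: "0 < e"
    \<comment> \<open>The slack of \<open>K x i\<close> inside the ball around \<open>Z x i\<close>.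
      One half is spent on the motion of the point, the other half on the motion of
      \<open>Z\<close>.\<close>
    define r where "r = \<epsilon> - dist (K x i) (Z x i)"
    have r: "r > 0" using K(2)[OF x i] by (simp add: r_def)
    define d where "d = min e (r / 2)"
    have d: "d > 0" using e r by (simp add: d_def)
    have "eventually (\<lambda>y. h y \<in> conf_nbhd n (K x) d) (at x within S)"
      by (rule eventually_conf_nbhd[OF h x K(1)[OF x] d])
    moreover have "eventually (\<lambda>y. dist (Z y i) (Z x i) < r / 2) (at x within S)"
      using Z[OF i] x r unfolding continuous_on by (intro tendstoD) auto
    moreover have "eventually (\<lambda>y. y \<in> S) (at x within S)"
      by (simp add: eventually_at_filter)
    ultimately show "eventually (\<lambda>y. dist (K y i) (K x i) < e) (at x within S)"
    proof eventually_elim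
      case (elim y)
      then obtain u where u: "h y = u ` {1..n}" "\<forall>i\<in>{1..n}. dist (u i) (K x i) < d"
        unfolding conf_nbhd_def by blast
      have "u i \<in> K y ` {1..n}" using u(1) K(1)[OF elim(3)] i by blast
      then obtain j where j: "j \<in> {1..n}" "u i = K y j" by blast
      have "dist (u i) (Z y i) \<le> dist (u i) (K x i) + dist (K x i) (Z x i) + dist (Z y i) (Z x i)"
        using dist_triangle[of "u i" "Z y i" "K x i"] dist_triangle[of "K x i" "Z y i" "Z x i"]
        by (simp add: dist_commute)
      also have "\<dots> < r / 2 + (\<epsilon> - r) + r / 2"
        using u(2) i elim(2) by (intro add_strict_mono add_less_le_mono) (auto simp: d_def r_def)
      finally have "dist (K y j) (Z y i) < \<epsilon>" using j(2) by simp
      then have "j = i" using separated_by_unique[OF sep[OF elim(3)] j(1) i K(2)[OF elim(3) j(1)]] by simp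
      then show ?case using u(2)[rule_format, OF i] j by (simp add: d_def)
    qed
  qed
  have "conf_map n S K"
    unfolding conf_map_def
  proof (intro conjI ballI cont)
    fix x assume x: "x \<in> S"
    obtain W where W: "h x = W ` {1..n}" "\<forall>i\<in>{1..n}. W i \<in> polygon n" "inj_on W {1..n}"
      by (rule conf_map_point[OF continuous_map_UConf_point[OF h x]])
    have eq: "K x ` {1..n} = W ` {1..n}" using K(1)[OF x] W(1) by simp
    show "inj_on (K x) {1..n}" by (rule inj_on_same_image(1)[OF W(3) eq])
    show "K x i \<in> polygon n" if "i \<in> {1..n}" for i
    proof -
      have "K x i \<in> W ` {1..n}" using eq that by blast
      then show ?thesis using W(2) by (metis imageE)
    qed
  qed
  then show ?thesis using that K by metis
qed

text \<open>Subdivision by \<open>Bolzano\<close>. The predicate \<open>P a b\<close> quantifies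
  over all labellings at \<open>a\<close>, so that lifts over adjacent intervals can be joined; on a
  short interval \<open>lift_near\<close> applies with a constant reference labelling, and its
  result is renumbered to start as prescribed.\<close>

lemma path_lift:
  fixes f :: "real \<Rightarrow> complex set"
  assumes f: "continuous_map (top_of_set {0..1}) (UConf n) f"
    and x: "x ` {1..n} = f 0"
  obtains F where "conf_map n {0..1} F" "\<And>t. t \<in> {0..1} \<Longrightarrow> F t ` {1..n} = f t"
    "\<And>i. i \<in> {1..n} \<Longrightarrow> F 0 i = x i"
proof -
  define P where "P a b \<longleftrightarrow> (0 \<le> a \<and> a \<le> b \<and> b \<le> 1 \<longrightarrow> (\<forall>x. x ` {1..n} = f a \<longrightarrow>
    (\<exists>F. conf_map n {a..b} F \<and> (\<forall>t\<in>{a..b}. F t ` {1..n} = f t) \<and> (\<forall>i\<in>{1..n}. F a i = x i))))" for a b :: real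
  have "P 0 1"
  proof (rule Bolzano[of 0 1 P])
    fix a b c :: real assume trans: "P a b" "P b c" "a \<le> b" "b \<le> c"
    show "P a c"
      unfolding P_def
    proof (intro impI allI)
      fix x :: "nat \<Rightarrow> complex"
      assume abc: "0 \<le> a \<and> a \<le> c \<and> c \<le> 1" and x: "x ` {1..n} = f a"
      then obtain F where F: "conf_map n {a..b} F" "\<forall>t\<in>{a..b}. F t ` {1..n} = f t" "\<forall>i\<in>{1..n}. F a i = x i"
        using trans unfolding P_def by force
      have Fb: "F b ` {1..n} = f b" using F(2) trans(3) by simp
      then obtain G where G: "conf_map n {b..c} G" "\<forall>t\<in>{b..c}. G t ` {1..n} = f t" "\<forall>i\<in>{1..n}. G b i = F b i"
        using trans abc unfolding P_def by force
      let ?H = "\<lambda>t. if t \<in> {a..b} then F t else G t"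
      have "conf_map n ({a..b} \<union> {b..c}) ?H"
      proof (rule conf_map_glue[OF F(1) G(1)])
        fix t i assume "t \<in> {a..b}" "t \<in> {b..c}" "i \<in> {1..n}"
        then have "t = b" by auto
        then show "F t i = G t i" using G(3) \<open>i \<in> {1..n}\<close> by simp
      qed auto
      moreover have "{a..b} \<union> {b..c} = {a..c}" using trans(3,4) by auto
      ultimately show "\<exists>F. conf_map n {a..c} F \<and> (\<forall>t\<in>{a..c}. F t ` {1..n} = f t) \<and> (\<forall>i\<in>{1..n}. F a i = x i)"
        using F(2,3) G(2) trans(3,4) by (intro exI[of _ ?H]) auto
    qed
  next
    fix t0 :: real assume "0 \<le> t0" "t0 \<le> 1"
    then have t0: "t0 \<in> {0..1}" by simp
    obtain Z where Z: "f t0 = Z ` {1..n}" "\<forall>i\<in>{1..n}. Z i \<in> polygon n" "inj_on Z {1..n}"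
      by (rule conf_map_point[OF continuous_map_UConf_point[OF f t0]])
    have "conf_map n {t0} (\<lambda>_. Z)" using Z by (simp add: conf_map_def)
    from conf_map_separated[OF this] obtain \<epsilon> where \<epsilon>: "\<epsilon> > 0" "separated_by n \<epsilon> Z" by auto
    from eventually_conf_nbhd[OF f t0 Z(1) \<epsilon>(1)]
    obtain d where d: "d > 0" "\<forall>t\<in>{0..1}. t \<noteq> t0 \<and> dist t t0 < d \<longrightarrow> f t \<in> conf_nbhd n Z \<epsilon>"
      unfolding eventually_at by blast
    have near: "f t \<in> conf_nbhd n Z \<epsilon>" if "t \<in> {0..1}" "dist t t0 < d" for t
      using d(2) that conf_nbhd_refl[OF continuous_map_UConf_point[OF f t0] \<epsilon>(1) Z(1)] by (cases "t = t0") auto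
    have "P a b" if ab: "a \<le> t0 \<and> t0 \<le> b \<and> b - a < d" for a b
      unfolding P_def
    proof (intro impI allI)
      fix x :: "nat \<Rightarrow> complex"
      assume ab': "0 \<le> a \<and> a \<le> b \<and> b \<le> 1" and x: "x ` {1..n} = f a"
      have sub: "{a..b} \<subseteq> {0..1}" using ab' by auto
      have "f t \<in> conf_nbhd n Z \<epsilon>" if "t \<in> {a..b}" for t
        using near[of t] ab ab' that by (auto simp: dist_real_def)
      with continuous_map_from_subtopology_mono[OF f sub]
      obtain K where K: "conf_map n {a..b} K" "\<And>t. t \<in> {a..b} \<Longrightarrow> K t ` {1..n} = f t"
        using lift_near[of "{a..b}" n f "\<lambda>_. Z" \<epsilon>] \<epsilon>(2) continuous_on_const by metis
      have "x ` {1..n} = K a ` {1..n}" using K(2)[of a] x ab' by simp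
      from inj_on_same_image(2)[OF conf_mapD(3)[OF K(1)] this] ab'
      obtain \<sigma> where \<sigma>: "bij_betw \<sigma> {1..n} {1..n}" "\<forall>i\<in>{1..n}. x i = K a (\<sigma> i)" by auto
      have "(\<lambda>i. K t (\<sigma> i)) ` {1..n} = f t" if "t \<in> {a..b}" for t
        using K(2)[OF that] \<sigma>(1) by (metis bij_betw_def image_image)
      then show "\<exists>F. conf_map n {a..b} F \<and> (\<forall>t\<in>{a..b}. F t ` {1..n} = f t) \<and> (\<forall>i\<in>{1..n}. F a i = x i)"
        using conf_map_reindex[OF K(1) \<sigma>(1)] \<sigma>(2) by (intro exI[of _ "\<lambda>t i. K t (\<sigma> i)"]) auto
    qed
    then show "\<exists>d>0. \<forall>a b. a \<le> t0 \<and> t0 \<le> b \<and> b - a < d \<longrightarrow> P a b" using d(1) by blast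
  qed simp
  then obtain F where "conf_map n {0..1} F" "\<forall>t\<in>{0..1}. F t ` {1..n} = f t" "\<forall>i\<in>{1..n}. F 0 i = x i"
    using x unfolding P_def by (meson order_refl zero_le_one)
  then show ?thesis using that by blast
qed

text \<open>Near a point \<open>y\<close>, the value \<open>F z i\<close> equals
  \<open>G z j\<close> for one fixed \<open>j\<close>, because the points of the common
  configuration are separated. Hence \<open>F z i = G z i\<close> means \<open>i = j\<close> there,
  which is a locally constant condition on a connected set.\<close>

lemma lift_unique:
  fixes F G :: "'a::topological_space \<Rightarrow> nat \<Rightarrow> complex"
  assumes F: "conf_map n S F" and G: "conf_map n S G" and S: "connected S"
    and eq: "\<And>x. x \<in> S \<Longrightarrow> F x ` {1..n} = G x ` {1..n}"
    and x0: "x0 \<in> S" "F x0 i = G x0 i" and i: "i \<in> {1..n}" and x: "x \<in> S"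
  shows "F x i = G x i"
proof -
  have "(\<lambda>y. F y i = G y i) x"
  proof (rule connected_induction_simple[OF S, where P = "\<lambda>y. F y i = G y i"])
    fix y assume y: "y \<in> S"
    have "conf_map n {y} (\<lambda>_. F y)" using conf_mapD[OF F] y by (simp add: conf_map_def)
    from conf_map_separated[OF this] obtain \<epsilon> where \<epsilon>: "\<epsilon> > 0" "separated_by n \<epsilon> (F y)" by auto
    obtain j where j: "j \<in> {1..n}" "G y j = F y i" using eq[OF y] i by (metis image_iff)
    have "eventually (\<lambda>z. (\<forall>k\<in>{1..n}. dist (G z k) (G y k) < \<epsilon>) \<and> dist (F z i) (F y i) < \<epsilon>) (at y within S)"
      using conf_mapD(1)[OF F] conf_mapD(1)[OF G] \<epsilon>(1) i y
      unfolding continuous_on by (intro eventually_conj eventually_ball_finite ballI tendstoD) auto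
    then obtain T where T: "open T" "y \<in> T"
      "\<forall>z\<in>T. z \<noteq> y \<longrightarrow> z \<in> S \<longrightarrow> (\<forall>k\<in>{1..n}. dist (G z k) (G y k) < \<epsilon>) \<and> dist (F z i) (F y i) < \<epsilon>"
      unfolding eventually_at_topological by blast
    have key: "F z i = G z j" if z: "z \<in> T" "z \<in> S" for z
    proof -
      have near: "(\<forall>k\<in>{1..n}. dist (G z k) (G y k) < \<epsilon>) \<and> dist (F z i) (F y i) < \<epsilon>"
        using T(3) z \<epsilon>(1) by (cases "z = y") auto
      have "conf_map n {y} (\<lambda>_. G y)" using conf_mapD[OF G] y by (simp add: conf_map_def)
      obtain k where k: "k \<in> {1..n}" "F z i = G z k" using eq[OF z(2)] i by (metis image_iff)
      obtain l where l: "l \<in> {1..n}" "G y k = F y l" using eq[OF y] k(1) by (metis image_iff)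
      have "dist (F z i) (F y l) < \<epsilon>" using near k l by metis
      then have "l = i" using separated_by_unique[OF \<epsilon>(2) l(1) i] near by blast
      then have "G y k = G y j" using l j by simp
      then have "k = j" using conf_map_neq[OF G y k(1) j(1)] by blast
      then show ?thesis using k by simp
    qed
    have "G z i = G z j \<longleftrightarrow> i = j" if "z \<in> S" for z
      using conf_map_neq[OF G that i j(1)] by blast
    then have "\<forall>u\<in>S \<inter> T. \<forall>v\<in>S \<inter> T. F u i = G u i \<longrightarrow> F v i = G v i"
      using key by (metis IntD1 IntD2)
    moreover have "openin (top_of_set S) (S \<inter> T)" using T(1) by (simp add: openin_open_Int)
    ultimately show "\<exists>T. openin (top_of_set S) T \<and> y \<in> T \<and> (\<forall>x\<in>T. \<forall>z\<in>T. F x i = G x i \<longrightarrow> F z i = G z i)"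
      using T(2) y by blast
  qed (use x0 x in auto)
  then show ?thesis .
qed

text \<open>The homotopy of unordered configurations is lifted strip by strip in the homotopy
  parameter. Around one value \<open>s0\<close> the lift of the path at \<open>s0\<close> is the
  reference labelling for \<open>lift_near\<close>. The ends stay put because the configurations at
  times 0 and 1 are constant.\<close>

lemma strand_homotopy:
  assumes n: "n > 0" and F: "strand_loop n F" and G: "strand_loop n G" and eq: "strands_braid n F = strands_braid n G"
  obtains H where "conf_map n unit_square H"
    "\<forall>t\<in>{0..1}. \<forall>i\<in>{1..n}. H (0, t) i = F t i"
    "\<forall>t\<in>{0..1}. \<forall>i\<in>{1..n}. H (1, t) i = G t i"
    "\<forall>s\<in>{0..1}. \<forall>i\<in>{1..n}. H (s, 0) i = vtx n i"
    "\<forall>s\<in>{0..1}. \<forall>i\<in>{1..n}. H (s, 1) i = F 1 i"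
proof -
  have "(\<lambda>t. F t ` {1..n}, \<lambda>t. G t ` {1..n}) \<in> loop_homotopy n"
    using eq strand_loop_braid_loop[OF F] strand_loop_braid_loop[OF G]
    by (simp only: strands_braid_def braid_class_eq_iff)
  then obtain h where h: "continuous_map (top_of_set unit_square) (UConf n) h"
       "\<forall>t\<in>{0..1}. h (0, t) = F t ` {1..n}" "\<forall>t\<in>{0..1}. h (1, t) = G t ` {1..n}"
       "\<forall>s\<in>{0..1}. h (s, 0) = base_conf n \<and> h (s, 1) = base_conf n"
    unfolding loop_homotopy_iff by (elim exE conjE) (rule that; assumption)
  have hb: "h (s, u) = base_conf n" if "0 \<le> s" "s \<le> 1" "u \<in> {0, 1}" for s u :: real
  proof -
    have "h (s, 0) = base_conf n \<and> h (s, 1) = base_conf n"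
      using that(1,2) by (intro h(4)[rule_format]) simp
    then show ?thesis using that(3) by (metis insertE singletonD)
  qed
  \<comment> \<open>Along the sides at times 0 and 1 the unordered configuration is constantly the
    set of vertices, so the lift agrees with a constant one by \<open>lift_unique\<close>.\<close>
  have const: "H (s, u) i = H (a, u) i"
    if H: "conf_map n ({a..b} \<times> {0..1}) H" and hH: "\<And>s t. s \<in> {a..b} \<Longrightarrow> t \<in> {0..1} \<Longrightarrow> H (s, t) ` {1..n} = h (s, t)"
      and ab: "0 \<le> a" "b \<le> 1" and s: "s \<in> {a..b}" and u: "u \<in> {0, 1}" and i: "i \<in> {1..n}"
    for H :: "real \<times> real \<Rightarrow> nat \<Rightarrow> complex" and a b s u :: real and i
  proof -
    have u01: "u \<in> {0..1}" using u by auto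
    have aI: "a \<in> {a..b}" using s by auto
    have c1: "conf_map n {a..b} (\<lambda>s. H (s, u))"
      by (rule conf_map_compose[OF H]) (use u01 in \<open>auto intro!: continuous_intros\<close>)
    have "conf_map n {a..b} (\<lambda>_. H (a, u))"
      using conf_mapD[OF c1] aI by (simp add: conf_map_def)
    moreover have im: "H (x, u) ` {1..n} = H (a, u) ` {1..n}" if "x \<in> {a..b}" for x
    proof -
      have "0 \<le> x" "x \<le> 1" "0 \<le> a" "a \<le> 1" using ab s that by auto
      then show ?thesis
        using hH[OF that u01] hH[OF aI u01] hb[OF _ _ u] by metis
    qed
    ultimately show ?thesis
      using lift_unique[OF c1 _ connected_Icc im aI refl i s] by blast
  qed
  define P where "P a b \<longleftrightarrow> (0 \<le> a \<and> a \<le> b \<and> b \<le> 1 \<longrightarrow> (\<forall>G. conf_map n {0..1} G \<longrightarrow>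
      (\<forall>t\<in>{0..1}. G t ` {1..n} = h (a, t)) \<longrightarrow> (\<forall>i\<in>{1..n}. G 0 i = vtx n i) \<longrightarrow>
      (\<exists>H. conf_map n ({a..b} \<times> {0..1}) H \<and> (\<forall>t\<in>{0..1}. \<forall>i\<in>{1..n}. H (a, t) i = G t i) \<and>
        (\<forall>s\<in>{a..b}. \<forall>t\<in>{0..1}. H (s, t) ` {1..n} = h (s, t)))))" for a b :: real
  have "P 0 1"
  proof (rule Bolzano[of 0 1 P])
    fix a b c :: real assume trans: "P a b" "P b c" "a \<le> b" "b \<le> c"
    show "P a c"
      unfolding P_def
    proof (intro impI allI)
      fix G assume abc: "0 \<le> a \<and> a \<le> c \<and> c \<le> 1" and G: "conf_map n {0..1} G"
        "\<forall>t\<in>{0..1}. G t ` {1..n} = h (a, t)" "\<forall>i\<in>{1..n}. G 0 i = vtx n i"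
      have ab: "0 \<le> a \<and> a \<le> b \<and> b \<le> 1" and bc: "0 \<le> b \<and> b \<le> c \<and> c \<le> 1" using abc trans(3,4) by auto
      from trans(1)[unfolded P_def, rule_format, OF ab G(1) G(2)[rule_format] G(3)[rule_format]]
      obtain H where H: "conf_map n ({a..b} \<times> {0..1}) H" "\<forall>t\<in>{0..1}. \<forall>i\<in>{1..n}. H (a, t) i = G t i"
        "\<forall>s\<in>{a..b}. \<forall>t\<in>{0..1}. H (s, t) ` {1..n} = h (s, t)" by blast
      have bI: "b \<in> {a..b}" using ab by simp
      have cb: "conf_map n {0..1} (\<lambda>t. H (b, t))"
        by (rule conf_map_compose[OF H(1)]) (use bI in \<open>auto intro!: continuous_intros\<close>)
      have vb: "H (b, 0) i = vtx n i" if "i \<in> {1..n}" for i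
        using const[OF H(1) _ _ _ bI, of 0 i] H(2,3) G(3) that ab by simp
      have ib: "H (b, t) ` {1..n} = h (b, t)" if "t \<in> {0..1}" for t using H(3) bI that by blast
      from trans(2)[unfolded P_def, rule_format, OF bc cb ib vb]
      obtain K where K: "conf_map n ({b..c} \<times> {0..1}) K" "\<forall>t\<in>{0..1}. \<forall>i\<in>{1..n}. K (b, t) i = H (b, t) i"
        "\<forall>s\<in>{b..c}. \<forall>t\<in>{0..1}. K (s, t) ` {1..n} = h (s, t)" by blast
      let ?S = "{a..b} \<times> {0..1::real}" and ?T = "{b..c} \<times> {0..1::real}"
      let ?L = "\<lambda>x. if x \<in> ?S then H x else K x"
      have "conf_map n (?S \<union> ?T) ?L"
      proof (rule conf_map_glue[OF H(1) K(1)])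
        fix x :: "real \<times> real" and i assume x: "x \<in> ?S" "x \<in> ?T" "i \<in> {1..n}"
        then obtain t where "x = (b, t)" "t \<in> {0..1}" by auto
        then show "H x i = K x i" using K(2) x(3) by simp
      qed (auto intro: closed_Times)
      moreover have "?S \<union> ?T = {a..c} \<times> {0..1}" using trans(3,4) by auto
      ultimately have "conf_map n ({a..c} \<times> {0..1}) ?L" by simp
      moreover have "?L (s, t) ` {1..n} = h (s, t)" if "s \<in> {a..c}" "t \<in> {0..1}" for s t
      proof (cases "s \<le> b")
        case True then show ?thesis using H(3) that by simp
      next
        case False then show ?thesis using K(3) that by simp
      qed
      moreover have "?L (a, t) i = G t i" if "t \<in> {0..1}" "i \<in> {1..n}" for t i
        using H(2) that ab by simp
      ultimately show "\<exists>H. conf_map n ({a..c} \<times> {0..1}) H \<and> (\<forall>t\<in>{0..1}. \<forall>i\<in>{1..n}. H (a, t) i = G t i) \<and>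
        (\<forall>s\<in>{a..c}. \<forall>t\<in>{0..1}. H (s, t) ` {1..n} = h (s, t))"
        by (intro exI[of _ ?L] conjI ballI)
    qed
  next
    fix s0 :: real assume "0 \<le> s0" "s0 \<le> 1"
    then have s0: "s0 \<in> {0..1}" by simp
    have hs: "continuous_map (top_of_set {0..1}) (UConf n) (\<lambda>t. h (s0, t))"
      by (rule continuous_map_compose[OF _ h(1), unfolded o_def])
        (use s0 in \<open>auto simp: continuous_map_in_subtopology intro!: continuous_intros\<close>)
    have "vtx n ` {1..n} = h (s0, 0)" using hb[of s0 0] s0 by simp
    from path_lift[OF hs this]
    obtain G0 where G0: "conf_map n {0..1} G0" "\<And>t. t \<in> {0..1} \<Longrightarrow> G0 t ` {1..n} = h (s0, t)"
      "\<And>i. i \<in> {1..n} \<Longrightarrow> G0 0 i = vtx n i" by metis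
    obtain \<epsilon> where \<epsilon>: "\<epsilon> > 0" "\<And>t. t \<in> {0..1} \<Longrightarrow> separated_by n \<epsilon> (G0 t)"
      using conf_map_separated[OF G0(1) compact_Icc] by metis
    \<comment> \<open>The largest open set on which the configurations stay close to the lifted path
      at \<open>s0\<close>. It contains the whole segment over \<open>s0\<close>, so by the tube
      lemma it contains a strip.\<close>
    define W where "W = \<Union>{O'. open O' \<and> (\<forall>x\<in>O' \<inter> unit_square. h x \<in> conf_nbhd n (G0 (snd x)) \<epsilon>)}"
    have inW: "(s0, t0) \<in> W" if t0: "t0 \<in> {0..1}" for t0
    proof -
      have st: "(s0, t0) \<in> unit_square" using s0 t0 by simp
      have g: "h (s0, t0) = G0 t0 ` {1..n}" using G0(2)[OF t0] by simp
      have "eventually (\<lambda>y. h y \<in> conf_nbhd n (G0 t0) (\<epsilon> / 2)) (at (s0, t0) within unit_square)"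
        by (rule eventually_conf_nbhd[OF h(1) st g]) (use \<epsilon> in simp)
      moreover have "eventually (\<lambda>y. \<forall>i\<in>{1..n}. dist (G0 (snd y) i) (G0 (snd (s0, t0)) i) < \<epsilon> / 2) (at (s0, t0) within unit_square)"
      proof (intro eventually_ball_finite ballI tendstoD)
        fix i assume i: "i \<in> {1..n}"
        have "continuous_on unit_square (\<lambda>y. G0 (snd y) i)"
          by (rule continuous_on_compose2[OF conf_mapD(1)[OF G0(1) i]]) (auto intro!: continuous_intros)
        then show "((\<lambda>y. G0 (snd y) i) \<longlongrightarrow> G0 (snd (s0, t0)) i) (at (s0, t0) within unit_square)"
          using st unfolding continuous_on by blast
      qed (use \<epsilon> in auto)
      ultimately have "eventually (\<lambda>y. h y \<in> conf_nbhd n (G0 (snd y)) \<epsilon>) (at (s0, t0) within unit_square)"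
      proof eventually_elim
        case (elim y)
        then obtain u where u: "h y \<in> topspace (UConf n)" "h y = u ` {1..n}" "\<forall>i\<in>{1..n}. dist (u i) (G0 t0 i) < \<epsilon> / 2"
          unfolding conf_nbhd_def by blast
        have "dist (u i) (G0 (snd y) i) < \<epsilon>" if "i \<in> {1..n}" for i
          using u(3)[rule_format, OF that] elim(2)[rule_format, OF that]
            dist_triangle2[of "u i" "G0 (snd y) i" "G0 t0 i"] by simp
        then show ?case unfolding conf_nbhd_def using u(1,2) by blast
      qed
      then obtain T where T: "open T" "(s0, t0) \<in> T"
        "\<forall>y\<in>T. y \<noteq> (s0, t0) \<longrightarrow> y \<in> unit_square \<longrightarrow> h y \<in> conf_nbhd n (G0 (snd y)) \<epsilon>"
        unfolding eventually_at_topological by blast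
      have "h (s0, t0) \<in> conf_nbhd n (G0 t0) \<epsilon>"
        using conf_nbhd_refl[OF continuous_map_UConf_point[OF h(1) st] \<epsilon>(1) g] .
      then have "\<forall>x\<in>T \<inter> unit_square. h x \<in> conf_nbhd n (G0 (snd x)) \<epsilon>" using T(3) by force
      then show ?thesis unfolding W_def using T(1,2) by blast
    qed
    have oW: "open W" unfolding W_def by (intro open_Union) blast
    have "{s0} \<times> {0..1} \<subseteq> W" using inW by blast
    from Elementary_Topology.tube_lemma[OF compact_Icc oW this] obtain X where X: "s0 \<in> X" "open X" "X \<times> {0..1} \<subseteq> W"
      by blast
    then obtain d where d: "d > 0" "\<And>s. dist s s0 < d \<Longrightarrow> s \<in> X" unfolding open_dist by blast
    have "P a b" if ab: "a \<le> s0 \<and> s0 \<le> b \<and> b - a < d" for a b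
      unfolding P_def
    proof (intro impI allI)
      fix G assume ab': "0 \<le> a \<and> a \<le> b \<and> b \<le> 1" and G: "conf_map n {0..1} G"
        "\<forall>t\<in>{0..1}. G t ` {1..n} = h (a, t)" "\<forall>i\<in>{1..n}. G 0 i = vtx n i"
      let ?S = "{a..b} \<times> {0..1::real}"
      have sub: "?S \<subseteq> unit_square" using ab' by auto
      have near: "h x \<in> conf_nbhd n (G0 (snd x)) \<epsilon>" if x: "x \<in> ?S" for x
      proof -
        have "fst x \<in> X" using ab x by (intro d(2)) (auto simp: dist_real_def)
        then have "x \<in> W" using X(3) x by (cases x) auto
        then show ?thesis unfolding W_def using x sub by blast
      qed
      have cZ: "continuous_on ?S (\<lambda>x. G0 (snd x) i)" if i: "i \<in> {1..n}" for i
        by (rule continuous_on_compose2[OF conf_mapD(1)[OF G0(1) i]]) (auto intro!: continuous_intros)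
      have sepZ: "separated_by n \<epsilon> (G0 (snd x))" if "x \<in> ?S" for x using that by (intro \<epsilon>(2)) auto
      obtain K where K: "conf_map n ?S K" "\<And>x. x \<in> ?S \<Longrightarrow> K x ` {1..n} = h x"
        "\<And>x i. x \<in> ?S \<Longrightarrow> i \<in> {1..n} \<Longrightarrow> dist (K x i) (G0 (snd x) i) < \<epsilon>"
        using lift_near[OF continuous_map_from_subtopology_mono[OF h(1) sub], of "\<lambda>x. G0 (snd x)", OF cZ sepZ near]
        by metis
      have a0: "(a, 0) \<in> ?S" using ab' by simp
      \<comment> \<open>The lift starts within \<open>\<epsilon>\<close> of the labels of
        \<open>G0\<close>, which starts in the standard labelling; as vertices are separated, the
        two labellings coincide.\<close>
      have K0: "K (a, 0) i = vtx n i" if i: "i \<in> {1..n}" for i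
      proof -
        have "K (a, 0) i \<in> base_conf n" using K(2)[OF a0] hb[of a 0] ab' i by (metis imageI insertI1 order_trans)
        then obtain j where j: "j \<in> {1..n}" "K (a, 0) i = vtx n j" by blast
        have "dist (vtx n j) (G0 0 i) < \<epsilon>" using K(3)[OF a0 i] j by simp
        moreover have "dist (vtx n j) (G0 0 j) < \<epsilon>" using G0(3)[OF j(1)] \<epsilon>(1) by simp
        ultimately have "i = j" using separated_by_unique[OF \<epsilon>(2)[of 0] i j(1)] by simp
        then show ?thesis using j by simp
      qed
      have ca: "conf_map n {0..1} (\<lambda>t. K (a, t))"
        by (rule conf_map_compose[OF K(1)]) (use ab' in \<open>auto intro!: continuous_intros\<close>)
      have "K (a, t) i = G t i" if "t \<in> {0..1}" "i \<in> {1..n}" for t i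
      proof (rule lift_unique[OF ca G(1)])
        show "K (a, x) ` {1..n} = G x ` {1..n}" if "x \<in> {0..1}" for x
          using K(2)[of "(a, x)"] G(2) that ab' by simp
        show "K (a, 0) i = G 0 i" using K0 G(3) that by simp
      qed (use that in auto)
      then show "\<exists>H. conf_map n ?S H \<and> (\<forall>t\<in>{0..1}. \<forall>i\<in>{1..n}. H (a, t) i = G t i) \<and>
        (\<forall>s\<in>{a..b}. \<forall>t\<in>{0..1}. H (s, t) ` {1..n} = h (s, t))"
        using K(1,2) by (intro exI[of _ K] conjI ballI) auto
    qed
    then show "\<exists>d>0. \<forall>a b. a \<le> s0 \<and> s0 \<le> b \<and> b - a < d \<longrightarrow> P a b" using d(1) by blast
  qed simp
  moreover have "F t ` {1..n} = h (0, t)" if "t \<in> {0..1}" for t using h(2) that by simp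
  ultimately obtain H where H: "conf_map n unit_square H" "\<forall>t\<in>{0..1}. \<forall>i\<in>{1..n}. H (0, t) i = F t i"
    "\<forall>s\<in>{0..1}. \<forall>t\<in>{0..1}. H (s, t) ` {1..n} = h (s, t)"
    unfolding P_def using strand_loopD(1,2)[OF F] by (metis order_refl zero_le_one)
  have H0: "H (s, 0) i = vtx n i" if "s \<in> {0..1}" "i \<in> {1..n}" for s i
    using const[OF H(1) _ _ _ that(1), of 0 i] H(2,3) strand_loopD(2)[OF F] that by simp
  have H1: "H (s, 1) i = F 1 i" if "s \<in> {0..1}" "i \<in> {1..n}" for s i
    using const[OF H(1) _ _ _ that(1), of 1 i] H(2,3) that by simp
  have "conf_map n {0..1} (\<lambda>t. H (1, t))"
    by (rule conf_map_compose[OF H(1)]) (auto intro!: continuous_intros)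
  then have "H (1, t) i = G t i" if "t \<in> {0..1}" "i \<in> {1..n}" for t i
  proof (rule lift_unique[OF _ strand_loopD(1)[OF G]])
    show "H (1, x) ` {1..n} = G x ` {1..n}" if "x \<in> {0..1}" for x
      using H(3) h(3) that by simp
    show "H (1, 0) i = G 0 i" using H0[of 1 i] strand_loopD(2)[OF G] that by simp
  qed (use that in auto)
  then show ?thesis using that[OF H(1)] H(2) H0 H1 by blast
qed

section \<open>The geometry of the polygon\<close>

text \<open>Integer indices address vertices through lifts of residues; questions of orientation
  become inequalities between integers in a window of length \<open>n\<close>.\<close>

definition vtxi :: "nat \<Rightarrow> int \<Rightarrow> complex" where
  "vtxi n z = cis (2 * pi * of_int z / real n)"

lemma vtx_vtxi: "vtx n j = vtxi n (int j)"
  by (simp add: vtx_def vtxi_def)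

lemma vtxi_periodic: assumes "n > 0" shows "vtxi n (z + int n * k) = vtxi n z"
proof -
  have "vtxi n (z + int n * k) = cis (2 * pi * of_int z / real n + 2 * pi * of_int k)"
    unfolding vtxi_def using assms by (intro arg_cong[of _ _ cis]) (simp add: field_simps)
  also have "\<dots> = vtxi n z" by (simp add: vtxi_def cis_mult[symmetric] cis_multiple_2pi)
  finally show ?thesis .
qed

lemma vtxi_eq_iff:
  assumes "n > 0" shows "vtxi n y = vtxi n z \<longleftrightarrow> cyc_residue n y = cyc_residue n z"
proof
  assume "cyc_residue n y = cyc_residue n z"
  then obtain w where "y - z = int n * w" using cyc_residue_eq_iff[OF assms] by blast
  then have "y = z + int n * w" by simp
  then show "vtxi n y = vtxi n z" using vtxi_periodic[OF assms] by simp
next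
  have *: "vtxi n z = vtx n (cyc_residue n z)" for z
  proof -
    have "cyc_residue n (int (cyc_residue n z)) = cyc_residue n z"
      using cyc_residue_of_nat cyc_residue_in[OF assms] by blast
    then obtain w where "int (cyc_residue n z) - z = int n * w"
      using cyc_residue_eq_iff[OF assms] by blast
    then have "int (cyc_residue n z) = z + int n * w" by simp
    then show ?thesis using vtxi_periodic[OF assms] by (simp add: vtx_vtxi)
  qed
  assume "vtxi n y = vtxi n z"
  then show "cyc_residue n y = cyc_residue n z"
    unfolding * using vtx_eq_iff[OF assms cyc_residue_in[OF assms] cyc_residue_in[OF assms]] by simp
qed

lemma vtx_cyc_residue: assumes "n > 0" shows "vtx n (cyc_residue n z) = vtxi n z"
  unfolding vtx_vtxi using cyc_residue_of_nat[OF cyc_residue_in[OF assms]]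
  by (simp add: vtxi_eq_iff[OF assms])

lemma vtxi_polygon: "n > 0 \<Longrightarrow> vtxi n z \<in> polygon n"
  using vtx_polygon[OF cyc_residue_in] vtx_cyc_residue by metis

lemma norm_vtx [simp]: "cmod (vtx n i) = 1" and norm_vtxi [simp]: "cmod (vtxi n z) = 1"
  by (simp_all add: vtx_def vtxi_def)

lemma convex_polygon: "convex (polygon n)"
  by (simp add: polygon_def)

lemma compact_polygon: "compact (polygon n)"
  unfolding polygon_def by (intro finite_imp_compact_convex_hull) simp

lemma polygon_norm_le: "z \<in> polygon n \<Longrightarrow> cmod z \<le> 1"
proof -
  assume z: "z \<in> polygon n"
  have "convex hull (vtx n ` {1..n}) \<subseteq> cball 0 1"
    by (intro hull_minimal) auto
  then show ?thesis using z by (auto simp: polygon_def)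
qed

lemma polygon_convex_comb:
  "x \<in> polygon n \<Longrightarrow> y \<in> polygon n \<Longrightarrow> 0 \<le> s \<Longrightarrow> s \<le> 1 \<Longrightarrow>
    of_real (1 - s) * x + of_real s * y \<in> polygon n"
  using convexD_alt[OF convex_polygon, of x n y s] by (simp add: scaleR_conv_of_real)

text \<open>Vertices lie on the unit circle and the polygon in the unit disc, so each vertex is the
  unique maximum of the linear functional that it defines. Extremality and the exclusion of vertices
  from hulls of other vertices rest on this.\<close>

lemma inner_vtx_le:
  assumes "cmod x \<le> 1" "cmod v = 1"
  shows "inner v x \<le> 1" and "inner v x = 1 \<Longrightarrow> x = v"
proof -
  have "inner v x \<le> cmod v * cmod x" by (rule norm_cauchy_schwarz)
  also have "\<dots> \<le> 1" using assms by simp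
  finally show "inner v x \<le> 1" .
  assume e: "inner v x = 1"
  have "(cmod (x - v))\<^sup>2 = inner x x - 2 * inner v x + inner v v"
    by (simp add: power2_norm_eq_inner inner_diff_left inner_diff_right inner_commute algebra_simps)
  also have "\<dots> = (cmod x)\<^sup>2 - 2 + (cmod v)\<^sup>2" using e by (simp add: power2_norm_eq_inner)
  also have "\<dots> \<le> 0" using assms by (simp add: power_le_one)
  finally show "x = v" by simp
qed

text \<open>The functional of the vertex is at most 1 at both points and has the weighted mean 1, so
  it is 1 at both.\<close>

lemma vtx_extreme:
  assumes "x \<in> polygon n" "y \<in> polygon n" "0 < s" "s < 1"
    and e: "vtx n i = of_real (1 - s) * x + of_real s * y"
  shows "x = vtx n i" "y = vtx n i"
proof -
  let ?v = "vtx n i"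
  have "inner ?v ?v = (1 - s) * inner ?v x + s * inner ?v y"
    by (subst (2) e) (simp add: inner_add_right scaleR_conv_of_real[symmetric] del: of_real_diff)
  then have 1: "1 = (1 - s) * inner ?v x + s * inner ?v y"
    by (simp add: power2_norm_eq_inner[symmetric])
  note lx = inner_vtx_le[OF polygon_norm_le[OF assms(1)], of ?v, simplified]
    and ly = inner_vtx_le[OF polygon_norm_le[OF assms(2)], of ?v, simplified]
  have a: "(1 - s) * inner ?v x \<le> (1 - s) * 1" "s * inner ?v y \<le> s * 1"
    using lx(1) ly(1) assms(3,4) by (simp_all add: mult_left_le)
  define p q where "p = (1 - s) * inner ?v x" and "q = s * inner ?v y"
  have "1 = p + q" "p \<le> (1 - s) * 1" "q \<le> s * 1" using 1 a by (simp_all only: p_def q_def)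
  then have "p = (1 - s) * 1" "q = s * 1" by simp_all
  then have "(1 - s) * inner ?v x = (1 - s) * 1" "s * inner ?v y = s * 1" by (simp_all only: p_def q_def)
  then show "x = ?v" "y = ?v" using lx(2) ly(2) assms(3,4) by simp_all
qed

lemma vtx_notin_hull:
  assumes "n > 0" "A \<subseteq> {1..n}" "i \<in> {1..n}" "i \<notin> A"
  shows "vtx n i \<notin> convex hull (vtx n ` A)"
proof -
  have "inner (vtx n i) (vtx n a) < 1" if "a \<in> A" for a
  proof -
    have "vtx n a \<noteq> vtx n i" using vtx_eq_iff[OF assms(1)] assms that by auto
    then show ?thesis using inner_vtx_le[of "vtx n a" "vtx n i"] by force
  qed
  then have "vtx n ` A \<subseteq> {z. inner (vtx n i) z < 1}" by auto
  then have "convex hull (vtx n ` A) \<subseteq> {z. inner (vtx n i) z < 1}"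
    by (intro hull_minimal convex_halfspace_lt)
  moreover have "inner (vtx n i) (vtx n i) = 1" by (simp add: power2_norm_eq_inner[symmetric])
  ultimately show ?thesis by auto
qed

text \<open>Positive if and only if \<open>z\<close> lies to the left of the line from \<open>a\<close> to \<open>b\<close>.\<close>

definition side :: "complex \<Rightarrow> complex \<Rightarrow> complex \<Rightarrow> real" where
  "side a b z = inner (\<i> * (b - a)) (z - a)"

lemma side_simps [simp]: "side a b a = 0" "side a b b = 0"
  by (simp_all add: side_def inner_complex_def algebra_simps)

lemma side_affine: "side a b (of_real (1 - s) * x + of_real s * y) = (1 - s) * side a b x + s * side a b y"
  by (simp add: side_def inner_complex_def algebra_simps)

lemma side_rotate: "side a b z = side b z a"
  by (simp add: side_def inner_complex_def algebra_simps)

lemma side_swap: "side b a z = - side a b z"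
  by (simp add: side_def inner_complex_def algebra_simps)

text \<open>Twice the signed area of a triangle inscribed in the unit circle. Each chord is
  \<open>\<i>\<close> times twice the sine of half the angle difference times a unit vector, and the
  formula lets the sign be read off from the order of the angles.\<close>

lemma side_cis:
  "side (cis \<alpha>) (cis \<beta>) (cis \<gamma>) = 4 * sin ((\<beta> - \<alpha>) / 2) * sin ((\<gamma> - \<alpha>) / 2) * sin ((\<gamma> - \<beta>) / 2)"
proof -
  define x y z where "x = \<alpha> / 2" and "y = \<beta> / 2" and "z = \<gamma> / 2"
  have h: "\<alpha> = 2 * x" "\<beta> = 2 * y" "\<gamma> = 2 * z" "(\<beta> - \<alpha>) / 2 = y - x" "(\<gamma> - \<alpha>) / 2 = z - x" "(\<gamma> - \<beta>) / 2 = z - y"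
    by (simp_all add: x_def y_def z_def field_simps)
  have s: "(sin w)\<^sup>2 = 1 - (cos w)\<^sup>2" for w :: real by (simp add: sin_squared_eq)
  have d: "cis (2 * y) - cis (2 * x) = \<i> * of_real (2 * sin (y - x)) * cis (x + y)" for x y
  proof -
    have "cis (2 * y) = cis (y - x) * cis (x + y)" "cis (2 * x) = cis (- (y - x)) * cis (x + y)"
      by (simp_all add: cis_mult)
    then have "cis (2 * y) - cis (2 * x) = (cis (y - x) - cis (- (y - x))) * cis (x + y)"
      by (simp only: left_diff_distrib)
    also have "cis w - cis (- w) = \<i> * of_real (2 * sin w)" for w :: real
      by (simp add: complex_eq_iff)
    finally show ?thesis .
  qed
  have "side (cis \<alpha>) (cis \<beta>) (cis \<gamma>) =
     inner (\<i> * (\<i> * of_real (2 * sin (y - x)) * cis (x + y))) (\<i> * of_real (2 * sin (z - x)) * cis (x + z))"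
    unfolding side_def h d ..
  also have "\<dots> = 4 * sin (y - x) * sin (z - x) * (cos (x + y) * sin (x + z) - sin (x + y) * cos (x + z))"
    by (simp add: inner_complex_def algebra_simps)
  also have "cos (x + y) * sin (x + z) - sin (x + y) * cos (x + z) = sin ((x + z) - (x + y))"
    unfolding sin_diff by simp
  finally show ?thesis unfolding h(4-6) h(1-3)[symmetric] by simp
qed

lemma side_vtxi:
  "side (vtxi n \<alpha>) (vtxi n \<beta>) (vtxi n \<gamma>) =
     4 * sin (pi * of_int (\<beta> - \<alpha>) / n) * sin (pi * of_int (\<gamma> - \<alpha>) / n) * sin (pi * of_int (\<gamma> - \<beta>) / n)"
proof -
  have "(2 * pi * of_int y / real n - 2 * pi * of_int x / real n) / 2 = pi * of_int (y - x) / real n" for x y :: int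
    by (simp add: algebra_simps diff_divide_distrib)
  then show ?thesis unfolding vtxi_def side_cis by simp
qed

lemma sin_pos_int: "0 < k \<Longrightarrow> k < int n \<Longrightarrow> 0 < sin (pi * of_int k / real n)"
  by (intro sin_gt_zero) (auto simp: field_simps)

lemma side_pos:
  assumes "\<alpha> < \<beta>" "\<beta> < \<gamma>" "\<gamma> < \<alpha> + int n"
  shows "0 < side (vtxi n \<alpha>) (vtxi n \<beta>) (vtxi n \<gamma>)"
  unfolding side_vtxi using assms by (intro mult_pos_pos sin_pos_int) auto

text \<open>The inradius is cos(\<pi>/n), at least 1/2 for \<open>n \<ge> 3\<close>. A separating
  functional for a point of the smaller disc would fail at the vertex nearest to the direction
  opposite to it.\<close>

lemma interior_polygon: assumes n: "n \<ge> 3" shows "0 \<in> interior (polygon n)"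
proof -
  have "ball 0 (1/2) \<subseteq> polygon n"
  proof
    fix z :: complex assume "z \<in> ball 0 (1/2)"
    then have z: "cmod z < 1/2" by simp
    show "z \<in> polygon n"
    proof (rule ccontr)
      assume "z \<notin> polygon n"
      from separating_hyperplane_closed_point[OF convex_polygon compact_imp_closed[OF compact_polygon] this]
      obtain a b where ab: "inner a z < b" "\<And>x. x \<in> polygon n \<Longrightarrow> b < inner a x" by blast
      \<comment> \<open>The real index of the direction opposite to \<open>a\<close>. Rounding
        changes the direction by at most \<pi>/n, hence by at most \<pi>/3, whose cosine is
        1/2.\<close>
      define x where "x = (Arg a + pi) * n / (2 * pi)"
      define i where "i = round x"
      define \<delta> where "\<delta> = 2 * pi / n * (x - of_int i)"
      have "\<bar>x - of_int i\<bar> \<le> 1/2" unfolding i_def using of_int_round_abs_le[of x] by (simp add: abs_minus_commute)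
      then have "\<bar>\<delta>\<bar> \<le> 2 * pi / n * (1/2)"
        unfolding \<delta>_def abs_mult by (intro mult_mono) auto
      also have "\<dots> = pi / n" by simp
      also have "\<dots> \<le> pi / 3" using n by (intro divide_left_mono) auto
      finally have d: "\<bar>\<delta>\<bar> \<le> pi / 3" .
      then have "cos \<bar>\<delta>\<bar> \<ge> cos (pi / 3)" by (intro cos_monotone_0_pi_le) auto
      then have c: "cos \<delta> \<ge> 1/2" by (simp add: cos_60)
      have "2 * pi * of_int i / n = Arg a + pi - \<delta>"
        using n by (simp add: x_def \<delta>_def field_simps)
      then have v: "vtxi n i = cis (Arg a + pi - \<delta>)" by (simp only: vtxi_def)
      have "inner a (vtxi n i) = cmod a * inner (cis (Arg a)) (cis (Arg a + pi - \<delta>))"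
        unfolding v by (subst (1) rcis_cmod_Arg[of a, symmetric])
          (simp add: rcis_def inner_complex_def algebra_simps)
      also have "inner (cis (Arg a)) (cis (Arg a + pi - \<delta>)) = cos (Arg a - (Arg a + pi - \<delta>))"
        by (simp only: cos_diff[of "Arg a" "Arg a + pi - \<delta>"] inner_complex_def cis.simps)
      also have "\<dots> = - cos \<delta>" by (simp add: cos_diff)
      finally have "inner a (vtxi n i) \<le> - (cmod a * (1/2))"
        using mult_left_mono[OF c, of "cmod a"] by simp
      moreover have "vtxi n i \<in> polygon n" using n by (intro vtxi_polygon) simp
      moreover have "\<bar>inner a z\<bar> \<le> cmod a * cmod z" by (rule Cauchy_Schwarz_ineq2)
      moreover have "cmod a * cmod z \<le> cmod a * (1/2)" using z by (intro mult_left_mono) auto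
      ultimately show False using ab(1) ab(2)[of "vtxi n i"] by linarith
    qed
  qed
  then show ?thesis by (meson centre_in_ball half_gt_zero_iff interior_maximal open_ball subsetD zero_less_one)
qed

lemma scale_interior:
  assumes "n \<ge> 3" "z \<in> polygon n" "0 \<le> r" "r < 1"
  shows "of_real r * z \<in> interior (polygon n)"
proof -
  have "z - (1 - r) *\<^sub>R (z - 0) \<in> interior (polygon n)"
    by (intro mem_interior_convex_shrink convex_polygon interior_polygon) (use assms in auto)
  then show ?thesis by (simp add: scaleR_conv_of_real algebra_simps)
qed

lemma interior_convex_comb:
  assumes "x \<in> polygon n" "y \<in> interior (polygon n)" "0 < s" "s \<le> 1"
  shows "of_real (1 - s) * x + of_real s * y \<in> interior (polygon n)"
proof -
  have "x - s *\<^sub>R (x - y) \<in> interior (polygon n)"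
    by (intro mem_interior_convex_shrink convex_polygon) (use assms in auto)
  then show ?thesis by (simp add: scaleR_conv_of_real algebra_simps)
qed

lemma frontier_polygon_iff: "z \<in> frontier (polygon n) \<longleftrightarrow> z \<in> polygon n \<and> z \<notin> interior (polygon n)"
  by (simp add: frontier_def compact_imp_closed compact_polygon closure_closed)

text \<open>From an interior point of the polygon one could step a little to the right of the line,
  where the functional \<open>side a b\<close> would become negative.\<close>

lemma side_frontier:
  assumes z: "z \<in> polygon n" and ab: "a \<noteq> b" and ge: "\<And>x. x \<in> polygon n \<Longrightarrow> 0 \<le> side a b x" and s: "side a b z = 0"
  shows "z \<in> frontier (polygon n)"
proof -
  have "z \<notin> interior (polygon n)"
  proof
    assume "z \<in> interior (polygon n)"
    then obtain e where e: "e > 0" "ball z e \<subseteq> polygon n" by (meson mem_interior)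
    define d where "d = e / (2 * cmod (b - a))"
    define w where "w = z - of_real d * (\<i> * (b - a))"
    have d: "d > 0" using ab e(1) by (simp add: d_def)
    have "cmod (of_real d * (\<i> * (b - a))) = d * cmod (b - a)" using d by (simp add: norm_mult)
    also have "\<dots> = e / 2" using ab by (simp add: d_def)
    finally have "cmod (of_real d * (\<i> * (b - a))) = e / 2" .
    then have "w \<in> polygon n" using e by (intro subsetD[OF e(2)]) (simp add: w_def dist_norm)
    moreover have "side a b w = side a b z - d * (cmod (b - a))\<^sup>2"
      unfolding side_def w_def inner_complex_def cmod_power2 by (simp add: power2_eq_square algebra_simps)
    moreover have "d * (cmod (b - a))\<^sup>2 > 0" using ab d by simp
    ultimately show False using ge[of w] s by simp
  qed
  then show ?thesis using z by (simp add: frontier_polygon_iff)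
qed

lemma side_hull_ge:
  assumes "\<And>i. i \<in> A \<Longrightarrow> 0 \<le> side a b (vtx n i)" "z \<in> convex hull (vtx n ` A)"
  shows "0 \<le> side a b z"
proof -
  have *: "{z. 0 \<le> side a b z} = {z. inner (\<i> * (b - a)) z \<ge> inner (\<i> * (b - a)) a}"
    by (auto simp: side_def inner_diff_right)
  have "convex {z. 0 \<le> side a b z}" unfolding * by (rule convex_halfspace_ge)
  then have "convex hull (vtx n ` A) \<subseteq> {z. 0 \<le> side a b z}"
    using assms(1) by (intro hull_minimal) auto
  then show ?thesis using assms(2) by auto
qed

lemma side_hull_gt:
  assumes "\<And>i. i \<in> A \<Longrightarrow> 0 < side a b (vtx n i)" "z \<in> convex hull (vtx n ` A)"
  shows "0 < side a b z"
proof -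
  have *: "{z. 0 < side a b z} = {z. inner (\<i> * (b - a)) z > inner (\<i> * (b - a)) a}"
    by (auto simp: side_def inner_diff_right)
  have "convex {z. 0 < side a b z}" unfolding * by (rule convex_halfspace_gt)
  then have "convex hull (vtx n ` A) \<subseteq> {z. 0 < side a b z}"
    using assms(1) by (intro hull_minimal) auto
  then show ?thesis using assms(2) by auto
qed

lemma residue_window:
  assumes "n > 0" obtains \<gamma> where "\<alpha> \<le> \<gamma>" "\<gamma> < \<alpha> + int n" "cyc_residue n \<gamma> = cyc_residue n z"
proof
  let ?g = "\<alpha> + (z - \<alpha>) mod int n"
  show "\<alpha> \<le> ?g" "?g < \<alpha> + int n" using assms by simp_all
  have "?g - z = int n * (- ((z - \<alpha>) div int n))"
    using mult_div_mod_eq[of "int n" "z - \<alpha>"] by (simp add: algebra_simps)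
  then show "cyc_residue n ?g = cyc_residue n z" using cyc_residue_eq_iff[OF assms] by blast
qed

lemma vtx_window:
  assumes "i \<in> {1..n}" obtains \<gamma> where "\<alpha> \<le> \<gamma>" "\<gamma> < \<alpha> + int n" "vtx n i = vtxi n \<gamma>" "cyc_residue n \<gamma> = i"
proof -
  have n: "n > 0" using assms by auto
  obtain \<gamma> where g: "\<alpha> \<le> \<gamma>" "\<gamma> < \<alpha> + int n" "cyc_residue n \<gamma> = cyc_residue n (int i)"
    by (rule residue_window[OF n])
  then have "cyc_residue n \<gamma> = i" using cyc_residue_of_nat[OF assms] by simp
  then show ?thesis using that g vtx_cyc_residue[OF n, of \<gamma>] by metis
qed

lemma side_edge_ge:
  assumes n: "n \<ge> 3" and x: "x \<in> polygon n"
  shows "0 \<le> side (vtxi n \<alpha>) (vtxi n (\<alpha> + 1)) x"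
proof (rule side_hull_ge[OF _ x[unfolded polygon_def]])
  fix i assume "i \<in> {1..n}"
  then obtain \<gamma> where g: "\<alpha> \<le> \<gamma>" "\<gamma> < \<alpha> + int n" "vtx n i = vtxi n \<gamma>" by (rule vtx_window)
  then consider "\<gamma> = \<alpha>" | "\<gamma> = \<alpha> + 1" | "\<alpha> + 1 < \<gamma>" by linarith
  then show "0 \<le> side (vtxi n \<alpha>) (vtxi n (\<alpha> + 1)) (vtx n i)"
    by cases (use g n in \<open>auto intro!: less_imp_le side_pos\<close>)
qed

lemma vtxi_neq: assumes "\<alpha> < \<beta>" "\<beta> < \<alpha> + int n" shows "vtxi n \<alpha> \<noteq> vtxi n \<beta>"
proof
  assume "vtxi n \<alpha> = vtxi n \<beta>"
  moreover have n: "n > 0" using assms by linarith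
  ultimately have "cyc_residue n \<beta> = cyc_residue n \<alpha>" using vtxi_eq_iff by simp
  then obtain w where w: "\<beta> - \<alpha> = int n * w" using cyc_residue_eq_iff[OF n] by blast
  have "0 < int n * w" "int n * w < int n * 1" unfolding w[symmetric] using assms by simp_all
  then have "0 < w" using n by (simp add: zero_less_mult_iff)
  moreover have "w < 1" using \<open>int n * w < int n * 1\<close> by (rule mult_left_less_imp_less) simp
  ultimately show False by simp
qed

lemma edge_frontier:
  assumes n: "n \<ge> 3" and t: "0 \<le> t" "t \<le> 1"
  shows "of_real (1 - t) * vtxi n \<alpha> + of_real t * vtxi n (\<alpha> + 1) \<in> frontier (polygon n)"
proof (rule side_frontier)
  have "n > 0" using n by simp
  then show "of_real (1 - t) * vtxi n \<alpha> + of_real t * vtxi n (\<alpha> + 1) \<in> polygon n"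
    using t by (intro polygon_convex_comb vtxi_polygon)
  show "vtxi n \<alpha> \<noteq> vtxi n (\<alpha> + 1)" using n by (intro vtxi_neq) auto
qed (use n side_edge_ge in \<open>simp_all add: side_affine del: of_real_diff\<close>)

lemma vtxi_frontier: "n \<ge> 3 \<Longrightarrow> vtxi n \<alpha> \<in> frontier (polygon n)"
  using edge_frontier[of n 0 \<alpha>] by simp

lemma vtx_frontier: "n \<ge> 3 \<Longrightarrow> vtx n i \<in> frontier (polygon n)"
  unfolding vtx_vtxi by (rule vtxi_frontier)

lemma side_neg:
  assumes "\<alpha> < \<gamma>" "\<gamma> < \<beta>" "\<beta> < \<alpha> + int n"
  shows "side (vtxi n \<alpha>) (vtxi n \<beta>) (vtxi n \<gamma>) < 0"
  using side_pos[OF assms] by (metis side_rotate side_swap neg_less_0_iff_less)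

text \<open>The point of the boundary of the polygon in the direction of angle \<open>2 \<pi> u / n\<close>.\<close>

definition bpoint :: "nat \<Rightarrow> real \<Rightarrow> complex" where
  "bpoint n u = the_inv_into (frontier (polygon n)) sgn (cis (2 * pi * u / real n))"

section \<open>The boundary of the polygon in polar coordinates\<close>

locale ngon =
  fixes n :: nat
  assumes n3: "n \<ge> 3"
begin

abbreviation D :: "complex set" where "D \<equiv> polygon n"

lemma n_pos: "n > 0" using n3 by simp

lemma frontier_nonzero: "z \<in> frontier D \<Longrightarrow> z \<noteq> 0"
  using interior_polygon[OF n3] frontier_polygon_iff by auto

lemma frontier_D: "z \<in> frontier D \<Longrightarrow> z \<in> D" and interior_D: "z \<in> interior D \<Longrightarrow> z \<in> D"
  and interior_frontier: "z \<in> interior D \<Longrightarrow> w \<in> frontier D \<Longrightarrow> z \<noteq> w"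
  using frontier_polygon_iff interior_subset by auto

text \<open>The centre is an interior point, so shrinking a point of the polygon towards it gives an
  interior point. Thus a frontier point is the last point of the polygon on its ray.\<close>

lemma frontier_scale:
  assumes "z \<in> frontier D" "of_real r * z \<in> D" "0 \<le> r" shows "r \<le> 1"
proof (rule ccontr)
  assume "\<not> r \<le> 1"
  then have "of_real (1 / r) * (of_real r * z) \<in> interior D"
    using assms by (intro scale_interior[OF n3]) auto
  then have "z \<in> interior D" using \<open>\<not> r \<le> 1\<close> by simp
  then show False using assms(1) by (simp add: frontier_polygon_iff)
qed

lemma inj_on_sgn_frontier: "inj_on sgn (frontier D)"
proof (rule inj_onI)
  fix z w assume zw: "z \<in> frontier D" "w \<in> frontier D" "sgn z = sgn w"
  have nz: "z \<noteq> 0" "w \<noteq> 0" using zw frontier_nonzero by auto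
  have e: "z = of_real (cmod z / cmod w) * w" "w = of_real (cmod w / cmod z) * z"
    using zw(3) nz by (simp_all add: sgn_eq field_simps)
  have "cmod z / cmod w \<le> 1" using frontier_scale[OF zw(2)] e(1) frontier_D[OF zw(1)]
    by (metis divide_nonneg_nonneg norm_ge_zero)
  moreover have "cmod w / cmod z \<le> 1" using frontier_scale[OF zw(1)] e(2) frontier_D[OF zw(2)]
    by (metis divide_nonneg_nonneg norm_ge_zero)
  ultimately have "cmod z = cmod w" using nz by (simp add: divide_le_eq)
  then show "z = w" using e(1) nz by simp
qed

lemma sgn_frontier: "sgn ` frontier D = sphere 0 1"
proof (intro equalityI subsetI)
  fix x assume "x \<in> sgn ` frontier D"
  then show "x \<in> sphere 0 1" using frontier_nonzero by (auto simp: norm_sgn)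
next
  fix x :: complex assume "x \<in> sphere 0 1"
  then have x: "cmod x = 1" by simp
  have "bounded D" using compact_polygon compact_imp_bounded by blast
  then obtain d where d: "d > 0" "0 + d *\<^sub>R x \<in> frontier D"
    using ray_to_frontier[OF _ interior_polygon[OF n3], of x] x by force
  have "sgn (d *\<^sub>R x) = x" using d(1) x by (simp add: sgn_scaleR) (simp add: sgn_eq)
  then show "x \<in> sgn ` frontier D" using d(2) by force
qed

lemma sgn_bpoint: "sgn (bpoint n u) = cis (2 * pi * u / n)"
  and bpoint_frontier: "bpoint n u \<in> frontier D"
proof -
  have c: "cis (2 * pi * u / n) \<in> sgn ` frontier D" unfolding sgn_frontier by simp
  show "sgn (bpoint n u) = cis (2 * pi * u / n)"
    unfolding bpoint_def by (rule f_the_inv_into_f[OF inj_on_sgn_frontier c])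
  show "bpoint n u \<in> frontier D"
    unfolding bpoint_def by (rule the_inv_into_into[OF inj_on_sgn_frontier c]) simp
qed

text \<open>Radial projection is a continuous injection of the compact frontier onto the unit
  circle, so its inverse is continuous.\<close>

lemma continuous_on_bpoint: "continuous_on UNIV (bpoint n)"
proof -
  have "continuous_on (frontier D) sgn"
    using frontier_nonzero by (intro continuous_intros) auto
  then have "continuous_on (sgn ` frontier D) (the_inv_into (frontier D) sgn)"
    by (rule continuous_on_inv)
      (auto simp: compact_frontier compact_polygon the_inv_into_f_f[OF inj_on_sgn_frontier])
  then have "continuous_on (sphere 0 1) (the_inv_into (frontier D) sgn)" unfolding sgn_frontier .
  then show ?thesis
    unfolding bpoint_def
    by (rule continuous_on_compose2) (use n3 in \<open>auto intro!: continuous_intros\<close>)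
qed

lemma continuous_on_bpoint' [continuous_intros]:
  "continuous_on S f \<Longrightarrow> continuous_on S (\<lambda>x. bpoint n (f x))"
  by (rule continuous_on_compose2[OF continuous_on_bpoint]) auto

lemma bpoint_unique:
  assumes "z \<in> frontier D" "sgn z = cis (2 * pi * u / n)" shows "z = bpoint n u"
  using inj_onD[OF inj_on_sgn_frontier, of z "bpoint n u"] assms sgn_bpoint bpoint_frontier by simp

lemma bpoint_D: "bpoint n u \<in> D" and bpoint_nonzero: "bpoint n u \<noteq> 0"
  using bpoint_frontier frontier_D frontier_nonzero by blast+

lemma cis_eq_iff_mod:
  "cis (2 * pi * u / n) = cis (2 * pi * v / n) \<longleftrightarrow> (\<exists>k::int. u = v + real n * of_int k)"
proof
  assume "cis (2 * pi * u / n) = cis (2 * pi * v / n)"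
  then obtain k :: int where "2 * pi * u / n - 2 * pi * v / n = 2 * pi * of_int k"
    unfolding cis_conv_exp exp_eq by (auto simp: complex_eq_iff algebra_simps)
  then have "2 * pi * u - 2 * pi * v = 2 * pi * k * n" using n3 by (simp add: field_simps)
  then have "2 * pi * (u - (v + real n * of_int k)) = 0" by (simp add: algebra_simps)
  then have "u = v + real n * of_int k" by simp
  then show "\<exists>k::int. u = v + real n * of_int k" by blast
next
  assume "\<exists>k::int. u = v + real n * of_int k"
  then obtain k :: int where "u = v + real n * of_int k" by blast
  then have "cis (2 * pi * u / n) = cis (2 * pi * v / n + 2 * pi * of_int k)"
    using n3 by (intro arg_cong[of _ _ cis]) (simp add: field_simps)
  then show "cis (2 * pi * u / n) = cis (2 * pi * v / n)"
    by (simp add: cis_mult[symmetric] cis_multiple_2pi)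
qed

lemma bpoint_eq_iff: "bpoint n u = bpoint n v \<longleftrightarrow> (\<exists>k::int. u = v + real n * of_int k)"
proof -
  have "bpoint n u = bpoint n v \<longleftrightarrow> cis (2 * pi * u / n) = cis (2 * pi * v / n)"
  proof
    assume "bpoint n u = bpoint n v"
    then have "sgn (bpoint n u) = sgn (bpoint n v)" by (rule arg_cong)
    then show "cis (2 * pi * u / n) = cis (2 * pi * v / n)" unfolding sgn_bpoint .
  next
    assume "cis (2 * pi * u / n) = cis (2 * pi * v / n)"
    then show "bpoint n u = bpoint n v"
      using bpoint_unique[OF bpoint_frontier, of u v] by (simp only: sgn_bpoint)
  qed
  then show ?thesis by (simp only: cis_eq_iff_mod)
qed

lemma bpoint_scaled_eq:
  assumes "0 < r" "0 < s" "of_real r * bpoint n u = of_real s * bpoint n v"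
  shows "\<exists>k::int. u = v + real n * of_int k" "r = s"
proof -
  have "sgn (of_real r * bpoint n u) = sgn (of_real s * bpoint n v)" using assms(3) by simp
  then have "cis (2 * pi * u / n) = cis (2 * pi * v / n)"
    using assms(1,2) by (simp add: sgn_mult sgn_bpoint sgn_of_real)
  then show k: "\<exists>k::int. u = v + real n * of_int k" by (simp only: cis_eq_iff_mod)
  then have "bpoint n u = bpoint n v" by (simp only: bpoint_eq_iff)
  then show "r = s" using assms(3) bpoint_nonzero by simp
qed

lemma vtxi_sgn: "sgn (vtxi n z) = cis (2 * pi * of_int z / n)"
  by (simp add: vtxi_def sgn_eq)

lemma bpoint_of_int: "bpoint n (of_int z) = vtxi n z"
  by (rule bpoint_unique[OF vtxi_frontier[OF n3] vtxi_sgn, symmetric])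

lemma bpoint_of_nat: "bpoint n (real i) = vtx n i"
  using bpoint_of_int[of "int i"] by (simp add: vtx_vtxi)

lemma bpoint_periodic: "bpoint n (u + real n * of_int k) = bpoint n u"
  unfolding bpoint_eq_iff by blast

text \<open>A continuous logarithm exists because the path avoids 0. Its imaginary part is rescaled
  so that consecutive vertices differ by 1, and a multiple of \<open>n\<close> is added so that the
  lift starts in \<open>b\<close> itself.\<close>

lemma frontier_path_lift:
  assumes F: "continuous_on {0..1} F" "\<And>t. t \<in> {0..1::real} \<Longrightarrow> F t \<in> frontier D" and F0: "F 0 = vtx n b"
  obtains u where "continuous_on {0..1} u" "\<And>t. t \<in> {0..1} \<Longrightarrow> F t = bpoint n (u t)" "u 0 = real b"
proof -
  obtain g where g: "continuous_on {0..1} g" "\<And>t. t \<in> {0..1} \<Longrightarrow> F t = exp (g t)"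
    using continuous_logarithm_on_contractible[OF F(1)] F(2) frontier_nonzero
    by (metis convex_imp_contractible convex_closed_interval cbox_interval convex_box(1))
  define v where "v t = Im (g t) * n / (2 * pi)" for t
  have Fv: "F t = bpoint n (v t)" if t: "t \<in> {0..1}" for t
  proof (rule bpoint_unique[OF F(2)[OF t]])
    have "2 * pi * v t / n = Im (g t)" using n3 by (simp add: v_def)
    moreover have "sgn (exp (g t)) = cis (Im (g t))"
      by (simp add: sgn_eq exp_eq_polar[of "g t"] norm_mult)
    ultimately show "sgn (F t) = cis (2 * pi * v t / n)" using g(2)[OF t] by simp
  qed
  have "bpoint n (real b) = bpoint n (v 0)" using Fv[of 0] F0 by (simp add: bpoint_of_nat)
  then obtain k :: int where k: "real b = v 0 + real n * of_int k" unfolding bpoint_eq_iff by blast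
  show ?thesis
  proof (rule that[of "\<lambda>t. v t + n * k"])
    show "continuous_on {0..1} (\<lambda>t. v t + n * k)"
      unfolding v_def using g(1) by (intro continuous_intros) auto
    show "F t = bpoint n (v t + n * k)" if "t \<in> {0..1}" for t
      using Fv[OF that] by (simp add: bpoint_periodic)
  qed (use k in simp)
qed

text \<open>Motion at constant speed along an edge is not linear in the angular coordinate of
  \<open>bpoint\<close>. This is the change of parameter, computed on the edge that starts at 1 and
  transported to the other edges by rotation.\<close>

definition edge_param :: "real \<Rightarrow> real" where
  "edge_param t = Arg (of_real (1 - t) + of_real t * vtxi n 1) * n / (2 * pi)"

lemma edge_param:
  assumes t: "0 \<le> t" "t \<le> 1"
  shows "of_real (1 - t) * vtxi n z + of_real t * vtxi n (z + 1) = bpoint n (of_int z + edge_param t)"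
    and "0 \<le> edge_param t" "edge_param t \<le> 1"
proof -
  let ?p = "of_real (1 - t) + of_real t * vtxi n 1"
  have m: "vtxi n (z + 1) = vtxi n z * vtxi n 1"
    by (simp add: vtxi_def cis_mult algebra_simps add_divide_distrib)
  have e: "of_real (1 - t) * vtxi n z + of_real t * vtxi n (z + 1) = vtxi n z * ?p"
    unfolding m by (simp add: algebra_simps)
  have fr: "of_real (1 - t) * vtxi n z + of_real t * vtxi n (z + 1) \<in> frontier D"
    using edge_frontier[OF n3 t, of z] .
  then have nz: "?p \<noteq> 0" using frontier_nonzero e by fastforce
  have "sgn (vtxi n z * ?p) = cis (2 * pi * of_int z / n) * cis (Arg ?p)"
    using cis_Arg[OF nz] by (simp add: sgn_mult vtxi_sgn)
  also have "\<dots> = cis (2 * pi * (of_int z + edge_param t) / n)"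
  proof -
    have "2 * pi * (of_int z + A * n / (2 * pi)) / n = 2 * pi * of_int z / n + A" for A :: real
      using n3 by (simp add: field_simps)
    then show ?thesis unfolding cis_mult edge_param_def by (simp only:)
  qed
  finally show "of_real (1 - t) * vtxi n z + of_real t * vtxi n (z + 1) = bpoint n (of_int z + edge_param t)"
    using bpoint_unique[OF fr] e by simp
  have s: "0 < sin (2 * pi / n)" using n3 by (intro sin_gt_zero) (auto simp: field_simps)
  have im: "Im ?p = t * sin (2 * pi / n)" by (simp add: vtxi_def)
  have "0 \<le> Im ?p" unfolding im using s t by simp
  then have a0: "0 \<le> Arg ?p" using Arg_less_0 by (meson not_le)
  then show "0 \<le> edge_param t" by (simp add: edge_param_def)
  have pp: "?p = of_real (cmod ?p) * cis (Arg ?p)" using rcis_cmod_Arg[of ?p] by (simp add: rcis_def)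
  \<comment> \<open>This imaginary part is proportional to the sine of the remaining angle from
    \<open>?p\<close> to the end of the edge; its sign bounds the argument of \<open>?p\<close> from
    above.\<close>
  have "Im (cnj ?p * vtxi n 1) = (1 - t) * sin (2 * pi / n)"
    by (simp add: vtxi_def algebra_simps)
  moreover have "Im (cnj ?p * vtxi n 1) = cmod ?p * sin (2 * pi / n - Arg ?p)"
    by (subst pp) (simp add: vtxi_def sin_diff algebra_simps)
  moreover have "0 \<le> (1 - t) * sin (2 * pi / n)" using s t by simp
  ultimately have "0 \<le> cmod ?p * sin (2 * pi / n - Arg ?p)" by linarith
  then have "0 \<le> sin (2 * pi / n - Arg ?p)" using nz by (simp add: zero_le_mult_iff)
  moreover have "2 * pi / n < pi" using n3 by (simp add: field_simps)
  moreover have "Arg ?p \<le> pi" by (rule Arg_le_pi)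
  ultimately have "Arg ?p \<le> 2 * pi / n" if "Arg ?p \<noteq> pi"
    using sin_gt_zero[of "Arg ?p - 2 * pi / n"] that sin_minus[of "Arg ?p - 2 * pi / n"] a0 pi_gt_zero
    by (smt (verit) divide_pos_pos n_pos of_nat_0_less_iff)
  moreover have "Arg ?p \<noteq> pi"
  proof
    assume "Arg ?p = pi"
    then have "?p = - of_real (cmod ?p)" by (subst pp) simp
    then have "Im ?p = 0" "Re ?p \<le> 0" by (metis Im_complex_of_real complex_cnj_complex_of_real minus_complex.simps(2) neg_0_equal_iff_equal uminus_complex.sel(2), metis Re_complex_of_real neg_le_0_iff_le norm_ge_zero uminus_complex.sel(1))
    then have "t = 0" using im s by (metis mult_eq_0_iff less_irrefl)
    then show False using \<open>Re ?p \<le> 0\<close> by simp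
  qed
  ultimately show "edge_param t \<le> 1" using n3 by (simp add: edge_param_def field_simps)
qed

lemma edge_param_01: "edge_param 0 = 0" "edge_param 1 = 1"
proof -
  show "edge_param 0 = 0" by (simp add: edge_param_def)
  have "2 * pi / n \<le> pi" using n3 by (simp add: field_simps)
  then have "Arg (vtxi n 1) = 2 * pi / n" using n3 pi_gt_zero unfolding vtxi_def
    by (subst Arg_cis) (auto intro: less_le_trans[of _ 0])
  then show "edge_param 1 = 1" using n3 by (simp add: edge_param_def)
qed

lemma continuous_on_edge_param: "continuous_on {0..1} edge_param"
  unfolding edge_param_def
proof (intro continuous_intros)
  fix t :: real assume t: "t \<in> {0..1}"
  let ?p = "of_real (1 - t) + of_real t * vtxi n 1"
  have s: "0 < sin (2 * pi / n)" using n3 by (intro sin_gt_zero) (auto simp: field_simps)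
  show "?p \<notin> \<real>\<^sub>\<le>\<^sub>0"
  proof
    assume "?p \<in> \<real>\<^sub>\<le>\<^sub>0"
    then have "Im ?p = 0" "Re ?p \<le> 0" by (simp_all only: complex_nonpos_Reals_iff)
    then have "t = 0" using s by (simp add: vtxi_def)
    then show False using \<open>Re ?p \<le> 0\<close> by simp
  qed
qed (use n3 in auto)

end

section \<open>Displacements of boundary strands\<close>

lemma two_pi_int_constant:
  fixes \<theta> :: "real \<Rightarrow> real"
  assumes c: "continuous_on {0..1} \<theta>" and k: "\<And>t. t \<in> {0..1} \<Longrightarrow> \<exists>k::int. \<theta> t = c + 2 * pi * of_int k"
  shows "\<theta> 1 = \<theta> 0"
proof -
  have "\<theta> constant_on {0..1}"
  proof (rule continuous_discrete_range_constant[OF connected_Icc c])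
    fix x :: real assume x: "x \<in> {0..1}"
    have "2 * pi \<le> norm (\<theta> y - \<theta> x)" if y: "y \<in> {0..1}" "\<theta> y \<noteq> \<theta> x" for y
    proof -
      obtain k l :: int where kl: "\<theta> x = c + 2 * pi * of_int k" "\<theta> y = c + 2 * pi * of_int l" using k x y by meson
      then have "k \<noteq> l" using y by auto
      then have "1 \<le> \<bar>l - k\<bar>" by linarith
      then have "1 \<le> \<bar>real_of_int l - real_of_int k\<bar>" by (metis of_int_1_le_iff of_int_abs of_int_diff)
      then have "2 * pi * 1 \<le> 2 * pi * \<bar>real_of_int l - real_of_int k\<bar>" by (intro mult_left_mono) auto
      also have "\<dots> = \<bar>2 * pi * (real_of_int l - real_of_int k)\<bar>" by (simp add: abs_mult)
      also have "2 * pi * (real_of_int l - real_of_int k) = \<theta> y - \<theta> x" by (simp add: kl algebra_simps)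
      finally show ?thesis by simp
    qed
    then show "\<exists>e>0. \<forall>y. y \<in> {0..1} \<and> \<theta> y \<noteq> \<theta> x \<longrightarrow> e \<le> norm (\<theta> y - \<theta> x)"
      by (intro exI[of _ "2 * pi"]) auto
  qed
  then show ?thesis by (auto simp: constant_on_def)
qed

lemma exp_eq_Im:
  assumes "exp z = of_real r * exp w" "r > 0"
  shows "\<exists>k::int. Im z = Im w + 2 * pi * of_int k"
proof -
  have "exp z = exp (of_real (ln r) + w)" using assms by (simp add: exp_add exp_of_real)
  then obtain k :: int where "z = of_real (ln r) + w + (of_int (2 * k) * pi) * \<i>" unfolding exp_eq by blast
  then have "Im z = Im w + 2 * pi * of_int k" by simp
  then show ?thesis by blast
qed

context ngon
begin

text \<open>The angle of the vector from another strand to a boundary strand stays close to the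
  angle of the boundary strand: their difference is the argument of a point of the slit plane,
  which is in the right half-plane whenever both strands are at vertices.\<close>

lemma strand_angle:
  assumes F: "strand_loop n F" and bc: "b \<in> {1..n}" "c \<in> {1..n}" "b \<noteq> c"
    and u: "continuous_on {0..1} u" "\<And>t. t \<in> {0..1} \<Longrightarrow> F t b = bpoint n (u t)"
    and l: "continuous_on {0..1} l" "\<And>t. t \<in> {0..1} \<Longrightarrow> F t b - F t c = exp (l t)"
  shows "\<bar>Im (l 1 - l 0) - 2 * pi / n * (u 1 - u 0)\<bar> < pi"
proof -
  define q where "q t = (F t b - F t c) / F t b" for t
  have fr: "F t b \<in> frontier D" if "t \<in> {0..1}" for t using u(2)[OF that] bpoint_frontier by simp
  have nz: "F t b \<noteq> 0" if "t \<in> {0..1}" for t using fr[OF that] frontier_nonzero by blast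
  have neq: "F t b \<noteq> F t c" if "t \<in> {0..1}" for t
    using conf_map_neq[OF strand_loopD(1)[OF F] that bc] .
  \<comment> \<open>A value on the slit would place the other strand on the ray through the boundary
    point, at or beyond that point, and then equal to it.\<close>
  have q: "q t \<notin> \<real>\<^sub>\<le>\<^sub>0" if t: "t \<in> {0..1}" for t
  proof
    assume "q t \<in> \<real>\<^sub>\<le>\<^sub>0"
    then obtain r where r: "q t = of_real r" "r \<le> 0" by (auto elim: nonpos_Reals_cases)
    then have "F t c = of_real (1 - r) * F t b"
      using nz[OF t] by (simp add: q_def divide_eq_eq algebra_simps)
    moreover have "F t c \<in> D" by (rule conf_mapD(2)[OF strand_loopD(1)[OF F] t bc(2)])
    ultimately have "1 - r \<le> 1" using frontier_scale[OF fr[OF t], of "1 - r"] r(2) by simp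
    then have "r = 0" using r(2) by simp
    then show False using r(1) neq[OF t] nz[OF t] by (simp add: q_def)
  qed
  have cF: "continuous_on {0..1} (\<lambda>t. F t b)" "continuous_on {0..1} (\<lambda>t. F t c)"
    using conf_mapD(1)[OF strand_loopD(1)[OF F]] bc by auto
  have cq: "continuous_on {0..1} (\<lambda>t. Ln (q t))"
    using q nz cF unfolding q_def by (intro continuous_intros) auto
  \<comment> \<open>The vector between the strands is \<open>F t b * q t\<close>, so the arguments
    add up modulo 2\<pi>; \<open>\<theta>\<close> is the discrepancy, a continuous function with
    values in the multiples of 2\<pi>.\<close>
  define \<theta> where "\<theta> t = Im (l t) - Im (Ln (q t)) - 2 * pi * u t / n" for t
  have "\<theta> 1 = \<theta> 0"
  proof (rule two_pi_int_constant[where c = 0])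
    show "continuous_on {0..1} \<theta>"
      unfolding \<theta>_def by (intro continuous_intros l cq u) (use n3 in auto)
    fix t :: real assume t: "t \<in> {0..1}"
    have q0: "q t \<noteq> 0" using q[OF t] by auto
    have s: "F t b = of_real (cmod (F t b)) * cis (2 * pi * u t / n)"
    proof -
      have "sgn (F t b) = cis (2 * pi * u t / n)" using u(2)[OF t] by (simp add: sgn_bpoint)
      then show ?thesis using nz[OF t] by (simp add: sgn_eq field_simps)
    qed
    have "exp (l t) = F t b * q t" using l(2)[OF t] nz[OF t] by (simp add: q_def)
    also have "\<dots> = of_real (cmod (F t b)) * exp (\<i> * of_real (2 * pi * u t / n) + Ln (q t))"
      using s q0 by (simp add: exp_add cis_conv_exp)
    finally obtain k :: int where "Im (l t) = Im (\<i> * of_real (2 * pi * u t / n) + Ln (q t)) + 2 * pi * of_int k"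
      using exp_eq_Im nz[OF t] by (meson zero_less_norm_iff)
    then have "\<theta> t = 0 + 2 * pi * of_int k" by (simp add: \<theta>_def)
    then show "\<exists>k::int. \<theta> t = 0 + 2 * pi * of_int k" by blast
  qed
  then have eq: "Im (l 1 - l 0) - 2 * pi / n * (u 1 - u 0) = Im (Ln (q 1)) - Im (Ln (q 0))"
    by (simp add: \<theta>_def algebra_simps diff_divide_distrib)
  \<comment> \<open>With both strands at vertices, \<open>F t b\<close> is a unit vector and
    division by it is multiplication by its conjugate. So the real part of \<open>q t\<close> is 1
    minus an inner product smaller than 1.\<close>
  have bound: "\<bar>Im (Ln (q t))\<bar> < pi / 2"
    if t: "t \<in> {0..1}" and v: "F t b = vtx n i" "F t c = vtx n j" for t i j
  proof -
    have "inner (F t b) (F t c) < 1"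
      using inner_vtx_le[of "F t c" "F t b"] v neq[OF t] by force
    moreover have "Re (F t b * cnj (F t b)) = 1" using v by (simp add: complex_norm_square[symmetric])
    moreover have "q t = (F t b - F t c) * cnj (F t b)"
      using v complex_div_cnj[of "F t b - F t c" "F t b"] by (simp add: q_def)
    moreover have "Re ((F t b - F t c) * cnj (F t b)) = Re (F t b * cnj (F t b)) - inner (F t b) (F t c)"
      by (simp add: inner_complex_def algebra_simps)
    ultimately have "0 < Re (q t)" by simp
    moreover from this have "q t \<noteq> 0" by auto
    ultimately show ?thesis using Re_Ln_pos_lt[of "q t"] by simp
  qed
  have "\<bar>Im (Ln (q 0))\<bar> < pi / 2" using bound[of 0 b c] strand_loopD(2)[OF F] bc by simp
  moreover have "\<bar>Im (Ln (q 1))\<bar> < pi / 2"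
    using bound[of 1] end_ix(2)[OF n_pos F] bc by simp
  ultimately show ?thesis unfolding eq by linarith
qed

text \<open>A logarithm of the vector from strand \<open>c\<close> to strand \<open>b\<close> on the
  whole homotopy square has the same change along the first and the last loop. Each displacement, as
  an angle, differs from this change by less than \<pi>, so the displacements differ by less than
  \<open>n\<close>; having the same end point, they also differ by a multiple of
  \<open>n\<close>.\<close>

lemma lift_end_unique:
  assumes F: "strand_loop n F" and G: "strand_loop n G" and eq: "strands_braid n F = strands_braid n G" and b: "b \<in> {1..n}"
    and u: "continuous_on {0..1} u" "\<And>t. t \<in> {0..1} \<Longrightarrow> F t b = bpoint n (u t)" "u 0 = real b"
    and v: "continuous_on {0..1} v" "\<And>t. t \<in> {0..1} \<Longrightarrow> G t b = bpoint n (v t)" "v 0 = real b"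
  shows "u 1 = v 1"
proof -
  obtain c where c: "c \<in> {1..n}" "b \<noteq> c"
  proof (cases "b = 1")
    case True then show ?thesis using n3 by (intro that[of 2]) auto
  next
    case False then show ?thesis using n3 by (intro that[of 1]) auto
  qed
  obtain H where H: "conf_map n unit_square H"
    "\<forall>t\<in>{0..1}. \<forall>i\<in>{1..n}. H (0, t) i = F t i"
    "\<forall>t\<in>{0..1}. \<forall>i\<in>{1..n}. H (1, t) i = G t i"
    "\<forall>s\<in>{0..1}. \<forall>i\<in>{1..n}. H (s, 0) i = vtx n i"
    "\<forall>s\<in>{0..1}. \<forall>i\<in>{1..n}. H (s, 1) i = F 1 i"
    by (rule strand_homotopy[OF n_pos F G eq]) (rule that; assumption)
  have cbc: "continuous_on unit_square (\<lambda>x. H x b - H x c)"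
    using conf_mapD(1)[OF H(1)] b c by (intro continuous_intros) auto
  have ctr: "contractible unit_square"
    by (intro convex_imp_contractible convex_Times) auto
  have nz: "H x b - H x c \<noteq> 0" if "x \<in> unit_square" for x
    using conf_map_neq[OF H(1) that b c] by simp
  obtain L where L: "continuous_on unit_square L" "\<And>x. x \<in> unit_square \<Longrightarrow> H x b - H x c = exp (L x)"
    using continuous_logarithm_on_contractible[OF cbc ctr nz] by blast
  have cL: "continuous_on {0..1} (\<lambda>s. Im (L (s, a)))" "continuous_on {0..1} (\<lambda>t. L (a, t))"
    if "a \<in> {0..1}" for a
  proof -
    show "continuous_on {0..1} (\<lambda>s. Im (L (s, a)))"
      by (rule continuous_on_Im, rule continuous_on_compose2[OF L(1)])
        (use that in \<open>auto intro!: continuous_intros\<close>)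
    show "continuous_on {0..1} (\<lambda>t. L (a, t))"
      by (rule continuous_on_compose2[OF L(1)]) (use that in \<open>auto intro!: continuous_intros\<close>)
  qed
  \<comment> \<open>At times 0 and 1 the strands do not move under the homotopy, so there the
    logarithm varies only by multiples of 2\<pi>\<i>.\<close>
  have const: "Im (L (1, a)) = Im (L (0, a))" if a: "a = 0 \<or> a = 1" for a
  proof (rule two_pi_int_constant[of "\<lambda>s. Im (L (s, a))", where c = "Im (L (0, a))"])
    have aI: "a \<in> {0..1}" using a by auto
    show "continuous_on {0..1} (\<lambda>s. Im (L (s, a)))" by (rule cL(1)[OF aI])
    fix s :: real assume s: "s \<in> {0..1}"
    have "H (s, a) i = H (0, a) i" if "i \<in> {1..n}" for i
      using a H(4,5) that s by (metis atLeastAtMost_iff order_refl zero_le_one)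
    then have "exp (L (s, a)) = of_real 1 * exp (L (0, a))"
      using L(2)[of "(s, a)"] L(2)[of "(0, a)"] s aI b c by simp
    from exp_eq_Im[OF this] show "\<exists>k::int. Im (L (s, a)) = Im (L (0, a)) + 2 * pi * of_int k" by simp
  qed
  have "\<bar>Im (L (0, 1) - L (0, 0)) - 2 * pi / n * (u 1 - u 0)\<bar> < pi"
  proof (rule strand_angle[OF F b c u(1,2), of "\<lambda>t. L (0, t)"])
    show "F t b - F t c = exp (L (0, t))" if "t \<in> {0..1}" for t
      using L(2)[of "(0, t)"] H(2) b c that by simp
  qed (use cL(2)[of 0] in auto)
  moreover have "\<bar>Im (L (1, 1) - L (1, 0)) - 2 * pi / n * (v 1 - v 0)\<bar> < pi"
  proof (rule strand_angle[OF G b c v(1,2), of "\<lambda>t. L (1, t)"])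
    show "G t b - G t c = exp (L (1, t))" if "t \<in> {0..1}" for t
      using L(2)[of "(1, t)"] H(3) b c that by simp
  qed (use cL(2)[of 1] in auto)
  moreover have "Im (L (1, 1) - L (1, 0)) = Im (L (0, 1) - L (0, 0))"
    using const[of 0] const[of 1] by simp
  ultimately have "\<bar>2 * pi / n * (v 1 - v 0) - 2 * pi / n * (u 1 - u 0)\<bar> < 2 * pi" by linarith
  then have "\<bar>2 * pi / n * (v 1 - u 1)\<bar> < 2 * pi" using u(3) v(3) by (simp add: right_diff_distrib)
  then have "2 * pi / n * \<bar>v 1 - u 1\<bar> < 2 * pi / n * n"
    using n3 by (simp add: abs_mult)
  then have lt: "\<bar>v 1 - u 1\<bar> < n" by (rule mult_left_less_imp_less) simp
  have "bpoint n (u 1) = bpoint n (v 1)" using u(2)[of 1] v(2)[of 1] H(3,5) b by (metis atLeastAtMost_iff order_refl zero_le_one)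
  then obtain k :: int where k: "u 1 = v 1 + real n * of_int k" using bpoint_eq_iff by blast
  then have "\<bar>real n * of_int k\<bar> < real n * 1" using lt by simp
  then have "\<bar>real_of_int k\<bar> < 1" using n3 by (simp add: abs_mult)
  then have "k = 0" by linarith
  then show ?thesis using k by simp
qed

end

definition equivariant :: "nat \<Rightarrow> (int \<Rightarrow> int) \<Rightarrow> bool" where
  "equivariant n w \<longleftrightarrow> (\<forall>z k. w (z + int n * k) = w z + int n * k)"

definition res_image :: "nat \<Rightarrow> (int \<Rightarrow> int) \<Rightarrow> nat set \<Rightarrow> nat set" where
  "res_image n w V = (\<lambda>v. cyc_residue n (w (int v))) ` V"

lemma convex_between:
  fixes a b c s :: real
  assumes "0 < a" "a < c" "0 < b" "b < c" "0 \<le> s" "s \<le> 1"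
  shows "0 < (1 - s) * a + s * b" "(1 - s) * a + s * b < c"
proof -
  show "(1 - s) * a + s * b < c" using assms by (intro convex_bound_lt) auto
  have "(1 - s) * (c - a) + s * (c - b) < c" using assms by (intro convex_bound_lt) auto
  then show "0 < (1 - s) * a + s * b" by (simp add: algebra_simps)
qed

lemma conf_map_squareI:
  fixes H :: "real \<Rightarrow> real \<Rightarrow> nat \<Rightarrow> complex"
  assumes "\<And>i. i \<in> {1..n} \<Longrightarrow> continuous_on unit_square (\<lambda>x. H (fst x) (snd x) i)"
    and "\<And>s t i. s \<in> {0..1} \<Longrightarrow> t \<in> {0..1} \<Longrightarrow> i \<in> {1..n} \<Longrightarrow> H s t i \<in> polygon n"
    and "\<And>s t i j. s \<in> {0..1} \<Longrightarrow> t \<in> {0..1} \<Longrightarrow> i \<in> {1..n} \<Longrightarrow> j \<in> {1..n} \<Longrightarrow> i < j \<Longrightarrow>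
      H s t i \<noteq> H s t j"
  shows "conf_map n unit_square (\<lambda>(s, t). H s t)"
  by (rule conf_mapI) (use assms in \<open>auto simp: case_prod_unfold\<close>)

context ngon
begin

abbreviation res :: "int \<Rightarrow> nat" where "res \<equiv> cyc_residue n"

lemma res_in [simp]: "res z \<in> {1..n}" by (rule cyc_residue_in[OF n_pos])

lemma res_of_nat: "b \<in> {1..n} \<Longrightarrow> res (int b) = b" by (rule cyc_residue_of_nat)

lemma res_decomp: obtains k where "z = int (res z) + int n * k"
proof -
  have "res (int (res z)) = res z" by (rule res_of_nat[OF res_in])
  then obtain k where "z - int (res z) = int n * k" using cyc_residue_eq_iff[OF n_pos] by metis
  then show ?thesis by (intro that[of k]) simp
qed

lemma res_eq_iff: "res y = res z \<longleftrightarrow> (\<exists>k. y = z + int n * k)"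
  using cyc_residue_eq_iff[OF n_pos, of y z] by (simp add: algebra_simps)

lemma res_shift [simp]: "res (z + int n * k) = res z"
  unfolding res_eq_iff by blast

lemma equivariant_res:
  assumes "equivariant n w"
  shows "w z = w (int (res z)) + (z - int (res z))" "res (w z) = res (w (int (res z)))"
proof -
  obtain k where k: "z = int (res z) + int n * k" by (rule res_decomp)
  have e: "w z = w (int (res z)) + int n * k"
    using assms unfolding equivariant_def by (subst k) simp
  then show "w z = w (int (res z)) + (z - int (res z))" using k by simp
  show "res (w z) = res (w (int (res z)))" unfolding e by simp
qed

lemma bpoint_neq: "0 < v - (u::real) \<Longrightarrow> v - u < n \<Longrightarrow> bpoint n u \<noteq> bpoint n v"
proof
  assume a: "0 < v - u" "v - u < n" "bpoint n u = bpoint n v"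
  then obtain k :: int where "v = u + real n * of_int k" using bpoint_eq_iff by metis
  then have e: "real n * of_int k = v - u" by simp
  have "0 < real n * of_int k" "real n * of_int k < real n * 1" unfolding e using a by simp_all
  then have "0 < real_of_int k" "real_of_int k < 1"
    using n3 by (simp_all add: zero_less_mult_iff)
  then have "0 < k" "k < 1" by simp_all
  then show False by simp
qed

text \<open>Only the values of \<open>w\<close> at the elements of \<open>B\<close> matter here. A
  function on all integers is used because equivariant functions can be composed in the way braids
  are multiplied.\<close>

definition displacement :: "nat set \<Rightarrow> (real \<Rightarrow> complex set) set \<Rightarrow> (int \<Rightarrow> int) \<Rightarrow> bool" where
  "displacement B \<beta> w \<longleftrightarrow> (\<exists>F. strand_loop n F \<and> \<beta> = strands_braid n F \<and> (\<forall>b\<in>B. \<exists>u. continuous_on {0..1} u \<and>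
     (\<forall>t\<in>{0..1}. F t b = bpoint n (u t)) \<and> u 0 = real b \<and> u 1 = of_int (w (int b))))"

lemma displacementE:
  assumes "displacement B \<beta> w"
  obtains F u where "strand_loop n F" "\<beta> = strands_braid n F" "\<forall>b\<in>B. continuous_on {0..1} (u b)"
    "\<forall>b\<in>B. \<forall>t\<in>{0..1}. F t b = bpoint n (u b t)" "\<forall>b\<in>B. u b 0 = real b"
    "\<forall>b\<in>B. u b 1 = of_int (w (int b))"
proof -
  obtain F where F: "strand_loop n F" "\<beta> = strands_braid n F" "\<forall>b\<in>B. \<exists>u. continuous_on {0..1} u \<and>
     (\<forall>t\<in>{0..1}. F t b = bpoint n (u t)) \<and> u 0 = real b \<and> u 1 = of_int (w (int b))"
    using assms unfolding displacement_def by blast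
  obtain u where "\<forall>b\<in>B. continuous_on {0..1} (u b) \<and>
     (\<forall>t\<in>{0..1}. F t b = bpoint n (u b t)) \<and> u b 0 = real b \<and> u b 1 = of_int (w (int b))"
    using bchoice[OF F(3)] by blast
  then show ?thesis using that[of F u] F(1,2) by blast
qed

lemma displacement_unique:
  assumes "displacement B \<beta> w" "displacement B \<beta> w'" "B \<subseteq> {1..n}" "b \<in> B"
  shows "w (int b) = w' (int b)"
proof -
  obtain F u where F: "strand_loop n F" "\<beta> = strands_braid n F" "\<forall>b\<in>B. continuous_on {0..1} (u b)"
    "\<forall>b\<in>B. \<forall>t\<in>{0..1}. F t b = bpoint n (u b t)" "\<forall>b\<in>B. u b 0 = real b"
    "\<forall>b\<in>B. u b 1 = of_int (w (int b))" using assms(1) by (rule displacementE)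
  obtain G v where G: "strand_loop n G" "\<beta> = strands_braid n G" "\<forall>b\<in>B. continuous_on {0..1} (v b)"
    "\<forall>b\<in>B. \<forall>t\<in>{0..1}. G t b = bpoint n (v b t)" "\<forall>b\<in>B. v b 0 = real b"
    "\<forall>b\<in>B. v b 1 = of_int (w' (int b))" using assms(2) by (rule displacementE)
  have eq: "strands_braid n F = strands_braid n G" using F(2) G(2) by simp
  have b: "b \<in> {1..n}" using assms(3,4) by blast
  have "u b 1 = v b 1"
    by (rule lift_end_unique[OF F(1) G(1) eq b]) (use F(3-5) G(3-5) assms(4) in auto)
  then show ?thesis using F(6) G(6) assms(4) by simp
qed

text \<open>The difference of the two lifts starts strictly between 0 and \<open>n\<close>. By the
  intermediate value theorem, leaving this range would produce a multiple of \<open>n\<close>, where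
  the strands collide.\<close>

lemma lift_order:
  fixes F :: "real \<Rightarrow> nat \<Rightarrow> complex"
  assumes F: "conf_map n {0..1} F" and bc: "b \<in> {1..n}" "c \<in> {1..n}" "b < c"
    and u: "continuous_on {0..1} u" "\<And>t. t \<in> {0..1} \<Longrightarrow> F t b = bpoint n (u t)" "u 0 = real b"
    and v: "continuous_on {0..1} v" "\<And>t. t \<in> {0..1} \<Longrightarrow> F t c = bpoint n (v t)" "v 0 = real c"
    and t: "t \<in> {0..1}"
  shows "u t < v t \<and> v t < u t + n"
proof -
  define d where "d s = v s - u s" for s
  have cd: "continuous_on {0..t} d"
  proof -
    have "{0..t} \<subseteq> {0..1}" using t by simp
    then show ?thesis unfolding d_def
      by (intro continuous_intros continuous_on_subset[OF u(1)] continuous_on_subset[OF v(1)])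
  qed
  have d0: "0 < d 0" "d 0 < n" using u(3) v(3) bc by (auto simp: d_def)
  have ne: "d s \<noteq> real n * of_int k" if s: "s \<in> {0..1}" for s and k :: int
  proof
    assume "d s = real n * of_int k"
    then have "v s = u s + real n * of_int k" by (simp add: d_def)
    then have "bpoint n (v s) = bpoint n (u s)" using bpoint_eq_iff by blast
    then show False using conf_map_neq[OF F s bc(1,2)] u(2)[OF s] v(2)[OF s] bc(3) by simp
  qed
  have "0 < d t"
  proof (rule ccontr)
    assume "\<not> 0 < d t"
    then obtain s where "0 \<le> s" "s \<le> t" "d s = 0"
      using IVT2'[of d t 0 0] d0 cd t by auto
    then show False using ne[of s 0] t by auto
  qed
  moreover have "d t < n"
  proof (rule ccontr)
    assume "\<not> d t < n"
    then obtain s where "0 \<le> s" "s \<le> t" "d s = n"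
      using IVT'[of d 0 n t] d0 cd t by auto
    then show False using ne[of s 1] t by auto
  qed
  ultimately show ?thesis by (simp add: d_def)
qed

text \<open>The order inequalities are those of \<open>lift_order\<close> at time 1. They are what
  later makes the displacement realisable by an edge path.\<close>

lemma boundary_displacement:
  assumes B: "B \<subseteq> {1..n}" "B' \<subseteq> {1..n}" and \<beta>: "\<beta> \<in> boundary_braids n B B'"
  obtains w where "equivariant n w" "displacement B \<beta> w" "res_image n w B = B'"
    "\<forall>b\<in>B. \<forall>c\<in>B. b < c \<longrightarrow> w (int b) < w (int c) \<and> w (int c) < w (int b) + int n"
proof -
  obtain F where F: "card B = card B'" "strand_loop n F" "\<beta> = strands_braid n F" "\<forall>b\<in>B. F 1 b \<in> vtx n ` B'"
    "\<forall>b\<in>B. \<forall>t\<in>{0..1}. F t b \<in> frontier D"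
    using \<beta> unfolding boundary_braids_iff[OF B(1)] by blast
  have "\<exists>u w. continuous_on {0..1} u \<and> (\<forall>t\<in>{0..1}. F t b = bpoint n (u t)) \<and> u 0 = real b \<and>
      u 1 = of_int w \<and> res w \<in> B' \<and> F 1 b = vtx n (res w)" if b: "b \<in> B" for b
  proof -
    have bI: "b \<in> {1..n}" using B b by blast
    obtain u where u: "continuous_on {0..1} u" "\<And>t. t \<in> {0..1} \<Longrightarrow> F t b = bpoint n (u t)" "u 0 = real b"
      using frontier_path_lift[OF conf_mapD(1)[OF strand_loopD(1)[OF F(2)] bI] _ strand_loopD(2)[OF F(2) bI]]
        F(5) b by metis
    obtain j where j: "j \<in> B'" "F 1 b = vtx n j" using F(4) b by blast
    have "bpoint n (u 1) = bpoint n (real j)" using u(2)[of 1] j(2) by (simp add: bpoint_of_nat)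
    then obtain k :: int where k: "u 1 = real j + real n * of_int k" using bpoint_eq_iff by blast
    then have "u 1 = of_int (int j + int n * k)" by simp
    moreover have "res (int j + int n * k) = j" using j(1) B(2) res_of_nat[of j] by auto
    ultimately show ?thesis using u j by metis
  qed
  then obtain u w0 where u: "\<forall>b\<in>B. continuous_on {0..1} (u b) \<and> (\<forall>t\<in>{0..1}. F t b = bpoint n (u b t)) \<and>
      u b 0 = real b \<and> u b 1 = of_int (w0 b) \<and> res (w0 b) \<in> B' \<and> F 1 b = vtx n (res (w0 b))"
    by metis
  \<comment> \<open>The equivariant extension from residues to integers. Its values over residues
    outside of \<open>B\<close> are arbitrary, so it need not be a permutation yet.\<close>
  define w where "w z = w0 (res z) + (z - int (res z))" for z
  have wb: "w (int b) = w0 b" if "b \<in> B" for b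
    using B(1) that res_of_nat[of b] by (auto simp: w_def)
  have eq: "equivariant n w" by (simp add: equivariant_def w_def)
  have "displacement B \<beta> w"
    unfolding displacement_def
  proof (intro exI conjI ballI)
    fix b assume b: "b \<in> B"
    show "continuous_on {0..1} (u b)" "u b 0 = real b" "u b 1 = real_of_int (w (int b))"
      using u b wb by auto
    show "F t b = bpoint n (u b t)" if "t \<in> {0..1}" for t using u b that by blast
  qed (use F in auto)
  moreover have "res_image n w B = B'"
  proof (rule card_subset_eq)
    show "finite B'" using B(2) finite_subset by blast
    show "res_image n w B \<subseteq> B'" unfolding res_image_def using u wb by auto
    have "inj_on (\<lambda>b. res (w (int b))) B"
    proof (rule inj_onI)
      fix b c assume bc: "b \<in> B" "c \<in> B" "res (w (int b)) = res (w (int c))"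
      then have "F 1 b = F 1 c" using u wb by metis
      moreover have "b \<in> {1..n}" "c \<in> {1..n}" using bc B(1) by blast+
      ultimately show "b = c" using conf_map_neq[OF strand_loopD(1)[OF F(2)], of 1 b c] by auto
    qed
    then show "card (res_image n w B) = card B'" unfolding res_image_def using F(1) by (simp add: card_image)
  qed
  moreover have "\<forall>b\<in>B. \<forall>c\<in>B. b < c \<longrightarrow> w (int b) < w (int c) \<and> w (int c) < w (int b) + int n"
  proof (intro ballI impI)
    fix b c assume bc: "b \<in> B" "c \<in> B" "b < c"
    then have "b \<in> {1..n}" "c \<in> {1..n}" using B(1) by blast+
    then have "u b 1 < u c 1 \<and> u c 1 < u b 1 + n"
      using lift_order[OF strand_loopD(1)[OF F(2)], of b c "u b" "u c" 1] u bc by simp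
    then have "real_of_int (w0 b) < of_int (w0 c)" "real_of_int (w0 c) < of_int (w0 b + int n)" using u bc by auto
    then show "w (int b) < w (int c) \<and> w (int c) < w (int b) + int n"
      unfolding of_int_less_iff using wb bc by simp
  qed
  ultimately show ?thesis using that eq by blast
qed

lemma displacement_end_ix:
  assumes F: "strand_loop n F" and b: "b \<in> {1..n}"
    and u: "\<forall>t\<in>{0..1}. F t b = bpoint n (u t)" "u 1 = of_int w"
  shows "end_ix n F b = res w" "F 1 b = vtx n (res w)"
proof -
  have "F 1 b = bpoint n (of_int w)" using u by simp
  then show "F 1 b = vtx n (res w)" by (simp add: bpoint_of_int vtx_cyc_residue[OF n_pos])
  then show "end_ix n F b = res w" by (intro end_ix_eq n_pos res_in)
qed

lemma displacement_boundary:
  assumes "displacement B \<beta> w" "B \<subseteq> {1..n}"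
  shows "\<beta> \<in> boundary_braids n B (res_image n w B)"
proof -
  obtain F u where F: "strand_loop n F" "\<beta> = strands_braid n F" "\<forall>b\<in>B. continuous_on {0..1} (u b)"
    "\<forall>b\<in>B. \<forall>t\<in>{0..1}. F t b = bpoint n (u b t)" "\<forall>b\<in>B. u b 0 = real b"
    "\<forall>b\<in>B. u b 1 = of_int (w (int b))" using assms(1) by (rule displacementE)
  have e: "end_ix n F b = res (w (int b))" "F 1 b = vtx n (res (w (int b)))" if "b \<in> B" for b
    using displacement_end_ix[OF F(1), of b "u b" "w (int b)"] F(4,6) that assms(2) by auto
  have "inj_on (end_ix n F) B"
    using end_ix_bij[OF n_pos F(1)] assms(2) by (meson bij_betw_def inj_on_subset)
  then have "inj_on (\<lambda>b. res (w (int b))) B" using inj_on_cong[of B "end_ix n F" "\<lambda>b. res (w (int b))"] e(1) by simp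
  then have "card (res_image n w B) = card B" by (simp add: res_image_def card_image)
  moreover have "F 1 b \<in> vtx n ` res_image n w B" if "b \<in> B" for b
    using e(2)[OF that] that by (auto simp: res_image_def)
  ultimately show ?thesis
    unfolding boundary_braids_iff[OF assms(2)] using F(1,2,4) bpoint_frontier by metis
qed

lemma displacement_mult:
  assumes w: "displacement B \<beta> w" and w': "displacement (res_image n w B) \<beta>' w'" "equivariant n w'" and B: "B \<subseteq> {1..n}"
  shows "displacement B (\<beta> \<otimes>\<^bsub>Braid n\<^esub> \<beta>') (w' \<circ> w)"
proof -
  obtain F u where F: "strand_loop n F" "\<beta> = strands_braid n F" "\<forall>b\<in>B. continuous_on {0..1} (u b)"
    "\<forall>b\<in>B. \<forall>t\<in>{0..1}. F t b = bpoint n (u b t)" "\<forall>b\<in>B. u b 0 = real b"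
    "\<forall>b\<in>B. u b 1 = of_int (w (int b))" using w by (rule displacementE)
  let ?B' = "res_image n w B"
  obtain G v where G: "strand_loop n G" "\<beta>' = strands_braid n G" "\<forall>b\<in>?B'. continuous_on {0..1} (v b)"
    "\<forall>b\<in>?B'. \<forall>t\<in>{0..1}. G t b = bpoint n (v b t)" "\<forall>b\<in>?B'. v b 0 = real b"
    "\<forall>b\<in>?B'. v b 1 = of_int (w' (int b))" using w'(1) by (rule displacementE)
  note c = sconcat_loop[OF n_pos F(1) G(1)]
  show ?thesis
    unfolding displacement_def
  proof (intro exI[of _ "sconcat n F G"] conjI ballI)
    show "strand_loop n (sconcat n F G)" by (rule c(1))
    show "\<beta> \<otimes>\<^bsub>Braid n\<^esub> \<beta>' = strands_braid n (sconcat n F G)" using c(2) F(2) G(2) by simp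
    fix b assume b: "b \<in> B"
    then have bI: "b \<in> {1..n}" using B by blast
    define r where "r = res (w (int b))"
    have r: "r \<in> ?B'" using b by (auto simp: r_def res_image_def)
    have e: "end_ix n F b = r"
      unfolding r_def by (rule displacement_end_ix(1)[OF F(1) bI, of "u b"]) (use F(4,6) b in auto)
    \<comment> \<open>The second loop is lifted from the residue \<open>r\<close> although the first
      lift ends in \<open>w (int b)\<close>; the two differ by this multiple of \<open>n\<close>,
      which \<open>bpoint\<close> does not see.\<close>
    obtain k where k: "w (int b) = int r + int n * k" unfolding r_def by (rule res_decomp)
    define x where "x t = u b (min 1 (2 * t)) + (v r (max 0 (2 * t - 1)) - real r)" for t
    have "sconcat n F G t b = bpoint n (x t)" if t: "t \<in> {0..1}" for t
    proof (cases "t \<le> 1/2")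
      case True
      then have m: "min 1 (2 * t) = 2 * t" "max 0 (2 * t - 1) = 0" by auto
      have "sconcat n F G t b = F (2 * t) b" by (rule sconcat_simps(1)[OF n_pos F(1) G(1) bI True])
      also have "\<dots> = bpoint n (u b (2 * t))" using F(4) b t True by simp
      also have "u b (2 * t) = x t" using G(5) r by (simp add: x_def m)
      finally show ?thesis .
    next
      case False
      then have m: "min 1 (2 * t) = 1" "max 0 (2 * t - 1) = 2 * t - 1" and t2: "t \<ge> 1/2" by auto
      have "sconcat n F G t b = G (2 * t - 1) r"
        using sconcat_simps(2)[OF n_pos F(1) G(1) bI t2] e by simp
      also have "\<dots> = bpoint n (v r (2 * t - 1))" using G(4) r t t2 by simp
      also have "\<dots> = bpoint n (v r (2 * t - 1) + real n * of_int k)" by (simp only: bpoint_periodic)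
      also have "v r (2 * t - 1) + real n * of_int k = x t" using F(6) b k by (simp add: x_def m)
      finally show ?thesis .
    qed
    moreover have "continuous_on {0..1} x"
      unfolding x_def
      by (intro continuous_intros continuous_on_compose2[OF F(3)[rule_format, OF b]]
          continuous_on_compose2[OF G(3)[rule_format, OF r]]) auto
    moreover have "x 0 = real b" using F(5) G(5) b r by (simp add: x_def)
    moreover have "x 1 = of_int ((w' \<circ> w) (int b))"
      using F(6) G(6) b r w'(2) k by (simp add: x_def equivariant_def)
    ultimately show "\<exists>u. continuous_on {0..1} u \<and> (\<forall>t\<in>{0..1}. sconcat n F G t b = bpoint n (u t)) \<and>
        u 0 = real b \<and> u 1 = of_int ((w' \<circ> w) (int b))" by blast
  qed
qed

lemma fix_displacement:
  assumes "\<beta> \<in> fix_braids n B" "B \<subseteq> {1..n}" shows "displacement B \<beta> id"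
proof -
  obtain F where F: "strand_loop n F" "\<beta> = strands_braid n F" "\<forall>b\<in>B. \<forall>t\<in>{0..1}. F t b = vtx n b"
    using assms fix_braids_iff by blast
  then show ?thesis
    unfolding displacement_def
    by (intro exI[of _ F] conjI ballI exI[of _ "\<lambda>_. real _"]) (auto simp: bpoint_of_nat)
qed

text \<open>The other strands are pushed into the interior for intermediate times; afterwards the
  boundary strands can be moved freely, by a straight line homotopy of their lifts.\<close>

lemma displacement_id_fix:
  assumes "displacement B \<beta> id" "B \<subseteq> {1..n}"
  shows "\<beta> \<in> fix_braids n B"
proof -
  obtain F u where F: "strand_loop n F" "\<beta> = strands_braid n F" "\<forall>b\<in>B. continuous_on {0..1} (u b)"
    "\<forall>b\<in>B. \<forall>t\<in>{0..1}. F t b = bpoint n (u b t)" "\<forall>b\<in>B. u b 0 = real b"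
    "\<forall>b\<in>B. u b 1 = of_int (id (int b))" using assms(1) by (rule displacementE)
  note cF = conf_mapD[OF strand_loopD(1)[OF F(1)]]
  define x where "x s t i = (1 - s) * u i t + s * real i" for s t i
  \<comment> \<open>The factor is 1 at both ends of time and at \<open>s = 0\<close>, and otherwise
    between 1/2 and 1; so the strands outside of \<open>B\<close> enter the interior exactly for
    intermediate times.\<close>
  define r :: "real \<Rightarrow> real \<Rightarrow> real" where "r s t = 1 - s * (t * (1 - t))" for s t
  define H where "H s t i = (if i \<in> B then bpoint n (x s t i) else of_real (r s t) * F t i)" for s t i
  have r: "0 < r s t" "r s t \<le> 1" "r s t = 1 \<longrightarrow> s = 0 \<or> t = 0 \<or> t = 1"
    if "0 \<le> s" "s \<le> 1" "0 \<le> t" "t \<le> 1" for s t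
  proof -
    have "t * (1 - t) \<le> t" using that by (simp add: mult_left_le)
    moreover have "t * (1 - t) \<le> 1 - t" using that by (simp add: mult_left_le_one_le)
    ultimately have t: "0 \<le> t * (1 - t)" "t * (1 - t) \<le> 1/2" using that by auto
    have "0 \<le> s * (t * (1 - t))" using t that by simp
    moreover have "s * (t * (1 - t)) \<le> 1 * (1/2)"
      using t that by (intro mult_mono) auto
    ultimately show "0 < r s t" "r s t \<le> 1" by (auto simp: r_def)
    show "r s t = 1 \<longrightarrow> s = 0 \<or> t = 0 \<or> t = 1" by (auto simp: r_def)
  qed
  have x_end: "x s t i = u i t" if "i \<in> B" "s = 0 \<or> t = 0 \<or> t = 1" for s t i
    using that F(5,6) by (auto simp: x_def algebra_simps)
  have same: "H s t i = F t i" if "s = 0 \<or> t = 0 \<or> t = 1" "0 \<le> t" "t \<le> 1" for s t i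
    using that x_end[of i s t] F(4) by (auto simp: H_def r_def)
  have H: "conf_map n unit_square (\<lambda>(s, t). H s t)"
  proof (rule conf_map_squareI)
    fix i assume i: "i \<in> {1..n}"
    show "continuous_on unit_square (\<lambda>x. H (fst x) (snd x) i)"
    proof (cases "i \<in> B")
      case True
      have "continuous_on unit_square (\<lambda>p. bpoint n (x (fst p) (snd p) i))"
        unfolding x_def by (intro continuous_intros continuous_on_compose2[OF F(3)[rule_format, OF True]]) auto
      then show ?thesis using True by (simp add: H_def)
    next
      case False
      have "continuous_on unit_square (\<lambda>p. of_real (r (fst p) (snd p)) * F (snd p) i)"
        unfolding r_def by (intro continuous_intros continuous_on_compose2[OF cF(1)[OF i]]) auto
      then show ?thesis using False by (simp add: H_def)
    qed
  next
    fix s t :: real and i assume st: "s \<in> {0..1}" "t \<in> {0..1}" and i: "i \<in> {1..n}"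
    have "of_real (r s t) * F t i \<in> D"
    proof (cases "r s t = 1")
      case True then show ?thesis using cF(2)[OF st(2) i] by simp
    next
      case False
      then have "of_real (r s t) * F t i \<in> interior D"
        using r[of s t] st by (intro scale_interior[OF n3 cF(2)[OF st(2) i]]) auto
      then show ?thesis by (rule interior_D)
    qed
    then show "H s t i \<in> D" by (simp add: H_def bpoint_D)
  next
    fix s t :: real and i j
    assume st: "s \<in> {0..1}" "t \<in> {0..1}" and ij: "i \<in> {1..n}" "j \<in> {1..n}" "i < j"
    show "H s t i \<noteq> H s t j"
    proof
    assume eq: "H s t i = H s t j"
    have neF: "F t i \<noteq> F t j" using conf_map_neq[OF strand_loopD(1)[OF F(1)] st(2)] ij by simp
    \<comment> \<open>A boundary strand lies on the frontier and a pushed strand in the interior,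
      unless the factor is 1, where \<open>H\<close> still coincides with \<open>F\<close>.\<close>
    have mixed: False if "k \<in> B" "l \<notin> B" "k \<in> {1..n}" "l \<in> {1..n}" "H s t k = H s t l" "F t k \<noteq> F t l" for k l
    proof (cases "r s t = 1")
      case True
      then show False using r(3)[of s t] same[of s t] st that by auto
    next
      case False
      then have "H s t l \<in> interior D"
        using that r[of s t] st by (simp add: H_def) (intro scale_interior[OF n3 cF(2)[OF st(2)]]; simp)
      moreover have "H s t k \<in> frontier D" using that(1) by (simp only: H_def bpoint_frontier if_True)
      ultimately show False using interior_frontier that(5) by metis
    qed
    consider "i \<in> B" "j \<in> B" | "i \<in> B" "j \<notin> B" | "i \<notin> B" "j \<in> B" | "i \<notin> B" "j \<notin> B" by blast
    then show False
    proof cases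
      case 1
      have o: "u i t < u j t \<and> u j t < u i t + n"
        using lift_order[OF strand_loopD(1)[OF F(1)] ij, of "u i" "u j" t] F(3-5) 1 st by auto
      have d: "x s t j - x s t i = (1 - s) * (u j t - u i t) + s * (real j - real i)"
        by (simp add: x_def algebra_simps)
      have "real j - real i > 0" "real j - real i < n" using ij by auto
      with o have "0 < (1 - s) * (u j t - u i t) + s * (real j - real i)" "(1 - s) * (u j t - u i t) + s * (real j - real i) < n"
        using convex_between[of "u j t - u i t" n "real j - real i" s] st by auto
      then show False using bpoint_neq[of "x s t j" "x s t i"] d eq 1 by (simp add: H_def)
    next
      case 2 then show False using mixed[of i j] ij eq neF by simp
    next
      case 3 then show False using mixed[of j i] ij eq neF by simp
    next
      case 4 then show False using eq neF r(1)[of s t] st by (simp add: H_def)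
    qed
    qed
  qed
  have im: "H s a ` {1..n} = F a ` {1..n}" if "a = 0 \<or> a = 1" for s a
    by (rule image_cong[OF refl]) (use same that in auto)
  have "strands_braid n (H 0) = strands_braid n (H 1)"
    by (rule strands_braid_homotopy[OF H]) (simp_all add: im strand_loopD[OF F(1)])
  moreover have "strands_braid n F = strands_braid n (H 0)" by (rule strands_braid_cong[OF _ F(1)]) (use same in auto)
  ultimately have "\<beta> = strands_braid n (H 1)" using F(2) by simp
  moreover have "conf_map n {0..1} (H 1)"
  proof -
    have "continuous_on {0..1} (\<lambda>t::real. (1::real, t))" "(\<lambda>t::real. (1::real, t)) ` {0..1} \<subseteq> unit_square"
      by (auto intro!: continuous_intros)
    from conf_map_compose[OF H this] show ?thesis by simp
  qed
  then have "strand_loop n (H 1)"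
    unfolding strand_loop_def using same[of 1 0] im[of 1 1] strand_loopD[OF F(1)] by simp
  moreover have "H 1 t b = vtx n b" if "b \<in> B" for t b
    using that by (simp add: H_def x_def bpoint_of_nat)
  ultimately show ?thesis using fix_braids_iff[OF assms(2)] by blast
qed

text \<open>The end permutation is injective and the cardinalities agree, so it maps
  \<open>B\<close> onto \<open>B'\<close>. Hence the reversed strands starting in \<open>B'\<close>
  are exactly the old strands of \<open>B\<close>, run backwards in the frontier.\<close>

lemma boundary_inv:
  assumes B: "B \<subseteq> {1..n}" "B' \<subseteq> {1..n}" and \<beta>: "\<beta> \<in> boundary_braids n B B'"
  shows "inv\<^bsub>Braid n\<^esub> \<beta> \<in> boundary_braids n B' B"
proof -
  obtain F where F: "card B = card B'" "strand_loop n F" "\<beta> = strands_braid n F" "\<forall>b\<in>B. F 1 b \<in> vtx n ` B'"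
    "\<forall>b\<in>B. \<forall>t\<in>{0..1}. F t b \<in> frontier D"
    using \<beta> unfolding boundary_braids_iff[OF B(1)] by blast
  let ?\<sigma> = "the_inv_into {1..n} (end_ix n F)"
  have bij: "bij_betw (end_ix n F) {1..n} {1..n}" by (rule end_ix_bij[OF n_pos F(2)])
  have "end_ix n F ` B = B'"
  proof (rule card_subset_eq)
    show "finite B'" using B(2) finite_subset by blast
    show "end_ix n F ` B \<subseteq> B'"
    proof clarify
      fix b assume "b \<in> B"
      then obtain j where "j \<in> B'" "F 1 b = vtx n j" using F(4) by blast
      then show "end_ix n F b \<in> B'" using end_ix_eq[OF n_pos, of j F b] B(2) by auto
    qed
    have "inj_on (end_ix n F) B" using bij B(1) by (meson bij_betw_def inj_on_subset)
    then show "card (end_ix n F ` B) = card B'" using F(1) by (simp add: card_image)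
  qed
  then have \<sigma>: "?\<sigma> c \<in> B" if "c \<in> B'" for c
  proof -
    have "c \<in> end_ix n F ` B" using that \<open>end_ix n F ` B = B'\<close> by simp
    then obtain b where b: "b \<in> B" "c = end_ix n F b" by blast
    have "inj_on (end_ix n F) {1..n}" using bij by (simp add: bij_betw_def)
    then have "?\<sigma> c = b" unfolding b(2) using b(1) B(1) by (intro the_inv_into_f_f) auto
    then show ?thesis using b(1) by simp
  qed
  have "srev n F 1 c \<in> vtx n ` B" if "c \<in> B'" for c
    using \<sigma>[OF that] strand_loopD(2)[OF F(2)] B(1) by (auto simp: srev_def)
  moreover have "srev n F t c \<in> frontier D" if "c \<in> B'" "t \<in> {0..1}" for c t
    using \<sigma>[OF that(1)] F(5) that(2) by (simp add: srev_def)
  ultimately show ?thesis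
    unfolding boundary_braids_iff[OF B(2)] using F(1,3) srev_loop[OF n_pos F(2)] by metis
qed

end

section \<open>Layered braids\<close>

context ngon
begin

section \<open>Affine permutations of the integers that keep the order in \<open>V\<close> and in
  its complement\<close>

definition mono_lifts :: "nat set \<Rightarrow> (int \<Rightarrow> int) \<Rightarrow> bool" where
  "mono_lifts V w \<longleftrightarrow> (\<forall>y z. res y \<in> V \<longrightarrow> res z \<in> V \<longrightarrow> y < z \<longrightarrow> w y < w z)"

lemma res_bounds [simp]: "1 \<le> res z" "res z \<le> n"
  using res_in[of z] by auto

text \<open>The number of turns of the points outside of \<open>V\<close> is normalised by the condition on the
  sum of all displacements.\<close>

definition affine_perm :: "nat set \<Rightarrow> (int \<Rightarrow> int) \<Rightarrow> bool" where
  "affine_perm V w \<longleftrightarrow> equivariant n w \<and> bij w \<and> mono_lifts V w \<and> mono_lifts ({1..n} - V) w \<and>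
     (V \<noteq> {1..n} \<longrightarrow> (\<Sum>i=1..n. w (int i) - int i) = 0)"

lemma affineD:
  assumes "affine_perm V w"
  shows "equivariant n w" "bij w" "mono_lifts V w" "mono_lifts ({1..n} - V) w"
    "V \<noteq> {1..n} \<Longrightarrow> (\<Sum>i=1..n. w (int i) - int i) = 0"
  using assms by (simp_all add: affine_perm_def)

lemma affine_perm_res_eq_iff:
  assumes "affine_perm V w" shows "res (w y) = res (w z) \<longleftrightarrow> res y = res z"
proof
  assume "res y = res z"
  then obtain k where "y = z + int n * k" using res_eq_iff by blast
  then have "w y = w z + int n * k" using affineD(1)[OF assms] by (simp add: equivariant_def)
  then show "res (w y) = res (w z)" using res_eq_iff by blast
next
  assume "res (w y) = res (w z)"
  then obtain k where "w y = w z + int n * k" using res_eq_iff by blast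
  then have "w y = w (z + int n * k)" using affineD(1)[OF assms] by (simp add: equivariant_def)
  then have "y = z + int n * k" using affineD(2)[OF assms] by (simp add: bij_def inj_eq)
  then show "res y = res z" by simp
qed

lemma res_image_iff:
  assumes w: "affine_perm V' w" and V: "V \<subseteq> {1..n}"
  shows "res (w z) \<in> res_image n w V \<longleftrightarrow> res z \<in> V"
proof
  assume "res z \<in> V"
  then show "res (w z) \<in> res_image n w V"
    using equivariant_res(2)[OF affineD(1)[OF w], of z] unfolding res_image_def by (metis imageI)
next
  assume "res (w z) \<in> res_image n w V"
  then obtain v where "v \<in> V" "res (w z) = res (w (int v))" by (auto simp: res_image_def)
  then show "res z \<in> V" using affine_perm_res_eq_iff[OF w] res_of_nat V by (metis subsetD)
qed

lemma res_image_subset: "res_image n w V \<subseteq> {1..n}"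
  unfolding res_image_def using res_in by blast

lemma affine_perm_bij_betw:
  assumes "affine_perm V w" shows "bij_betw (\<lambda>i. res (w (int i))) {1..n} {1..n}"
proof -
  have "inj_on (\<lambda>i. res (w (int i))) {1..n}"
    using affine_perm_res_eq_iff[OF assms] res_of_nat by (metis (no_types, lifting) inj_onI)
  moreover have "(\<lambda>i. res (w (int i))) ` {1..n} \<subseteq> {1..n}" using res_in by blast
  ultimately show ?thesis unfolding bij_betw_def by (meson endo_inj_surj finite_atLeastAtMost)
qed

lemma res_image_compl:
  assumes w: "affine_perm V' w" and V: "V \<subseteq> {1..n}"
  shows "res_image n w ({1..n} - V) = {1..n} - res_image n w V"
proof -
  have "inj_on (\<lambda>i. res (w (int i))) {1..n}" "(\<lambda>i. res (w (int i))) ` {1..n} = {1..n}"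
    using affine_perm_bij_betw[OF w] by (auto simp: bij_betw_def)
  then show ?thesis unfolding res_image_def using V by (metis Diff_subset inj_on_image_set_diff)
qed

lemma res_image_full_iff:
  assumes w: "affine_perm V' w" and V: "V \<subseteq> {1..n}"
  shows "res_image n w V = {1..n} \<longleftrightarrow> V = {1..n}"
proof -
  have "inj_on (\<lambda>i. res (w (int i))) {1..n}"
    using affine_perm_bij_betw[OF w] by (simp add: bij_betw_def)
  then have "inj_on (\<lambda>i. res (w (int i))) V" using V by (rule inj_on_subset)
  then have c: "card (res_image n w V) = card V" by (simp add: res_image_def card_image)
  show ?thesis
    using card_subset_eq[OF _ V] card_subset_eq[OF _ res_image_subset, of w V] c by fastforce
qed

text \<open>The function \<open>g z - z\<close> has period \<open>n\<close>, and \<open>w\<close>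
  permutes the residues. This makes the normalising sum additive under composition.\<close>

lemma equivariant_diff_sum:
  assumes w: "affine_perm V w" and g: "equivariant n g"
  shows "(\<Sum>i=1..n. g (w (int i)) - w (int i)) = (\<Sum>i=1..n. g (int i) - int i)"
proof -
  have "(\<Sum>i=1..n. g (w (int i)) - w (int i)) = (\<Sum>i=1..n. g (int (res (w (int i)))) - int (res (w (int i))))"
  proof (rule sum.cong[OF refl])
    fix i
    show "g (w (int i)) - w (int i) = g (int (res (w (int i)))) - int (res (w (int i)))"
      using equivariant_res(1)[OF g, of "w (int i)"] by linarith
  qed
  also have "\<dots> = (\<Sum>i=1..n. g (int i) - int i)"
    by (rule sum.reindex_bij_betw[OF affine_perm_bij_betw[OF w]])
  finally show ?thesis .
qed

lemma mono_lifts_compose: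
  assumes "affine_perm V' w" "V \<subseteq> {1..n}" "mono_lifts V w" "mono_lifts (res_image n w V) w'" shows "mono_lifts V (w' \<circ> w)"
  using assms(3,4) res_image_iff[OF assms(1,2)] unfolding mono_lifts_def by simp

lemma affine_perm_compose:
  assumes w: "affine_perm V w" and w': "affine_perm (res_image n w V) w'" and V: "V \<subseteq> {1..n}"
  shows "affine_perm V (w' \<circ> w)" "res_image n (w' \<circ> w) V = res_image n w' (res_image n w V)"
proof -
  have "mono_lifts V (w' \<circ> w)" by (rule mono_lifts_compose[OF w V affineD(3)[OF w] affineD(3)[OF w']])
  moreover have "mono_lifts ({1..n} - V) (w' \<circ> w)"
    by (rule mono_lifts_compose[OF w _ affineD(4)[OF w]])
      (use affineD(4)[OF w'] res_image_compl[OF w V] in auto)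
  moreover have "(\<Sum>i=1..n. (w' \<circ> w) (int i) - int i) = 0" if "V \<noteq> {1..n}"
  proof -
    have "(\<Sum>i=1..n. (w' \<circ> w) (int i) - int i) =
        (\<Sum>i=1..n. w' (w (int i)) - w (int i)) + (\<Sum>i=1..n. w (int i) - int i)"
      by (simp add: sum.distrib[symmetric])
    then show ?thesis
      using equivariant_diff_sum[OF w affineD(1)[OF w']] affineD(5)[OF w that] affineD(5)[OF w']
        res_image_full_iff[OF w V] that by simp
  qed
  moreover have "equivariant n (w' \<circ> w)" using affineD(1)[OF w] affineD(1)[OF w'] by (simp add: equivariant_def)
  ultimately show "affine_perm V (w' \<circ> w)"
    unfolding affine_perm_def using bij_comp[OF affineD(2)[OF w] affineD(2)[OF w']] by blast
  have "res (w' (w (int v))) = res (w' (int (res (w (int v)))))" for v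
    using equivariant_res(2)[OF affineD(1)[OF w']] .
  then show "res_image n (w' \<circ> w) V = res_image n w' (res_image n w V)"
    unfolding res_image_def by (simp add: image_image)
qed

lemma affine_perm_inv:
  assumes w: "affine_perm V w" and V: "V \<subseteq> {1..n}"
  shows "affine_perm (res_image n w V) (inv_into UNIV w)" "res_image n (inv_into UNIV w) (res_image n w V) = V"
proof -
  have b: "bij w" by (rule affineD(2)[OF w])
  have iw: "inv_into UNIV w (w z) = z" "w (inv_into UNIV w z) = z" for z
    using b by (auto simp: bij_def surj_f_inv_f)
  have eq: "equivariant n (inv_into UNIV w)"
    unfolding equivariant_def
  proof (intro allI)
    fix z k
    have "w (inv_into UNIV w z + int n * k) = z + int n * k"
      using affineD(1)[OF w] iw by (simp add: equivariant_def)
    then show "inv_into UNIV w (z + int n * k) = inv_into UNIV w z + int n * k" using iw(1) by metis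
  qed
  have sm: "mono_lifts (res_image n w U) (inv_into UNIV w)" if U: "U \<subseteq> {1..n}" "mono_lifts U w" for U
    unfolding mono_lifts_def
  proof (intro allI impI)
    fix y z assume yz: "res y \<in> res_image n w U" "res z \<in> res_image n w U" "y < z"
    then have "res (inv_into UNIV w y) \<in> U" "res (inv_into UNIV w z) \<in> U" using res_image_iff[OF w U(1)] iw(2) by metis+
    then show "inv_into UNIV w y < inv_into UNIV w z" using U(2) yz(3) iw(2) unfolding mono_lifts_def
      by (metis linorder_neqE_linordered_idom order_less_asym order_less_irrefl)
  qed
  have "(\<Sum>i=1..n. inv_into UNIV w (int i) - int i) = 0" if "res_image n w V \<noteq> {1..n}"
  proof -
    have "(\<Sum>i=1..n. inv_into UNIV w (int i) - int i) = (\<Sum>i=1..n. int i - w (int i))"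
      using equivariant_diff_sum[OF w eq] by (simp add: iw(1))
    also have "\<dots> = - (\<Sum>i=1..n. w (int i) - int i)" by (simp add: sum_negf[symmetric])
    finally show ?thesis using affineD(5)[OF w] res_image_full_iff[OF w V] that by simp
  qed
  then show "affine_perm (res_image n w V) (inv_into UNIV w)"
    unfolding affine_perm_def using eq bij_imp_bij_inv[OF b] sm[OF V affineD(3)[OF w]]
      sm[OF _ affineD(4)[OF w]] res_image_compl[OF w V] by auto
  have "res (inv_into UNIV w (int (res (w (int v))))) = v" if "v \<in> V" for v
    using equivariant_res(2)[OF eq, of "w (int v)"] iw(1) res_of_nat V that by (metis subsetD)
  then show "res_image n (inv_into UNIV w) (res_image n w V) = V"
    unfolding res_image_def by (simp add: image_image)
qed

text \<open>Over the residues outside of \<open>V\<close> both functions are increasing bijections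
  onto the same set of integers, so neither can be ahead of the other in one place and behind in
  another. Therefore all differences have the same sign, and the equal sums make them
  vanish.\<close>

lemma affine_perm_unique:
  assumes w: "affine_perm V w" and w': "affine_perm V w'" and V: "V \<subseteq> {1..n}" and eq: "\<And>v. v \<in> V \<Longrightarrow> w (int v) = w' (int v)"
  shows "w = w'"
proof -
  note ew = affineD(1)[OF w] and ew' = affineD(1)[OF w']
  have eqV: "w z = w' z" if "res z \<in> V" for z
    using eq[OF that] equivariant_res(1)[OF ew, of z] equivariant_res(1)[OF ew', of z] by simp
  have im: "res_image n w V = res_image n w' V" unfolding res_image_def using eq by simp
  \<comment> \<open>At the last point \<open>z\<close> before \<open>a\<close> where
    \<open>w'\<close> is not ahead, let \<open>s\<close> be the next point outside of the residues
    \<open>V\<close>. The value \<open>w s\<close> lies strictly between \<open>w' z\<close> and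
    \<open>w' s\<close>, so \<open>w'\<close> would have to attain it at a point strictly between
    \<open>z\<close> and \<open>s\<close>.\<close>
  have contra: False if ab: "res a \<notin> V" "res b \<notin> V" "w a < w' a" "w' b \<le> w b" "b < a" for a b
  proof -
    have sm: "w y < w z" "w' y < w' z" if "res y \<notin> V" "res z \<notin> V" "y < z" for y z
      using affineD(4)[OF w] affineD(4)[OF w'] that by (auto simp: mono_lifts_def)
    define Z where "Z = {z. res z \<notin> V \<and> b \<le> z \<and> z < a \<and> w' z \<le> w z}"
    have Z: "finite Z" "Z \<noteq> {}" using ab by (auto simp: Z_def intro: finite_subset[of _ "{b..a}"])
    define z where "z = Max Z"
    have z: "res z \<notin> V" "b \<le> z" "z < a" "w' z \<le> w z" using Max_in[OF Z] by (auto simp: z_def Z_def)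
    have zmax: "\<not> w' y \<le> w y" if "res y \<notin> V" "z < y" "y < a" for y
    proof
      assume "w' y \<le> w y"
      then have "y \<in> Z" using that z(2) by (simp add: Z_def)
      then show False using Max_ge[OF Z(1)] that(2) by (force simp: z_def)
    qed
    define S where "S = {s. res s \<notin> V \<and> z < s \<and> s \<le> a}"
    have S: "finite S" "S \<noteq> {}" using ab z by (auto simp: S_def intro: finite_subset[of _ "{z..a}"])
    define s where "s = Min S"
    have s: "res s \<notin> V" "z < s" "s \<le> a" using Min_in[OF S] by (auto simp: s_def S_def)
    have ws: "w s < w' s" using zmax[of s] s ab(3) by (cases "s = a") auto
    define y where "y = (inv_into UNIV w') (w s)"
    have y: "w' y = w s" using affineD(2)[OF w'] by (simp add: y_def bij_def surj_f_inv_f)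
    have ry: "res y \<notin> V"
    proof
      assume "res y \<in> V"
      then have "res (w' y) \<in> res_image n w V" using res_image_iff[OF w' V] im by simp
      then show False using res_image_iff[OF w V] s(1) y by simp
    qed
    have "w' z < w' y" using z(4) sm(1)[OF z(1) s(1,2)] y by simp
    then have "z < y" using sm(2)[OF ry z(1)] by (metis linorder_neqE_linordered_idom order_less_asym order_less_irrefl)
    have "w' y < w' s" using y ws by simp
    then have "y < s" using sm(2)[OF s(1) ry] by (metis linorder_neqE_linordered_idom order_less_asym order_less_irrefl)
    then have "y \<in> S" using \<open>z < y\<close> s(3) ry by (simp add: S_def)
    then show False using Min_le[OF S(1)] \<open>y < s\<close> by (force simp: s_def)
  qed
  \<comment> \<open>By equivariance one of the two indices may be moved back by \<open>n\<close>,
    which brings the pair into the order that \<open>contra\<close> asks for.\<close>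
  have contra': False if "affine_perm V p" "affine_perm V q" "p = w \<and> q = w' \<or> p = w' \<and> q = w" "i \<in> {1..n}" "j \<in> {1..n}"
    "p (int i) < q (int i)" "q (int j) < p (int j)" for p q i j
  proof -
    have "w (int i) \<noteq> w' (int i)" "w (int j) \<noteq> w' (int j)" using that by auto
    then have r: "res (int i) \<notin> V" "res (int j) \<notin> V" using eqV by auto
    have sh: "f (int k - int n) = f (int k) - int n" if "f = w \<or> f = w'" for f k
      using that ew[unfolded equivariant_def, rule_format, of "int k" "-1"]
        ew'[unfolded equivariant_def, rule_format, of "int k" "-1"] by auto
    have rs: "res (int k - int n) = res (int k)" for k using res_shift[of "int k" "-1"] by simp
    show False
      using that(3)
    proof
      assume pq: "p = w \<and> q = w'"
      show False by (rule contra[of "int i" "int j - int n"]) (use pq that r rs sh[of w j] sh[of w' j] in auto)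
    next
      assume pq: "p = w' \<and> q = w"
      show False by (rule contra[of "int j" "int i - int n"]) (use pq that r rs sh[of w i] sh[of w' i] in auto)
    qed
  qed
  have eqI: "w (int i) = w' (int i)" if i: "i \<in> {1..n}" for i
  proof (cases "V = {1..n}")
    case True then show ?thesis using eq i by simp
  next
    case False
    have s0: "(\<Sum>i=1..n. w (int i) - w' (int i)) = 0"
      using affineD(5)[OF w False] affineD(5)[OF w' False] by (simp add: sum_subtractf)
    show ?thesis
    proof (rule ccontr)
      assume "w (int i) \<noteq> w' (int i)"
      then consider "w (int i) < w' (int i)" | "w' (int i) < w (int i)" by linarith
      then show False
      proof cases
        case 1
        then have "\<forall>j\<in>{1..n}. w (int j) - w' (int j) \<le> 0"
          using contra'[OF w w' _ i] by (meson diff_le_0_iff_le not_le)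
        then have "(\<Sum>i=1..n. w (int i) - w' (int i)) < 0"
          using sum_strict_mono_ex1[of "{1..n}" "\<lambda>i. w (int i) - w' (int i)" "\<lambda>_. 0"] 1 i
          by (simp, blast)
        then show False using s0 by simp
      next
        case 2
        then have "\<forall>j\<in>{1..n}. 0 \<le> w (int j) - w' (int j)"
          using contra'[OF w' w _ i] by (meson diff_ge_0_iff_ge not_le)
        then have "0 < (\<Sum>i=1..n. w (int i) - w' (int i))"
          using sum_strict_mono_ex1[of "{1..n}" "\<lambda>_. 0" "\<lambda>i. w (int i) - w' (int i)"] 2 i
          by (simp, blast)
        then show False using s0 by simp
      qed
    qed
  qed
  show ?thesis
    using eqI[OF res_in] equivariant_res(1)[OF ew] equivariant_res(1)[OF ew'] by (intro ext) metis
qed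

lemma affine_perm_id: "affine_perm V id"
  by (simp add: affine_perm_def equivariant_def mono_lifts_def)

lemma nxt_res: "nxt n (res z) = res (z + 1)"
  by (rule nxt_cyc_residue[OF n_pos])

lemma nxt_inj: assumes "i \<in> {1..n}" "j \<in> {1..n}" "nxt n i = nxt n j" shows "i = j"
  using assms by (auto simp: nxt_def split: if_splits)

lemma nxt_in: "i \<in> {1..n} \<Longrightarrow> nxt n i \<in> {1..n}"
  using n3 by (auto simp: nxt_def)

lemma nxt_neq: "i \<in> {1..n} \<Longrightarrow> nxt n i \<noteq> i"
  using n3 by (auto simp: nxt_def)

lemma affine_perm_rotate: "affine_perm {1..n} (\<lambda>z. z + 1)"
proof -
  have "bij (\<lambda>z::int. z + 1)" by (rule o_bij[of "\<lambda>z. z - 1"]) auto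
  then show ?thesis by (simp add: affine_perm_def equivariant_def mono_lifts_def)
qed

text \<open>The affine transposition: it exchanges neighbours over \<open>b\<close> and
  \<open>nxt n b\<close> in every period at once.\<close>

definition swap :: "nat \<Rightarrow> int \<Rightarrow> int" where
  "swap b z = (if res z = b then z + 1 else if res z = nxt n b then z - 1 else z)"

text \<open>The only point that moves forward inside \<open>V\<close> is \<open>b\<close>, and the
  place it takes belongs to no point of \<open>V\<close>; symmetrically for the complement. So order
  can be violated only between \<open>V\<close> and its complement, where \<open>affine_perm\<close>
  asks for nothing.\<close>

lemma swap:
  assumes b: "b \<in> V" "nxt n b \<notin> V" and V: "V \<subseteq> {1..n}"
  shows "affine_perm V (swap b)" "res_image n (swap b) V = shift n V {b}"
proof -
  have bI: "b \<in> {1..n}" using b V by blast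
  note nb = nxt_in[OF bI] nxt_neq[OF bI]
  have r1: "res (z + 1) = nxt n b" if "res z = b" for z using nxt_res[of z] that by simp
  have r2: "res (z - 1) = b" if "res z = nxt n b" for z
    using nxt_res[of "z - 1"] that nxt_inj[OF _ bI, of "res (z - 1)"] res_in by simp
  have inv: "swap b (swap b z) = z" for z
    using r1 r2 nb by (simp add: swap_def)
  then have "bij (swap b)" by (intro o_bij[of "swap b"]) (auto simp: fun_eq_iff)
  moreover have "equivariant n (swap b)" by (simp add: equivariant_def swap_def)
  moreover have "mono_lifts V (swap b)"
    unfolding mono_lifts_def
  proof (intro allI impI)
    fix y z assume yz: "res y \<in> V" "res z \<in> V" "y < z"
    have "swap b z \<ge> z" using yz b by (auto simp: swap_def)
    moreover have "swap b y < z"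
    proof (cases "res y = b")
      case True
      then have "z \<noteq> y + 1" using r1 yz b by auto
      then show ?thesis using True yz by (simp add: swap_def)
    next
      case False
      then show ?thesis using yz b by (auto simp: swap_def)
    qed
    ultimately show "swap b y < swap b z" by simp
  qed
  moreover have "mono_lifts ({1..n} - V) (swap b)"
    unfolding mono_lifts_def
  proof (intro allI impI)
    fix y z assume yz: "res y \<in> {1..n} - V" "res z \<in> {1..n} - V" "y < z"
    have "swap b y \<le> y" using yz b by (auto simp: swap_def)
    moreover have "y < swap b z"
    proof (cases "res z = nxt n b")
      case True
      then have "z - 1 \<noteq> y" using r2 yz b by auto
      then show ?thesis using True yz nb by (simp add: swap_def)
    next
      case False
      then show ?thesis using yz b by (auto simp: swap_def)
    qed
    ultimately show "swap b y < swap b z" by simp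
  qed
  moreover have "(\<Sum>i=1..n. swap b (int i) - int i) = 0"
  proof -
    have "(\<Sum>i=1..n. swap b (int i) - int i) = (\<Sum>i=1..n. (if i = b then 1 else 0) - (if i = nxt n b then 1 else 0))"
      using nb res_of_nat by (intro sum.cong refl) (auto simp: swap_def)
    also have "\<dots> = 0" using bI nb by (simp add: sum_subtractf)
    finally show ?thesis .
  qed
  ultimately show "affine_perm V (swap b)" by (simp add: affine_perm_def)
  have "res (swap b (int v)) = (if v = b then nxt n b else v)" if "v \<in> V" for v
  proof -
    have "res (int v) = v" using V that res_of_nat by blast
    then show ?thesis using that b r1[of "int v"] by (auto simp: swap_def)
  qed
  then have "res_image n (swap b) V = (\<lambda>v. if v = b then nxt n b else v) ` V"
    unfolding res_image_def by (intro image_cong refl)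
  also have "\<dots> = shift n V {b}" using b by (auto simp: shift_def)
  finally show "res_image n (swap b) V = shift n V {b}" .
qed

end

sublocale ngon \<subseteq> braid: group "Braid n"
  by (rule group_Braid[OF n_pos])

section \<open>Loops of points on two concentric layers\<close>

lemma parabola_bounds:
  fixes t :: real assumes "0 \<le> t" "t \<le> 1"
  shows "0 \<le> t * (1 - t)" "t * (1 - t) \<le> 1 / 4" "0 < t \<Longrightarrow> t < 1 \<Longrightarrow> 0 < t * (1 - t)"
proof -
  show "0 \<le> t * (1 - t)" using assms by simp
  have "0 \<le> (t - 1/2) * (t - 1/2)" by simp
  also have "\<dots> = 1/4 - t * (1 - t)" by (simp add: algebra_simps)
  finally show "t * (1 - t) \<le> 1 / 4" by simp
qed simp

context ngon
begin

text \<open>Says that the points \<open>bpoint n (u i)\<close> of one layer are distinct and in the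
  cyclic order of their indices. Being a system of strict linear inequalities, it is preserved under
  convex combinations.\<close>

definition cyc_ord :: "nat set \<Rightarrow> (nat \<Rightarrow> real) \<Rightarrow> bool" where
  "cyc_ord V u \<longleftrightarrow> (\<forall>i\<in>{1..n}. \<forall>j\<in>{1..n}. i < j \<longrightarrow> (i \<in> V \<longleftrightarrow> j \<in> V) \<longrightarrow> u i < u j \<and> u j < u i + n)"

lemma cyc_ord_convex:
  assumes "cyc_ord V u" "cyc_ord V v" "0 \<le> s" "s \<le> 1"
  shows "cyc_ord V (\<lambda>i. (1 - s) * u i + s * v i)"
  unfolding cyc_ord_def
proof (intro ballI impI)
  fix i j assume ij: "i \<in> {1..n}" "j \<in> {1..n}" "i < j" "i \<in> V \<longleftrightarrow> j \<in> V"
  have "u i < u j \<and> u j < u i + n" "v i < v j \<and> v j < v i + n"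
    using assms(1,2) ij unfolding cyc_ord_def by blast+
  then have "0 < (1 - s) * (u j - u i) + s * (v j - v i)" "(1 - s) * (u j - u i) + s * (v j - v i) < n"
    using convex_between[of "u j - u i" n "v j - v i" s] assms(3,4) by simp_all
  then show "(1 - s) * u i + s * v i < (1 - s) * u j + s * v j \<and>
      (1 - s) * u j + s * v j < (1 - s) * u i + s * v i + n"
    by (simp add: algebra_simps)
qed

lemma cyc_ord_id: "cyc_ord V real"
  unfolding cyc_ord_def by auto

lemma affine_perm_cyc_ord:
  assumes w: "affine_perm V w" shows "cyc_ord V (\<lambda>i. of_int (w (int i)))"
  unfolding cyc_ord_def
proof (intro ballI impI)
  fix i j assume ij: "i \<in> {1..n}" "j \<in> {1..n}" "i < j" "i \<in> V \<longleftrightarrow> j \<in> V"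
  have r: "res (int i) = i" "res (int j) = j" "res (int i + int n) = i"
    using ij res_of_nat res_shift[of "int i" 1] by auto
  have sm: "w y < w z" if "res y \<in> V \<longleftrightarrow> res z \<in> V" "y < z" for y z
    using affineD(3,4)[OF w] that unfolding mono_lifts_def by (metis DiffI res_in)
  have "w (int i) < w (int j)" using sm[of "int i" "int j"] r ij by simp
  moreover have "w (int j) < w (int i + int n)" using sm[of "int j" "int i + int n"] r ij by auto
  moreover have "w (int i + int n) = w (int i) + int n"
    using affineD(1)[OF w, unfolded equivariant_def, rule_format, of "int i" 1] by simp
  ultimately show "real_of_int (w (int i)) < real_of_int (w (int j)) \<and>
      real_of_int (w (int j)) < real_of_int (w (int i)) + real n" by linarith
qed

text \<open>Equal points have equal radii, so they belong to the same layer; there the lifts differ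
  by less than \<open>n\<close> and not by 0.\<close>

lemma layer_distinct:
  assumes u: "cyc_ord V u" and r: "\<And>i. i \<in> {1..n} \<Longrightarrow> 0 < r i \<and> (i \<in> V \<longrightarrow> r i = 1) \<and> (i \<notin> V \<longrightarrow> r i < 1)"
    and ij: "i \<in> {1..n}" "j \<in> {1..n}" "i < j"
  shows "of_real (r i) * bpoint n (u i) \<noteq> of_real (r j) * bpoint n (u j)"
proof
  assume eq: "of_real (r i) * bpoint n (u i) = of_real (r j) * bpoint n (u j)"
  have e: "\<exists>k::int. u i = u j + real n * of_int k" "r i = r j"
    using bpoint_scaled_eq[OF _ _ eq] r ij by auto
  show False
  proof (cases "i \<in> V \<longleftrightarrow> j \<in> V")
    case True
    then have "u i < u j \<and> u j < u i + n" using u ij unfolding cyc_ord_def by blast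
    then have "bpoint n (u i) \<noteq> bpoint n (u j)" by (intro bpoint_neq) auto
    then show False using e(1) bpoint_eq_iff by blast
  next
    case False
    then show False using r[OF ij(1)] r[OF ij(2)] e(2) by auto
  qed
qed

text \<open>The parabola vanishes at times 0 and 1, where every point has to be at a vertex, and
  keeps the inner layer strictly inside in between.\<close>

definition depth :: "nat set \<Rightarrow> real \<Rightarrow> nat \<Rightarrow> real" where
  "depth V t i = (if i \<in> V then 1 else 1 - t * (1 - t))"

definition layered_loop :: "nat set \<Rightarrow> (int \<Rightarrow> int) \<Rightarrow> real \<Rightarrow> nat \<Rightarrow> complex" where
  "layered_loop V w t i = of_real (depth V t i) * bpoint n ((1 - t) * real i + t * of_int (w (int i)))"

definition layered_braid :: "nat set \<Rightarrow> (int \<Rightarrow> int) \<Rightarrow> (real \<Rightarrow> complex set) set" where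
  "layered_braid V w = strands_braid n (layered_loop V w)"

lemma depth:
  assumes "0 \<le> t" "t \<le> 1"
  shows "0 < depth V t i" "depth V t i \<le> 1" "i \<in> V \<Longrightarrow> depth V t i = 1"
    "i \<notin> V \<Longrightarrow> 0 < t \<Longrightarrow> t < 1 \<Longrightarrow> depth V t i < 1" "t = 0 \<or> t = 1 \<Longrightarrow> depth V t i = 1"
  using parabola_bounds[OF assms] by (auto simp: depth_def)

lemma continuous_on_depth [continuous_intros]:
  "continuous_on S f \<Longrightarrow> continuous_on S (\<lambda>x. depth V (f x) i)"
  by (cases "i \<in> V") (auto simp: depth_def intro!: continuous_intros)

lemma scaled_bpoint_D: "0 < r \<Longrightarrow> r \<le> 1 \<Longrightarrow> of_real r * bpoint n u \<in> D"
  using scale_interior[OF n3 bpoint_D, of r u] interior_D bpoint_D by (cases "r = 1") auto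

text \<open>Layered loops are determined up to homotopy by their ends, since the positions of the points
  on each layer form a convex set.\<close>

lemma layered_homotopy:
  assumes w: "affine_perm V w" and V: "V \<subseteq> {1..n}" and F: "strand_loop n F"
    and cu: "\<And>i. i \<in> {1..n} \<Longrightarrow> continuous_on {0..1} (u i)"
    and cr: "\<And>i. i \<in> {1..n} \<Longrightarrow> continuous_on {0..1} (r i)"
    and Fu: "\<And>t i. t \<in> {0..1} \<Longrightarrow> i \<in> {1..n} \<Longrightarrow> F t i = of_real (r i t) * bpoint n (u i t)"
    and u0: "\<And>i. i \<in> {1..n} \<Longrightarrow> u i 0 = real i" and u1: "\<And>i. i \<in> {1..n} \<Longrightarrow> u i 1 = of_int (w (int i))"
    and r: "\<And>t i. t \<in> {0..1} \<Longrightarrow> i \<in> {1..n} \<Longrightarrow> 0 < r i t \<and> r i t \<le> 1"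
    and rV: "\<And>t i. t \<in> {0..1} \<Longrightarrow> i \<in> V \<Longrightarrow> r i t = 1"
    and r01: "\<And>i. i \<in> {1..n} \<Longrightarrow> r i 0 = 1" "\<And>i. i \<in> {1..n} \<Longrightarrow> r i 1 = 1"
    and ord: "\<And>t. t \<in> {0..1} \<Longrightarrow> cyc_ord V (\<lambda>i. u i t)"
  shows "strands_braid n F = layered_braid V w"
proof -
  define rr where "rr s t i = (1 - s) * r i t + s * depth V t i" for s t i
  define uu where "uu s t i = (1 - s) * u i t + s * ((1 - t) * real i + t * of_int (w (int i)))" for s t i
  define H where "H s t i = of_real (rr s t i) * bpoint n (uu s t i)" for s t i
  have rr: "0 < rr s t i" "rr s t i \<le> 1" if "s \<in> {0..1}" "t \<in> {0..1}" "i \<in> {1..n}" for s t i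
  proof -
    have d: "0 < depth V t i" "depth V t i \<le> 1" using depth that by auto
    have a: "0 < r i t" "r i t \<le> 1" using r that by auto
    show "rr s t i \<le> 1" unfolding rr_def using d a that by (intro convex_bound_le) auto
    show "0 < rr s t i" unfolding rr_def
      using convex_between(1)[of "r i t" 2 "depth V t i" s] d a that by auto
  qed
  have ends: "H s t i = F t i" if "s = 0 \<or> t = 0 \<or> t = 1" "s \<in> {0..1}" "t \<in> {0..1}" "i \<in> {1..n}" for s t i
  proof -
    have "rr s t i = r i t \<and> uu s t i = u i t"
      using that(1) u0[OF that(4)] u1[OF that(4)] r01(1)[OF that(4)] r01(2)[OF that(4)] depth(5)[of t V i]
      by (auto simp: rr_def uu_def algebra_simps)
    then show ?thesis using Fu[OF that(3,4)] by (simp add: H_def)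
  qed
  have H: "conf_map n unit_square (\<lambda>(s, t). H s t)"
  proof (rule conf_map_squareI)
    fix i assume i: "i \<in> {1..n}"
    show "continuous_on unit_square (\<lambda>x. H (fst x) (snd x) i)"
      unfolding H_def rr_def uu_def
      by (intro continuous_intros continuous_on_compose2[OF cu[OF i]] continuous_on_compose2[OF cr[OF i]]) auto
  next
    fix s t :: real and i assume "s \<in> {0..1}" "t \<in> {0..1}" "i \<in> {1..n}"
    then show "H s t i \<in> D" unfolding H_def using rr by (intro scaled_bpoint_D) auto
  next
    fix s t :: real and i j assume st: "s \<in> {0..1}" "t \<in> {0..1}" and ij: "i \<in> {1..n}" "j \<in> {1..n}" "i < j"
    show "H s t i \<noteq> H s t j"
    \<comment> \<open>On these three sides the two layers may touch, so the radii cannot separate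
      the points. There \<open>H\<close> equals the given loop and its strands are distinct by
      assumption.\<close>
    proof (cases "s = 0 \<or> t = 0 \<or> t = 1")
      case True
      then show ?thesis
        using ends[OF True st ij(1)] ends[OF True st ij(2)] conf_map_neq[OF strand_loopD(1)[OF F] st(2) ij(1,2)] ij(3)
        by simp
    next
      case False
      have "cyc_ord V (\<lambda>i. uu s t i)"
        unfolding uu_def using st by (intro cyc_ord_convex ord cyc_ord_id affine_perm_cyc_ord[OF w]) auto
      moreover have "0 < rr s t k \<and> (k \<in> V \<longrightarrow> rr s t k = 1) \<and> (k \<notin> V \<longrightarrow> rr s t k < 1)" if k: "k \<in> {1..n}" for k
      proof (intro conjI impI)
        show "0 < rr s t k" using rr st k by blast
        show "rr s t k = 1" if "k \<in> V" using that rV st depth(3)[of t k V] by (simp add: rr_def)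
        show "rr s t k < 1" if "k \<notin> V"
        proof -
          have "depth V t k < 1" using depth(4)[of t k V] st False that by auto
          then have "s * depth V t k < s * 1" using st False by (intro mult_strict_left_mono) auto
          moreover have "(1 - s) * r k t \<le> (1 - s) * 1" using r[OF st(2) k] st by (intro mult_left_mono) auto
          ultimately show ?thesis by (simp add: rr_def)
        qed
      qed
      ultimately show ?thesis unfolding H_def by (rule layer_distinct[OF _ _ ij])
    qed
  qed
  have im: "H s a ` {1..n} = F a ` {1..n}" if "a = 0 \<or> a = 1" "s \<in> {0..1}" for s a
    by (rule image_cong[OF refl], rule ends) (use that in auto)
  have "strands_braid n (H 0) = strands_braid n (H 1)"
    by (rule strands_braid_homotopy[OF H]) (simp_all add: im strand_loopD[OF F])
  moreover have "strands_braid n F = strands_braid n (H 0)" by (rule strands_braid_cong[OF _ F]) (use ends in auto)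
  moreover have "H 1 = layered_loop V w" by (simp add: fun_eq_iff H_def rr_def uu_def layered_loop_def)
  ultimately show ?thesis by (simp add: layered_braid_def)
qed

lemma layered_loop_strand:
  assumes w: "affine_perm V w" and V: "V \<subseteq> {1..n}"
  shows "strand_loop n (layered_loop V w)"
  unfolding strand_loop_def
proof (intro conjI ballI)
  have m0: "layered_loop V w 0 i = vtx n i" for i by (simp add: layered_loop_def depth bpoint_of_nat)
  have m1: "layered_loop V w 1 i = vtx n (res (w (int i)))" for i
    by (simp add: layered_loop_def depth bpoint_of_int vtx_cyc_residue[OF n_pos])
  show "layered_loop V w 0 i = vtx n i" for i by (rule m0)
  have "(\<lambda>i. res (w (int i))) ` {1..n} = {1..n}" using affine_perm_bij_betw[OF w] by (simp add: bij_betw_def)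
  then show "layered_loop V w 1 ` {1..n} = base_conf n" unfolding m1 by (metis image_image)
  show "conf_map n {0..1} (layered_loop V w)"
  proof (rule conf_mapI)
    show "continuous_on {0..1} (\<lambda>t. layered_loop V w t i)" for i
      unfolding layered_loop_def by (intro continuous_intros)
    show "layered_loop V w t i \<in> D" if "t \<in> {0..1}" for t i
      unfolding layered_loop_def using depth that by (intro scaled_bpoint_D) auto
    fix t :: real and i j assume t: "t \<in> {0..1}" and ij: "i \<in> {1..n}" "j \<in> {1..n}" "i < j"
    consider "t = 0" | "t = 1" | "0 < t" "t < 1" using t by fastforce
    then show "layered_loop V w t i \<noteq> layered_loop V w t j"
    proof cases
      case 1 then show ?thesis using m0 vtx_eq_iff[OF n_pos] ij by simp
    next
      case 2
      have "res (w (int i)) \<noteq> res (w (int j))"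
        using affine_perm_res_eq_iff[OF w] res_of_nat ij by simp
      then show ?thesis using 2 m1 vtx_eq_iff[OF n_pos res_in res_in] by simp
    next
      case 3
      have "cyc_ord V (\<lambda>i. (1 - t) * real i + t * of_int (w (int i)))"
        using t by (intro cyc_ord_convex cyc_ord_id affine_perm_cyc_ord[OF w]) auto
      then show ?thesis
        unfolding layered_loop_def using 3 depth by (intro layer_distinct[OF _ _ ij]) auto
    qed
  qed
qed

lemma layered_braid_carrier: "affine_perm V w \<Longrightarrow> V \<subseteq> {1..n} \<Longrightarrow> layered_braid V w \<in> carrier (Braid n)"
  unfolding layered_braid_def by (intro strands_braid_carrier layered_loop_strand)

lemma layered_braid_id: assumes "V \<subseteq> {1..n}" shows "layered_braid V id = \<one>\<^bsub>Braid n\<^esub>"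
proof -
  have "strands_braid n (\<lambda>_. vtx n) = layered_braid V id"
    by (rule layered_homotopy[OF affine_perm_id assms const_strand_loop(1)[OF n_pos],
          of "\<lambda>i _. real i" "\<lambda>_ _. 1"]) (auto simp: bpoint_of_nat cyc_ord_id)
  then show ?thesis using const_strand_loop(2)[OF n_pos] by simp
qed

lemma layered_braid_bdisp:
  assumes w: "affine_perm V w" and V: "V \<subseteq> {1..n}"
  shows "displacement V (layered_braid V w) w"
  unfolding displacement_def
proof (intro exI[of _ "layered_loop V w"] conjI ballI layered_loop_strand[OF w V])
  fix b assume "b \<in> V"
  then show "\<exists>u. continuous_on {0..1} u \<and> (\<forall>t\<in>{0..1}. layered_loop V w t b = bpoint n (u t)) \<and>
      u 0 = real b \<and> u 1 = real_of_int (w (int b))"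
    by (intro exI[of _ "\<lambda>t. (1 - t) * real b + t * of_int (w (int b))"])
      (auto simp: layered_loop_def depth intro!: continuous_intros)
qed (simp add: layered_braid_def)

text \<open>In each half of the concatenation the points run on two layers in cyclic order, so
  \<open>layered_homotopy\<close> compares it directly with the layered loop of the
  composite.\<close>

lemma layered_braid_mult:
  assumes w: "affine_perm V w" and w': "affine_perm (res_image n w V) w'" and V: "V \<subseteq> {1..n}"
  shows "layered_braid V w \<otimes>\<^bsub>Braid n\<^esub> layered_braid (res_image n w V) w' = layered_braid V (w' \<circ> w)"
proof -
  let ?V' = "res_image n w V"
  let ?F = "layered_loop V w" and ?G = "layered_loop ?V' w'"
  note F = layered_loop_strand[OF w V] and G = layered_loop_strand[OF w' res_image_subset]
  note c = sconcat_loop[OF n_pos F G]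
  define f g where "f t = min 1 (2 * t)" and "g t = max 0 (2 * t - 1)" for t :: real

  \<comment> \<open>In the second half the lift continues from \<open>w (int i)\<close> to the value
    of the composite, instead of starting again at the residue of \<open>w (int i)\<close>.\<close>
  define x where "x i t = ((1 - f t) * real i + f t * of_int (w (int i))) +
      g t * (of_int ((w' \<circ> w) (int i)) - of_int (w (int i)))" for i t
  \<comment> \<open>At every time one of the two factors is 1: \<open>g\<close> is 0 in the first
    half and \<open>f\<close> is 1 in the second.\<close>
  define r where "r i t = depth V (f t) i * depth V (g t) i" for i t
  have fg: "t \<le> 1/2 \<Longrightarrow> f t = 2 * t \<and> g t = 0" "t \<ge> 1/2 \<Longrightarrow> f t = 1 \<and> g t = 2 * t - 1" for t
    by (auto simp: f_def g_def)
  have fg01: "0 \<le> f t" "f t \<le> 1" "0 \<le> g t" "g t \<le> 1" if "t \<in> {0..1}" for t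
    using that by (auto simp: f_def g_def)
  have e: "end_ix n ?F i = res (w (int i))" for i
    by (rule end_ix_eq[OF n_pos res_in]) (simp add: layered_loop_def depth bpoint_of_int vtx_cyc_residue[OF n_pos])
  have Ft: "sconcat n ?F ?G t i = of_real (r i t) * bpoint n (x i t)" if t: "t \<in> {0..1}" and i: "i \<in> {1..n}" for t i
  proof (cases "t \<le> 1/2")
    case True
    then have s: "f t = 2 * t" "g t = 0" using fg by auto
    have "sconcat n ?F ?G t i = ?F (2 * t) i" by (rule sconcat_simps(1)[OF n_pos F G i True])
    then show ?thesis by (simp add: layered_loop_def r_def x_def s depth)
  next
    case False
    then have t2: "t \<ge> 1/2" by simp
    have s: "f t = 1" "g t = 2 * t - 1" using fg(2)[OF t2] by auto
    let ?r = "res (w (int i))"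
    obtain k where k: "w (int i) = int ?r + int n * k" by (rule res_decomp)
    have iV: "?r \<in> ?V' \<longleftrightarrow> i \<in> V" using res_image_iff[OF w V, of "int i"] res_of_nat[OF i] by simp
    have "w' (w (int i)) = w' (int ?r) + int n * k"
      using affineD(1)[OF w'] by (subst k) (simp add: equivariant_def)
    then have "x i t = ((1 - g t) * real ?r + g t * of_int (w' (int ?r))) + real n * of_int k"
    proof -
      have "real_of_int (w (int i)) = real ?r + real n * of_int k" by (subst k) simp
      moreover have "real_of_int (w' (w (int i))) = of_int (w' (int ?r)) + real n * of_int k"
        using \<open>w' (w (int i)) = _\<close> by simp
      ultimately show ?thesis unfolding x_def s(1) o_def by (simp only:) (simp add: algebra_simps)
    qed
    then have "bpoint n (x i t) = bpoint n ((1 - g t) * real ?r + g t * of_int (w' (int ?r)))"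
      by (simp only: bpoint_periodic)
    moreover have "sconcat n ?F ?G t i = ?G (2 * t - 1) ?r"
      using sconcat_simps(2)[OF n_pos F G i t2] e by simp
    moreover have "depth ?V' (2 * t - 1) ?r = depth V (2 * t - 1) i" using iV by (simp add: depth_def)
    ultimately show ?thesis by (simp add: layered_loop_def r_def s depth)
  qed
  have ord: "cyc_ord V (\<lambda>i. x i t)" if t: "t \<in> {0..1}" for t
  proof (cases "t \<le> 1/2")
    case True
    then have s: "g t = 0" using fg by auto
    have "cyc_ord V (\<lambda>i. (1 - f t) * real i + f t * of_int (w (int i)))"
      by (intro cyc_ord_convex cyc_ord_id affine_perm_cyc_ord[OF w]) (use fg01[OF t] in auto)
    then show ?thesis by (simp add: x_def s)
  next
    case False
    then have s: "f t = 1" using fg(2)[of t] by auto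
    have "cyc_ord V (\<lambda>i. (1 - g t) * of_int (w (int i)) + g t * of_int ((w' \<circ> w) (int i)))"
      by (intro cyc_ord_convex affine_perm_cyc_ord[OF w] affine_perm_cyc_ord[OF affine_perm_compose(1)[OF w w' V]]) (use fg01[OF t] in auto)
    then show ?thesis by (simp add: x_def s algebra_simps)
  qed
  have cfg: "continuous_on {0..1} f" "continuous_on {0..1} g"
    unfolding f_def g_def by (intro continuous_intros)+
  have "strands_braid n (sconcat n ?F ?G) = layered_braid V (w' \<circ> w)"
  proof (rule layered_homotopy[OF affine_perm_compose(1)[OF w w' V] V c(1), of x r])
    show "continuous_on {0..1} (x i)" "continuous_on {0..1} (r i)" for i
      unfolding x_def r_def by (intro continuous_intros cfg)+
    show "0 < r i t \<and> r i t \<le> 1" if "t \<in> {0..1}" for t i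
      unfolding r_def using depth(1,2) fg01[OF that]
      by (auto intro!: mult_pos_pos mult_le_one less_imp_le[OF depth(1)])
    show "r i t = 1" if "t \<in> {0..1}" "i \<in> V" for t i
      unfolding r_def using depth(3) fg01[OF that(1)] that(2) by simp
    show "r i 0 = 1" "r i 1 = 1" for i by (simp_all add: r_def f_def g_def depth)
    show "x i 0 = real i" "x i 1 = of_int ((w' \<circ> w) (int i))" for i
      by (simp_all add: x_def f_def g_def)
  qed (use Ft ord in auto)
  then show ?thesis using c(2) by (simp add: layered_braid_def)
qed

lemma layered_braid_inv:
  assumes w: "affine_perm V w" and V: "V \<subseteq> {1..n}"
  shows "inv\<^bsub>Braid n\<^esub> layered_braid V w = layered_braid (res_image n w V) (inv_into UNIV w)"
proof -
  note i = affine_perm_inv[OF w V]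
  have "w \<circ> inv_into UNIV w = id"
    using affineD(2)[OF w] by (simp add: bij_def fun_eq_iff surj_f_inv_f)
  moreover have "affine_perm (res_image n (inv_into UNIV w) (res_image n w V)) w" unfolding i(2) by (rule w)
  ultimately have "layered_braid (res_image n w V) (inv_into UNIV w) \<otimes>\<^bsub>Braid n\<^esub> layered_braid V w = \<one>\<^bsub>Braid n\<^esub>"
    using layered_braid_mult[OF i(1) _ res_image_subset, of w] i(2) layered_braid_id[OF res_image_subset] by simp
  then show ?thesis
    using braid.inv_equality layered_braid_carrier[OF w V] layered_braid_carrier[OF i(1) res_image_subset] by blast
qed

end

section \<open>Rotation braids\<close>

text \<open>The cotangent of x is at most 1/x, because sin x - x cos x has the derivative x sin x;
  here x is at least \<pi>/n, so 1/x is below n. This is the bound on base angles that the bulge of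
  \<open>rotation_strand\<close> requires.\<close>

lemma cos_le_sin_multiple:
  fixes k n :: int assumes "1 \<le> k" "k < n"
  shows "cos (pi * of_int k / of_int n) \<le> of_int n * sin (pi * of_int k / of_int n)"
proof -
  define x where "x = pi * real_of_int k / of_int n"
  have n: "0 < real_of_int n" "1 \<le> real_of_int k" using assms by auto
  have x: "pi / of_int n \<le> x" "0 < x" "x < pi" using assms n by (auto simp: x_def field_simps)
  have s: "0 < sin x" using x by (intro sin_gt_zero) auto
  show ?thesis
  proof (cases "x \<le> pi / 2")
    case False
    then have "cos x \<le> 0" using x cos_monotone_0_pi_le[of "pi / 2" x] by simp
    also have "0 \<le> of_int n * sin x" using s n by simp
    finally show ?thesis by (simp add: x_def)
  next
    case True
    have c: "0 \<le> cos x" using True x by (intro cos_ge_zero) auto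
    have "sin 0 - 0 * cos 0 \<le> sin x - x * cos x"
    proof (rule DERIV_nonneg_imp_nondecreasing[of 0 x "\<lambda>x. sin x - x * cos x"])
      fix y assume y: "0 \<le> y" "y \<le> x"
      have "((\<lambda>x. sin x - x * cos x) has_real_derivative y * sin y) (at y)"
        by (auto intro!: derivative_eq_intros)
      moreover have "0 \<le> y * sin y" using y x by (intro mult_nonneg_nonneg sin_ge_zero) auto
      ultimately show "\<exists>d. ((\<lambda>x. sin x - x * cos x) has_real_derivative d) (at y) \<and> 0 \<le> d" by blast
    qed (use x in auto)
    then have "x * cos x \<le> sin x" by simp
    have "1 \<le> pi" using pi_gt3 by simp
    then have "1 \<le> of_int n * x" using x(1) n by (simp add: field_simps)
    then have "1 * cos x \<le> of_int n * x * cos x" using c by (intro mult_right_mono) auto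
    also have "\<dots> = of_int n * (x * cos x)" by simp
    also have "\<dots> \<le> of_int n * sin x" using \<open>x * cos x \<le> sin x\<close> n by (intro mult_left_mono) auto
    finally show ?thesis by (simp add: x_def)
  qed
qed

lemma cis_minus_one: "cis (2 * x) - 1 = \<i> * of_real (2 * sin x) * cis x"
  by (simp add: complex_eq_iff cos_double_sin sin_double power2_eq_square)

text \<open>The bulge over the chord from \<open>a\<close> to \<open>b\<close> is contained in every triangle formed by the chord
  and a vertex \<open>v\<close> on its right hand side, because the base angles of this triangle have
  cotangent at most \<open>n\<close>.\<close>

lemma bulge_triangle:
  fixes \<alpha> m k :: int and t \<kappa> :: real
  assumes k: "0 < k" "k < m" "m < int n" and t: "0 < t" "t < 1" and \<kappa>: "0 < \<kappa>" "\<kappa> \<le> 1 / n"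
  defines "a \<equiv> vtxi n \<alpha>" and "b \<equiv> vtxi n (\<alpha> + m)" and "v \<equiv> vtxi n (\<alpha> + k)"
  obtains p q r :: real where "0 < p" "0 < q" "0 < r" "p + q + r = 1"
    "a + of_real t * (b - a) - of_real (\<kappa> * (t * (1 - t))) * \<i> * (b - a) = of_real p * a + of_real q * b + of_real r * v"
proof -
  define \<theta> \<phi> \<eta> where "\<theta> = pi * of_int k / n" and "\<phi> = pi * of_int m / n" and "\<eta> = pi * of_int (m - k) / n"
  have n: "0 < real n" using k by simp
  have sum: "\<phi> = \<eta> + \<theta>" using n by (simp add: \<theta>_def \<phi>_def \<eta>_def field_simps)
  have pos: "0 < sin \<theta>" "0 < sin \<phi>" "0 < sin \<eta>"
    unfolding \<theta>_def \<phi>_def \<eta>_def using k by (intro sin_pos_int; simp)+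
  have cot: "cos \<theta> \<le> n * sin \<theta>" "cos \<eta> \<le> n * sin \<eta>"
    unfolding \<theta>_def \<eta>_def using cos_le_sin_multiple[of k "int n"] cos_le_sin_multiple[of "m - k" "int n"] k by auto
  have m1: "vtxi n (\<alpha> + l) = a * cis (2 * (pi * of_int l / n))" for l
    by (simp add: a_def vtxi_def cis_mult algebra_simps add_divide_distrib)
  have bw: "b - a = a * (\<i> * of_real (2 * sin \<phi>) * cis \<phi>)"
    unfolding b_def m1 \<phi>_def cis_minus_one[symmetric] by (simp add: algebra_simps)
  have vw: "v - a = a * (\<i> * of_real (2 * sin \<theta>) * cis \<theta>)"
    unfolding v_def m1 \<theta>_def cis_minus_one[symmetric] by (simp add: algebra_simps)
  \<comment> \<open>Coordinates of the apex \<open>v\<close> when the chord is the unit of length: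
    \<open>x\<close> along the chord and \<open>y\<close> to its right, by the law of sines. The
    ratios x/y and (1 - x)/y are the cotangents of the two base angles.\<close>
  define x y where "x = sin \<theta> / sin \<phi> * cos \<eta>" and "y = sin \<theta> / sin \<phi> * sin \<eta>"
  have "cis \<theta> = cis \<phi> * cis (- \<eta>)" by (simp add: cis_mult sum)
  then have v: "v - a = (b - a) * (of_real x - \<i> * of_real y)"
  proof -
    assume c: "cis \<theta> = cis \<phi> * cis (- \<eta>)"
    have "of_real x - \<i> * of_real y = of_real (sin \<theta> / sin \<phi>) * cis (- \<eta>)"
      by (simp add: x_def y_def complex_eq_iff)
    then have "(b - a) * (of_real x - \<i> * of_real y) =
        a * (\<i> * of_real (2 * sin \<phi> * (sin \<theta> / sin \<phi>)) * (cis \<phi> * cis (- \<eta>)))"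
      unfolding bw by (simp only: of_real_mult mult.assoc mult.left_commute)
    also have "2 * sin \<phi> * (sin \<theta> / sin \<phi>) = 2 * sin \<theta>" using pos by simp
    finally show ?thesis unfolding vw c by simp
  qed
  have y: "0 < y" using pos by (simp add: y_def)
  have xy: "x \<le> n * y"
    using mult_left_mono[OF cot(2), of "sin \<theta> / sin \<phi>"] pos by (simp add: x_def y_def algebra_simps)
  have "1 - x = sin \<eta> / sin \<phi> * cos \<theta>"
    using pos by (simp add: x_def field_simps) (simp add: sum sin_add)
  then have xy': "1 - x \<le> n * y"
    using mult_left_mono[OF cot(1), of "sin \<eta> / sin \<phi>"] pos by (simp add: y_def algebra_simps)
  \<comment> \<open>Barycentric coordinates: \<open>r\<close> is fixed by the distance from the
    chord, then \<open>q\<close> by the position along it. The cotangent bounds give positivity of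
    \<open>p\<close> and \<open>q\<close>.\<close>
  define r where "r = \<kappa> * (t * (1 - t)) / y"
  define q where "q = t - r * x"
  define p where "p = 1 - t - r * (1 - x)"
  have tt: "0 < t * (1 - t)" using t by simp
  have r: "0 < r" using tt \<kappa> y by (simp add: r_def)
  have "r * (n * y) = n * \<kappa> * (t * (1 - t))" using y by (simp add: r_def)
  also have "\<dots> \<le> 1 * (t * (1 - t))" using \<kappa> n tt by (intro mult_right_mono) (auto simp: field_simps)
  finally have rn: "r * (n * y) \<le> t * (1 - t)" by simp
  have "r * x \<le> r * (n * y)" "r * (1 - x) \<le> r * (n * y)" using xy xy' r by (auto intro: mult_left_mono)
  moreover have "t * (1 - t) < t" "t * (1 - t) < 1 - t"
    using t mult_strict_right_mono[of t 1 "1 - t"] by simp_all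
  ultimately have pq: "0 < p" "0 < q" using rn by (simp_all add: p_def q_def)
  have ry: "r * y = \<kappa> * (t * (1 - t))" using y by (simp add: r_def)
  have "of_real p * a + of_real q * b + of_real r * v = a + of_real q * (b - a) + of_real r * (v - a)"
    by (simp add: p_def q_def algebra_simps)
  also have "\<dots> = a + of_real (q + r * x) * (b - a) - of_real (r * y) * \<i> * (b - a)"
    unfolding v by (simp add: algebra_simps)
  also have "q + r * x = t" by (simp add: q_def)
  finally show ?thesis using that[OF pq r] ry by (simp add: p_def q_def algebra_simps)
qed

lemma side_comb3:
  assumes "p + q + r = 1"
  shows "side a b (of_real p * x + of_real q * y + of_real r * z) = p * side a b x + q * side a b y + r * side a b z"
proof -
  have p: "p = 1 - q - r" using assms by simp
  show ?thesis unfolding p by (simp add: side_def inner_complex_def algebra_simps)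
qed

context ngon
begin

lemma polygon_comb3:
  assumes "0 \<le> p" "0 \<le> q" "0 \<le> r" "p + q + r = 1" "x \<in> D" "y \<in> D" "z \<in> D"
  shows "of_real p * x + of_real q * y + of_real r * z \<in> D"
proof -
  have "p *\<^sub>R x + q *\<^sub>R y + r *\<^sub>R z \<in> convex hull {x, y, z}"
    unfolding convex_hull_3 using assms by blast
  moreover have "convex hull {x, y, z} \<subseteq> D"
    using assms by (intro hull_minimal convex_polygon) auto
  ultimately show ?thesis by (auto simp: scaleR_conv_of_real)
qed

lemma vtx_mix:
  assumes "vtx n c = of_real (1 - s) * x + of_real s * y" "x \<in> D" "y \<in> D" "0 < s" "s \<le> 1"
  shows "y = vtx n c"
proof (cases "s = 1")
  case True then show ?thesis using assms(1) by simp
next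
  case False then show ?thesis using vtx_extreme(2)[OF assms(2,3,4) _ assms(1)] assms(5) by simp
qed

text \<open>Two of the three points are merged into the point of their segment with the right
  proportion, which reduces the claim to \<open>vtx_mix\<close>.\<close>

lemma vtx_comb3:
  assumes "vtx n c = of_real p * x + of_real q * y + of_real r * z" "x \<in> D" "y \<in> D" "z \<in> D"
    "0 < p" "0 < q" "0 < r" "p + q + r = 1"
  shows "x = vtx n c" "y = vtx n c"
proof -
  have *: "x = vtx n c" if e: "vtx n c = of_real p * x + of_real q * y + of_real r * z" and "x \<in> D" "y \<in> D" "z \<in> D"
    and p: "0 < p" "0 < q" "0 < r" "p + q + r = 1" for p q r :: real and x y z
  proof -
    have "of_real 0 * x + of_real (q / (1 - p)) * y + of_real (r / (1 - p)) * z \<in> D"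
    proof (rule polygon_comb3[OF _ _ _ _ that(2-4)])
      have "q / (1 - p) + r / (1 - p) = (q + r) / (1 - p)" by (simp add: add_divide_distrib)
      also have "\<dots> = 1" using p by simp
      finally show "0 + q / (1 - p) + r / (1 - p) = 1" by simp
    qed (use p in auto)
    then have d: "of_real (q / (1 - p)) * y + of_real (r / (1 - p)) * z \<in> D" by simp
    have np: "1 - p \<noteq> 0" using p by simp
    have "vtx n c = of_real (1 - p) * (of_real (q / (1 - p)) * y + of_real (r / (1 - p)) * z) + of_real p * x"
    proof -
      have "of_real (1 - p) * (of_real (q / (1 - p)) * y + of_real (r / (1 - p)) * z) =
          of_real ((1 - p) * (q / (1 - p))) * y + of_real ((1 - p) * (r / (1 - p))) * z"
        by (simp only: of_real_mult distrib_left mult.assoc)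
      also have "\<dots> = of_real q * y + of_real r * z" using np by simp
      finally show ?thesis using e by (simp add: algebra_simps)
    qed
    then show ?thesis using vtx_mix[OF _ d \<open>x \<in> D\<close> p(1)] p by simp
  qed
  show "x = vtx n c" by (rule *[OF assms])
  show "y = vtx n c" by (rule *[of q y p x r z]) (use assms in \<open>auto simp: algebra_simps\<close>)
qed

section \<open>Cyclic successors within a set of vertices and the edges of its hull\<close>

lemma nxt_funpow: "a \<in> {1..n} \<Longrightarrow> (nxt n ^^ m) a = res (int a + int m)"
proof (induction m)
  case 0 then show ?case using res_of_nat by simp
next
  case (Suc m)
  then have "(nxt n ^^ Suc m) a = nxt n (res (int a + int m))" by simp
  also have "\<dots> = res (int a + int m + 1)" by (rule nxt_res)
  finally show ?case by (simp add: algebra_simps)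
qed

text \<open>Unfolds the iterated \<open>nxt n\<close> into integers: the successor is the residue of
  the first integer after \<open>a\<close> that lies over \<open>A\<close>. It is found within one
  period because \<open>A\<close> has a second element.\<close>

lemma next_in:
  assumes A: "A \<subseteq> {1..n}" "a \<in> A" "2 \<le> card A"
  obtains m :: int where "0 < m" "m < int n" "next_in n A a = res (int a + m)" "next_in n A a \<in> A"
    "\<And>k. 0 < k \<Longrightarrow> k < m \<Longrightarrow> res (int a + k) \<notin> A"
proof -
  have aI: "a \<in> {1..n}" using A by blast
  have "\<not> A \<subseteq> {a}" using A(3) card_mono[of "{a}" A] by auto
  then obtain c where c: "c \<in> A" "c \<noteq> a" by blast
  then have "c \<in> {1..n}" using A(1) by blast
  then obtain \<gamma> where g: "int a \<le> \<gamma>" "\<gamma> < int a + int n" "res \<gamma> = c" by (rule vtx_window)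
  have "\<gamma> \<noteq> int a" using g(3) c res_of_nat[OF aI] by auto
  define P where "P m \<longleftrightarrow> 0 < m \<and> (nxt n ^^ m) a \<in> A" for m :: nat
  define m where "m = (LEAST m. P m)"
  have P: "P (nat (\<gamma> - int a))"
    unfolding P_def nxt_funpow[OF aI] using g c \<open>\<gamma> \<noteq> int a\<close> by simp
  then have m: "P m" unfolding m_def by (rule LeastI)
  have "m \<le> nat (\<gamma> - int a)" unfolding m_def by (rule Least_le) (rule P)
  then have "int m < int n" using g by linarith
  moreover have "next_in n A a = res (int a + int m)"
    unfolding next_in_def P_def[symmetric] m_def[symmetric] by (rule nxt_funpow[OF aI])
  moreover have "res (int a + k) \<notin> A" if "0 < k" "k < int m" for k
  proof -
    have "\<not> P (nat k)" using that not_less_Least[of "nat k" P] by (simp add: m_def)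
    then show ?thesis unfolding P_def nxt_funpow[OF aI] using that by simp
  qed
  moreover have "res (int a + int m) \<in> A" using m unfolding P_def nxt_funpow[OF aI] by blast
  ultimately show ?thesis using that[of "int m"] m by (simp add: P_def)
qed

lemma vtx_res: "vtx n (res z) = vtxi n z"
  by (rule vtx_cyc_residue[OF n_pos])

text \<open>Between \<open>a\<close> and its successor there is no lift of an element of
  \<open>A\<close>, so all other elements follow the successor counterclockwise and lie to the left
  of the chord.\<close>

lemma next_in_props:
  assumes A: "A \<subseteq> {1..n}" "a \<in> A" "2 \<le> card A"
  shows "next_in n A a \<in> A" "next_in n A a \<noteq> a"
    and "c \<in> A \<Longrightarrow> 0 \<le> side (vtx n a) (vtx n (next_in n A a)) (vtx n c)"
    and "c \<in> A \<Longrightarrow> c \<noteq> a \<Longrightarrow> c \<noteq> next_in n A a \<Longrightarrow>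
      0 < side (vtx n a) (vtx n (next_in n A a)) (vtx n c)"
proof -
  have aI: "a \<in> {1..n}" using A by blast
  obtain m where m: "0 < m" "m < int n" "next_in n A a = res (int a + m)" "next_in n A a \<in> A"
    and k: "\<And>k. 0 < k \<Longrightarrow> k < m \<Longrightarrow> res (int a + k) \<notin> A" using next_in[OF A] by metis
  show "next_in n A a \<in> A" by (rule m(4))
  show "next_in n A a \<noteq> a"
  proof
    assume "next_in n A a = a"
    then have "vtxi n (int a + m) = vtxi n (int a)"
      using m(3) res_of_nat[OF aI] by (simp add: vtxi_eq_iff[OF n_pos])
    then show False using vtxi_neq[of "int a" "int a + m" n] m by simp
  qed
  have b: "vtx n (next_in n A a) = vtxi n (int a + m)" using m(3) by (simp add: vtx_res)
  show pos: "0 < side (vtx n a) (vtx n (next_in n A a)) (vtx n c)"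
    if c: "c \<in> A" "c \<noteq> a" "c \<noteq> next_in n A a" for c
  proof -
    have "c \<in> {1..n}" using c A(1) by blast
    then obtain \<gamma> where g: "int a \<le> \<gamma>" "\<gamma> < int a + int n" "vtx n c = vtxi n \<gamma>" "res \<gamma> = c" by (rule vtx_window)
    have "\<gamma> \<noteq> int a" using g(4) c(2) res_of_nat[OF aI] by auto
    moreover have "\<gamma> \<noteq> int a + m" using g(4) c(3) m(3) by auto
    moreover have "\<not> \<gamma> < int a + m"
      using k[of "\<gamma> - int a"] g(1,4) c(1) \<open>\<gamma> \<noteq> int a\<close> by auto
    ultimately have "int a + m < \<gamma>" using g(1) by simp
    then show ?thesis unfolding b g(3) unfolding vtx_vtxi[of n a] using m(1) g(2) by (intro side_pos) auto
  qed
  show "c \<in> A \<Longrightarrow> 0 \<le> side (vtx n a) (vtx n (next_in n A a)) (vtx n c)"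
    using pos[of c] by (cases "c = a \<or> c = next_in n A a") auto
qed

text \<open>If \<open>a\<close> and \<open>c\<close> had the same successor, each would lie to the
  left of the edge of the other, and these are opposite orientations of the same triangle.\<close>

lemma next_in_inj:
  assumes A: "A \<subseteq> {1..n}" "2 \<le> card A" and ac: "a \<in> A" "c \<in> A" "a \<noteq> c"
  shows "next_in n A a \<noteq> next_in n A c"
proof
  assume eq: "next_in n A a = next_in n A c"
  let ?b = "next_in n A a"
  note na = next_in_props[OF A(1) ac(1) A(2)] and nc = next_in_props[OF A(1) ac(2) A(2)]
  have "c \<noteq> ?b" using nc(2) eq by simp
  then have "0 < side (vtx n a) (vtx n ?b) (vtx n c)" using na(4)[OF ac(2)] ac(3) by simp
  moreover have "a \<noteq> ?b" using na(2) by simp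
  then have "0 < side (vtx n c) (vtx n ?b) (vtx n a)" using nc(4)[OF ac(1)] ac(3) eq by simp
  ultimately show False using side_rotate[of "vtx n c" "vtx n ?b" "vtx n a"] side_swap[of "vtx n a" "vtx n ?b"]
    by (simp add: side_rotate)
qed

lemma next_in_two:
  assumes A: "A \<subseteq> {1..n}" "2 \<le> card A" "a \<in> A" and nn: "next_in n A (next_in n A a) = a"
  shows "A = {a, next_in n A a}"
proof -
  let ?b = "next_in n A a"
  note na = next_in_props[OF A(1,3,2)] note nb = next_in_props[OF A(1) na(1) A(2)]
  have "c = a \<or> c = ?b" if c: "c \<in> A" for c
  proof (rule ccontr)
    assume "\<not> (c = a \<or> c = ?b)"
    then have "0 < side (vtx n a) (vtx n ?b) (vtx n c)" "0 < side (vtx n ?b) (vtx n a) (vtx n c)"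
      using na(4)[OF c] nb(4)[OF c] nn by auto
    then show False using side_swap[of "vtx n a" "vtx n ?b" "vtx n c"] by simp
  qed
  then show ?thesis using A(3) na(1) by blast
qed

text \<open>The functional of the edge at \<open>a\<close> is nonnegative on \<open>A\<close>. If it
  vanishes inside the edge at \<open>c\<close>, it vanishes at both ends, so \<open>c\<close> is the
  successor of \<open>a\<close> and, by injectivity, \<open>a\<close> that of \<open>c\<close>; then
  \<open>A\<close> has only two elements.\<close>

lemma open_edges_disjoint:
  assumes A: "A \<subseteq> {1..n}" "3 \<le> card A" and ac: "a \<in> A" "c \<in> A" "a \<noteq> c" and s: "0 < s" "s < 1"
  shows "of_real (1 - t) * vtx n a + of_real t * vtx n (next_in n A a) \<noteq>
    of_real (1 - s) * vtx n c + of_real s * vtx n (next_in n A c)"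
proof
  assume eq: "of_real (1 - t) * vtx n a + of_real t * vtx n (next_in n A a) =
    of_real (1 - s) * vtx n c + of_real s * vtx n (next_in n A c)"
  let ?b = "next_in n A a" and ?d = "next_in n A c"
  have A2: "2 \<le> card A" using A by simp
  note na = next_in_props[OF A(1) ac(1) A2] and nc = next_in_props[OF A(1) ac(2) A2]
  let ?f = "side (vtx n a) (vtx n ?b)"
  have "(1 - t) * ?f (vtx n a) + t * ?f (vtx n ?b) = (1 - s) * ?f (vtx n c) + s * ?f (vtx n ?d)"
    using arg_cong[OF eq, of ?f] by (simp only: side_affine)
  then have z: "(1 - s) * ?f (vtx n c) + s * ?f (vtx n ?d) = 0" by simp
  have "0 \<le> (1 - s) * ?f (vtx n c)" "0 \<le> s * ?f (vtx n ?d)"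
    using na(3)[OF ac(2)] na(3)[OF nc(1)] s by simp_all
  then have "(1 - s) * ?f (vtx n c) = 0" "s * ?f (vtx n ?d) = 0" using z by linarith+
  then have f0: "?f (vtx n c) = 0" "?f (vtx n ?d) = 0" using s by auto
  then have "c = ?b" using na(4)[OF ac(2)] ac(3) by force
  moreover have "?d = a \<or> ?d = ?b" using na(4)[OF nc(1)] f0 by force
  moreover have "?d \<noteq> ?b" using next_in_inj[OF A(1) A2 ac] by metis
  ultimately have "next_in n A ?b = a" by simp
  then have "A = {a, ?b}" by (rule next_in_two[OF A(1) A2 ac(1)])
  then have "card A = card {a, ?b}" by (rule arg_cong)
  then show False using A(2) card_insert_le_m1[of 2 "{?b}" a] by simp
qed

text \<open>The strands of \<open>rotation_strand\<close> with the height of the bulge as a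
  parameter. Every height in (0, 1/n] gives the same braid, and small heights keep the motion near
  the hull of \<open>A\<close>.\<close>

definition rst :: "nat set \<Rightarrow> real \<Rightarrow> real \<Rightarrow> nat \<Rightarrow> complex" where
  "rst A \<kappa> t a =
     (if a \<in> A then
        let b = next_in n A a; w = vtx n b - vtx n a in
          vtx n a + of_real t * w -
          (if card A = 2 \<and> b \<noteq> nxt n a then of_real (\<kappa> * (t * (1 - t))) * \<i> * w else 0)
      else vtx n a)"

lemma rotation_strand_rst: "rotation_strand n A = rst A (1 / n)"
proof -
  have "t * (1 - t) / real n = 1 / n * (t * (1 - t))" for t :: real by simp
  then show ?thesis unfolding fun_eq_iff rotation_strand_def rst_def Let_def by (simp only: simp_thms)
qed

lemma rst_static: "a \<notin> A \<Longrightarrow> rst A \<kappa> t a = vtx n a"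
  by (simp add: rst_def)

lemma rst_straight:
  "a \<in> A \<Longrightarrow> card A \<noteq> 2 \<or> next_in n A a = nxt n a \<Longrightarrow>
    rst A \<kappa> t a = of_real (1 - t) * vtx n a + of_real t * vtx n (next_in n A a)"
  by (auto simp: rst_def Let_def algebra_simps)

lemma rst_0: "rst A \<kappa> 0 a = vtx n a" and rst_1: "rst A \<kappa> 1 a = (if a \<in> A then vtx n (next_in n A a) else vtx n a)"
  by (auto simp: rst_def Let_def)

text \<open>Any vertex \<open>v\<close> to the right of the chord may serve as third corner;
  different choices of \<open>v\<close> bound the same bulge in different directions.\<close>

lemma rst_bulge:
  assumes A: "A \<subseteq> {1..n}" "card A = 2" "a \<in> A" "next_in n A a \<noteq> nxt n a"
    and t: "0 < t" "t < 1" and \<kappa>: "0 < \<kappa>" "\<kappa> \<le> 1 / n"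
    and v: "v \<in> {1..n}" "side (vtx n a) (vtx n (next_in n A a)) (vtx n v) < 0"
  obtains p q r :: real where "0 < p" "0 < q" "0 < r" "p + q + r = 1"
    "rst A \<kappa> t a = of_real p * vtx n a + of_real q * vtx n (next_in n A a) + of_real r * vtx n v"
proof -
  have A2: "2 \<le> card A" using A by simp
  obtain m where m: "0 < m" "m < int n" "next_in n A a = res (int a + m)" using next_in[OF A(1,3) A2] by metis
  obtain \<gamma> where g: "int a \<le> \<gamma>" "\<gamma> < int a + int n" "vtx n v = vtxi n \<gamma>" "res \<gamma> = v" using v(1) by (rule vtx_window)
  have b: "vtx n (next_in n A a) = vtxi n (int a + m)" using m(3) by (simp add: vtx_res)
  have "\<gamma> \<noteq> int a" "\<gamma> \<noteq> int a + m" using v(2) g(3) b by (auto simp: vtx_vtxi[of n a])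
  moreover have "\<not> int a + m < \<gamma>"
    using v(2) side_pos[of "int a" "int a + m" \<gamma> n] m(1) g b by (auto simp: vtx_vtxi[of n a])
  ultimately have k: "0 < \<gamma> - int a" "\<gamma> - int a < m" using g(1) by auto
  obtain p q r :: real where "0 < p" "0 < q" "0 < r" "p + q + r = 1"
    "vtxi n (int a) + of_real t * (vtxi n (int a + m) - vtxi n (int a)) -
       of_real (\<kappa> * (t * (1 - t))) * \<i> * (vtxi n (int a + m) - vtxi n (int a)) =
     of_real p * vtxi n (int a) + of_real q * vtxi n (int a + m) + of_real r * vtxi n (int a + (\<gamma> - int a))"
    by (rule bulge_triangle[OF k m(2) t \<kappa>])
  moreover have "rst A \<kappa> t a = vtx n a + of_real t * (vtx n (next_in n A a) - vtx n a) -
      of_real (\<kappa> * (t * (1 - t))) * \<i> * (vtx n (next_in n A a) - vtx n a)"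
    using A by (simp add: rst_def Let_def)
  ultimately show ?thesis using that g(3) b by (simp add: vtx_vtxi[of n a])
qed

lemma rst_bulge_nxt:
  assumes A: "A \<subseteq> {1..n}" "2 \<le> card A" "a \<in> A" "next_in n A a \<noteq> nxt n a"
  shows "side (vtx n a) (vtx n (next_in n A a)) (vtx n (nxt n a)) < 0"
proof -
  have aI: "a \<in> {1..n}" using A by blast
  obtain m where m: "0 < m" "m < int n" "next_in n A a = res (int a + m)" using next_in[OF A(1,3,2)] by metis
  have nx: "nxt n a = res (int a + 1)" using nxt_res[of "int a"] res_of_nat[OF aI] by simp
  then have "m \<noteq> 1" using m(3) A(4) by auto
  then show ?thesis
    unfolding nx m(3) vtx_res vtx_vtxi[of n a] using m by (intro side_neg) auto
qed

text \<open>A strand in motion is a proper convex combination of polygon points, among them two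
  different vertices, so it cannot be an extreme point of the polygon.\<close>

lemma rst_D:
  assumes A: "A \<subseteq> {1..n}" "2 \<le> card A" and t: "0 < t" "t < 1" and \<kappa>: "0 < \<kappa>" "\<kappa> \<le> 1 / n" and i: "i \<in> {1..n}"
  shows "rst A \<kappa> t i \<in> D" and "i \<in> A \<Longrightarrow> c \<in> {1..n} \<Longrightarrow> rst A \<kappa> t i \<noteq> vtx n c"
proof -
  have "rst A \<kappa> t i \<in> D \<and> (i \<in> A \<longrightarrow> c \<in> {1..n} \<longrightarrow> rst A \<kappa> t i \<noteq> vtx n c)" for c
  proof (cases "i \<in> A")
    case False then show ?thesis using i vtx_polygon by (simp add: rst_static)
  next
    case True
    note nb = next_in_props[OF A(1) True A(2)]
    let ?b = "next_in n A i"
    have bI: "?b \<in> {1..n}" using nb(1) A(1) by blast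
    have vD: "vtx n i \<in> D" "vtx n ?b \<in> D" using vtx_polygon i bI by auto
    have neq: "vtx n i \<noteq> vtx n ?b" using vtx_eq_iff[OF n_pos i bI] nb(2) by simp
    show ?thesis
    proof (cases "card A \<noteq> 2 \<or> ?b = nxt n i")
      case st: True
      have e: "rst A \<kappa> t i = of_real (1 - t) * vtx n i + of_real t * vtx n ?b" by (rule rst_straight[OF True st])
      have "rst A \<kappa> t i \<noteq> vtx n c" using vtx_extreme[OF vD t, of c] e neq by metis
      moreover have "rst A \<kappa> t i \<in> D" unfolding e using vD t by (intro polygon_convex_comb) auto
      ultimately show ?thesis by blast
    next
      case False
      have v: "nxt n i \<in> {1..n}" by (rule nxt_in[OF i])
      obtain p q r :: real where e: "0 < p" "0 < q" "0 < r" "p + q + r = 1"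
        "rst A \<kappa> t i = of_real p * vtx n i + of_real q * vtx n ?b + of_real r * vtx n (nxt n i)"
        using rst_bulge[OF A(1) _ True _ t \<kappa> v] rst_bulge_nxt[OF A True] False by metis
      have "rst A \<kappa> t i \<noteq> vtx n c"
        using vtx_comb3[of c p "vtx n i" q "vtx n ?b" r "vtx n (nxt n i)"] e vD vtx_polygon[OF v] neq by metis
      moreover have "rst A \<kappa> t i \<in> D" unfolding e(5) using e vD vtx_polygon[OF v] by (intro polygon_comb3) auto
      ultimately show ?thesis by blast
    qed
  qed
  then show "rst A \<kappa> t i \<in> D" "i \<in> A \<Longrightarrow> c \<in> {1..n} \<Longrightarrow> rst A \<kappa> t i \<noteq> vtx n c" by blast+
qed

lemma rst_distinct:
  assumes A: "A \<subseteq> {1..n}" "2 \<le> card A" and t: "t \<in> {0..1}" and \<kappa>: "0 < \<kappa>" "\<kappa> \<le> 1 / n"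
    and ij: "i \<in> {1..n}" "j \<in> {1..n}" "i \<noteq> j"
  shows "rst A \<kappa> t i \<noteq> rst A \<kappa> t j"
proof -
  consider "t = 0" | "t = 1" | "0 < t" "t < 1" using t by fastforce
  then show ?thesis
  proof cases
    case 1 then show ?thesis using vtx_eq_iff[OF n_pos ij(1,2)] ij(3) by (simp add: rst_0)
  next
    case 2
    define s where "s k = (if k \<in> A then next_in n A k else k)" for k
    have "s i \<noteq> s j"
      using next_in_inj[OF A, of i j] next_in_props(1)[OF A(1) _ A(2)] ij(3) by (auto simp: s_def)
    moreover have "s k \<in> {1..n}" if "k \<in> {1..n}" for k
      using next_in_props(1)[OF A(1) _ A(2), of k] A(1) that by (auto simp: s_def)
    ultimately have "vtx n (s i) \<noteq> vtx n (s j)"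
      using vtx_eq_iff[OF n_pos, of "s i" "s j"] ij by simp
    moreover have "rst A \<kappa> t k = vtx n (s k)" for k by (simp add: 2 rst_1 s_def)
    ultimately show ?thesis by simp
  next
    case 3
    consider "i \<in> A" "j \<in> A" | "i \<in> A" "j \<notin> A" | "i \<notin> A" "j \<in> A" | "i \<notin> A" "j \<notin> A" by blast
    then show ?thesis
    proof cases
      case 1
      show ?thesis
      proof (cases "card A = 2")
        case False
        then have A3: "3 \<le> card A" using A(2) by simp
        show ?thesis
          using open_edges_disjoint[OF A(1) A3 1 ij(3) 3, of t] rst_straight[OF 1(1)] rst_straight[OF 1(2)] False by simp
      next
        case True
        have fin: "finite A" using A(1) finite_subset by blast
        have Aij: "A = {i, j}" using 1 ij(3) True card_subset_eq[OF fin, of "{i, j}"] by auto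
        have nij: "next_in n A i = j" "next_in n A j = i"
          using next_in_props(1,2)[OF A(1) 1(1) A(2)] next_in_props(1,2)[OF A(1) 1(2) A(2)] Aij by auto
        \<comment> \<open>As \<open>n \<ge> 3\<close>, at most one side of the bigon is an edge
          traversed counterclockwise. So at least one side bulges, and the difference of the strands
          is \<open>?w\<close> times a number with nonzero imaginary part.\<close>
        have notboth: "\<not> (j = nxt n i \<and> i = nxt n j)" using ij n3 by (auto simp: nxt_def split: if_splits)
        define c where "c = \<kappa> * (t * (1 - t))"
        have c: "0 < c" using \<kappa> 3 by (simp add: c_def)
        let ?w = "vtx n j - vtx n i"
        define ci cj where "ci = (if j \<noteq> nxt n i then c else 0)" and "cj = (if i \<noteq> nxt n j then c else 0)"
        have "0 < ci + cj" using notboth c by (auto simp: ci_def cj_def)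
        have e: "rst A \<kappa> t i = vtx n i + of_real t * ?w - of_real ci * \<i> * ?w"
          "rst A \<kappa> t j = vtx n j - of_real t * ?w + of_real cj * \<i> * ?w"
          using 1 nij True by (simp_all add: rst_def Let_def c_def ci_def cj_def algebra_simps)
        have "rst A \<kappa> t i - rst A \<kappa> t j = ?w * Complex (2 * t - 1) (- (ci + cj))"
          unfolding e Complex_eq by (simp add: algebra_simps)
        moreover have "Complex (2 * t - 1) (- (ci + cj)) \<noteq> 0"
          using \<open>0 < ci + cj\<close> by (metis complex.sel(2) neg_0_equal_iff_equal order_less_irrefl zero_complex.sel(2))
        moreover have "?w \<noteq> 0" using vtx_eq_iff[OF n_pos ij(1,2)] ij(3) by auto
        ultimately show ?thesis by (metis mult_eq_0_iff right_minus_eq)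
      qed
    next
      case 2 then show ?thesis using rst_D(2)[OF A 3 \<kappa> ij(1) 2(1) ij(2)] rst_static[OF 2(2)] by metis
    next
      case c3: 3 then show ?thesis using rst_D(2)[OF A 3 \<kappa> ij(2) c3(2) ij(1)] rst_static[OF c3(1)] by metis
    next
      case 4 then show ?thesis using vtx_eq_iff[OF n_pos ij(1,2)] ij(3) by (simp add: rst_static)
    qed
  qed
qed

lemma rst_in_D:
  assumes A: "A \<subseteq> {1..n}" "2 \<le> card A" and t: "t \<in> {0..1}" and \<kappa>: "0 < \<kappa>" "\<kappa> \<le> 1 / n" and i: "i \<in> {1..n}"
  shows "rst A \<kappa> t i \<in> D"
proof -
  consider "t = 0" | "t = 1" | "0 < t" "t < 1" using t by fastforce
  then show ?thesis
  proof cases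
    case 1 then show ?thesis using vtx_polygon[OF i] by (simp add: rst_0)
  next
    case 2
    have "i \<in> A \<Longrightarrow> next_in n A i \<in> {1..n}" using next_in_props(1)[OF A(1) _ A(2)] A(1) by blast
    then show ?thesis using 2 vtx_polygon i by (simp add: rst_1)
  next
    case 3 then show ?thesis by (intro rst_D(1)[OF A _ _ \<kappa> i])
  qed
qed

lemma rst_1_image:
  assumes A: "A \<subseteq> {1..n}" "2 \<le> card A"
  shows "rst A \<kappa> 1 ` {1..n} = base_conf n"
proof (rule card_subset_eq)
  show "rst A \<kappa> 1 ` {1..n} \<subseteq> base_conf n"
    using next_in_props(1)[OF A(1) _ A(2)] A(1) by (auto simp: rst_1)
  have k: "0 < 1 / real n" "1 / real n \<le> 1 / n" using n3 by auto
  have "inj_on (rst A (1 / n) 1) {1..n}"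
    using rst_distinct[OF A _ k, of 1] unfolding inj_on_def by force
  moreover have "rst A (1 / n) 1 = rst A \<kappa> 1" by (simp add: fun_eq_iff rst_1)
  ultimately have "inj_on (rst A \<kappa> 1) {1..n}" by simp
  then show "card (rst A \<kappa> 1 ` {1..n}) = card (base_conf n)"
    using vtx_inj[OF n_pos] by (simp add: card_image)
qed simp

lemma continuous_on_rst:
  assumes "continuous_on S f" "continuous_on S g"
  shows "continuous_on S (\<lambda>x. rst A (f x) (g x) i)"
  by (cases "i \<in> A"; cases "card A = 2 \<and> next_in n A i \<noteq> nxt n i")
    (auto simp: rst_def Let_def intro!: continuous_intros assms)

lemma rst_strand:
  assumes A: "A \<subseteq> {1..n}" "2 \<le> card A" and \<kappa>: "0 < \<kappa>" "\<kappa> \<le> 1 / n"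
  shows "strand_loop n (rst A \<kappa>)"
  unfolding strand_loop_def
proof (intro conjI ballI)
  show "conf_map n {0..1} (rst A \<kappa>)"
  proof (rule conf_mapI)
    show "continuous_on {0..1} (\<lambda>t. rst A \<kappa> t i)" for i
      by (intro continuous_on_rst continuous_intros)
  qed (use rst_in_D[OF A _ \<kappa>] rst_distinct[OF A _ \<kappa>] in auto)
qed (use rst_1_image[OF A] rst_0 in auto)

text \<open>The heights from 1/n to \<open>\<kappa>\<close> form a segment of admissible heights,
  and \<open>rst\<close> at these heights is a homotopy.\<close>

lemma rotation_braid_rst:
  assumes A: "A \<subseteq> {1..n}" "2 \<le> card A" and \<kappa>: "0 < \<kappa>" "\<kappa> \<le> 1 / n"
  shows "rotation_braid n A = strands_braid n (rst A \<kappa>)"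
proof -
  define f where "f s = (1 - s) * (1 / n) + s * \<kappa>" for s :: real
  have f: "0 < f s" "f s \<le> 1 / n" if "s \<in> {0..1}" for s
  proof -
    have "1 / real n < 2" using n3 by (simp add: field_simps)
    moreover from this have "\<kappa> < 2" using \<kappa> by simp
    ultimately show "0 < f s" unfolding f_def using convex_between(1)[of "1 / n" 2 \<kappa> s] that \<kappa> n3
      by simp
    show "f s \<le> 1 / n" unfolding f_def by (rule convex_bound_le) (use that \<kappa> in auto)
  qed
  have "strands_braid n (rst A (f 0)) = strands_braid n (rst A (f 1))"
  proof (rule strands_braid_homotopy[of n "\<lambda>s. rst A (f s)"])
    show "conf_map n unit_square (\<lambda>(s, t). rst A (f s) t)"
    proof (rule conf_map_squareI)
      show "continuous_on unit_square (\<lambda>x. rst A (f (fst x)) (snd x) i)" for i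
        unfolding f_def by (intro continuous_on_rst continuous_intros)
    qed (use rst_in_D[OF A _ f] rst_distinct[OF A _ f] in auto)
    show "rst A (f s) 0 ` {1..n} = base_conf n" for s
      by (rule image_cong[OF refl rst_0])
  qed (use rst_1_image[OF A] in auto)
  then show ?thesis using A(2) by (simp add: rotation_braid_def rotation_strand_rst strands_braid_def f_def)
qed

end

subsection \<open>Relations between rotation braids\<close>

context ngon
begin

lemma next_in_eqI:
  assumes "a \<in> {1..n}" "0 < m" "res (int a + m) \<in> A" "\<And>k. 0 < k \<Longrightarrow> k < m \<Longrightarrow> res (int a + k) \<notin> A"
  shows "next_in n A a = res (int a + m)"
proof -
  have "(LEAST j. 0 < j \<and> (nxt n ^^ j) a \<in> A) = nat m"
  proof (rule Least_equality)
    show "0 < nat m \<and> (nxt n ^^ nat m) a \<in> A" using assms(2,3) by (simp add: nxt_funpow[OF assms(1)])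
    fix j assume j: "0 < j \<and> (nxt n ^^ j) a \<in> A"
    show "nat m \<le> j"
    proof (rule ccontr)
      assume "\<not> nat m \<le> j"
      then have "res (int a + int j) \<notin> A" using j by (intro assms(4)) auto
      then show False using j by (simp add: nxt_funpow[OF assms(1)])
    qed
  qed
  then show ?thesis unfolding next_in_def using assms(2) by (simp add: nxt_funpow[OF assms(1)])
qed

lemma next_in_nxt: "a \<in> {1..n} \<Longrightarrow> nxt n a \<in> A \<Longrightarrow> next_in n A a = nxt n a"
  using next_in_eqI[of a 1 A] nxt_res[of "int a"] res_of_nat[of a] by simp

lemma next_in_subset:
  assumes A: "A \<subseteq> {1..n}" "2 \<le> card A" "a \<in> A" and A': "A' \<subseteq> A" "next_in n A a \<in> A'"
  shows "next_in n A' a = next_in n A a"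
proof -
  obtain m where m: "0 < m" "next_in n A a = res (int a + m)"
    "\<And>k. 0 < k \<Longrightarrow> k < m \<Longrightarrow> res (int a + k) \<notin> A" using next_in[OF A(1,3,2)] by metis
  have "next_in n A' a = res (int a + m)"
    by (rule next_in_eqI) (use m A A' in auto)
  then show ?thesis using m(2) by simp
qed

lemma end_ix_rst:
  assumes A: "A \<subseteq> {1..n}" "2 \<le> card A" and i: "i \<in> {1..n}"
  shows "end_ix n (rst A \<kappa>) i = (if i \<in> A then next_in n A i else i)"
  using next_in_props(1)[OF A(1) _ A(2), of i] A(1) i
  by (intro end_ix_eq[OF n_pos]) (auto simp: rst_1)

lemma rst_near_hull:
  assumes A: "A \<subseteq> {1..n}" "2 \<le> card A" "a \<in> A" and t: "t \<in> {0..1}" and \<kappa>: "0 < \<kappa>"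
  obtains z where "z \<in> convex hull (vtx n ` A)" "dist (rst A \<kappa> t a) z \<le> \<kappa>"
proof -
  let ?b = "next_in n A a"
  let ?z = "of_real (1 - t) * vtx n a + of_real t * vtx n ?b"
  have b: "?b \<in> A" by (rule next_in_props(1)[OF A(1,3,2)])
  have "(1 - t) *\<^sub>R vtx n a + t *\<^sub>R vtx n ?b \<in> convex hull (vtx n ` A)"
    using t A(3) b by (intro convexD_alt convex_convex_hull hull_inc) auto
  then have z: "?z \<in> convex hull (vtx n ` A)" by (simp add: scaleR_conv_of_real)
  have "dist (rst A \<kappa> t a) ?z \<le> \<kappa>"
  proof (cases "card A = 2 \<and> ?b \<noteq> nxt n a")
    case False
    then show ?thesis using rst_straight[OF A(3), of \<kappa> t] \<kappa> by auto
  next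
    case True
    define x where "x = \<kappa> * (t * (1 - t))"
    have "rst A \<kappa> t a - ?z = - (of_real x * \<i> * (vtx n ?b - vtx n a))"
      using True A(3) by (simp add: rst_def Let_def x_def algebra_simps)
    then have "dist (rst A \<kappa> t a) ?z = \<bar>x\<bar> * cmod (vtx n ?b - vtx n a)"
      unfolding dist_norm by (simp only: norm_minus_cancel norm_mult norm_of_real norm_ii mult_1_right)
    also have "\<dots> = \<bar>\<kappa> * (t * (1 - t))\<bar> * cmod (vtx n ?b - vtx n a)" by (simp only: x_def)
    \<comment> \<open>The parabola is at most 1/4, and a chord of the unit circle has length at most
      2.\<close>
    also have "\<dots> \<le> \<kappa> * (1 / 4) * 2"
    proof (rule mult_mono)
      show "\<bar>\<kappa> * (t * (1 - t))\<bar> \<le> \<kappa> * (1 / 4)"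
      proof -
        have "\<kappa> * (t * (1 - t)) \<le> \<kappa> * (1 / 4)"
          by (rule mult_left_mono[OF parabola_bounds(2)]) (use t \<kappa> in auto)
        moreover have "0 \<le> \<kappa> * (t * (1 - t))"
          by (rule mult_nonneg_nonneg[OF _ parabola_bounds(1)]) (use t \<kappa> in auto)
        ultimately show ?thesis by (simp only: abs_of_nonneg)
      qed
      show "cmod (vtx n ?b - vtx n a) \<le> 2"
        using norm_triangle_ineq4[of "vtx n ?b" "vtx n a"] by simp
    qed (use \<kappa> in auto)
    also have "\<dots> \<le> \<kappa>" using \<kappa> by simp
    finally show ?thesis .
  qed
  then show ?thesis using that z by blast
qed

text \<open>With bulges small compared to the distance of the two hulls, the two rotations can run
  on independent clocks without meeting. Both products are paths in the square of clock readings
  with the same ends.\<close>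

theorem rotation_braids_commute:
  assumes A: "A \<subseteq> {1..n}" "2 \<le> card A" and A': "A' \<subseteq> {1..n}" "2 \<le> card A'"
    and dj: "convex hull (vtx n ` A) \<inter> convex hull (vtx n ` A') = {}"
  shows "rotation_braid n A \<otimes>\<^bsub>Braid n\<^esub> rotation_braid n A' = rotation_braid n A' \<otimes>\<^bsub>Braid n\<^esub> rotation_braid n A"
proof -
  have comp: "compact (convex hull (vtx n ` B))" if "B \<subseteq> {1..n}" for B
    using finite_subset[OF that] by (intro finite_imp_compact_convex_hull) simp
  obtain d where d: "d > 0" "\<And>x y. x \<in> convex hull (vtx n ` A) \<Longrightarrow> y \<in> convex hull (vtx n ` A') \<Longrightarrow> d \<le> dist x y"
    using separate_compact_closed[OF comp[OF A(1)] compact_imp_closed[OF comp[OF A'(1)]] dj] by blast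
  \<comment> \<open>Strands stay within \<open>\<kappa>\<close> of their hulls, so d/3 leaves a
    positive distance between the two groups.\<close>
  define \<kappa> where "\<kappa> = min (1 / real n) (d / 3)"
  have \<kappa>: "0 < \<kappa>" "\<kappa> \<le> 1 / n" "\<kappa> \<le> d / 3" using d(1) n3 by (auto simp: \<kappa>_def)
  have AA': "A \<inter> A' = {}"
  proof (rule ccontr)
    assume "A \<inter> A' \<noteq> {}"
    then obtain a where "a \<in> A" "a \<in> A'" by blast
    then have "vtx n a \<in> convex hull (vtx n ` A)" "vtx n a \<in> convex hull (vtx n ` A')" by (simp_all add: hull_inc)
    then show False using dj by blast
  qed
  let ?F = "rst A \<kappa>" and ?G = "rst A' \<kappa>"
  have cross: "?F t i \<noteq> ?G t' j" if ij: "i \<in> A" "j \<in> A'" "t \<in> {0..1}" "t' \<in> {0..1}" for t t' i j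
  proof
    assume eq: "?F t i = ?G t' j"
    obtain x where x: "x \<in> convex hull (vtx n ` A)" "dist (?F t i) x \<le> \<kappa>"
      by (rule rst_near_hull[OF A ij(1,3) \<kappa>(1)])
    obtain y where y: "y \<in> convex hull (vtx n ` A')" "dist (?G t' j) y \<le> \<kappa>"
      by (rule rst_near_hull[OF A' ij(2,4) \<kappa>(1)])
    have "d \<le> dist x y" by (rule d(2)[OF x(1) y(1)])
    also have "\<dots> \<le> dist (?F t i) x + dist (?F t i) y" by (rule dist_triangle3)
    also have "\<dots> \<le> \<kappa> + \<kappa>" using x(2) y(2) eq by simp
    finally show False using \<kappa>(3) d(1) by simp
  qed
  \<comment> \<open>The two rotations with separate clocks \<open>\<phi>\<close> and
    \<open>\<psi>\<close>. Points in neither set are at rest, and \<open>?G\<close> describes them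
    correctly.\<close>
  define K where "K \<phi> \<psi> i = (if i \<in> A then ?F \<phi> i else ?G \<psi> i)" for \<phi> \<psi> i
  have K_distinct: "K \<phi> \<psi> i \<noteq> K \<phi> \<psi> j"
    if ij: "i \<in> {1..n}" "j \<in> {1..n}" "i \<noteq> j" and p: "\<phi> \<in> {0..1}" "\<psi> \<in> {0..1}" for \<phi> \<psi> i j
  proof -
    have dF: "?F \<phi> i \<noteq> ?F \<phi> j" by (rule rst_distinct[OF A p(1) \<kappa>(1,2) ij])
    have dG: "?G \<psi> i \<noteq> ?G \<psi> j" by (rule rst_distinct[OF A' p(2) \<kappa>(1,2) ij])
    have mixed: "?F \<phi> k \<noteq> ?G \<psi> l" if "k \<in> A" "l \<notin> A" "?F \<phi> k \<noteq> ?F \<phi> l" for k l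
      using that cross[of k l \<phi> \<psi>] p rst_static[of l A \<kappa> \<phi>] rst_static[of l A' \<kappa> \<psi>] by (cases "l \<in> A'") auto
    show ?thesis
      using dF dG mixed[of i j] mixed[of j i] by (auto simp: K_def)
  qed
  have K_D: "K \<phi> \<psi> i \<in> D" if "i \<in> {1..n}" "\<phi> \<in> {0..1}" "\<psi> \<in> {0..1}" for \<phi> \<psi> i
    using rst_in_D[OF A that(2) \<kappa>(1,2) that(1)] rst_in_D[OF A' that(3) \<kappa>(1,2) that(1)] by (simp add: K_def)
  note F = rst_strand[OF A \<kappa>(1,2)] and G = rst_strand[OF A' \<kappa>(1,2)]
  define f g where "f t = min 1 (2 * t)" and "g t = max 0 (2 * t - 1)" for t :: real
  have fg: "t \<le> 1/2 \<Longrightarrow> f t = 2 * t \<and> g t = 0" "t \<ge> 1/2 \<Longrightarrow> f t = 1 \<and> g t = 2 * t - 1" for t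
    by (auto simp: f_def g_def)
  have fg01: "f t \<in> {0..1}" "g t \<in> {0..1}" if "t \<in> {0..1}" for t
    using that by (auto simp: f_def g_def)
  have cFG: "sconcat n ?F ?G t i = K (f t) (g t) i" if i: "i \<in> {1..n}" for t i
  proof (cases "t \<le> 1/2")
    case True
    then show ?thesis
      using sconcat_simps(1)[OF n_pos F G i True] fg(1)[OF True] by (simp add: K_def rst_0 rst_static)
  next
    case False
    then have t: "t \<ge> 1/2" by simp
    have "sconcat n ?F ?G t i = ?G (2 * t - 1) (if i \<in> A then next_in n A i else i)"
      using sconcat_simps(2)[OF n_pos F G i t] end_ix_rst[OF A i] by simp
    moreover have "i \<in> A \<Longrightarrow> next_in n A i \<notin> A'" using next_in_props(1)[OF A(1) _ A(2)] AA' by blast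
    ultimately show ?thesis using fg(2)[OF t] by (auto simp: K_def rst_1 rst_static)
  qed
  have cGF: "sconcat n ?G ?F t i = K (g t) (f t) i" if i: "i \<in> {1..n}" for t i
  proof (cases "t \<le> 1/2")
    case True
    have "i \<in> A \<Longrightarrow> i \<notin> A'" using AA' by blast
    then show ?thesis
      using sconcat_simps(1)[OF n_pos G F i True] fg(1)[OF True] by (auto simp: K_def rst_0 rst_static)
  next
    case False
    then have t: "t \<ge> 1/2" by simp
    have "sconcat n ?G ?F t i = ?F (2 * t - 1) (if i \<in> A' then next_in n A' i else i)"
      using sconcat_simps(2)[OF n_pos G F i t] end_ix_rst[OF A' i] by simp
    moreover have "i \<in> A' \<Longrightarrow> next_in n A' i \<notin> A \<and> i \<notin> A" using next_in_props(1)[OF A'(1) _ A'(2)] AA' by blast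
    ultimately show ?thesis using fg(2)[OF t] by (auto simp: K_def rst_1 rst_static)
  qed
  \<comment> \<open>The straight line from the schedule (f, g), which rotates \<open>A\<close>
    first, to the schedule (g, f).\<close>
  define H where "H s t = K ((1 - s) * f t + s * g t) ((1 - s) * g t + s * f t)" for s t
  have conv: "(1 - s) * x + s * y \<in> {0..1}" if "s \<in> {0..1}" "x \<in> {0..1}" "y \<in> {0..1}" for s x y :: real
    using convexD_alt[of "{0..1::real}" x y s] that by auto
  have "strands_braid n (H 0) = strands_braid n (H 1)"
  proof (rule strands_braid_homotopy)
    show "conf_map n unit_square (\<lambda>(s, t). H s t)"
    proof (rule conf_map_squareI)
      show "continuous_on unit_square (\<lambda>x. H (fst x) (snd x) i)" for i
        unfolding H_def K_def f_def g_def by (cases "i \<in> A") (auto intro!: continuous_on_rst continuous_intros)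
    next
      fix s t :: real and i assume "s \<in> {0..1}" "t \<in> {0..1}" "i \<in> {1..n}"
      then show "H s t i \<in> D" unfolding H_def by (intro K_D conv fg01)
    next
      fix s t :: real and i j assume "s \<in> {0..1}" "t \<in> {0..1}" and ij: "i \<in> {1..n}" "j \<in> {1..n}" "i < j"
      then show "H s t i \<noteq> H s t j" unfolding H_def by (intro K_distinct conv fg01) auto
    qed
    have "H s 0 i = sconcat n ?F ?G 0 i" "H s 1 i = sconcat n ?F ?G 1 i" if "i \<in> {1..n}" for s i
      using cFG[OF that, of 0] cFG[OF that, of 1] by (simp_all add: H_def f_def g_def)
    then have "H s 0 ` {1..n} = sconcat n ?F ?G 0 ` {1..n}" "H s 1 ` {1..n} = sconcat n ?F ?G 1 ` {1..n}" for s
      by (intro image_cong refl; blast)+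
    then show "H s 0 ` {1..n} = base_conf n" "H s 1 ` {1..n} = base_conf n" for s
      using strand_loopD(3,4)[OF sconcat_loop(1)[OF n_pos F G]] by simp_all
  qed
  moreover have "strands_braid n (sconcat n ?F ?G) = strands_braid n (H 0)"
    by (rule strands_braid_cong[OF _ sconcat_loop(1)[OF n_pos F G]]) (simp add: cFG H_def)
  moreover have "strands_braid n (sconcat n ?G ?F) = strands_braid n (H 1)"
    by (rule strands_braid_cong[OF _ sconcat_loop(1)[OF n_pos G F]]) (simp add: cGF H_def)
  ultimately show ?thesis
    unfolding rotation_braid_rst[OF A \<kappa>(1,2)] rotation_braid_rst[OF A' \<kappa>(1,2)]
    by (simp only: sconcat_loop(2)[OF n_pos F G] sconcat_loop(2)[OF n_pos G F])
qed

lemma inv_n: "0 < 1 / real n" "1 / real n \<le> 1 / n"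
  using n3 by auto

lemma edge_bpoint:
  assumes b: "b \<in> {1..n}" and t: "t \<in> {0..1}"
  shows "of_real (1 - t) * vtx n b + of_real t * vtx n (nxt n b) = bpoint n (real b + edge_param t)"
proof -
  have "nxt n b = res (int b + 1)" using nxt_res[of "int b"] res_of_nat[OF b] by simp
  then have "vtx n (nxt n b) = vtxi n (int b + 1)" by (simp only: vtx_res)
  then show ?thesis using edge_param(1)[of t "int b"] t by (simp add: vtx_vtxi[of n b])
qed

text \<open>All points run along their edges at the same angular coordinate
  \<open>edge_param t\<close>, so there is only the boundary layer and the loop is homotopic to the
  one with linear angular speed.\<close>

theorem rotation_full: "rotation_braid n {1..n} = layered_braid {1..n} (\<lambda>z. z + 1)"
proof -
  have A: "{1..n} \<subseteq> {1..n}" "2 \<le> card {1..n}" using n3 by auto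
  let ?F = "rst {1..n} (1 / n)"
  have "strands_braid n ?F = layered_braid {1..n} (\<lambda>z. z + 1)"
  proof (rule layered_homotopy[OF affine_perm_rotate A(1) rst_strand[OF A inv_n],
        of "\<lambda>i t. real i + edge_param t" "\<lambda>_ _. 1"])
    show "continuous_on {0..1} (\<lambda>t. real i + edge_param t)" for i
      by (intro continuous_intros continuous_on_edge_param)
    show "?F t i = of_real 1 * bpoint n (real i + edge_param t)" if "t \<in> {0..1}" "i \<in> {1..n}" for t i
      using rst_straight[of i "{1..n}" "1 / n" t] next_in_nxt[OF that(2) nxt_in[OF that(2)]] that n3
        edge_bpoint[OF that(2,1)] by simp
  qed (auto simp: edge_param_01 cyc_ord_def)
  then show ?thesis using rotation_braid_rst[OF A inv_n] by simp
qed

lemma next_in_pair: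
  assumes b: "b \<in> {1..n}"
  shows "{b, nxt n b} \<subseteq> {1..n}" "card {b, nxt n b} = 2" "next_in n {b, nxt n b} b = nxt n b"
    "next_in n {b, nxt n b} (nxt n b) = b" "nxt n (nxt n b) \<noteq> b"
proof -
  show A: "{b, nxt n b} \<subseteq> {1..n}" using b nxt_in[OF b] by simp
  show c: "card {b, nxt n b} = 2" using nxt_neq[OF b] by simp
  show "next_in n {b, nxt n b} b = nxt n b" by (rule next_in_nxt[OF b]) simp
  show "next_in n {b, nxt n b} (nxt n b) = b"
    using next_in_props(1,2)[OF A, of "nxt n b"] c by auto
  show "nxt n (nxt n b) \<noteq> b" using b n3 by (auto simp: nxt_def split: if_splits)
qed

text \<open>All strands except the one returning from \<open>nxt n b\<close> to \<open>b\<close>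
  stay in the frontier. So the returning strand can be deformed by straight lines through the
  interior into a path on the inner layer.\<close>

theorem rotation_swap:
  assumes b: "b \<in> V" "nxt n b \<notin> V" and V: "V \<subseteq> {1..n}"
  shows "rotation_braid n {b, nxt n b} = layered_braid V (swap b)"
proof -
  have bI: "b \<in> {1..n}" using b V by blast
  let ?c = "nxt n b"
  let ?A = "{b, ?c}"
  note pr = next_in_pair[OF bI]
  have A: "?A \<subseteq> {1..n}" "2 \<le> card ?A" using pr(1,2) by auto
  have cI: "?c \<in> {1..n}" by (rule nxt_in[OF bI])
  let ?F = "rst ?A (1 / n)"
  note F = rst_strand[OF A inv_n]
  note cF = conf_mapD[OF strand_loopD(1)[OF F]]
  \<comment> \<open>The return path of the layered loop: one place backwards in angle, at the depth
    of a point outside of \<open>V\<close>.\<close>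
  define G where "G t = of_real (depth V t ?c) * bpoint n (real ?c - t)" for t
  define H where "H s t i = (if i = ?c then of_real (1 - s) * ?F t i + of_real s * G t else ?F t i)" for s t i
  have Fb: "?F t b = bpoint n (real b + edge_param t)" if "t \<in> {0..1}" for t
    using rst_straight[of b ?A "1 / n" t] pr(3) edge_bpoint[OF bI that] by simp
  have frF: "?F t i \<in> frontier D" if "i \<noteq> ?c" "t \<in> {0..1}" for t i
    using Fb[OF that(2)] that(1) by (cases "i = b") (auto simp: rst_static bpoint_frontier vtx_frontier[OF n3])
  have Fc: "?F 0 ?c = vtx n ?c" "?F 1 ?c = vtx n b" using pr(4) by (simp_all add: rst_0 rst_1)
  have G01: "G 0 = vtx n ?c" "G 1 = vtx n b"
  proof -
    show "G 0 = vtx n ?c" by (simp add: G_def depth bpoint_of_nat)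
    have "res (int ?c - 1) = b"
      using nxt_res[of "int ?c - 1"] res_of_nat[OF cI] nxt_inj[OF res_in bI] by simp
    then have "vtxi n (int ?c - 1) = vtx n b" using vtx_res[of "int ?c - 1"] by simp
    then show "G 1 = vtx n b" using bpoint_of_int[of "int ?c - 1"] by (simp add: G_def depth)
  qed
  have GI: "G t \<in> interior D" if "0 < t" "t < 1" for t
    unfolding G_def using depth[where t = t and V = V and i = ?c] b that by (intro scale_interior[OF n3 bpoint_D]) auto
  have GD: "G t \<in> D" if "t \<in> {0..1}" for t
    unfolding G_def using depth that by (intro scaled_bpoint_D) auto
  have ends: "H s t i = ?F t i" if "s = 0 \<or> t = 0 \<or> t = 1" for s t i
    using that G01 Fc by (auto simp: H_def algebra_simps)
  have H: "conf_map n unit_square (\<lambda>(s, t). H s t)"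
  proof (rule conf_map_squareI)
    fix i assume i: "i \<in> {1..n}"
    show "continuous_on unit_square (\<lambda>x. H (fst x) (snd x) i)"
      unfolding H_def G_def by (cases "i = ?c") (auto intro!: continuous_intros continuous_on_rst)
  next
    fix s t :: real and i assume st: "s \<in> {0..1}" "t \<in> {0..1}" and i: "i \<in> {1..n}"
    then show "H s t i \<in> D" using polygon_convex_comb[OF cF(2)[OF st(2) cI] GD[OF st(2)], of s] cF(2)[OF st(2) i]
      by (simp add: H_def del: of_real_diff)
  next
    fix s t :: real and i j assume st: "s \<in> {0..1}" "t \<in> {0..1}" and ij: "i \<in> {1..n}" "j \<in> {1..n}" "i < j"
    have ne: "?F t i \<noteq> ?F t j" using conf_map_neq[OF strand_loopD(1)[OF F] st(2) ij(1,2)] ij(3) by simp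
    show "H s t i \<noteq> H s t j"
    proof (cases "s = 0 \<or> t = 0 \<or> t = 1")
      case True then show ?thesis using ends ne by simp
    next
      case False
      have I: "H s t ?c \<in> interior D"
        using interior_convex_comb[OF cF(2)[OF st(2) cI] GI[of t], of s] False st
        by (simp add: H_def del: of_real_diff)
      have Fr: "H s t k \<in> frontier D" if "k \<noteq> ?c" for k
        using frF[OF that st(2)] that by (simp add: H_def)
      consider "i = ?c" | "j = ?c" | "i \<noteq> ?c" "j \<noteq> ?c" by blast
      then show ?thesis
      proof cases
        case 1 then show ?thesis using interior_frontier[OF I Fr[of j]] ij by simp
      next
        case 2 then show ?thesis using interior_frontier[OF I Fr[of i]] ij by (metis less_irrefl)
      next
        case 3 then show ?thesis using ne by (simp add: H_def)
      qed
    qed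
  qed
  have im: "H s a ` {1..n} = ?F a ` {1..n}" if "a = 0 \<or> a = 1" for s a
    by (rule image_cong[OF refl], rule ends) (use that in auto)
  have "strands_braid n (H 0) = strands_braid n (H 1)"
    by (rule strands_braid_homotopy[OF H]) (simp_all only: im strand_loopD(3,4)[OF F] simp_thms)
  moreover have "strands_braid n ?F = strands_braid n (H 0)" by (rule strands_braid_cong[OF _ F]) (simp add: ends)
  moreover have "strands_braid n (H 1) = layered_braid V (swap b)"
  \<comment> \<open>The resting vertices outside of \<open>V\<close> keep radius 1 here. This is
    admissible, as \<open>layered_homotopy\<close> asks for radius 1 on \<open>V\<close> and only
    for radii up to 1 elsewhere.\<close>
  proof (rule layered_homotopy[OF swap(1)[OF b V] V, of _
        "\<lambda>i t. if i = b then real b + edge_param t else if i = ?c then real ?c - t else real i"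
        "\<lambda>i t. if i = ?c then depth V t ?c else 1"])
    have "continuous_on {0..1} (\<lambda>t::real. (1::real, t))" "(\<lambda>t::real. (1::real, t)) ` {0..1} \<subseteq> unit_square"
      by (auto intro!: continuous_intros)
    from conf_map_compose[OF H this] have "conf_map n {0..1} (H 1)" by simp
    then show "strand_loop n (H 1)"
      unfolding strand_loop_def using ends[where s = 1 and t = 0] im[of 1 1] strand_loopD(2,3)[OF F] by simp
    show "continuous_on {0..1} (\<lambda>t. if i = b then real b + edge_param t else if i = ?c then real ?c - t else real i)" for i
      by (cases "i = b"; cases "i = ?c") (auto intro!: continuous_intros continuous_on_edge_param)
    show "continuous_on {0..1} (\<lambda>t. if i = ?c then depth V t ?c else 1)" for i
      by (cases "i = ?c") (auto intro!: continuous_intros)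
    show "H 1 t i = of_real (if i = ?c then depth V t ?c else 1) *
        bpoint n (if i = b then real b + edge_param t else if i = ?c then real ?c - t else real i)"
      if "t \<in> {0..1}" for t i
      using Fb[OF that] nxt_neq[OF bI] by (auto simp: H_def G_def rst_static bpoint_of_nat)
    show "(if i = b then real b + edge_param 1 else if i = ?c then real ?c - 1 else real i) = of_int (swap b (int i))"
      if "i \<in> {1..n}" for i
      using res_of_nat[OF that] nxt_neq[OF bI] by (auto simp: swap_def edge_param_01)
    show "0 < (if i = ?c then depth V t ?c else 1) \<and> (if i = ?c then depth V t ?c else 1) \<le> 1"
      if "t \<in> {0..1}" for t i using depth[where t = t and V = V and i = ?c] that by auto
    show "cyc_ord V (\<lambda>i. if i = b then real b + edge_param t else if i = ?c then real ?c - t else real i)"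
      if t: "t \<in> {0..1}" for t
    proof -
      have e: "0 \<le> edge_param t" "edge_param t \<le> 1" "0 \<le> t" "t \<le> 1" using edge_param(2,3)[of t] t by auto
      show ?thesis
        unfolding cyc_ord_def
      proof (intro ballI impI)
        fix i j assume ij: "i \<in> {1..n}" "j \<in> {1..n}" "i < j" "i \<in> V \<longleftrightarrow> j \<in> V"
        let ?u = "\<lambda>i. if i = b then real b + edge_param t else if i = ?c then real ?c - t else real i"
        \<comment> \<open>The pair of \<open>b\<close> and \<open>nxt n b\<close> does not occur,
          since exactly one of them lies in \<open>V\<close>. Any other index is at least two places
          away in the direction of the motion, which covers at most one place.\<close>
        consider "i = b" "j \<noteq> b" "j \<noteq> ?c" | "j = b" "i \<noteq> b" "i \<noteq> ?c" | "i = ?c" "j \<noteq> b" "j \<noteq> ?c"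
          | "j = ?c" "i \<noteq> b" "i \<noteq> ?c" | "i \<noteq> b" "j \<noteq> b" "i \<noteq> ?c" "j \<noteq> ?c"
          using ij b nxt_neq[OF bI] by blast
        then show "?u i < ?u j \<and> ?u j < ?u i + n"
        proof cases
          case 1
          then have "i + 2 \<le> j" using ij by (auto simp: nxt_def split: if_splits)
          then show ?thesis using 1 ij e by auto
        next
          case 2
          then have "j + 2 \<le> i + n" using ij by (auto simp: nxt_def split: if_splits)
          then have "real j + 2 \<le> real i + real n" by linarith
          then show ?thesis using 2 ij e by auto
        next
          case 3
          then have "j + 2 \<le> i + n" using ij bI by (auto simp: nxt_def split: if_splits)
          then have "real j + 2 \<le> real i + real n" by linarith
          then show ?thesis using 3 ij e nxt_neq[OF bI] by auto
        next
          case 4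
          then have "i + 2 \<le> j" using ij by (auto simp: nxt_def split: if_splits)
          then have "real i + 2 \<le> real j" by linarith
          then show ?thesis using 4 ij e nxt_neq[OF bI] by auto
        next
          case 5 then show ?thesis using ij by auto
        qed
      qed
    qed
  qed (use nxt_neq[OF bI] b in \<open>auto simp: edge_param_01 depth\<close>)
  ultimately show ?thesis using rotation_braid_rst[OF A inv_n] by simp
qed

text \<open>A straight line homotopy. The relevant separations are the line from \<open>p\<close> to \<open>c\<close> (between
  the strand of the predecessor \<open>p\<close> of \<open>b\<close> and the other strands) and the line through the edge from
  \<open>b\<close> to \<open>c\<close> (between the strand of \<open>b\<close> and the other ones).\<close>

theorem rotation_remove:
  assumes A: "A \<subseteq> {1..n}" "3 \<le> card A" and b: "b \<in> A" "nxt n b \<in> A"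
  shows "rotation_braid n A = rotation_braid n (A - {b}) \<otimes>\<^bsub>Braid n\<^esub> rotation_braid n {b, nxt n b}"
proof -
  define c A' E where "c = nxt n b" and "A' = A - {b}" and "E = {b, c}"
  have fin: "finite A" using A(1) finite_subset by blast
  have A2: "2 \<le> card A" using A by simp
  have A': "A' \<subseteq> {1..n}" "2 \<le> card A'" using A b fin by (auto simp: A'_def)
  have bI: "b \<in> {1..n}" using A b by blast
  have cI: "c \<in> {1..n}" unfolding c_def by (rule nxt_in[OF bI])
  have cb: "c \<noteq> b" unfolding c_def by (rule nxt_neq[OF bI])
  note pr = next_in_pair[OF bI, folded c_def, folded E_def]
  have E: "E \<subseteq> {1..n}" "2 \<le> card E" using pr(1,2) by auto
  have cA: "c \<in> A" "c \<in> A'" using b cb by (auto simp: A'_def c_def)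
  have nAb: "next_in n A b = c" unfolding c_def by (rule next_in_nxt[OF bI b(2)])
  have im: "next_in n A ` A = A"
  proof (rule endo_inj_surj[OF fin])
    show "next_in n A ` A \<subseteq> A" using next_in_props(1)[OF A(1) _ A2] by blast
    show "inj_on (next_in n A) A" using next_in_inj[OF A(1) A2] by (meson inj_onI)
  qed
  \<comment> \<open>The predecessor of \<open>b\<close> in \<open>A\<close>. In the product its
    strand passes by \<open>b\<close> to \<open>c\<close> and is then brought back to
    \<open>b\<close> by the second rotation; in the rotation of \<open>A\<close> it goes to
    \<open>b\<close> directly.\<close>
  then obtain p where p: "p \<in> A" "next_in n A p = b" using b(1) by (metis imageE)
  have pb: "p \<noteq> b" using next_in_props(2)[OF A(1) p(1) A2] p(2) by simp
  have pc: "p \<noteq> c"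
  proof
    assume "p = c"
    then have "next_in n A (next_in n A b) = b" using nAb p(2) by simp
    then have "A = {b, c}" using next_in_two[OF A(1) A2 b(1)] nAb by simp
    then have "card A = card {b, c}" by (rule arg_cong)
    then show False using A(2) cb by simp
  qed
  have pA': "p \<in> A'" using p pb by (simp add: A'_def)
  have pI: "p \<in> {1..n}" using p(1) A(1) by blast
  have nA'p: "next_in n A' p = c"
  proof -
    obtain m where m: "0 < m" "m < int n" "next_in n A p = res (int p + m)"
      "\<And>k. 0 < k \<Longrightarrow> k < m \<Longrightarrow> res (int p + k) \<notin> A" using next_in[OF A(1) p(1) A2] by metis
    have c1: "c = res (int p + (m + 1))"
      using nxt_res[of "int p + m"] m(3) p(2) by (simp add: c_def algebra_simps)
    have "res (int p + k) \<notin> A'" if "0 < k" "k < m + 1" for k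
    proof (cases "k = m")
      case True then show ?thesis using m(3) p(2) by (simp add: A'_def)
    next
      case False then show ?thesis using m(4)[of k] that by (simp add: A'_def)
    qed
    then have "next_in n A' p = res (int p + (m + 1))"
      by (intro next_in_eqI[OF pI]) (use m(1) cA c1 in auto)
    then show ?thesis using c1 by simp
  qed
  have nA'a: "next_in n A' a = next_in n A a \<and> next_in n A a \<in> A' \<and> next_in n A a \<noteq> c"
    if a: "a \<in> A'" "a \<noteq> p" for a
  proof -
    have aA: "a \<in> A" "a \<noteq> b" using a by (auto simp: A'_def)
    have "next_in n A a \<noteq> b" using next_in_inj[OF A(1) A2 aA(1) p(1) a(2)] p(2) by simp
    then have 1: "next_in n A a \<in> A'" using next_in_props(1)[OF A(1) aA(1) A2] by (simp add: A'_def)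
    have "next_in n A a \<noteq> c" using next_in_inj[OF A(1) A2 aA(1) b(1) aA(2)] nAb by simp
    then show ?thesis using next_in_subset[OF A(1) A2 aA(1) _ 1] 1 by (auto simp: A'_def)
  qed
  define \<kappa> where "\<kappa> = 1 / real n"
  have \<kappa>: "0 < \<kappa>" "\<kappa> \<le> 1 / n" using inv_n by (auto simp: \<kappa>_def)
  let ?F = "rst A' \<kappa>" and ?G = "rst E \<kappa>" and ?Z = "rst A \<kappa>"
  note F = rst_strand[OF A' \<kappa>] and G = rst_strand[OF E \<kappa>] and Z = rst_strand[OF A(1) A2 \<kappa>]
  define X where "X = sconcat n ?F ?G"
  have X: "strand_loop n X" unfolding X_def by (rule sconcat_loop(1)[OF n_pos F G])
  note cX = conf_mapD[OF strand_loopD(1)[OF X]] and cZ = conf_mapD[OF strand_loopD(1)[OF Z]]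
  have X1: "X t i = ?F (2 * t) i" if "t \<le> 1/2" "i \<in> {1..n}" for t i
    unfolding X_def using sconcat_simps(1)[OF n_pos F G] that by simp
  have X2: "X t i = ?G (2 * t - 1) (if i \<in> A' then next_in n A' i else i)" if "1/2 \<le> t" "i \<in> {1..n}" for t i
    unfolding X_def using sconcat_simps(2)[OF n_pos F G] end_ix_rst[OF A'] that by simp
  have Zst: "?Z t a = of_real (1 - t) * vtx n a + of_real t * vtx n (next_in n A a)" if "a \<in> A" for t a
    using rst_straight[OF that] A(2) by simp
  define H where "H s t i = of_real (1 - s) * X t i + of_real s * ?Z t i" for s t i
  have XZ: "X t i = ?Z t i" if t: "t = 0 \<or> t = 1" and i: "i \<in> {1..n}" for t i
  proof (cases "t = 0")
    case True then show ?thesis using X1[of 0 i] i by (simp add: rst_0)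
  next
    case False
    then have t1: "t = 1" using t by simp
    consider "i = p" | "i = b" | "i \<in> A'" "i \<noteq> p" | "i \<notin> A" by (auto simp: A'_def)
    then show ?thesis
    proof cases
      case 1
      then show ?thesis using X2[of 1 i] i t1 pA' p nA'p pr(4) by (simp add: rst_1 E_def)
    next
      case 2
      then have "i \<notin> A'" by (simp add: A'_def)
      then show ?thesis using X2[of 1 i] 2 i t1 b nAb pr(3) by (simp add: rst_1 E_def)
    next
      case 3
      have "next_in n A i \<notin> E" using nA'a[OF 3] by (auto simp: E_def A'_def)
      then show ?thesis using X2[of 1 i] 3 i t1 nA'a[OF 3] by (simp add: rst_1 A'_def)
    next
      case 4
      then have "i \<notin> A'" "i \<notin> E" using b cA by (auto simp: A'_def E_def)
      then show ?thesis using X2[of 1 i] 4 i t1 by (simp add: rst_1)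
    qed
  qed
  have ends: "H s t i = X t i" if "s = 0 \<or> t = 0 \<or> t = 1" "i \<in> {1..n}" for s t i
    using that XZ[of t i] by (auto simp: H_def algebra_simps)
  let ?f = "side (vtx n p) (vtx n c)" and ?g = "side (vtx n b) (vtx n c)"
  have gD: "0 \<le> ?g z" if "z \<in> D" for z
  proof -
    have "c = res (int b + 1)" using nxt_res[of "int b"] res_of_nat[OF bI] by (simp add: c_def)
    then have "vtx n c = vtxi n (int b + 1)" by (simp only: vtx_res)
    then show ?thesis using side_edge_ge[OF n3 that, of "int b"] by (simp add: vtx_vtxi[of n b])
  qed
  have gpos: "0 < ?g (vtx n a)" if "a \<in> A" "a \<noteq> b" "a \<noteq> c" for a
    using next_in_props(4)[OF A(1) b(1) A2 that(1)] that nAb by simp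
  have gp: "0 < ?g (vtx n p)" by (rule gpos[OF p(1) pb pc])
  have fb: "?f (vtx n b) < 0"
    using gp side_rotate[of "vtx n b" "vtx n c" "vtx n p"] side_swap[of "vtx n p" "vtx n c" "vtx n b"]
      side_rotate[of "vtx n c" "vtx n p" "vtx n b"] by simp
  have fa: "0 \<le> ?f (vtx n a)" if "a \<in> A'" for a
    using next_in_props(3)[OF A'(1) pA' A'(2) that] nA'p by simp
  \<comment> \<open>In the first half the strand follows the chord from \<open>p\<close> to
    \<open>c\<close> or a bulge in the triangle with third corner \<open>b\<close>; in the second
    half a bulge over the chord from \<open>c\<close> to \<open>b\<close>, in the triangle with
    third corner \<open>p\<close>. Neither crosses to the left of the line.\<close>
  have fX_p: "?f (X t p) \<le> 0" if t: "0 < t" "t < 1" for t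
  proof (cases "t \<le> 1/2")
    case True
    have e: "X t p = ?F (2 * t) p" by (rule X1[OF True pI])
    show ?thesis
    proof (cases "card A' \<noteq> 2 \<or> next_in n A' p = nxt n p")
      case st: True
      show ?thesis unfolding e rst_straight[OF pA' st] nA'p side_affine by simp
    next
      case bu: False
      show ?thesis
      proof (cases "t = 1/2")
        case True
        then have "2 * t = 1" by simp
        then show ?thesis unfolding e by (simp only: rst_1 pA' nA'p if_True side_simps order_refl)
      next
        case False
        obtain q1 q2 q3 :: real where q: "0 < q1" "0 < q2" "0 < q3" "q1 + q2 + q3 = 1"
          "?F (2 * t) p = of_real q1 * vtx n p + of_real q2 * vtx n (next_in n A' p) + of_real q3 * vtx n b"
          by (rule rst_bulge[OF A'(1) _ pA' _ _ _ \<kappa> bI, where t = "2 * t"]) (use bu t True False fb nA'p in auto)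
        show ?thesis unfolding e q(5) side_comb3[OF q(4)] nA'p using fb q(3) by (simp add: mult_nonneg_nonpos)
      qed
    qed
  next
    case False
    then have t2: "1/2 \<le> t" by simp
    have e: "X t p = ?G (2 * t - 1) c" using X2[OF t2 pI] pA' nA'p by simp
    have "?g (vtx n p) = side (vtx n c) (vtx n p) (vtx n b)" by (rule side_rotate)
    have scb: "side (vtx n c) (vtx n b) (vtx n p) < 0" using gp side_swap[of "vtx n c" "vtx n b"] by simp
    obtain q1 q2 q3 :: real where q: "0 < q1" "0 < q2" "0 < q3" "q1 + q2 + q3 = 1"
      "?G (2 * t - 1) c = of_real q1 * vtx n c + of_real q2 * vtx n (next_in n E c) + of_real q3 * vtx n p"
      by (rule rst_bulge[OF E(1) pr(2) _ _ _ _ \<kappa> pI, where t = "2 * t - 1" and a = c])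
        (use pr t False scb in \<open>auto simp: E_def c_def\<close>)
    show ?thesis unfolding e q(5) side_comb3[OF q(4)] pr(4) using fb q(2) by (simp add: mult_nonneg_nonpos)
  qed
  have fX_a: "0 \<le> ?f (X t a)" if t: "0 < t" "t < 1" and a: "a \<in> A'" "a \<noteq> p" for t a
  proof (cases "t \<le> 1/2")
    case True
    have aI: "a \<in> {1..n}" using a A' by blast
    have e: "X t a = ?F (2 * t) a" by (rule X1[OF True aI])
    note na = nA'a[OF a]
    have fna: "0 \<le> ?f (vtx n (next_in n A' a))" using fa na by simp
    show ?thesis
    proof (cases "card A' \<noteq> 2 \<or> next_in n A' a = nxt n a")
      case st: True
      show ?thesis unfolding e rst_straight[OF a(1) st] side_affine using fa[OF a(1)] fna t True by simp
    next
      case bu: False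
      show ?thesis
      proof (cases "t = 1/2")
        case True
        then have "2 * t = 1" by simp
        then show ?thesis unfolding e using fna a(1) by (simp only: rst_1 if_True)
      next
        case False
        \<comment> \<open>If only two points are left, the strand considered is that of
          \<open>c\<close>, returning to \<open>p\<close>. Its bulge is directed towards
          \<open>nxt n c\<close>, which lies to the left of the line from \<open>p\<close> to
          \<open>c\<close>.\<close>
        have "{p, c} = A'" using pA' cA pc bu finite_subset[OF A'(1)] by (intro card_subset_eq) auto
        then have ac: "a = c" using a by blast
        have nc: "next_in n A' c = p"
          using next_in_props(1,2)[OF A'(1) cA(2) A'(2)] \<open>{p, c} = A'\<close> by blast
        have s: "side (vtx n c) (vtx n p) (vtx n (nxt n c)) < 0"
          using rst_bulge_nxt[OF A' cA(2)] bu ac nc by simp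
        obtain q1 q2 q3 :: real where q: "0 < q1" "0 < q2" "0 < q3" "q1 + q2 + q3 = 1"
          "?F (2 * t) a = of_real q1 * vtx n a + of_real q2 * vtx n (next_in n A' a) + of_real q3 * vtx n (nxt n c)"
          by (rule rst_bulge[OF A'(1) _ a(1) _ _ _ \<kappa> nxt_in[OF cI], where t = "2 * t"]) (use bu t True False s ac nc in auto)
        have "0 < ?f (vtx n (nxt n c))" using s side_swap[of "vtx n c" "vtx n p"] by simp
        then show ?thesis unfolding e q(5) side_comb3[OF q(4)] using ac nc q(3) by simp
      qed
    qed
  next
    case False
    then have t2: "1/2 \<le> t" by simp
    have aI: "a \<in> {1..n}" using a A' by blast
    have "next_in n A' a \<notin> E" using nA'a[OF a] by (auto simp: E_def A'_def)
    then have "X t a = vtx n (next_in n A' a)" using X2[OF t2 aI] a by (simp add: rst_static)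
    then show ?thesis using fa nA'a[OF a] by simp
  qed
  have gX_b: "?g (X t b) = 0" if t: "0 < t" "t < 1" for t
  proof (cases "t \<le> 1/2")
    case True
    then show ?thesis using X1[OF True bI] by (simp add: rst_static A'_def)
  next
    case False
    then have t2: "1/2 \<le> t" by simp
    have "X t b = ?G (2 * t - 1) b" using X2[OF t2 bI] by (simp add: A'_def)
    moreover have "?G (2 * t - 1) b = of_real (1 - (2 * t - 1)) * vtx n b + of_real (2 * t - 1) * vtx n (next_in n E b)"
      by (rule rst_straight) (use pr in \<open>auto simp: E_def c_def\<close>)
    ultimately show ?thesis unfolding pr(3) by (simp only: side_affine side_simps mult_zero_right add_0)
  qed
  \<comment> \<open>The condition \<open>o\<close> is asymmetric, but every pair of different
    indices that meets \<open>A\<close> satisfies it in one of its two orders. Its cases are: a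
    resting vertex, the strand of \<open>b\<close>, the strand of \<open>p\<close> against the
    others, and two ordinary strands.\<close>
  have dist: "H s t i \<noteq> H s t j"
    if st: "0 < s" "s \<le> 1" "0 < t" "t < 1" and ij: "i \<in> A" "j \<in> {1..n}" "i \<noteq> j" and
      o: "j \<notin> A \<or> i = b \<or> i = p \<and> j \<noteq> b \<or> (i \<noteq> b \<and> i \<noteq> p \<and> j \<noteq> b \<and> j \<noteq> p)" for s t i j
  proof -
    have tI: "t \<in> {0..1}" using st by simp
    have iI: "i \<in> {1..n}" using ij A by blast
    have fp: "?f (H s t p) < 0"
    proof -
      have "?f (?Z t p) = t * ?f (vtx n b)" unfolding Zst[OF p(1)] p(2) side_affine by simp
      then have "s * ?f (?Z t p) < 0" using fb st by (simp add: mult_pos_neg)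
      moreover have "(1 - s) * ?f (X t p) \<le> 0" using fX_p[OF st(3,4)] st by (simp add: mult_nonneg_nonpos)
      ultimately show ?thesis unfolding H_def side_affine by linarith
    qed
    have fa': "0 \<le> ?f (H s t a)" if a: "a \<in> A'" "a \<noteq> p" for a
    proof -
      have aA: "a \<in> A" using a by (simp add: A'_def)
      have "0 \<le> ?f (?Z t a)" unfolding Zst[OF aA] side_affine using fa[OF a(1)] fa[of "next_in n A a"] nA'a[OF a] st by simp
      then show ?thesis unfolding H_def side_affine using fX_a[OF st(3,4) a] st by simp
    qed
    have gb: "?g (H s t b) = 0"
      unfolding H_def side_affine gX_b[OF st(3,4)] Zst[OF b(1)] nAb by simp
    have ga: "0 < ?g (H s t a)" if a: "a \<in> A" "a \<noteq> b" for a
    proof -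
      have aI: "a \<in> {1..n}" using a A by blast
      have na: "next_in n A a \<in> A" by (rule next_in_props(1)[OF A(1) a(1) A2])
      then have nI: "next_in n A a \<in> {1..n}" using A by blast
      have g0: "0 \<le> ?g (vtx n a)" "0 \<le> ?g (vtx n (next_in n A a))" using gD vtx_polygon aI nI by auto
      \<comment> \<open>The strand of \<open>c\<close> starts on the line through \<open>b\<close>
        and \<open>c\<close> but ends off it; every other strand considered starts off it. A proper
        combination of both ends is therefore strictly to the left.\<close>
      have "0 < ?g (vtx n a) \<or> 0 < ?g (vtx n (next_in n A a))"
      proof (cases "a = c")
        case True
        then have "next_in n A a \<noteq> c" using next_in_props(2)[OF A(1) a(1) A2] by simp
        moreover have "next_in n A a \<noteq> b" using True p(2) pc next_in_inj[OF A(1) A2 a(1) p(1)] by metis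
        ultimately show ?thesis using gpos[OF na] by simp
      next
        case False then show ?thesis using gpos[OF a(1)] a by simp
      qed
      then have "0 < (1 - t) * ?g (vtx n a) + t * ?g (vtx n (next_in n A a))"
        using g0 st by (metis add_nonneg_pos add_pos_nonneg diff_gt_0_iff_gt less_imp_le mult_nonneg_nonneg mult_pos_pos)
      then have "0 < ?g (?Z t a)" unfolding Zst[OF a(1)] side_affine .
      then have "0 < s * ?g (?Z t a)" using st by simp
      moreover have "0 \<le> (1 - s) * ?g (X t a)" using gD[OF cX(2)[OF tI aI]] st by simp
      ultimately show ?thesis unfolding H_def side_affine by linarith
    qed
    show ?thesis
    proof (cases "j \<in> A")
      case False
      then have jn: "j \<notin> A'" "j \<notin> E" using b cA by (auto simp: A'_def E_def)
      have "X t j = vtx n j" using X1[of t j] X2[of t j] ij jn by (cases "t \<le> 1/2") (simp_all add: rst_static)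
      then have Hj: "H s t j = vtx n j" using False by (simp add: H_def rst_static algebra_simps)
      have "H s t i \<noteq> vtx n j"
      proof
        assume "H s t i = vtx n j"
        then have "vtx n j = of_real (1 - s) * X t i + of_real s * ?Z t i" by (simp only: H_def)
        then have "?Z t i = vtx n j" using vtx_mix[OF _ cX(2)[OF tI iI] cZ(2)[OF tI iI] st(1,2)] by blast
        then show False using rst_D(2)[OF A(1) A2 st(3,4) \<kappa> iI ij(1,2)] by blast
      qed
      then show ?thesis using Hj by simp
    next
      case jA: True
      consider "i = b" | "i = p" "j \<noteq> b" | "i \<noteq> b" "i \<noteq> p" "j \<noteq> b" "j \<noteq> p" using o jA by blast
      then show ?thesis
      proof cases
        case 1 then show ?thesis using gb ga[OF jA] ij(3) by (metis less_irrefl)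
      next
        case 2
        then have "0 \<le> ?f (H s t j)" using fa'[of j] jA ij(3) by (simp add: A'_def)
        then show ?thesis using fp 2 by (metis not_less)
      next
        case 3
        have ijA': "i \<in> A'" "j \<in> A'" using ij jA 3 by (auto simp: A'_def)
        \<comment> \<open>Now \<open>A'\<close> has at least three elements, so nothing bulges, and
          both loops move the two strands along the same edges of \<open>A\<close>. The interpolated
          position is the common time \<open>\<tau>\<close> on these edges.\<close>
        have "card {p, i, j} \<le> card A'" using ijA' pA' finite_subset[OF A'(1)] by (intro card_mono) auto
        then have c3: "card A' \<noteq> 2" using 3 ij(3) by simp
        define \<sigma> where "\<sigma> = min 1 (2 * t)"
        have Xk: "X t k = of_real (1 - \<sigma>) * vtx n k + of_real \<sigma> * vtx n (next_in n A k)"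
          if k: "k \<in> A'" "k \<noteq> p" for k
        proof -
          have kI: "k \<in> {1..n}" using k A' by blast
          show ?thesis
          proof (cases "t \<le> 1/2")
            case True
            then have "\<sigma> = 2 * t" by (simp add: \<sigma>_def)
            then show ?thesis using X1[OF True kI] rst_straight[OF k(1), of \<kappa> "2 * t"] c3 nA'a[OF k] by simp
          next
            case False
            then have "\<sigma> = 1" "1/2 \<le> t" by (auto simp: \<sigma>_def)
            moreover have "next_in n A k \<notin> E" using nA'a[OF k] by (auto simp: E_def A'_def)
            ultimately show ?thesis using X2[OF _ kI] k nA'a[OF k] by (simp add: rst_static)
          qed
        qed
        define \<tau> where "\<tau> = (1 - s) * \<sigma> + s * t"
        have Hk: "H s t k = of_real (1 - \<tau>) * vtx n k + of_real \<tau> * vtx n (next_in n A k)"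
          if k: "k \<in> A'" "k \<noteq> p" for k
        proof -
          have kA: "k \<in> A" using k by (simp add: A'_def)
          show ?thesis unfolding H_def Xk[OF k] Zst[OF kA] \<tau>_def by (simp add: algebra_simps)
        qed
        have \<sigma>: "0 < \<sigma>" "\<sigma> \<le> 1" using st by (auto simp: \<sigma>_def)
        have "(1 - s) * \<sigma> \<le> (1 - s) * 1" using \<sigma> st by (intro mult_left_mono) auto
        moreover have "s * t < s * 1" using st by (intro mult_strict_left_mono) auto
        moreover have "0 \<le> (1 - s) * \<sigma>" "0 < s * t" using \<sigma> st by auto
        ultimately have \<tau>: "0 < \<tau>" "\<tau> < 1" by (auto simp: \<tau>_def)
        show ?thesis
          unfolding Hk[OF ijA'(1) 3(2)] Hk[OF ijA'(2) 3(4)]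
          by (rule open_edges_disjoint[OF A ij(1) jA ij(3) \<tau>])
      qed
    qed
  qed
  have H: "conf_map n unit_square (\<lambda>(s, t). H s t)"
  proof (rule conf_map_squareI)
    fix i assume i: "i \<in> {1..n}"
    show "continuous_on unit_square (\<lambda>x. H (fst x) (snd x) i)"
      unfolding H_def
      by (intro continuous_intros continuous_on_compose2[OF cX(1)[OF i]] continuous_on_rst) auto
  next
    fix s t :: real and i assume "s \<in> {0..1}" "t \<in> {0..1}" "i \<in> {1..n}"
    then show "H s t i \<in> D" unfolding H_def by (intro polygon_convex_comb cX(2) cZ(2)) auto
  next
    fix s t :: real and i j assume st: "s \<in> {0..1}" "t \<in> {0..1}" and ij: "i \<in> {1..n}" "j \<in> {1..n}" "i < j"
    show "H s t i \<noteq> H s t j"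
    proof (cases "s = 0 \<or> t = 0 \<or> t = 1")
      case True
      then show ?thesis
        using ends ij conf_map_neq[OF strand_loopD(1)[OF X] st(2) ij(1,2)] by simp
    next
      case False
      then have st': "0 < s" "s \<le> 1" "0 < t" "t < 1" using st by auto
      consider "i \<notin> A" "j \<notin> A" | "i \<in> A" "j \<notin> A \<or> i = b \<or> i = p \<and> j \<noteq> b \<or> (i \<noteq> b \<and> i \<noteq> p \<and> j \<noteq> b \<and> j \<noteq> p)"
        | "j \<in> A" "i \<notin> A \<or> j = b \<or> j = p \<and> i \<noteq> b \<or> (j \<noteq> b \<and> j \<noteq> p \<and> i \<noteq> b \<and> i \<noteq> p)"
        using b p by blast
      then show ?thesis
      proof cases
        case 1
        have "H s t k = vtx n k" if "k \<notin> A" "k \<in> {1..n}" for k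
        proof -
          have kn: "k \<notin> A'" "k \<notin> E" using b cA that by (auto simp: A'_def E_def)
          have "X t k = vtx n k" using X1[of t k] X2[of t k] that kn by (cases "t \<le> 1/2") (simp_all add: rst_static)
          then show ?thesis using that by (simp add: H_def rst_static algebra_simps)
        qed
        then show ?thesis using 1 ij vtx_eq_iff[OF n_pos ij(1,2)] by simp
      next
        case 2 then show ?thesis using dist[OF st', of i j] ij by simp
      next
        case 3 then show ?thesis using dist[OF st', of j i] ij by (metis less_irrefl)
      qed
    qed
  qed
  have im: "H s a ` {1..n} = X a ` {1..n}" if "a = 0 \<or> a = 1" for s a
    by (rule image_cong[OF refl], rule ends) (use that in auto)
  have "strands_braid n (H 0) = strands_braid n (H 1)"
    by (rule strands_braid_homotopy[OF H]) (simp_all only: im strand_loopD(3,4)[OF X] simp_thms)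
  moreover have "strands_braid n X = strands_braid n (H 0)" by (rule strands_braid_cong[OF _ X]) (simp add: ends)
  moreover have "H 1 = ?Z" by (simp add: fun_eq_iff H_def)
  ultimately have "strands_braid n ?F \<otimes>\<^bsub>Braid n\<^esub> strands_braid n ?G = strands_braid n ?Z"
    using sconcat_loop(2)[OF n_pos F G] by (simp add: X_def)
  then show ?thesis
    using rotation_braid_rst[OF A(1) A2 \<kappa>] rotation_braid_rst[OF A' \<kappa>] rotation_braid_rst[OF E \<kappa>]
    by (simp add: A'_def E_def c_def)
qed

end

section \<open>Dual simple braids\<close>

context ngon
begin

section \<open>The permutation of the vertices induced by a braid\<close>

lemma carrier_strands:
  assumes "\<beta> \<in> carrier (Braid n)"
  obtains F where "strand_loop n F" "\<beta> = strands_braid n F"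
proof -
  obtain f where f: "f \<in> braid_loops n" "\<beta> = braid_class n f" using assms by (rule carrier_BraidE)
  then have p: "continuous_map (top_of_set {0..1}) (UConf n) f" and f0: "vtx n ` {1..n} = f 0"
    and f1: "f 1 = base_conf n" by (simp_all add: braid_loops_def pathin_def)
  obtain F where F: "conf_map n {0..1} F" "\<And>t. t \<in> {0..1} \<Longrightarrow> F t ` {1..n} = f t" "\<And>i. i \<in> {1..n} \<Longrightarrow> F 0 i = vtx n i"
    using path_lift[OF p f0] by metis
  have sl: "strand_loop n F" unfolding strand_loop_def using F(1,3) F(2)[of 1] f1 by simp
  have "(f, \<lambda>t. F t ` {1..n}) \<in> loop_homotopy n"
    using braid_loops_cong[OF f(1), of "\<lambda>t. F t ` {1..n}"] F(2) by simp
  then have "\<beta> = strands_braid n F" unfolding f(2) strands_braid_def by (rule braid_class_eqI)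
  then show ?thesis using that sl by blast
qed

text \<open>The choice of the strands is immaterial: by \<open>strand_homotopy\<close> the end
  points are invariant under homotopy.\<close>

definition braid_perm :: "(real \<Rightarrow> complex set) set \<Rightarrow> nat \<Rightarrow> nat" where
  "braid_perm \<beta> = end_ix n (SOME F. strand_loop n F \<and> \<beta> = strands_braid n F)"

lemma braid_perm_brd:
  assumes F: "strand_loop n F" and i: "i \<in> {1..n}"
  shows "braid_perm (strands_braid n F) i = end_ix n F i"
proof -
  let ?G = "SOME G. strand_loop n G \<and> strands_braid n F = strands_braid n G"
  have G: "strand_loop n ?G \<and> strands_braid n F = strands_braid n ?G"
    by (rule someI[of "\<lambda>G. strand_loop n G \<and> strands_braid n F = strands_braid n G" F]) (simp add: F)
  obtain H where H: "conf_map n unit_square H" "\<forall>t\<in>{0..1}. \<forall>i\<in>{1..n}. H (0, t) i = F t i"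
    "\<forall>t\<in>{0..1}. \<forall>i\<in>{1..n}. H (1, t) i = ?G t i"
    "\<forall>s\<in>{0..1}. \<forall>i\<in>{1..n}. H (s, 0) i = vtx n i"
    "\<forall>s\<in>{0..1}. \<forall>i\<in>{1..n}. H (s, 1) i = F 1 i"
    by (rule strand_homotopy[OF n_pos F conjunct1[OF G] conjunct2[OF G]]) (rule that; assumption)
  have "?G 1 i = F 1 i" using H(3)[rule_format, of 1 i] H(5)[rule_format, of 1 i] i by simp
  then show ?thesis unfolding braid_perm_def end_ix_def by simp
qed

lemma braid_perm_mult:
  assumes "\<alpha> \<in> carrier (Braid n)" "\<beta> \<in> carrier (Braid n)" and i: "i \<in> {1..n}"
  shows "braid_perm (\<alpha> \<otimes>\<^bsub>Braid n\<^esub> \<beta>) i = braid_perm \<beta> (braid_perm \<alpha> i)"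
proof -
  obtain F where F: "strand_loop n F" "\<alpha> = strands_braid n F" using assms(1) by (rule carrier_strands)
  obtain G where G: "strand_loop n G" "\<beta> = strands_braid n G" using assms(2) by (rule carrier_strands)
  note c = sconcat_loop[OF n_pos F(1) G(1)] and e = end_ix[OF n_pos F(1) i]
  have "braid_perm (\<alpha> \<otimes>\<^bsub>Braid n\<^esub> \<beta>) i = end_ix n (sconcat n F G) i"
    unfolding F(2) G(2) c(2) by (rule braid_perm_brd[OF c(1) i])
  also have "\<dots> = end_ix n G (end_ix n F i)" using c(3)[OF i] by (simp add: end_ix_def)
  finally show ?thesis using braid_perm_brd[OF F(1) i] braid_perm_brd[OF G(1) e(1)] F(2) G(2) by simp
qed

lemma braid_perm_one: "i \<in> {1..n} \<Longrightarrow> braid_perm \<one>\<^bsub>Braid n\<^esub> i = i"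
  using braid_perm_brd[OF const_strand_loop(1)[OF n_pos], of i] const_strand_loop(2)[OF n_pos]
    end_ix_eq[OF n_pos, of i "\<lambda>_. vtx n" i] by simp

lemma rotation_carrier [simp]: assumes "A \<subseteq> {1..n}" shows "rotation_braid n A \<in> carrier (Braid n)"
proof (cases "2 \<le> card A")
  case True then show ?thesis using rotation_braid_rst[OF assms True inv_n] strands_braid_carrier[OF rst_strand[OF assms True inv_n]] by simp
qed (simp add: rotation_braid_def)

text \<open>Includes sets with one element, whose point is its own successor after \<open>n\<close>
  steps. The bound on the number of steps drives the induction in
  \<open>dual_simple_inj\<close>.\<close>

lemma next_in_mem:
  assumes A: "A \<subseteq> {1..n}" "i \<in> A" shows "next_in n A i \<in> A"
    and "0 < k \<Longrightarrow> res (int i + int k) \<in> A \<Longrightarrow>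
      \<exists>m. 0 < m \<and> m \<le> k \<and> next_in n A i = res (int i + int m)"
proof -
  have iI: "i \<in> {1..n}" using A by blast
  let ?P = "\<lambda>m. 0 < m \<and> (nxt n ^^ m) i \<in> A"
  have "res (int i + int n) = i" using res_shift[of "int i" 1] res_of_nat[OF iI] by simp
  then have "?P n" using n_pos A(2) by (simp add: nxt_funpow[OF iI])
  then have L: "?P (LEAST m. ?P m)" by (rule LeastI)
  then show "next_in n A i \<in> A" by (simp add: next_in_def)
  assume k: "0 < k" "res (int i + int k) \<in> A"
  then have "?P k" by (simp add: nxt_funpow[OF iI])
  then have "(LEAST m. ?P m) \<le> k" by (rule Least_le)
  then show "\<exists>m. 0 < m \<and> m \<le> k \<and> next_in n A i = res (int i + int m)"
    using L unfolding next_in_def nxt_funpow[OF iI, symmetric] by blast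
qed

lemma rotation_perm:
  assumes A: "A \<subseteq> {1..n}" and i: "i \<in> {1..n}"
  shows "braid_perm (rotation_braid n A) i = (if i \<in> A then next_in n A i else i)"
proof (cases "2 \<le> card A")
  case True
  then show ?thesis
    using braid_perm_brd[OF rst_strand[OF A True inv_n] i] rotation_braid_rst[OF A True inv_n] end_ix_rst[OF A True i] by simp
next
  case False
  have fin: "finite A" using A finite_subset by blast
  have "next_in n A i = i" if "i \<in> A"
  proof -
    have "card A = 1" using False that fin card_gt_0_iff[of A] by fastforce
    then show ?thesis using that next_in_mem(1)[OF A that] by (metis card_1_singletonE singletonD)
  qed
  then show ?thesis using False braid_perm_one[OF i] by (simp add: rotation_braid_def)
qed

section \<open>Products of commuting rotation braids over lists of blocks\<close>

definition bprod :: "nat set list \<Rightarrow> (real \<Rightarrow> complex set) set" where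
  "bprod L = foldr (\<lambda>A \<beta>. rotation_braid n A \<otimes>\<^bsub>Braid n\<^esub> \<beta>) L \<one>\<^bsub>Braid n\<^esub>"

lemma bprod_simps [simp]: "bprod [] = \<one>\<^bsub>Braid n\<^esub>" "bprod (A # L) = rotation_braid n A \<otimes>\<^bsub>Braid n\<^esub> bprod L"
  by (simp_all add: bprod_def)

lemma bprod_carrier: "\<forall>A\<in>set L. A \<subseteq> {1..n} \<Longrightarrow> bprod L \<in> carrier (Braid n)"
  by (induction L) auto

lemma bprod_append:
  "\<forall>A\<in>set L. A \<subseteq> {1..n} \<Longrightarrow> \<forall>A\<in>set L'. A \<subseteq> {1..n} \<Longrightarrow> bprod (L @ L') = bprod L \<otimes>\<^bsub>Braid n\<^esub> bprod L'"
  by (induction L) (auto simp: bprod_carrier braid.m_assoc)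

text \<open>Formulated for arbitrary families of blocks, so that it passes to subfamilies; in
  inductions over lists the remaining blocks no longer form a partition.\<close>

definition commuting :: "nat set set \<Rightarrow> bool" where
  "commuting \<pi> \<longleftrightarrow> (\<forall>A\<in>\<pi>. A \<subseteq> {1..n}) \<and> (\<forall>A\<in>\<pi>. \<forall>A'\<in>\<pi>.
     rotation_braid n A \<otimes>\<^bsub>Braid n\<^esub> rotation_braid n A' = rotation_braid n A' \<otimes>\<^bsub>Braid n\<^esub> rotation_braid n A)"

lemma commutingD:
  assumes "commuting \<pi>"
  shows "A \<in> \<pi> \<Longrightarrow> A \<subseteq> {1..n}"
    and "A \<in> \<pi> \<Longrightarrow> A' \<in> \<pi> \<Longrightarrow> rotation_braid n A \<otimes>\<^bsub>Braid n\<^esub> rotation_braid n A' =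
      rotation_braid n A' \<otimes>\<^bsub>Braid n\<^esub> rotation_braid n A"
    and "\<sigma> \<subseteq> \<pi> \<Longrightarrow> commuting \<sigma>"
proof -
  note a = conjunct1[OF assms[unfolded commuting_def]] and c = conjunct2[OF assms[unfolded commuting_def]]
  show "A \<in> \<pi> \<Longrightarrow> A \<subseteq> {1..n}" by (rule bspec[OF a])
  show "A \<in> \<pi> \<Longrightarrow> A' \<in> \<pi> \<Longrightarrow> rotation_braid n A \<otimes>\<^bsub>Braid n\<^esub> rotation_braid n A' =
      rotation_braid n A' \<otimes>\<^bsub>Braid n\<^esub> rotation_braid n A"
    by (rule bspec[OF bspec[OF c]])
  assume s: "\<sigma> \<subseteq> \<pi>"
  show "commuting \<sigma>"
    unfolding commuting_def
    by (intro conjI ballI bspec[OF a] bspec[OF bspec[OF c]] subsetD[OF s])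
qed

lemma bprod_move:
  assumes "commuting (insert A (set L))"
  shows "bprod L \<otimes>\<^bsub>Braid n\<^esub> rotation_braid n A = rotation_braid n A \<otimes>\<^bsub>Braid n\<^esub> bprod L"
  using assms
proof (induction L)
  case Nil then show ?case by (simp add: commuting_def)
next
  case (Cons B L)
  have sub: "A \<subseteq> {1..n}" "B \<subseteq> {1..n}" "\<forall>A\<in>set L. A \<subseteq> {1..n}"
    using commutingD(1)[OF Cons.prems] by simp_all
  note c = rotation_carrier[OF sub(1)] rotation_carrier[OF sub(2)] bprod_carrier[OF sub(3)]
  have IH: "bprod L \<otimes>\<^bsub>Braid n\<^esub> rotation_braid n A = rotation_braid n A \<otimes>\<^bsub>Braid n\<^esub> bprod L"
    by (rule Cons.IH, rule commutingD(3)[OF Cons.prems]) auto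
  have AB: "rotation_braid n A \<otimes>\<^bsub>Braid n\<^esub> rotation_braid n B = rotation_braid n B \<otimes>\<^bsub>Braid n\<^esub> rotation_braid n A"
    by (rule commutingD(2)[OF Cons.prems]) simp_all
  have "bprod (B # L) \<otimes>\<^bsub>Braid n\<^esub> rotation_braid n A =
      rotation_braid n B \<otimes>\<^bsub>Braid n\<^esub> (bprod L \<otimes>\<^bsub>Braid n\<^esub> rotation_braid n A)"
    unfolding bprod_simps by (rule braid.m_assoc[OF c(2,3,1)])
  also have "\<dots> = (rotation_braid n B \<otimes>\<^bsub>Braid n\<^esub> rotation_braid n A) \<otimes>\<^bsub>Braid n\<^esub> bprod L"
    unfolding IH by (rule braid.m_assoc[OF c(2,1,3), symmetric])
  also have "\<dots> = rotation_braid n A \<otimes>\<^bsub>Braid n\<^esub> bprod (B # L)"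
    unfolding AB[symmetric] bprod_simps by (rule braid.m_assoc[OF c(1,2,3)])
  finally show ?case .
qed

lemma bprod_cong:
  "distinct L \<Longrightarrow> distinct L' \<Longrightarrow> set L = set L' \<Longrightarrow> commuting (set L) \<Longrightarrow> bprod L = bprod L'"
proof (induction L arbitrary: L')
  case Nil then show ?case by simp
next
  case (Cons A L)
  then have "A \<in> set L'" by (metis list.set_intros(1))
  then obtain L1 L2 where L': "L' = L1 @ A # L2" by (meson split_list)
  have d: "distinct (L1 @ L2)" using Cons.prems(2) L' by simp
  have s: "set L = set (L1 @ L2)" using Cons.prems(1-3) L' by auto
  have com: "commuting (set L)" by (rule commutingD(3)[OF Cons.prems(4)]) auto
  have eqL: "bprod L = bprod (L1 @ L2)" by (rule Cons.IH[OF _ d s com]) (use Cons.prems in simp)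
  have sub: "A \<subseteq> {1..n}" "\<forall>A\<in>set L1. A \<subseteq> {1..n}" "\<forall>A\<in>set L2. A \<subseteq> {1..n}"
    using commutingD(1)[OF Cons.prems(4)[unfolded Cons.prems(3) L']] by simp_all
  note c = rotation_carrier[OF sub(1)] bprod_carrier[OF sub(2)] bprod_carrier[OF sub(3)]
  have mv: "bprod L1 \<otimes>\<^bsub>Braid n\<^esub> rotation_braid n A = rotation_braid n A \<otimes>\<^bsub>Braid n\<^esub> bprod L1"
    by (rule bprod_move, rule commutingD(3)[OF Cons.prems(4)]) (use Cons.prems(3) L' in auto)
  have "bprod L' = bprod L1 \<otimes>\<^bsub>Braid n\<^esub> (rotation_braid n A \<otimes>\<^bsub>Braid n\<^esub> bprod L2)"
    unfolding L' using sub by (subst bprod_append) auto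
  also have "\<dots> = rotation_braid n A \<otimes>\<^bsub>Braid n\<^esub> bprod (L1 @ L2)"
    unfolding braid.m_assoc[OF c(2,1,3), symmetric] mv braid.m_assoc[OF c(1,2,3)] bprod_append[OF sub(2,3)] ..
  finally show ?case by (simp add: eqL)
qed

lemma noncrossingD:
  assumes "\<pi> \<in> noncrossing n"
  shows "partition_on {1..n} \<pi>" "A \<in> \<pi> \<Longrightarrow> A \<subseteq> {1..n}" "A \<in> \<pi> \<Longrightarrow> A \<noteq> {}" "finite \<pi>"
    "A \<in> \<pi> \<Longrightarrow> A' \<in> \<pi> \<Longrightarrow> A \<noteq> A' \<Longrightarrow> convex hull (vtx n ` A) \<inter> convex hull (vtx n ` A') = {}"
    "A \<in> \<pi> \<Longrightarrow> A' \<in> \<pi> \<Longrightarrow> i \<in> A \<Longrightarrow> i \<in> A' \<Longrightarrow> A = A'"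
    "i \<in> {1..n} \<Longrightarrow> \<exists>A\<in>\<pi>. i \<in> A"
proof -
  show p: "partition_on {1..n} \<pi>" using assms by (simp add: noncrossing_def)
  show "A \<in> \<pi> \<Longrightarrow> A \<subseteq> {1..n}" "A \<in> \<pi> \<Longrightarrow> A \<noteq> {}" using p by (auto simp: partition_on_def)
  show "finite \<pi>" using p by (rule finite_elements[rotated]) simp
  show "A \<in> \<pi> \<Longrightarrow> A' \<in> \<pi> \<Longrightarrow> A \<noteq> A' \<Longrightarrow> convex hull (vtx n ` A) \<inter> convex hull (vtx n ` A') = {}"
    using assms by (simp add: noncrossing_def)
  show "A \<in> \<pi> \<Longrightarrow> A' \<in> \<pi> \<Longrightarrow> i \<in> A \<Longrightarrow> i \<in> A' \<Longrightarrow> A = A'"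
    using partition_onD2[OF p] unfolding disjoint_def by blast
  show "i \<in> {1..n} \<Longrightarrow> \<exists>A\<in>\<pi>. i \<in> A" using partition_onD1[OF p] by blast
qed

lemma noncrossing_commuting:
  assumes "\<pi> \<in> noncrossing n" shows "commuting \<pi>"
  unfolding commuting_def
proof (intro conjI ballI)
  fix A A' assume AA': "A \<in> \<pi>" "A' \<in> \<pi>"
  note sub = noncrossingD(2)[OF assms AA'(1)] noncrossingD(2)[OF assms AA'(2)]
  show "rotation_braid n A \<otimes>\<^bsub>Braid n\<^esub> rotation_braid n A' = rotation_braid n A' \<otimes>\<^bsub>Braid n\<^esub> rotation_braid n A"
  proof (cases "A = A' \<or> card A < 2 \<or> card A' < 2")
    case True
    then show ?thesis using rotation_carrier[OF sub(1)] rotation_carrier[OF sub(2)]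
      by (auto simp: rotation_braid_def[of n A] rotation_braid_def[of n A'] split: if_splits)
  next
    case False
    then show ?thesis using rotation_braids_commute[OF sub(1) _ sub(2)] noncrossingD(5)[OF assms AA'] by simp
  qed
qed (use noncrossingD(2)[OF assms] in blast)

text \<open>Blocks are disjoint, so a block is recovered from its minimum; as the rotation braids
  commute, any enumeration of the blocks gives the same product.\<close>

lemma dual_simple_bprod:
  assumes \<pi>: "\<pi> \<in> noncrossing n" and L: "distinct L" "set L = \<pi>"
  shows "dual_simple n \<pi> = bprod L"
proof -
  let ?blk = "\<lambda>i. THE A. A \<in> \<pi> \<and> Min A = i"
  let ?xs = "sorted_list_of_set (Min ` \<pi>)"
  have fin: "finite \<pi>" by (rule noncrossingD(4)[OF \<pi>])
  have mem: "Min A \<in> A" if "A \<in> \<pi>" for A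
    using noncrossingD(2,3)[OF \<pi> that] finite_subset[of A "{1..n}"] by (intro Min_in) auto
  have blk: "?blk (Min A) = A" if A: "A \<in> \<pi>" for A
  proof (rule the_equality)
    fix B assume B: "B \<in> \<pi> \<and> Min B = Min A"
    then have "Min A \<in> B" using mem[of B] by simp
    then show "B = A" using noncrossingD(6)[OF \<pi>] B A mem[OF A] by blast
  qed (use A in simp)
  have set: "set (map ?blk ?xs) = \<pi>" using fin blk by (auto simp: image_image)
  have inj: "inj_on ?blk (set ?xs)" using fin blk by (auto simp: inj_on_def)
  have "dual_simple n \<pi> = bprod (map ?blk ?xs)"
    by (simp add: dual_simple_def bprod_def foldr_map o_def)
  also have "\<dots> = bprod L"
    by (rule bprod_cong) (use inj set L noncrossing_commuting[OF \<pi>] fin in \<open>auto simp: distinct_map\<close>)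
  finally show ?thesis .
qed

lemma noncrossing_list:
  assumes "\<pi> \<in> noncrossing n" obtains L where "distinct L" "set L = \<pi>"
  using finite_distinct_list[OF noncrossingD(4)[OF assms]] by blast

lemma dual_simple_carrier: assumes "\<pi> \<in> noncrossing n" shows "dual_simple n \<pi> \<in> carrier (Braid n)"
proof -
  obtain L where L: "distinct L" "set L = \<pi>" using assms by (rule noncrossing_list)
  show ?thesis unfolding dual_simple_bprod[OF assms L]
    by (rule bprod_carrier) (use L noncrossingD(2)[OF assms] in blast)
qed

lemma bprod_perm:
  assumes "distinct L" "\<forall>A\<in>set L. A \<subseteq> {1..n}" "\<forall>A\<in>set L. \<forall>B\<in>set L. A \<noteq> B \<longrightarrow> A \<inter> B = {}" and i: "i \<in> {1..n}"
  shows "A \<in> set L \<Longrightarrow> i \<in> A \<Longrightarrow> braid_perm (bprod L) i = next_in n A i"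
    and "(\<forall>A\<in>set L. i \<notin> A) \<Longrightarrow> braid_perm (bprod L) i = i"
proof -
  have "(\<forall>A\<in>set L. i \<in> A \<longrightarrow> braid_perm (bprod L) i = next_in n A i) \<and>
    ((\<forall>A\<in>set L. i \<notin> A) \<longrightarrow> braid_perm (bprod L) i = i)"
    using assms
  proof (induction L arbitrary: i)
    case Nil then show ?case using braid_perm_one by simp
  next
    case (Cons B L)
    have sub: "B \<subseteq> {1..n}" "\<forall>A\<in>set L. A \<subseteq> {1..n}" using Cons.prems by auto
    have dj: "A \<inter> B = {}" if "A \<in> set L" for A using Cons.prems(1,3) that by auto
    have IH: "(\<forall>A\<in>set L. j \<in> A \<longrightarrow> braid_perm (bprod L) j = next_in n A j) \<and>
       ((\<forall>A\<in>set L. j \<notin> A) \<longrightarrow> braid_perm (bprod L) j = j)" if "j \<in> {1..n}" for j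
      by (rule Cons.IH) (use Cons.prems that in auto)
    have e: "braid_perm (bprod (B # L)) i = braid_perm (bprod L) (if i \<in> B then next_in n B i else i)"
      using braid_perm_mult[OF rotation_carrier[OF sub(1)] bprod_carrier[OF sub(2)] Cons.prems(4)]
        rotation_perm[OF sub(1) Cons.prems(4)] by simp
    show ?case
    proof (cases "i \<in> B")
      case True
      have nB: "next_in n B i \<in> B" by (rule next_in_mem(1)[OF sub(1) True])
      then have "\<forall>A\<in>set L. next_in n B i \<notin> A" using dj by blast
      moreover have "next_in n B i \<in> {1..n}" using nB sub(1) by blast
      ultimately have "braid_perm (bprod (B # L)) i = next_in n B i" using IH e True by simp
      moreover have "A = B" if "A \<in> set (B # L)" "i \<in> A" for A using that dj True by auto
      ultimately show ?thesis using True by auto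
    next
      case False
      then show ?thesis using IH[OF Cons.prems(4)] e by auto
    qed
  qed
  then show "A \<in> set L \<Longrightarrow> i \<in> A \<Longrightarrow> braid_perm (bprod L) i = next_in n A i"
    "(\<forall>A\<in>set L. i \<notin> A) \<Longrightarrow> braid_perm (bprod L) i = i" by blast+
qed

lemma dual_simple_perm:
  assumes \<pi>: "\<pi> \<in> noncrossing n" and A: "A \<in> \<pi>" "i \<in> A"
  shows "braid_perm (dual_simple n \<pi>) i = next_in n A i"
proof -
  obtain L where L: "distinct L" "set L = \<pi>" using \<pi> by (rule noncrossing_list)
  have "i \<in> {1..n}" using A noncrossingD(2)[OF \<pi>] by blast
  then show ?thesis
    unfolding dual_simple_bprod[OF \<pi> L]
    using bprod_perm(1)[OF L(1) _ _ _ _ A(2)] noncrossingD(2,6)[OF \<pi>] L(2) A(1)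
    by (metis (no_types, lifting) disjoint_iff)
qed

text \<open>The blocks are the cycles of the induced permutation, so already the permutation
  determines the partition. This makes the definite description in \<open>move_part\<close>
  meaningful.\<close>

theorem dual_simple_inj:
  assumes \<pi>: "\<pi> \<in> noncrossing n" and \<pi>': "\<pi>' \<in> noncrossing n" and eq: "dual_simple n \<pi> = dual_simple n \<pi>'"
  shows "\<pi> = \<pi>'"
proof -
  \<comment> \<open>Walk from \<open>i\<close> by the common permutation towards the point
    \<open>k\<close> places ahead. The successor in \<open>A\<close> is at most \<open>k\<close>
    places ahead, so the remaining distance decreases and the walk stays in both blocks.\<close>
  have step: "res (int i + int k) \<in> A'"
    if p: "p \<in> noncrossing n" "q \<in> noncrossing n" "dual_simple n p = dual_simple n q"
      and A: "A \<in> p" "A' \<in> q" "i \<in> A" "i \<in> A'" "res (int i + int k) \<in> A" for p q A A' i k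
    using A(3-5)
  proof (induction k arbitrary: i rule: less_induct)
    case (less k)
    have iI: "i \<in> {1..n}" using less.prems(1) noncrossingD(2)[OF p(1) A(1)] by blast
    show ?case
    proof (cases "k = 0")
      case True then show ?thesis using less.prems(2) res_of_nat[OF iI] by simp
    next
      case False
      obtain m where m: "0 < m" "m \<le> k" "next_in n A i = res (int i + int m)"
        using next_in_mem(2)[OF noncrossingD(2)[OF p(1) A(1)] less.prems(1), of k] False less.prems(3) by blast
      have "next_in n A i = next_in n A' i"
        using dual_simple_perm[OF p(1) A(1) less.prems(1)] dual_simple_perm[OF p(2) A(2) less.prems(2)] p(3) by simp
      then have j: "next_in n A i \<in> A" "next_in n A i \<in> A'"
        using next_in_mem(1)[OF noncrossingD(2)[OF p(1) A(1)] less.prems(1)]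
          next_in_mem(1)[OF noncrossingD(2)[OF p(2) A(2)] less.prems(2)] by simp_all
      obtain l where l: "int i + int m = int (next_in n A i) + int n * l" unfolding m(3) by (rule res_decomp)
      have "int i + int k = int (next_in n A i) + int (k - m) + int n * l" using l m(2) by simp
      then have e: "res (int i + int k) = res (int (next_in n A i) + int (k - m))" by simp
      show ?thesis unfolding e
        by (rule less.IH) (use m j less.prems(3) e in auto)
    qed
  qed
  have sub: "A \<subseteq> A'"
    if p: "p \<in> noncrossing n" "q \<in> noncrossing n" "dual_simple n p = dual_simple n q"
      and A: "A \<in> p" "A' \<in> q" "i \<in> A" "i \<in> A'" for p q A A' i
  proof
    fix c assume c: "c \<in> A"
    then have "c \<in> {1..n}" using noncrossingD(2)[OF p(1) A(1)] by blast
    then obtain \<gamma> where g: "int i \<le> \<gamma>" "res \<gamma> = c" using vtx_window[of c n "int i"] by metis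
    then have "res (int i + int (nat (\<gamma> - int i))) = c" by simp
    then show "c \<in> A'" using step[OF p A, of "nat (\<gamma> - int i)"] c by simp
  qed
  have half: "p \<subseteq> q" if p: "p \<in> noncrossing n" "q \<in> noncrossing n" "dual_simple n p = dual_simple n q" for p q
  proof
    fix A assume A: "A \<in> p"
    then obtain i where i: "i \<in> A" using noncrossingD(3)[OF p(1)] by blast
    then have "i \<in> {1..n}" using noncrossingD(2)[OF p(1) A] by blast
    then obtain A' where A': "A' \<in> q" "i \<in> A'" using noncrossingD(7)[OF p(2)] by blast
    have "A \<subseteq> A'" by (rule sub[OF p A A'(1) i A'(2)])
    moreover have "A' \<subseteq> A" by (rule sub[OF p(2,1) p(3)[symmetric] A'(1) A A'(2) i])
    ultimately show "A \<in> q" using A'(1) by simp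
  qed
  show ?thesis using half[OF \<pi> \<pi>' eq] half[OF \<pi>' \<pi> eq[symmetric]] by blast
qed

lemma noncrossingI:
  assumes p: "partition_on {1..n} \<pi>"
    and h: "\<And>A A'. A \<in> \<pi> \<Longrightarrow> A' \<in> \<pi> \<Longrightarrow> A \<noteq> A' \<Longrightarrow> convex hull (vtx n ` A) \<inter> convex hull (vtx n ` A') = {}"
  shows "\<pi> \<in> noncrossing n"
  using assms by (simp add: noncrossing_def)

lemma hull_singleton_disjoint:
  assumes "A \<subseteq> {1..n}" "v \<in> {1..n}" "v \<notin> A"
  shows "convex hull (vtx n ` A) \<inter> convex hull (vtx n ` {v}) = {}"
  using vtx_notin_hull[OF n_pos assms] by simp

lemma fix_part_cases:
  assumes "X \<in> fix_part V \<pi>"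
  obtains A where "A \<in> \<pi>" "X = A - V" "X \<noteq> {}" | v where "v \<in> V" "X = {v}"
  using assms unfolding fix_part_def by blast

lemma fix_part_noncrossing:
  assumes \<pi>: "\<pi> \<in> noncrossing n" and V: "V \<subseteq> {1..n}"
  shows "fix_part V \<pi> \<in> noncrossing n"
proof -
  have hull: "convex hull (vtx n ` X) \<inter> convex hull (vtx n ` Y) = {}"
    if XY: "X \<in> fix_part V \<pi>" "Y \<in> fix_part V \<pi>" "X \<noteq> Y" for X Y
    using XY(1)
  proof (cases rule: fix_part_cases)
    case (1 A)
    note A = 1
    have AI: "X \<subseteq> {1..n}" using A(1,2) noncrossingD(2)[OF \<pi>] by blast
    show ?thesis using XY(2)
    proof (cases rule: fix_part_cases)
      case (1 A')
      have "convex hull (vtx n ` X) \<subseteq> convex hull (vtx n ` A)" "convex hull (vtx n ` Y) \<subseteq> convex hull (vtx n ` A')"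
        unfolding A(2) 1(2) by (rule hull_mono, rule image_mono, rule Diff_subset)+
      moreover have "A \<noteq> A'" using A 1 XY(3) by auto
      ultimately show ?thesis using noncrossingD(5)[OF \<pi> A(1) 1(1)] by blast
    next
      case (2 v)
      then show ?thesis using hull_singleton_disjoint[OF AI, of v] V A(2) by auto
    qed
  next
    case (2 v)
    have "v \<notin> Y" using XY(2) 2 XY(3) by (cases rule: fix_part_cases) auto
    moreover have "Y \<subseteq> {1..n}" using XY(2) V noncrossingD(2)[OF \<pi>] by (cases rule: fix_part_cases) auto
    ultimately show ?thesis using hull_singleton_disjoint[of Y v] 2 V by (auto simp: Int_commute)
  qed
  show ?thesis
  proof (rule noncrossingI[OF _ hull])
    show "partition_on {1..n} (fix_part V \<pi>)"
    proof (rule partition_onI)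
      show "\<Union> (fix_part V \<pi>) = {1..n}"
      proof
        show "\<Union> (fix_part V \<pi>) \<subseteq> {1..n}"
          using V noncrossingD(2)[OF \<pi>] by (auto simp: fix_part_def)
        show "{1..n} \<subseteq> \<Union> (fix_part V \<pi>)"
        proof
          fix i assume i: "i \<in> {1..n}"
          obtain A where "A \<in> \<pi>" "i \<in> A" using noncrossingD(7)[OF \<pi> i] by blast
          then show "i \<in> \<Union> (fix_part V \<pi>)" unfolding fix_part_def by (cases "i \<in> V") auto
        qed
      qed
      show "disjnt X Y" if "X \<in> fix_part V \<pi>" "Y \<in> fix_part V \<pi>" "X \<noteq> Y" for X Y
      proof (rule ccontr)
        assume "\<not> disjnt X Y"
        then obtain i where "i \<in> X" "i \<in> Y" by (auto simp: disjnt_def)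
        then have "vtx n i \<in> convex hull (vtx n ` X)" "vtx n i \<in> convex hull (vtx n ` Y)" by (simp_all add: hull_inc)
        then show False using hull[OF that] by blast
      qed
      show "{} \<notin> fix_part V \<pi>" by (simp add: fix_part_def image_iff)
    qed
  qed
qed

lemma discrete_noncrossing: "discrete_partition n \<in> noncrossing n"
proof (rule noncrossingI)
  show "partition_on {1..n} (discrete_partition n)"
    unfolding discrete_partition_def by (rule partition_onI) (auto simp: disjnt_def)
  fix A A' assume "A \<in> discrete_partition n" "A' \<in> discrete_partition n" "A \<noteq> A'"
  then obtain i j where ij: "A = {i}" "A' = {j}" "i \<in> {1..n}" "j \<in> {1..n}"
    unfolding discrete_partition_def by blast
  then have "i \<noteq> j" using \<open>A \<noteq> A'\<close> by blast
  with ij show "convex hull (vtx n ` A) \<inter> convex hull (vtx n ` A') = {}"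
    using hull_singleton_disjoint[of "{i}" j] by simp
qed

lemma bprod_singletons: "\<forall>A\<in>set L. card A \<le> 1 \<Longrightarrow> bprod L = \<one>\<^bsub>Braid n\<^esub>"
  by (induction L) (auto simp: rotation_braid_def)

lemma dual_simple_discrete: "dual_simple n (discrete_partition n) = \<one>\<^bsub>Braid n\<^esub>"
proof -
  obtain L where L: "distinct L" "set L = discrete_partition n" using discrete_noncrossing by (rule noncrossing_list)
  show ?thesis unfolding dual_simple_bprod[OF discrete_noncrossing L]
    by (rule bprod_singletons) (auto simp: L discrete_partition_def)
qed

text \<open>Adds the case of two-element blocks to \<open>rotation_remove\<close>: there the
  remaining block is a single point, with trivial rotation braid.\<close>

lemma rotation_split_off:
  assumes A: "A \<subseteq> {1..n}" and b: "b \<in> A" "nxt n b \<in> A"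
  shows "rotation_braid n A = rotation_braid n (A - {b}) \<otimes>\<^bsub>Braid n\<^esub> rotation_braid n {b, nxt n b}"
proof -
  have bI: "b \<in> {1..n}" using A b by blast
  have fin: "finite A" using A finite_subset by blast
  have "card {b, nxt n b} \<le> card A" using b fin by (intro card_mono) auto
  then have "2 \<le> card A" using next_in_pair(2)[OF bI] by simp
  then consider "3 \<le> card A" | "card A = 2" by linarith
  then show ?thesis
  proof cases
    case 1 then show ?thesis by (rule rotation_remove[OF A _ b])
  next
    case 2
    have "{b, nxt n b} = A" using b fin next_in_pair(2)[OF bI] 2 by (intro card_subset_eq) auto
    moreover have "rotation_braid n (A - {b}) = \<one>\<^bsub>Braid n\<^esub>" using 2 b fin by (simp add: rotation_braid_def)
    ultimately show ?thesis using A by simp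
  qed
qed

text \<open>Only the block of \<open>b\<close> changes. The factors are ordered such that this block
  comes last, and then \<open>rotation_split_off\<close> is applied to it.\<close>

lemma dual_simple_split_off:
  assumes \<pi>: "\<pi> \<in> noncrossing n" and A: "A \<in> \<pi>" and b: "b \<in> A" "nxt n b \<in> A"
  shows "dual_simple n \<pi> = dual_simple n (fix_part {b} \<pi>) \<otimes>\<^bsub>Braid n\<^esub> rotation_braid n {b, nxt n b}"
proof -
  have AI: "A \<subseteq> {1..n}" by (rule noncrossingD(2)[OF \<pi> A])
  have bI: "b \<in> {1..n}" using b AI by blast
  have "finite (\<pi> - {A})" using noncrossingD(4)[OF \<pi>] by simp
  then obtain L where L: "set L = \<pi> - {A}" "distinct L" using finite_distinct_list by blast
  have subL: "\<forall>B\<in>set L. B \<subseteq> {1..n}" using L noncrossingD(2)[OF \<pi>] by blast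
  have notb: "b \<notin> B" if "B \<in> \<pi>" "B \<noteq> A" for B using noncrossingD(6)[OF \<pi> that(1) A _ b(1)] that(2) by blast
  have nb: "nxt n b \<in> A - {b}" using b(2) nxt_neq[OF bI] by simp
  have sub': "A - {b} \<subseteq> {1..n}" "{b} \<subseteq> {1..n}" "{b, nxt n b} \<subseteq> {1..n}" using AI bI nxt_in[OF bI] by auto
  have set: "fix_part {b} \<pi> = insert (A - {b}) (insert {b} (\<pi> - {A}))"
  proof -
    have "(\<lambda>B. B - {b}) ` (\<pi> - {A}) = (\<lambda>B. B) ` (\<pi> - {A})"
      by (rule image_cong[OF refl]) (use notb in auto)
    moreover have "(\<lambda>B. B - {b}) ` \<pi> = insert (A - {b}) ((\<lambda>B. B - {b}) ` (\<pi> - {A}))" using A by blast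
    moreover have "{} \<notin> \<pi>" using noncrossingD(3)[OF \<pi>] by blast
    moreover have "A - {b} \<noteq> {}" using nb by blast
    ultimately have "(\<lambda>B. B - {b}) ` \<pi> - {{}} = insert (A - {b}) (\<pi> - {A})" by simp
    then show ?thesis unfolding fix_part_def by (simp add: insert_commute)
  qed
  have "dual_simple n (fix_part {b} \<pi>) = bprod (L @ [A - {b}, {b}])"
  proof (rule dual_simple_bprod[OF fix_part_noncrossing[OF \<pi> sub'(2)]])
    have "A - {b} \<notin> \<pi>"
    proof
      assume "A - {b} \<in> \<pi>"
      then have "A - {b} = A" using noncrossingD(6)[OF \<pi> _ A, of "A - {b}" "nxt n b"] nb by blast
      then show False using b(1) by blast
    qed
    moreover have "{b} \<notin> \<pi> - {A}" using notb[of "{b}"] by blast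
    moreover have "A - {b} \<noteq> {b}" by blast
    ultimately show "distinct (L @ [A - {b}, {b}])" using L by auto
    show "set (L @ [A - {b}, {b}]) = fix_part {b} \<pi>" unfolding set using L by auto
  qed
  also have "\<dots> = bprod L \<otimes>\<^bsub>Braid n\<^esub> rotation_braid n (A - {b})"
    using subL sub' rotation_carrier[OF sub'(1)] rotation_braid_def[of n "{b}"] by (subst bprod_append) auto
  finally have d1: "dual_simple n (fix_part {b} \<pi>) = bprod L \<otimes>\<^bsub>Braid n\<^esub> rotation_braid n (A - {b})" .
  have "dual_simple n \<pi> = bprod (L @ [A])"
    by (rule dual_simple_bprod[OF \<pi>]) (use L A in auto)
  also have "\<dots> = bprod L \<otimes>\<^bsub>Braid n\<^esub> rotation_braid n A"
    using subL AI by (subst bprod_append) auto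
  also have "\<dots> = (bprod L \<otimes>\<^bsub>Braid n\<^esub> rotation_braid n (A - {b})) \<otimes>\<^bsub>Braid n\<^esub> rotation_braid n {b, nxt n b}"
    unfolding rotation_split_off[OF AI b]
    by (rule braid.m_assoc[OF bprod_carrier[OF subL] rotation_carrier[OF sub'(1)] rotation_carrier[OF sub'(3)], symmetric])
  finally show ?thesis unfolding d1 .
qed

section \<open>Splitting dual simple braids into a fixing and a moving factor\<close>

definition is_edge :: "nat set \<Rightarrow> nat set \<Rightarrow> bool" where
  "is_edge V C \<longleftrightarrow> V \<subseteq> {1..n} \<and> C \<noteq> {} \<and> C \<subseteq> V \<and> nxt n ` C \<inter> (V - C) = {}"

definition moves :: "nat set \<Rightarrow> nat set \<Rightarrow> (int \<Rightarrow> int) \<Rightarrow> bool" where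
  "moves V C w \<longleftrightarrow> affine_perm V w \<and> (\<forall>v\<in>V. w (int v) = (if v \<in> C then int v + 1 else int v))"

lemma moves_unique: "moves V C w \<Longrightarrow> moves V C w' \<Longrightarrow> V \<subseteq> {1..n} \<Longrightarrow> w = w'"
  unfolding moves_def by (rule affine_perm_unique[of V w w']) auto

text \<open>Walk backwards from a point of \<open>C\<close> until the first point outside; it exists
  since \<open>C\<close> is not everything. The point just after it begins a run.\<close>

lemma first_of_run:
  assumes C: "C \<subseteq> {1..n}" "C \<noteq> {}" "C \<noteq> {1..n}"
  obtains b where "b \<in> C" "\<And>c. c \<in> C \<Longrightarrow> nxt n c \<noteq> b"
proof -
  obtain c where c: "c \<in> C" using C by blast
  then have cI: "c \<in> {1..n}" using C by blast
  obtain d where d: "d \<in> {1..n}" "d \<notin> C" using C by blast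
  obtain \<gamma> where g: "int c - int n \<le> \<gamma>" "\<gamma> < int c - int n + int n" "res \<gamma> = d"
    using d(1) vtx_window[of d n "int c - int n"] by metis
  define P where "P m \<longleftrightarrow> res (int c - int m) \<notin> C" for m :: nat
  define m where "m = (LEAST m. P m)"
  have "P (nat (int c - \<gamma>))" using g d by (simp add: P_def)
  then have m: "P m" unfolding m_def by (rule LeastI)
  have m0: "m \<noteq> 0"
  proof
    assume "m = 0"
    then show False using m c res_of_nat[OF cI] by (simp add: P_def)
  qed
  then have "\<not> P (m - 1)" using not_less_Least[of "m - 1" P] by (simp add: m_def)
  then have b: "res (int c - int (m - 1)) \<in> C" by (simp add: P_def)
  have nb: "nxt n (res (int c - int m)) = res (int c - int (m - 1))"
    unfolding nxt_res using m0 by (simp add: of_nat_diff algebra_simps)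
  show ?thesis
  proof (rule that[OF b])
    fix e assume e: "e \<in> C"
    show "nxt n e \<noteq> res (int c - int (m - 1))"
    proof
      assume "nxt n e = res (int c - int (m - 1))"
      then have "e = res (int c - int m)" using nxt_inj[of e "res (int c - int m)"] nb e C by auto
      then show False using e m by (simp add: P_def)
    qed
  qed
qed

lemma swap_values:
  assumes "b \<in> {1..n}"
  shows "swap b (int b) = int b + 1" "v \<in> {1..n} \<Longrightarrow> v \<noteq> b \<Longrightarrow> v \<noteq> nxt n b \<Longrightarrow> swap b (int v) = int v"
    "v \<in> {1..n} \<Longrightarrow> v \<noteq> b \<Longrightarrow> nxt n v \<noteq> b \<Longrightarrow> swap b (int v + 1) = int v + 1"
proof -
  show "swap b (int b) = int b + 1" using res_of_nat[OF assms] by (simp add: swap_def)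
  show "v \<in> {1..n} \<Longrightarrow> v \<noteq> b \<Longrightarrow> v \<noteq> nxt n b \<Longrightarrow> swap b (int v) = int v"
    using res_of_nat[of v] by (simp add: swap_def)
  assume v: "v \<in> {1..n}" "v \<noteq> b" "nxt n v \<noteq> b"
  have "res (int v + 1) = nxt n v" using nxt_res[of "int v"] res_of_nat[OF v(1)] by simp
  then show "swap b (int v + 1) = int v + 1" using v nxt_inj[OF v(1) assms] by (auto simp: swap_def)
qed

text \<open>The new point \<open>b\<close> steps last. By then its target is free, because a point
  of \<open>V\<close> at \<open>nxt n b\<close> has moved on, and no point has moved onto
  \<open>b\<close>; so \<open>swap b\<close> is admissible for the configuration reached by
  \<open>w\<close>.\<close>

lemma moves_insert:
  assumes w: "moves V C w" and V: "V \<subseteq> {1..n}" and C: "C \<subseteq> V" and b: "b \<in> V" "b \<notin> C"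
    and nb: "nxt n b \<in> V \<Longrightarrow> nxt n b \<in> C" and pb: "\<And>c. c \<in> C \<Longrightarrow> nxt n c \<noteq> b"
  shows "moves V (insert b C) (swap b \<circ> w)" "b \<in> res_image n w V" "nxt n b \<notin> res_image n w V"
proof -
  have bI: "b \<in> {1..n}" using b V by blast
  have wv: "w (int v) = (if v \<in> C then int v + 1 else int v)" if "v \<in> V" for v
    using w that by (simp add: moves_def)
  have aw: "affine_perm V w" using w by (simp add: moves_def)
  have rv: "res (w (int v)) = (if v \<in> C then nxt n v else v)" if "v \<in> V" for v
    using wv[OF that] nxt_res[of "int v"] res_of_nat[of v] V that by auto
  show 1: "b \<in> res_image n w V" unfolding res_image_def using rv[OF b(1)] b by (metis image_eqI)
  show 2: "nxt n b \<notin> res_image n w V"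
  proof
    assume "nxt n b \<in> res_image n w V"
    then obtain v where v: "v \<in> V" "nxt n b = res (w (int v))" by (auto simp: res_image_def)
    show False
    proof (cases "v \<in> C")
      case True
      then have "nxt n b = nxt n v" using v rv by simp
      then have "b = v" using nxt_inj[OF bI] v V by blast
      then show False using True b by simp
    next
      case False
      then have "nxt n b = v" using v rv by simp
      then show False using nb False v by simp
    qed
  qed
  have "affine_perm V (swap b \<circ> w)"
    by (rule affine_perm_compose(1)[OF aw swap(1)[OF 1 2 res_image_subset] V])
  moreover have "(swap b \<circ> w) (int v) = (if v \<in> insert b C then int v + 1 else int v)" if v: "v \<in> V" for v
  proof -
    have vI: "v \<in> {1..n}" using v V by blast
    consider "v = b" | "v \<in> C" "v \<noteq> b" | "v \<notin> C" "v \<noteq> b" by blast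
    then show ?thesis
    proof cases
      case 1 then show ?thesis using wv[OF v] b swap_values(1)[OF bI] by simp
    next
      case 2 then show ?thesis using wv[OF v] swap_values(3)[OF bI vI] pb by simp
    next
      case 3
      then have "v \<noteq> nxt n b" using nb v by blast
      then show ?thesis using 3 wv[OF v] swap_values(2)[OF bI vI] by simp
    qed
  qed
  ultimately show "moves V (insert b C) (swap b \<circ> w)" by (simp add: moves_def)
qed

lemma moves_full: "moves {1..n} {1..n} (\<lambda>z. z + 1)"
  using affine_perm_rotate by (simp add: moves_def)

lemma noncrossing_bdryD:
  assumes "\<pi> \<in> noncrossing_bdry n V"
  shows "\<pi> \<in> noncrossing n" "v \<in> V \<Longrightarrow> {v} \<notin> \<pi> \<Longrightarrow> \<exists>A\<in>\<pi>. v \<in> A \<and> nxt n v \<in> A"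
  using assms by (auto simp: noncrossing_bdry_def)

lemma singleton_block:
  assumes "\<pi> \<in> noncrossing n" "{v} \<in> \<pi>" "A \<in> \<pi>" "v \<in> A" shows "A = {v}"
  using noncrossingD(6)[OF assms(1,3,2,4)] by simp

text \<open>Induction on the number of moving points. For the first point \<open>b\<close> of a run,
  the rotation of the edge from \<open>b\<close> splits off on the right, which matches the fact
  that \<open>b\<close> steps last, and it is the layered braid of \<open>swap b\<close>. The
  partition with \<open>b\<close> isolated has the same fixed part over \<open>V\<close>.\<close>

theorem dual_simple_decompose:
  assumes V: "V \<subseteq> {1..n}" and "\<pi> \<in> noncrossing_bdry n V"
  obtains w where "moves V (bdry_edge V \<pi>) w"
    "dual_simple n \<pi> = dual_simple n (fix_part V \<pi>) \<otimes>\<^bsub>Braid n\<^esub> layered_braid V w"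
proof -
  have "\<exists>w. moves V (bdry_edge V \<pi>) w \<and>
    dual_simple n \<pi> = dual_simple n (fix_part V \<pi>) \<otimes>\<^bsub>Braid n\<^esub> layered_braid V w"
    if "\<pi> \<in> noncrossing_bdry n V" "bdry_edge V \<pi> \<noteq> {1..n}" for \<pi>
    using that
  proof (induction "card (bdry_edge V \<pi>)" arbitrary: \<pi> rule: less_induct)
    case less
    let ?C = "bdry_edge V \<pi>"
    note \<pi> = noncrossing_bdryD[OF less.prems(1)]
    have CV: "?C \<subseteq> V" by (auto simp: bdry_edge_def)
    show ?case
    proof (cases "?C = {}")
      case True
      have sing: "{v} \<in> \<pi>" if "v \<in> V" for v using True that by (auto simp: bdry_edge_def)
      have "fix_part V \<pi> = \<pi>"
      proof
        show "fix_part V \<pi> \<subseteq> \<pi>"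
        proof
          fix X assume "X \<in> fix_part V \<pi>"
          then show "X \<in> \<pi>"
          proof (cases rule: fix_part_cases)
            case (1 A)
            have "A \<inter> V = {}"
            proof (rule ccontr)
              assume "A \<inter> V \<noteq> {}"
              then obtain v where "v \<in> A" "v \<in> V" by blast
              then have "A = {v}" using singleton_block[OF \<pi>(1) sing 1(1)] by blast
              then show False using 1 \<open>v \<in> V\<close> by auto
            qed
            then have "X = A" using 1 by blast
            then show ?thesis using 1 by simp
          next
            case (2 v) then show ?thesis using sing by simp
          qed
        qed
        show "\<pi> \<subseteq> fix_part V \<pi>"
        proof
          fix A assume A: "A \<in> \<pi>"
          show "A \<in> fix_part V \<pi>"
          proof (cases "A \<inter> V = {}")
            case True
            then have "A - V = A" by blast
            then have "A \<in> (\<lambda>A. A - V) ` \<pi>" using A by (metis image_eqI)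
            then show ?thesis unfolding fix_part_def using noncrossingD(3)[OF \<pi>(1) A] by blast
          next
            case False
            then obtain v where "v \<in> A" "v \<in> V" by blast
            then have "A = {v}" using singleton_block[OF \<pi>(1) sing A] by blast
            then show ?thesis unfolding fix_part_def using \<open>v \<in> V\<close> by blast
          qed
        qed
      qed
      moreover have "moves V ?C id" unfolding True by (simp add: moves_def affine_perm_id)
      ultimately show ?thesis
        using layered_braid_id[OF V] dual_simple_carrier[OF \<pi>(1)] by (intro exI[of _ id]) simp
    next
      case False
      have CI: "?C \<subseteq> {1..n}" using CV V by blast
      obtain b where b: "b \<in> ?C" "\<And>c. c \<in> ?C \<Longrightarrow> nxt n c \<noteq> b"
        using first_of_run[OF CI False less.prems(2)] by metis
      have bV: "b \<in> V" "{b} \<notin> \<pi>" using b(1) by (auto simp: bdry_edge_def)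
      have bI: "b \<in> {1..n}" using bV V by blast
      obtain A where A: "A \<in> \<pi>" "b \<in> A" "nxt n b \<in> A" using \<pi>(2)[OF bV] by blast
      define \<rho> where "\<rho> = fix_part {b} \<pi>"
      have \<rho>n: "\<rho> \<in> noncrossing n" unfolding \<rho>_def using bI by (intro fix_part_noncrossing[OF \<pi>(1)]) simp
      \<comment> \<open>A new singleton could only come from a block consisting of \<open>v\<close>
        and \<open>b\<close> with \<open>nxt n v = b\<close>, which is excluded because
        \<open>b\<close> is the first point of its run.\<close>
      have sing: "{v} \<in> \<rho> \<longleftrightarrow> {v} \<in> \<pi>" if v: "v \<in> V" "v \<noteq> b" for v
      proof
        assume "{v} \<in> \<pi>"
        moreover have "{v} - {b} = {v}" using v by blast
        ultimately have "{v} \<in> (\<lambda>A. A - {b}) ` \<pi>" by (metis image_eqI)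
        then show "{v} \<in> \<rho>" unfolding \<rho>_def fix_part_def by blast
      next
        assume "{v} \<in> \<rho>"
        then obtain A' where A': "A' \<in> \<pi>" "{v} = A' - {b}" using v(2) by (auto simp: \<rho>_def fix_part_def)
        show "{v} \<in> \<pi>"
        proof (rule ccontr)
          assume nv: "{v} \<notin> \<pi>"
          then obtain A'' where A'': "A'' \<in> \<pi>" "v \<in> A''" "nxt n v \<in> A''" using \<pi>(2)[OF v(1)] by blast
          have "A'' = A'" using noncrossingD(6)[OF \<pi>(1) A''(1) A'(1) A''(2)] A'(2) by blast
          then have "nxt n v = v \<or> nxt n v = b" using A''(3) A'(2) by blast
          moreover have "nxt n v \<noteq> v" using nxt_neq v(1) V by blast
          moreover have "nxt n v \<noteq> b" using b(2)[of v] v(1) nv by (simp add: bdry_edge_def)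
          ultimately show False by blast
        qed
      qed
      have "{b} \<in> \<rho>" by (simp add: \<rho>_def fix_part_def)
      then have C\<rho>: "bdry_edge V \<rho> = ?C - {b}" using sing by (auto simp: bdry_edge_def)
      have \<rho>b: "\<rho> \<in> noncrossing_bdry n V"
        unfolding noncrossing_bdry_def
      proof (intro CollectI conjI ballI \<rho>n)
        fix v assume v: "v \<in> V"
        show "{v} \<in> \<rho> \<or> (\<exists>A\<in>\<rho>. v \<in> A \<and> nxt n v \<in> A)"
        proof (cases "v = b \<or> {v} \<in> \<rho>")
          case True then show ?thesis using \<open>{b} \<in> \<rho>\<close> by blast
        next
          case False
          then have nv: "{v} \<notin> \<pi>" using sing v by blast
          then obtain A' where A': "A' \<in> \<pi>" "v \<in> A'" "nxt n v \<in> A'" using \<pi>(2)[OF v] by blast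
          have "nxt n v \<noteq> b" using b(2)[of v] v nv by (simp add: bdry_edge_def)
          then have "v \<in> A' - {b}" "nxt n v \<in> A' - {b}" using A' False by auto
          note m = this
          have "A' - {b} \<in> (\<lambda>A. A - {b}) ` \<pi>" using A'(1) by (rule imageI)
          moreover have "A' - {b} \<noteq> {}" using m(1) by force
          ultimately have "A' - {b} \<in> \<rho>" unfolding \<rho>_def fix_part_def by (intro UnI1 DiffI) simp_all
          then show ?thesis using m by (intro disjI2 bexI[of _ "A' - {b}"] conjI)
        qed
      qed
      have card: "card (bdry_edge V \<rho>) < card ?C"
        unfolding C\<rho> using b(1) CI finite_subset[OF CI] by (intro card_Diff1_less) auto
      have "bdry_edge V \<rho> \<noteq> {1..n}" unfolding C\<rho> using bI by blast
      from less.hyps[OF card \<rho>b this]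
      obtain w where w: "moves V (?C - {b}) w"
        "dual_simple n \<rho> = dual_simple n (fix_part V \<rho>) \<otimes>\<^bsub>Braid n\<^esub> layered_braid V w"
        unfolding C\<rho> by blast
      have fp: "fix_part V \<rho> = fix_part V \<pi>"
      proof -
        have "(\<lambda>A. A - V) ` \<rho> - {{}} = (\<lambda>A. A - V) ` \<pi> - {{}}"
        proof (intro equalityI subsetI)
          fix X assume X: "X \<in> (\<lambda>A. A - V) ` \<rho> - {{}}"
          then obtain B where B: "B \<in> \<rho>" "X = B - V" "X \<noteq> {}" by blast
          have "B \<noteq> {b}" using B bV by auto
          then obtain A' where "A' \<in> \<pi>" "B = A' - {b}" using B(1) unfolding \<rho>_def fix_part_def by blast
          then have "X = A' - V" using B(2) bV by blast
          then show "X \<in> (\<lambda>A. A - V) ` \<pi> - {{}}" using \<open>A' \<in> \<pi>\<close> B(3) by blast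
        next
          fix X assume X: "X \<in> (\<lambda>A. A - V) ` \<pi> - {{}}"
          then obtain A' where A': "A' \<in> \<pi>" "X = A' - V" "X \<noteq> {}" by blast
          then have e: "X = (A' - {b}) - V" "A' - {b} \<noteq> {}" using bV by auto
          then have "A' - {b} \<in> \<rho>" using A'(1) unfolding \<rho>_def fix_part_def by blast
          then show "X \<in> (\<lambda>A. A - V) ` \<rho> - {{}}" using e A'(3) by blast
        qed
        then show ?thesis by (simp add: fix_part_def)
      qed
      have nb: "nxt n b \<in> ?C - {b}" if "nxt n b \<in> V"
      proof -
        have "{nxt n b} \<notin> \<pi>"
        proof
          assume "{nxt n b} \<in> \<pi>"
          then have "A = {nxt n b}" using singleton_block[OF \<pi>(1) _ A(1,3)] by blast
          then show False using A(2) nxt_neq[OF bI] by simp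
        qed
        then show ?thesis using that nxt_neq[OF bI] by (simp add: bdry_edge_def)
      qed
      have CV': "?C - {b} \<subseteq> V" using CV by blast
      have pb': "nxt n c \<noteq> b" if "c \<in> ?C - {b}" for c using that b(2) by simp
      have bn: "b \<notin> ?C - {b}" by simp
      have mi: "moves V (insert b (?C - {b})) (swap b \<circ> w)" "b \<in> res_image n w V" "nxt n b \<notin> res_image n w V"
        by (rule moves_insert[OF w(1) V CV' bV(1) bn], erule nb, erule pb')+
      have aw: "affine_perm V w" using w(1) by (simp add: moves_def)
      have "layered_braid V w \<otimes>\<^bsub>Braid n\<^esub> rotation_braid n {b, nxt n b} = layered_braid V (swap b \<circ> w)"
        unfolding rotation_swap[OF mi(2,3) res_image_subset]
        by (rule layered_braid_mult[OF aw swap(1)[OF mi(2,3) res_image_subset] V])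
      moreover have "dual_simple n \<pi> = dual_simple n \<rho> \<otimes>\<^bsub>Braid n\<^esub> rotation_braid n {b, nxt n b}"
        unfolding \<rho>_def by (rule dual_simple_split_off[OF \<pi>(1) A])
      moreover have "\<dots> = dual_simple n (fix_part V \<pi>) \<otimes>\<^bsub>Braid n\<^esub> (layered_braid V w \<otimes>\<^bsub>Braid n\<^esub> rotation_braid n {b, nxt n b})"
        unfolding w(2) fp
        by (rule braid.m_assoc[OF dual_simple_carrier[OF fix_part_noncrossing[OF \<pi>(1) V]] layered_braid_carrier[OF aw V]
              rotation_carrier[OF next_in_pair(1)[OF bI]]])
      moreover have "insert b (?C - {b}) = ?C" using b(1) by blast
      ultimately show ?thesis using mi(1) by (intro exI[of _ "swap b \<circ> w"]) simp
    qed
  qed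
  \<comment> \<open>If all points move there is no first point of a run. Then every block is closed
    under \<open>nxt n\<close>, so there is only one block, and the braid is the full
    rotation.\<close>
  moreover have "\<exists>w. moves V (bdry_edge V \<pi>) w \<and>
    dual_simple n \<pi> = dual_simple n (fix_part V \<pi>) \<otimes>\<^bsub>Braid n\<^esub> layered_braid V w"
    if \<pi>: "\<pi> \<in> noncrossing_bdry n V" and C: "bdry_edge V \<pi> = {1..n}" for \<pi>
  proof -
    note p = noncrossing_bdryD[OF \<pi>]
    have "{1..n} \<subseteq> V" unfolding C[symmetric] bdry_edge_def by simp
    then have VI: "V = {1..n}" using V by (rule antisym[rotated])
    have nsing: "{v} \<notin> \<pi>" if "v \<in> {1..n}" for v using that[folded C] by (simp add: bdry_edge_def)
    have closed: "nxt n v \<in> A" if A: "A \<in> \<pi>" "v \<in> A" for A v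
    proof -
      have v: "v \<in> {1..n}" using A noncrossingD(2)[OF p(1)] by blast
      obtain A' where A': "A' \<in> \<pi>" "v \<in> A'" "nxt n v \<in> A'" using p(2)[of v] v nsing VI by blast
      then show ?thesis using noncrossingD(6)[OF p(1) A(1) A'(1) A(2) A'(2)] by simp
    qed
    have full: "A = {1..n}" if A: "A \<in> \<pi>" for A
    proof -
      obtain a where a: "a \<in> A" using noncrossingD(3)[OF p(1) A] by blast
      have aI: "a \<in> {1..n}" using a noncrossingD(2)[OF p(1) A] by blast
      have r: "(nxt n ^^ m) a \<in> A" for m by (induction m) (use a closed[OF A] in auto)
      have "i \<in> A" if i: "i \<in> {1..n}" for i
      proof -
        obtain \<gamma> where g: "int a \<le> \<gamma>" "res \<gamma> = i" using i vtx_window[of i n "int a"] by metis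
        then show ?thesis using r[of "nat (\<gamma> - int a)"] nxt_funpow[OF aI, of "nat (\<gamma> - int a)"] by simp
      qed
      then show ?thesis using noncrossingD(2)[OF p(1) A] by blast
    qed
    have "1 \<in> {1..n}" using n3 by simp
    then obtain A where "A \<in> \<pi>" using noncrossingD(7)[OF p(1)] by blast
    then have \<pi>I: "\<pi> = {{1..n}}" using full by blast
    have "dual_simple n \<pi> = bprod [{1..n}]" by (rule dual_simple_bprod[OF p(1)]) (simp_all add: \<pi>I)
    then have "dual_simple n \<pi> = layered_braid V (\<lambda>z. z + 1)"
      using rotation_full layered_braid_carrier[OF affine_perm_rotate] VI by simp
    moreover have "fix_part V \<pi> = discrete_partition n" by (auto simp: fix_part_def \<pi>I VI discrete_partition_def)
    ultimately show ?thesis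
      using dual_simple_discrete moves_full C VI layered_braid_carrier[OF affine_perm_rotate] by (intro exI[of _ "\<lambda>z. z + 1"]) simp
  qed
  ultimately show ?thesis using that assms(2) by blast
qed

section \<open>Edges of the configuration space\<close>

text \<open>The chord joining the ends of the interval separates: \<open>A\<close> lies on one
  closed side and \<open>B\<close> strictly on the other.\<close>

lemma cyclic_interval_hull_disjoint:
  assumes Y: "Y - x < int n" and A: "A = res ` {x..Y}" and B: "B \<subseteq> {1..n}" "A \<inter> B = {}"
  shows "convex hull (vtx n ` A) \<inter> convex hull (vtx n ` B) = {}"
proof -
  consider "Y < x" | "Y = x" | "x < Y" by linarith
  then show ?thesis
  proof cases
    case 1 then show ?thesis using A by simp
  next
    case 2
    then have "A = {res x}" using A by simp
    then show ?thesis using hull_singleton_disjoint[OF B(1), of "res x"] B(2) by (simp add: Int_commute)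
  next
    case 3
    have neg: "0 \<le> side (vtxi n Y) (vtxi n x) (vtx n i)" if i: "i \<in> A" for i
    proof -
      obtain \<gamma> where g: "i = res \<gamma>" "x \<le> \<gamma>" "\<gamma> \<le> Y" using i A by auto
      have "0 \<le> side (vtxi n Y) (vtxi n x) (vtxi n \<gamma>)"
      proof (cases "\<gamma> = x \<or> \<gamma> = Y")
        case False
        then have "0 < side (vtxi n x) (vtxi n \<gamma>) (vtxi n Y)" using g Y by (intro side_pos) auto
        also have "\<dots> = side (vtxi n Y) (vtxi n x) (vtxi n \<gamma>)" by (simp add: side_rotate)
        finally show ?thesis by simp
      qed auto
      then show ?thesis using g(1) by (simp add: vtx_res)
    qed
    have pos: "0 < side (vtxi n x) (vtxi n Y) (vtx n i)" if i: "i \<in> B" for i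
    proof -
      have iI: "i \<in> {1..n}" using i B by blast
      obtain \<gamma> where g: "x \<le> \<gamma>" "\<gamma> < x + int n" "vtx n i = vtxi n \<gamma>" "res \<gamma> = i" using iI by (rule vtx_window)
      have "\<not> \<gamma> \<le> Y"
      proof
        assume "\<gamma> \<le> Y"
        then have "i \<in> A" using g(1,4) A by auto
        then show False using i B(2) by blast
      qed
      then show ?thesis unfolding g(3) using 3 g(2) by (intro side_pos) auto
    qed
    show ?thesis
    proof (rule ccontr)
      assume "\<not> ?thesis"
      then obtain z where z: "z \<in> convex hull (vtx n ` A)" "z \<in> convex hull (vtx n ` B)" by blast
      have "0 \<le> side (vtxi n Y) (vtxi n x) z" by (rule side_hull_ge[OF neg z(1)])
      moreover have "0 < side (vtxi n x) (vtxi n Y) z" by (rule side_hull_gt[OF pos z(2)])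
      ultimately show False using side_swap[of "vtxi n x" "vtxi n Y" z] by simp
    qed
  qed
qed

text \<open>The length of the run of \<open>C\<close> that begins at \<open>z\<close>, and 0 outside
  of \<open>C\<close>. For \<open>C\<close> equal to \<open>{1..n}\<close> the least number would be
  meaningless, which explains the hypothesis \<open>C \<subset> {1..n}\<close> below.\<close>

definition gap :: "nat set \<Rightarrow> int \<Rightarrow> nat" where
  "gap C z = (LEAST m. res (z + int m) \<notin> C)"

lemma gap_props:
  assumes C: "C \<subset> {1..n}"
  shows "res (z + int (gap C z)) \<notin> C" "m < gap C z \<Longrightarrow> res (z + int m) \<in> C" "gap C z < n"
proof -
  obtain d where d: "d \<in> {1..n}" "d \<notin> C" using C by blast
  obtain \<gamma> where g: "z \<le> \<gamma>" "\<gamma> < z + int n" "res \<gamma> = d" using d(1) vtx_window[of d n z] by metis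
  have e: "res (z + int (nat (\<gamma> - z))) \<notin> C" using g d by simp
  show "res (z + int (gap C z)) \<notin> C" unfolding gap_def by (rule LeastI) (rule e)
  show "res (z + int m) \<in> C" if "m < gap C z" using not_less_Least[OF that[unfolded gap_def]] by simp
  have "gap C z \<le> nat (\<gamma> - z)" unfolding gap_def using e by (rule Least_le)
  then show "gap C z < n" using g by linarith
qed

lemma gap_eqI:
  assumes "res (z + int m) \<notin> C" "\<And>k. k < m \<Longrightarrow> res (z + int k) \<in> C" shows "gap C z = m"
  unfolding gap_def using assms by (intro Least_equality) (auto simp: not_le[symmetric])

text \<open>In the partition whose rotation braid moves exactly the points of \<open>C\<close>, one step each, every maximal
  run of \<open>C\<close> is joined with the point following it.\<close>

definition run_end :: "nat set \<Rightarrow> nat \<Rightarrow> nat" where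
  "run_end C i = res (int i + int (gap C (int i)))"

definition run :: "nat set \<Rightarrow> nat \<Rightarrow> nat set" where
  "run C y = {i \<in> {1..n}. run_end C i = y}"

text \<open>Blocks are indexed by the points where runs end, all outside of \<open>C\<close>. A
  point outside of \<open>C\<close> that follows no run becomes a singleton; if \<open>C\<close> is
  everything there is no such index and the single block is given separately.\<close>

definition edge_part :: "nat set \<Rightarrow> nat set set" where
  "edge_part C = (if C = {1..n} then {{1..n}} else run C ` ({1..n} - C))"

lemma gap_res: "gap C (int (res z)) = gap C z"
proof -
  obtain k where k: "z = int (res z) + int n * k" by (rule res_decomp)
  have "res (z + int m) = res (int (res z) + int m)" for m
  proof -
    have "res (int (res z) + int m + int n * k) = res (int (res z) + int m)" by (rule res_shift)
    then show ?thesis using k by (simp add: algebra_simps)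
  qed
  then show ?thesis unfolding gap_def by simp
qed

lemma run_end_res: "run_end C (res z) = res (z + int (gap C z))"
proof -
  obtain k where k: "z = int (res z) + int n * k" by (rule res_decomp)
  then have "z + int (gap C z) = int (res z) + int (gap C z) + int n * k" by linarith
  then have "res (z + int (gap C z)) = res (int (res z) + int (gap C z))" by (simp only: res_shift)
  then show ?thesis unfolding run_end_def gap_res by simp
qed

lemma run_end:
  assumes C: "C \<subset> {1..n}" and i: "i \<in> {1..n}"
  shows "run_end C i \<in> {1..n} - C" "i \<notin> C \<Longrightarrow> run_end C i = i" "i \<in> C \<Longrightarrow> run_end C (nxt n i) = run_end C i"
proof -
  show "run_end C i \<in> {1..n} - C" using gap_props(1)[OF C] by (simp add: run_end_def)
  have ri: "res (int i) = i" by (rule res_of_nat[OF i])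
  show "run_end C i = i" if "i \<notin> C"
  proof -
    have "gap C (int i) = 0" using that ri by (intro gap_eqI) simp_all
    then show ?thesis by (simp add: run_end_def ri)
  qed
  assume iC: "i \<in> C"
  have "gap C (int i) \<noteq> 0"
  proof
    assume "gap C (int i) = 0"
    then show False using gap_props(1)[OF C, of "int i"] ri iC by simp
  qed
  then obtain m where m: "gap C (int i) = Suc m" by (cases "gap C (int i)") auto
  have "gap C (int i + 1) = m"
  proof (rule gap_eqI)
    show "res (int i + 1 + int m) \<notin> C" using gap_props(1)[OF C, of "int i"] m by (simp add: algebra_simps)
    show "res (int i + 1 + int k) \<in> C" if "k < m" for k
      using gap_props(2)[OF C, of "Suc k" "int i"] m that by (simp add: algebra_simps)
  qed
  moreover have "nxt n i = res (int i + 1)" using nxt_res[of "int i"] ri by simp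
  ultimately show "run_end C (nxt n i) = run_end C i"
    using run_end_res[of C "int i + 1"] m by (simp add: run_end_def algebra_simps)
qed

text \<open>If the point farthest back reaches \<open>y\<close> through \<open>C\<close> after
  \<open>M\<close> steps, so does every point passed on the way. Hence the block is the image of the
  interval of the \<open>M + 1\<close> integers ending in \<open>y\<close>.\<close>

lemma run_interval:
  assumes C: "C \<subset> {1..n}" and y: "y \<in> {1..n} - C"
  obtains x where "int y - x < int n" "run C y = res ` {x..int y}"
proof -
  let ?R = "run C y"
  have yR: "y \<in> ?R" using y run_end(2)[OF C, of y] by (simp add: run_def)
  have fin: "finite ?R" by (simp add: run_def)
  define M where "M = Max ((\<lambda>i. gap C (int i)) ` ?R)"
  have le: "gap C (int i) \<le> M" if "i \<in> ?R" for i unfolding M_def using fin that by (intro Max_ge) auto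
  have "M \<in> (\<lambda>i. gap C (int i)) ` ?R" unfolding M_def using fin yR by (intro Max_in) auto
  then obtain j where j: "j \<in> ?R" "M = gap C (int j)" by (rule imageE)
  have jI: "j \<in> {1..n}" "res (int j + int M) = y" using j by (simp_all add: run_def run_end_def)
  have lift: "i = res (int y - int (gap C (int i)))" if i: "i \<in> ?R" for i
  proof -
    have "res (int i + int (gap C (int i))) = res (int y)"
      using i res_of_nat[of y] y by (simp add: run_def run_end_def)
    then obtain k where "int i + int (gap C (int i)) = int y + int n * k" using res_eq_iff by blast
    then have "int y - int (gap C (int i)) = int i + int n * (- k)" by simp
    then have "res (int y - int (gap C (int i))) = res (int i)" by (metis res_shift)
    then show ?thesis using res_of_nat[of i] i by (simp add: run_def)
  qed
  show ?thesis
  proof (rule that)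
    show "int y - (int y - int M) < int n" using gap_props(3)[OF C, of "int j"] j(2) by simp
    show "?R = res ` {int y - int M..int y}"
    proof (intro equalityI subsetI)
      fix i assume i: "i \<in> ?R"
      show "i \<in> res ` {int y - int M..int y}"
        by (subst lift[OF i], rule imageI) (use le[OF i] in auto)
    next
      fix i assume "i \<in> res ` {int y - int M..int y}"
      then obtain z where z: "i = res z" "int y - int M \<le> z" "z \<le> int y" by auto
      define m where "m = nat (z - (int y - int M))"
      have m: "m \<le> M" "z = int y - int M + int m" using z by (auto simp: m_def)
      have "j = res (int y - int M)" using lift[OF j(1)] j(2) by simp
      then obtain k where k: "int y - int M = int j + int n * k" using res_decomp by metis
      have r: "res (z + int l) = res (int j + int (m + l))" for l
      proof -
        have "z + int l = int j + int (m + l) + int n * k" using k m(2) by simp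
        then show ?thesis by (simp only: res_shift)
      qed
      have "gap C z = M - m"
      proof (rule gap_eqI)
        have "res (z + int (M - m)) = y" unfolding r using m(1) jI(2) by simp
        then show "res (z + int (M - m)) \<notin> C" using y by simp
        show "res (z + int l) \<in> C" if "l < M - m" for l
          unfolding r using gap_props(2)[OF C, of "m + l" "int j"] that j(2) by simp
      qed
      then have "run_end C i = y" unfolding z(1) run_end_res using m res_of_nat[of y] y by simp
      then show "i \<in> ?R" unfolding run_def using z(1) by simp
    qed
  qed
qed

lemma edge_part:
  assumes e: "is_edge V C"
  shows "edge_part C \<in> noncrossing_bdry n V" "bdry_edge V (edge_part C) = C"
    "fix_part V (edge_part C) = discrete_partition n" "edge_part C \<noteq> discrete_partition n"
proof -
  have nC: "nxt n c \<notin> V - C" if "c \<in> C" for c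
    using e that by (auto simp: is_edge_def)
  have VI: "V \<subseteq> {1..n}" and C: "C \<noteq> {}" "C \<subseteq> V" using e by (simp_all add: is_edge_def)
  have all: "edge_part C \<in> noncrossing_bdry n V \<and> bdry_edge V (edge_part C) = C \<and>
    fix_part V (edge_part C) = discrete_partition n"
  proof (cases "C = {1..n}")
    case True
    then have V1: "V = {1..n}" using C VI by blast
    have p: "edge_part C = {{1..n}}" using True by (simp add: edge_part_def)
    have ns: "{v} \<noteq> {1..n}" for v
    proof
      assume "{v} = {1..n}"
      then have "card {v} = card {1..n}" by (rule arg_cong)
      then show False using n3 by simp
    qed
    have "{1..n} \<noteq> {}" using n3 by simp
    then have "edge_part C \<in> noncrossing n"
      unfolding p by (intro noncrossingI) (auto simp: partition_on_def)
    then have "edge_part C \<in> noncrossing_bdry n V"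
      unfolding noncrossing_bdry_def V1 p using nxt_in by blast
    moreover have "bdry_edge V (edge_part C) = C" using ns unfolding bdry_edge_def V1 p by (simp add: True del: atLeastAtMost_iff)
    moreover have "fix_part V (edge_part C) = discrete_partition n"
      unfolding fix_part_def V1 p discrete_partition_def by simp
    ultimately show ?thesis by blast
  next
    case False
    then have CI: "C \<subset> {1..n}" using C VI by blast
    have p: "edge_part C = run C ` ({1..n} - C)" using False by (simp add: edge_part_def)
    have mem: "i \<in> run C (run_end C i)" "run C (run_end C i) \<in> edge_part C" if "i \<in> {1..n}" for i
      using that run_end(1)[OF CI that] unfolding p by (auto simp: run_def)
    have runI: "run C y \<subseteq> {1..n}" for y by (auto simp: run_def)
    have yrun: "y \<in> run C y" if "y \<in> {1..n} - C" for y using that run_end(2)[OF CI, of y] by (simp add: run_def)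
    have disj: "run C y \<inter> run C y' = {}" if "y \<noteq> y'" for y y' using that by (auto simp: run_def)
    have nc: "edge_part C \<in> noncrossing n"
    proof (rule noncrossingI)
      show "partition_on {1..n} (edge_part C)"
      proof (rule partition_onI)
        show "\<Union> (edge_part C) = {1..n}" using mem runI unfolding p by blast
        show "disjnt X Y" if XY: "X \<in> edge_part C" "Y \<in> edge_part C" "X \<noteq> Y" for X Y
        proof -
          obtain x y where "X = run C x" "Y = run C y" using XY unfolding p by blast
          then show ?thesis using disj XY(3) unfolding disjnt_def by metis
        qed
        show "{} \<notin> edge_part C" using yrun unfolding p by blast
      qed
    next
      fix X Y assume XY: "X \<in> edge_part C" "Y \<in> edge_part C" "X \<noteq> Y"
      then obtain x y where xy: "X = run C x" "Y = run C y" "x \<in> {1..n} - C" unfolding p by blast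
      obtain z where z: "int x - z < int n" "run C x = res ` {z..int x}" by (rule run_interval[OF CI xy(3)])
      have "x \<noteq> y" using XY(3) xy by blast
      from cyclic_interval_hull_disjoint[OF z runI[of y] disj[OF this]]
      show "convex hull (vtx n ` X) \<inter> convex hull (vtx n ` Y) = {}" unfolding xy(1,2) .
    qed
    \<comment> \<open>A longer block ending in \<open>v\<close> would contain a point of
      \<open>C\<close> directly before \<open>v\<close>, and then the edge given by \<open>C\<close>
      would push it onto the resting point \<open>v\<close>.\<close>
    have single: "run C v = {v}" if v: "v \<in> V - C" for v
    proof
      have vI: "v \<in> {1..n} - C" using v VI by blast
      show "{v} \<subseteq> run C v" using yrun[OF vI] by simp
      show "run C v \<subseteq> {v}"
      proof
        fix i assume i: "i \<in> run C v"
        then have iI: "i \<in> {1..n}" and re: "res (int i + int (gap C (int i))) = v" by (simp_all add: run_def run_end_def)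
        show "i \<in> {v}"
        proof (cases "gap C (int i)")
          case 0
          then show ?thesis using re res_of_nat[OF iI] by simp
        next
          case (Suc m)
          have "res (int i + int m) \<in> C" using gap_props(2)[OF CI, of m "int i"] Suc by simp
          moreover have "nxt n (res (int i + int m)) = v" unfolding nxt_res using re Suc by (simp add: algebra_simps)
          ultimately show ?thesis using nC[of "res (int i + int m)"] v by simp
        qed
      qed
    qed
    have sing: "{v} \<in> edge_part C" if "v \<in> V - C" for v
    proof -
      have "run C v \<in> edge_part C" unfolding p using that VI by blast
      then show ?thesis using single[OF that] by simp
    qed
    have nb: "\<exists>A\<in>edge_part C. v \<in> A \<and> nxt n v \<in> A" if v: "v \<in> C" for v
    proof -
      have vI: "v \<in> {1..n}" using v C VI by blast
      have "nxt n v \<in> run C (run_end C v)" using run_end(3)[OF CI vI v] nxt_in[OF vI] by (simp add: run_def)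
      then show ?thesis using mem[OF vI] by (intro bexI[of _ "run C (run_end C v)"] conjI)
    qed
    have nsing: "{v} \<notin> edge_part C" if v: "v \<in> C" for v
    proof
      assume s: "{v} \<in> edge_part C"
      obtain A where A: "A \<in> edge_part C" "v \<in> A" "nxt n v \<in> A" using nb[OF v] by blast
      have "A = {v}" by (rule singleton_block[OF nc s A(1,2)])
      then show False using A(3) nxt_neq[of v] v C VI by blast
    qed
    have "edge_part C \<in> noncrossing_bdry n V"
      unfolding noncrossing_bdry_def using nc nb sing by blast
    moreover have "bdry_edge V (edge_part C) = C" unfolding bdry_edge_def using sing nsing C(2) by blast
    moreover have "fix_part V (edge_part C) = discrete_partition n"
    proof (intro equalityI subsetI)
      fix X assume "X \<in> fix_part V (edge_part C)"
      then show "X \<in> discrete_partition n"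
      proof (cases rule: fix_part_cases)
        case (1 A)
        obtain y where y: "A = run C y" using 1(1) unfolding p by blast
        have "run C y - V \<subseteq> {y}"
        proof
          fix i assume "i \<in> run C y - V"
          then have "i \<in> {1..n}" "i \<notin> C" "run_end C i = y" using C(2) by (auto simp: run_def)
          then show "i \<in> {y}" using run_end(2)[OF CI, of i] by simp
        qed
        then have "X = {y}" using 1(2,3) y by blast
        moreover have "y \<in> {1..n}" using runI[of y] 1(2) y \<open>X = {y}\<close> by blast
        ultimately show ?thesis by (simp add: discrete_partition_def)
      next
        case (2 v)
        then show ?thesis using VI unfolding discrete_partition_def by blast
      qed
    next
      fix X assume "X \<in> discrete_partition n"
      then obtain i where i: "i \<in> {1..n}" "X = {i}" unfolding discrete_partition_def by blast
      show "X \<in> fix_part V (edge_part C)"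
      proof (cases "i \<in> V")
        case True then show ?thesis using i(2) unfolding fix_part_def by simp
      next
        case False
        then have iC: "i \<in> {1..n} - C" using i C(2) by blast
        have "run C i - V = {i}"
        proof
          show "run C i - V \<subseteq> {i}"
          proof
            fix j assume "j \<in> run C i - V"
            then have "j \<in> {1..n}" "j \<notin> C" "run_end C j = i" using C(2) by (auto simp: run_def)
            then show "j \<in> {i}" using run_end(2)[OF CI, of j] by simp
          qed
          show "{i} \<subseteq> run C i - V" using yrun[OF iC] False by simp
        qed
        then have "X = run C i - V" using i by simp
        moreover have "run C i \<in> edge_part C" unfolding p using iC by (rule imageI)
        ultimately have "X \<in> (\<lambda>A. A - V) ` edge_part C" by (rule image_eqI)
        then show ?thesis unfolding fix_part_def using i(2) by simp
      qed
    qed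
    ultimately show ?thesis by blast
  qed
  then show "edge_part C \<in> noncrossing_bdry n V" "bdry_edge V (edge_part C) = C"
    "fix_part V (edge_part C) = discrete_partition n" by simp_all
  obtain c where c: "c \<in> C" using C by blast
  have "{c} \<notin> edge_part C" using c all unfolding bdry_edge_def by blast
  moreover have "{c} \<in> discrete_partition n" using c C VI unfolding discrete_partition_def by blast
  ultimately show "edge_part C \<noteq> discrete_partition n" by blast
qed

definition edge_move :: "nat set \<Rightarrow> nat set \<Rightarrow> int \<Rightarrow> int" where
  "edge_move V C = (THE w. moves V C w)"

text \<open>The fixed part of \<open>edge_part C\<close> is discrete, so in
  \<open>dual_simple_decompose\<close> only the layered factor remains.\<close>

lemma edge_move:
  assumes e: "is_edge V C"
  shows "moves V C (edge_move V C)" "dual_simple n (edge_part C) = layered_braid V (edge_move V C)"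
proof -
  note p = edge_part[OF e]
  have V: "V \<subseteq> {1..n}" using e by (simp add: is_edge_def)
  obtain w where w: "moves V C w"
    "dual_simple n (edge_part C) = \<one>\<^bsub>Braid n\<^esub> \<otimes>\<^bsub>Braid n\<^esub> layered_braid V w"
    using dual_simple_decompose[OF V p(1)] unfolding p(2,3) dual_simple_discrete by metis
  have "edge_move V C = w" unfolding edge_move_def using w(1) moves_unique[OF _ w(1) V] by blast
  moreover have "affine_perm V w" using w(1) by (simp add: moves_def)
  ultimately show "moves V C (edge_move V C)" "dual_simple n (edge_part C) = layered_braid V (edge_move V C)"
    using w layered_braid_carrier[OF _ V] by simp_all
qed

text \<open>By uniqueness of the affine permutation moving \<open>C\<close>, the second factor in
  \<open>dual_simple_decompose\<close> depends on \<open>V\<close> and \<open>C\<close> only. So the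
  condition \<open>move_part n V \<pi> = \<pi>\<close> on a lifted edge forces its label to be
  \<open>edge_part C\<close>.\<close>

lemma move_part_eq:
  assumes e: "is_edge V C" and \<pi>: "\<pi> \<in> noncrossing_bdry n V" "bdry_edge V \<pi> = C"
  shows "move_part n V \<pi> = edge_part C"
proof -
  have V: "V \<subseteq> {1..n}" using e by (simp add: is_edge_def)
  have fc: "dual_simple n (fix_part V \<pi>) \<in> carrier (Braid n)"
    by (rule dual_simple_carrier[OF fix_part_noncrossing[OF noncrossing_bdryD(1)[OF \<pi>(1)] V]])
  obtain w where w: "moves V C w" "dual_simple n \<pi> = dual_simple n (fix_part V \<pi>) \<otimes>\<^bsub>Braid n\<^esub> layered_braid V w"
    using dual_simple_decompose[OF V \<pi>(1)] unfolding \<pi>(2) by metis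
  have "w = edge_move V C" by (rule moves_unique[OF w(1) edge_move(1)[OF e] V])
  then have d: "dual_simple n \<pi> = dual_simple n (fix_part V \<pi>) \<otimes>\<^bsub>Braid n\<^esub> dual_simple n (edge_part C)"
    using w(2) edge_move(2)[OF e] by simp
  have nc: "edge_part C \<in> noncrossing n" by (rule noncrossing_bdryD(1)[OF edge_part(1)[OF e]])
  have q: "inv\<^bsub>Braid n\<^esub> (dual_simple n (fix_part V \<pi>)) \<otimes>\<^bsub>Braid n\<^esub> dual_simple n \<pi> = dual_simple n (edge_part C)"
    unfolding d using fc dual_simple_carrier[OF nc] by (simp add: braid.m_assoc[symmetric])
  show ?thesis
    unfolding move_part_def q
    by (rule the_equality) (use nc dual_simple_inj[OF _ nc] in auto)
qed

end

section \<open>Move braids\<close>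

lemma path_end_simps [simp]:
  "path_end n V [] = V" "path_end n V (e # es) = path_end n (dart_tgt n e) es"
  by (simp_all add: path_end_def)

lemma equivclp_invariant:
  assumes "equivclp r x y" "\<And>x y. r x y \<Longrightarrow> f x = f y"
  shows "f x = f y"
  using assms(1) by (induction rule: equivclp_induct) (use assms(2) in metis)+

lemma equiv_path_homotopy: "equiv (edge_paths n B) (path_homotopy n B)"
proof (rule equivI)
  show "path_homotopy n B \<subseteq> edge_paths n B \<times> edge_paths n B" by (auto simp: path_homotopy_def)
  show "refl_on (edge_paths n B) (path_homotopy n B)"
    by (rule refl_onI) (simp add: path_homotopy_def)
  show "sym (path_homotopy n B)"
    by (rule symI) (auto simp: path_homotopy_def intro: equivclp_sym)
  show "trans (path_homotopy n B)"
    by (rule transI) (auto simp: path_homotopy_def intro: equivclp_trans)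
qed

lemma elementary_path_homotopy:
  "p \<in> edge_paths n B \<Longrightarrow> q \<in> edge_paths n B \<Longrightarrow> elementary_homotopy n (card B) p q \<Longrightarrow>
    (p, q) \<in> path_homotopy n B"
  by (simp add: path_homotopy_def r_into_equivclp)

context ngon
begin

lemma cyc_simplex_edge_iff: "cyc_simplex n k V [C] \<longleftrightarrow> is_edge V C \<and> card V = k"
  unfolding cyc_simplex_edge[OF n3] is_edge_def by blast

text \<open>A vertex is a face of the edge with \<open>C = V\<close>, along which all points advance
  and no collision is possible.\<close>

lemma cyc_simplex_vertex:
  assumes "V \<subseteq> {1..n}" "V \<noteq> {}"
  shows "cyc_simplex n (card V) V []"
proof -
  have "cyc_simplex n (card V) V [V]" using assms by (simp add: cyc_simplex_edge_iff is_edge_def)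
  then obtain x Es where d: "ortho_simplex x Es \<inter> thick_diagonal n (card V) = {}"
    and V: "V = (\<lambda>i. res (x i)) ` {1..card V}"
    unfolding cyc_simplex_def by (elim exE conjE) (rule that)
  have "ortho_simplex x [] \<subseteq> ortho_simplex x Es"
  proof
    fix y assume "y \<in> ortho_simplex x []"
    then have "y = (\<lambda>i. real_of_int (x i))" by (auto simp: ortho_simplex_def)
    then show "y \<in> ortho_simplex x Es" unfolding ortho_simplex_def by (auto intro!: exI[of _ "\<lambda>_. 0"])
  qed
  then have "ortho_simplex x [] \<inter> thick_diagonal n (card V) = {}" using d by blast
  then show ?thesis unfolding cyc_simplex_def using V by (intro exI[of _ x] exI[of _ "[]"]) simp
qed

lemma moves_value:
  assumes w: "moves V C w" and C: "C \<subseteq> V" and z: "res z \<in> V"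
  shows "w z = (if res z \<in> C then z + 1 else z)"
proof -
  have "equivariant n w" using w affineD(1) by (auto simp: moves_def)
  then show ?thesis using equivariant_res(1)[of w z] w z by (simp add: moves_def)
qed

lemma is_edgeD:
  assumes "is_edge V C"
  shows "V \<subseteq> {1..n}" "C \<subseteq> V" "V \<noteq> {}" "C \<noteq> {}" "c \<in> C \<Longrightarrow> nxt n c \<notin> V - C"
  using assms by (auto simp: is_edge_def)

lemma moves_image:
  assumes w: "moves V C w" and C: "C \<subseteq> V" and V: "V \<subseteq> {1..n}"
  shows "res_image n w V = shift n V C"
proof -
  have r: "res (w (int v)) = (if v \<in> C then nxt n v else v)" if v: "v \<in> V" for v
  proof -
    have "res (int v) = v" using v V by (intro res_of_nat) blast
    then show ?thesis using w v nxt_res[of "int v"] by (simp add: moves_def)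
  qed
  have "res_image n w V = (\<lambda>v. if v \<in> C then nxt n v else v) ` V"
    unfolding res_image_def by (rule image_cong[OF refl r])
  also have "\<dots> = shift n V C" unfolding shift_def using C by auto
  finally show ?thesis .
qed

section \<open>Affine permutations along edge paths and their invariance under homotopy\<close>

fun dart_move :: "dart \<Rightarrow> int \<Rightarrow> int" where
  "dart_move (s, V, C) = (if s then edge_move V C else inv_into UNIV (edge_move V C))"

fun path_move :: "dart list \<Rightarrow> int \<Rightarrow> int" where
  "path_move [] = id"
| "path_move (e # es) = path_move es \<circ> dart_move e"

lemma path_move_append: "path_move (p @ q) = path_move q \<circ> path_move p"
  by (induction p) (simp_all add: o_assoc)

lemma edge_move_aff:
  assumes e: "is_edge V C"
  shows "affine_perm V (edge_move V C)" "res_image n (edge_move V C) V = shift n V C"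
proof -
  show "affine_perm V (edge_move V C)" using edge_move(1)[OF e] by (simp add: moves_def)
  show "res_image n (edge_move V C) V = shift n V C"
    by (rule moves_image[OF edge_move(1)[OF e] is_edgeD(2,1)[OF e]])
qed

lemma dart_move:
  assumes e: "is_edge V C"
  shows "affine_perm (dart_src n (s, V, C)) (dart_move (s, V, C))"
    "res_image n (dart_move (s, V, C)) (dart_src n (s, V, C)) = dart_tgt n (s, V, C)"
proof -
  note a = edge_move_aff[OF e]
  have i: "affine_perm (shift n V C) (inv_into UNIV (edge_move V C))"
    "res_image n (inv_into UNIV (edge_move V C)) (shift n V C) = V"
    using affine_perm_inv[OF a(1) is_edgeD(1)[OF e]] unfolding a(2) .
  show "affine_perm (dart_src n (s, V, C)) (dart_move (s, V, C))" using a(1) i(1) by simp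
  show "res_image n (dart_move (s, V, C)) (dart_src n (s, V, C)) = dart_tgt n (s, V, C)" using a(2) i(2) by simp
qed

lemma card_res_image:
  assumes w: "affine_perm V' w" and V: "V \<subseteq> {1..n}" shows "card (res_image n w V) = card V"
proof -
  have "inj_on (\<lambda>i. res (w (int i))) V"
    using affine_perm_bij_betw[OF w] V unfolding bij_betw_def by (blast intro: inj_on_subset)
  then show ?thesis unfolding res_image_def by (rule card_image)
qed

lemma dart_ends:
  assumes e: "is_edge V C"
  shows "dart_src n (s, V, C) \<subseteq> {1..n}" "dart_tgt n (s, V, C) \<subseteq> {1..n}"
    "card (dart_src n (s, V, C)) = card V" "card (dart_tgt n (s, V, C)) = card V"
proof -
  have "shift n V C \<subseteq> {1..n}" "card (shift n V C) = card V"
    using edge_move_aff[OF e] res_image_subset card_res_image[OF _ is_edgeD(1)[OF e]] by metis+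
  then show "dart_src n (s, V, C) \<subseteq> {1..n}" "dart_tgt n (s, V, C) \<subseteq> {1..n}"
    "card (dart_src n (s, V, C)) = card V" "card (dart_tgt n (s, V, C)) = card V"
    using is_edgeD(1)[OF e] by simp_all
qed

lemma edge_path_Cons:
  "edge_path n k V ((s, V', C) # es) \<longleftrightarrow>
    dart_src n (s, V', C) = V \<and> is_edge V' C \<and> card V' = k \<and> edge_path n k (dart_tgt n (s, V', C)) es"
  by (simp add: cyc_simplex_edge_iff)

lemma path_move:
  assumes "V \<subseteq> {1..n}" "edge_path n k V p"
  shows "affine_perm V (path_move p) \<and> res_image n (path_move p) V = path_end n V p"
  using assms
proof (induction p arbitrary: V)
  case Nil
  have "res_image n id V = (\<lambda>v. v) ` V"
    unfolding res_image_def by (rule image_cong[OF refl]) (use Nil res_of_nat in auto)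
  then show ?case using affine_perm_id[of V] by (simp only: path_move.simps path_end_simps image_ident)
next
  case (Cons e es)
  obtain s V' C where e: "e = (s, V', C)" by (cases e) auto
  have p: "dart_src n e = V" "is_edge V' C" "edge_path n k (dart_tgt n e) es"
    using Cons.prems(2) unfolding e edge_path_Cons by simp_all
  note d = dart_move[OF p(2), of s, folded e, unfolded p(1)]
  have IH: "affine_perm (dart_tgt n e) (path_move es)"
    "res_image n (path_move es) (dart_tgt n e) = path_end n (dart_tgt n e) es"
    using Cons.IH[OF _ p(3)] dart_ends(2)[OF p(2), of s, folded e] by simp_all
  show ?case
    using affine_perm_compose[OF d(1) _ Cons.prems(1), unfolded d(2), OF IH(1)] IH(2) by (simp only: path_move.simps path_end_simps simp_thms)
qed

lemma edge_path_append:
  assumes "V \<subseteq> {1..n}" "V \<noteq> {}" "card V = k"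
  shows "edge_path n k V (p @ q) \<longleftrightarrow> edge_path n k V p \<and> edge_path n k (path_end n V p) q"
  using assms
proof (induction p arbitrary: V)
  case Nil
  then show ?case using cyc_simplex_vertex[OF Nil(1,2)] by simp
next
  case (Cons e es)
  obtain s V' C where e: "e = (s, V', C)" by (cases e) auto
  have "edge_path n k (dart_tgt n e) (es @ q) \<longleftrightarrow>
      edge_path n k (dart_tgt n e) es \<and> edge_path n k (path_end n (dart_tgt n e) es) q"
    if i: "is_edge V' C" "card V' = k"
  proof (rule Cons.IH)
    note d = dart_ends[OF i(1), of s, folded e]
    show "dart_tgt n e \<subseteq> {1..n}" "card (dart_tgt n e) = k" using d i(2) by simp_all
    have "card V' \<noteq> 0" using is_edgeD(1,3)[OF i(1)] finite_subset by fastforce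
    then show "dart_tgt n e \<noteq> {}" using d(4) by auto
  qed
  then show ?case unfolding e append_Cons edge_path_Cons path_end_simps by blast
qed

lemma path_move_cancel:
  assumes e: "is_edge V C"
  shows "path_move [(s, V, C), (\<not> s, V, C)] = id"
proof -
  have b: "bij (edge_move V C)" by (rule affineD(2)[OF edge_move_aff(1)[OF e]])
  have "edge_move V C \<circ> inv_into UNIV (edge_move V C) = id" "inv_into UNIV (edge_move V C) \<circ> edge_move V C = id"
    using bij_is_surj[OF b, unfolded surj_iff] bij_is_inj[OF b, unfolded inj_iff] by simp_all
  then show ?thesis by simp
qed

text \<open>By \<open>moves_unique\<close> it suffices to compare the values on \<open>V\<close>,
  where it has to be seen that no point takes two steps.\<close>

lemma edge_move_triangle:
  assumes e1: "is_edge V C1" and e2: "is_edge (shift n V C1) (C2 - C1)" and e: "is_edge V C2"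
    and C: "C1 \<subseteq> C2"
  shows "edge_move (shift n V C1) (C2 - C1) \<circ> edge_move V C1 = edge_move V C2"
proof (rule moves_unique[OF _ edge_move(1)[OF e] is_edgeD(1)[OF e]])
  note V = is_edgeD(1)[OF e]
  note a = edge_move_aff[OF e1]
  let ?w = "edge_move V C1" and ?w' = "edge_move (shift n V C1) (C2 - C1)"
  have aw: "affine_perm (res_image n ?w V) ?w'" unfolding a(2) by (rule edge_move_aff(1)[OF e2])
  show "moves V C2 (?w' \<circ> ?w)"
    unfolding moves_def
  proof (intro conjI ballI)
    show "affine_perm V (?w' \<circ> ?w)" by (rule affine_perm_compose(1)[OF a(1) aw V])
    fix v assume v: "v \<in> V"
    have rv: "res (int v) = v" using v V by (intro res_of_nat) blast
    have w: "?w (int v) = (if v \<in> C1 then int v + 1 else int v)"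
      using moves_value[OF edge_move(1)[OF e1] is_edgeD(2)[OF e1], of "int v"] rv v by simp
    have rw: "res (?w (int v)) = (if v \<in> C1 then nxt n v else v)"
      using w rv nxt_res[of "int v"] by simp
    have "res (?w (int v)) \<in> shift n V C1" unfolding rw shift_def using v by simp
    from moves_value[OF edge_move(1)[OF e2] is_edgeD(2)[OF e2] this]
    have w': "?w' (?w (int v)) = (if res (?w (int v)) \<in> C2 - C1 then ?w (int v) + 1 else ?w (int v))" .
    \<comment> \<open>A point of \<open>C1\<close> that has arrived at its next place does not move
      again: that place is not in \<open>V - C1\<close>, by the edge condition for
      \<open>C1\<close>.\<close>
    have n1: "nxt n v \<notin> C2 - C1" if "v \<in> C1" using is_edgeD(5)[OF e1 that] is_edgeD(2)[OF e] by blast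
    show "(?w' \<circ> ?w) (int v) = (if v \<in> C2 then int v + 1 else int v)"
    proof (cases "v \<in> C1")
      case True
      then have "v \<in> C2" using C by blast
      then show ?thesis using w' w rw n1[OF True] True by simp
    next
      case False then show ?thesis using w' w rw by simp
    qed
  qed
qed

lemma cyc_simplex_triangle: "cyc_simplex n k V [C1, C2] \<Longrightarrow> C1 \<subseteq> C2"
proof -
  assume "cyc_simplex n k V [C1, C2]"
  then have "\<exists>x (Es :: nat set list). sorted_wrt (\<subset>) Es \<and> [C1, C2] = map (\<lambda>E. (\<lambda>i. res (x i)) ` E) Es"
    unfolding cyc_simplex_def by - (elim exE conjE, intro exI conjI, assumption+)
  then obtain x and Es :: "nat set list" where "sorted_wrt (\<subset>) Es" "[C1, C2] = map (\<lambda>E. (\<lambda>i. res (x i)) ` E) Es"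
    by (elim exE conjE) (rule that)
  then obtain E1 E2 where "E1 \<subset> E2" "C1 = (\<lambda>i. res (x i)) ` E1" "C2 = (\<lambda>i. res (x i)) ` E2"
    by (auto simp: Cons_eq_map_conv)
  then show ?thesis by (simp add: image_mono psubset_imp_subset)
qed

lemma elementary_path_move:
  assumes h: "elementary_homotopy n k p q" and B: "B \<subseteq> {1..n}" "B \<noteq> {}" "card B = k"
    and p: "edge_path n k B p" "edge_path n k B q"
  shows "path_move p = path_move q"
  using h
proof cases
  case (cancel p' s V C q')
  have p': "edge_path n k B p'" and r: "edge_path n k (path_end n B p') ((s, V, C) # (\<not> s, V, C) # q')"
    using p(1) unfolding cancel edge_path_append[OF B] by simp_all
  have e: "is_edge V C" using r unfolding edge_path_Cons by blast
  show ?thesis unfolding cancel path_move_append path_move_cancel[OF e] by simp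
next
  case (triangle V C1 C2 p' q')
  have r: "edge_path n k (path_end n B p') ((True, V, C1) # (True, shift n V C1, C2 - C1) # q')"
    using p(1) unfolding triangle edge_path_append[OF B] append_Cons append_Nil by (rule conjunct2)
  have r': "edge_path n k (path_end n B p') ((True, V, C2) # q')"
    using p(2) unfolding triangle edge_path_append[OF B] append_Cons append_Nil by (rule conjunct2)
  have e: "is_edge V C1" "is_edge (shift n V C1) (C2 - C1)" "is_edge V C2"
    using r r' unfolding edge_path_Cons by blast+
  have "edge_move (shift n V C1) (C2 - C1) \<circ> edge_move V C1 = edge_move V C2"
    by (rule edge_move_triangle[OF e cyc_simplex_triangle[OF triangle(3)]])
  then show ?thesis unfolding triangle path_move_append by simp
qed

text \<open>The generating homotopies preserve the affine permutation. The end of the path is then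
  determined as well, being the residue image of \<open>B\<close> under it.\<close>

lemma homotopy_path_move:
  assumes h: "(p, q) \<in> path_homotopy n B" and B: "B \<subseteq> {1..n}" "B \<noteq> {}"
  shows "path_move p = path_move q" "path_end n B p = path_end n B q"
proof -
  have pq: "p \<in> edge_paths n B" "q \<in> edge_paths n B" using h by (simp_all add: path_homotopy_def)
  have "equivclp (\<lambda>p q. p \<in> edge_paths n B \<and> q \<in> edge_paths n B \<and> elementary_homotopy n (card B) p q) p q"
    using h by (simp add: path_homotopy_def)
  then show m: "path_move p = path_move q"
    by (rule equivclp_invariant) (use elementary_path_move[OF _ B refl] in \<open>auto simp: edge_paths_def\<close>)
  show "path_end n B p = path_end n B q"
    using path_move[OF B(1)] pq m unfolding edge_paths_def by (metis mem_Collect_eq)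
qed

section \<open>The universal cover and the split map\<close>

definition path_class :: "nat set \<Rightarrow> dart list \<Rightarrow> dart list set" where
  "path_class B p = path_homotopy n B `` {p}"

lemma path_class_eq: "(p, q) \<in> path_homotopy n B \<Longrightarrow> path_class B p = path_class B q"
  unfolding path_class_def by (rule equiv_class_eq[OF equiv_path_homotopy])

lemma path_class_self: "p \<in> edge_paths n B \<Longrightarrow> p \<in> path_class B p"
  unfolding path_class_def by (rule equiv_class_self[OF equiv_path_homotopy])

lemma path_class_in: "p \<in> edge_paths n B \<Longrightarrow> path_class B p \<in> ucover n B"
  unfolding path_class_def ucover_def by (rule quotientI)

lemma ucoverE:
  assumes "W \<in> ucover n B" obtains p where "p \<in> edge_paths n B" "W = path_class B p"
  using assms unfolding ucover_def path_class_def by (rule quotientE)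

lemma path_class_images:
  assumes p: "p \<in> edge_paths n B" and B: "B \<subseteq> {1..n}" "B \<noteq> {}"
  shows "cov n B (path_class B p) = path_end n B p" "the_elem (path_move ` path_class B p) = path_move p"
proof -
  have s: "f ` path_class B p = {f p}" if "\<And>q. (p, q) \<in> path_homotopy n B \<Longrightarrow> f p = f q"
    for f :: "dart list \<Rightarrow> 'b"
  proof
    show "{f p} \<subseteq> f ` path_class B p" using path_class_self[OF p] by simp
    show "f ` path_class B p \<subseteq> {f p}"
    proof
      fix y assume "y \<in> f ` path_class B p"
      then obtain q where q: "q \<in> path_class B p" "y = f q" by (rule imageE)
      then have "f p = f q" by (intro that) (simp add: path_class_def)
      then show "y \<in> {f p}" using q(2) by simp
    qed
  qed
  have "path_end n B ` path_class B p = {path_end n B p}"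
    by (rule s) (rule homotopy_path_move(2)[OF _ B])
  then show "cov n B (path_class B p) = path_end n B p" by (simp add: cov_def)
  have "path_move ` path_class B p = {path_move p}"
    by (rule s) (rule homotopy_path_move(1)[OF _ B])
  then show "the_elem (path_move ` path_class B p) = path_move p" by simp
qed

lemma edge_paths_snoc:
  assumes B: "B \<subseteq> {1..n}" "B \<noteq> {}"
  shows "p @ [(s, V, C)] \<in> edge_paths n B \<longleftrightarrow>
    p \<in> edge_paths n B \<and> path_end n B p = dart_src n (s, V, C) \<and> is_edge V C \<and> card V = card B"
proof -
  have "edge_path n (card B) (dart_tgt n (s, V, C)) []" if e: "is_edge V C" "card V = card B"
  proof -
    note d = dart_ends[OF e(1), of s]
    have "card V \<noteq> 0" using is_edgeD(1,3)[OF e(1)] finite_subset by fastforce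
    then have "dart_tgt n (s, V, C) \<noteq> {}" using d(4) by auto
    from cyc_simplex_vertex[OF d(2) this] show ?thesis using d(4) e(2) by (simp only: edge_path.simps)
  qed
  then show ?thesis
    unfolding edge_paths_def mem_Collect_eq edge_path_append[OF B refl] edge_path_Cons by blast
qed

lemma ucover_edgeE:
  assumes B: "B \<subseteq> {1..n}" "B \<noteq> {}" and u: "ucover_edge n B W C W'"
  obtains p V where "p \<in> edge_paths n B" "W = path_class B p" "path_end n B p = V" "is_edge V C"
    "card V = card B" "p @ [(True, V, C)] \<in> edge_paths n B" "W' = path_class B (p @ [(True, V, C)])"
proof -
  have W: "W \<in> ucover n B" and c: "cyc_simplex n (card B) (cov n B W) [C]"
    using u by (simp_all add: ucover_edge_def)
  obtain p where p: "p \<in> W" "W' = path_class B (p @ [(True, cov n B W, C)])"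
    using u unfolding ucover_edge_def path_class_def by blast
  obtain q where q: "q \<in> edge_paths n B" "W = path_class B q" using W by (rule ucoverE)
  have h: "(q, p) \<in> path_homotopy n B" using p(1) unfolding q(2) path_class_def by simp
  then have pE: "p \<in> edge_paths n B" by (simp add: path_homotopy_def)
  have Wp: "W = path_class B p" using path_class_eq[OF h] q(2) by simp
  have e: "path_end n B p = cov n B W" unfolding Wp path_class_images(1)[OF pE B] ..
  have c': "is_edge (cov n B W) C" "card (cov n B W) = card B" using c unfolding cyc_simplex_edge_iff by simp_all
  show ?thesis
  proof (rule that[OF pE Wp e c' _ p(2)])
    show "p @ [(True, cov n B W, C)] \<in> edge_paths n B" unfolding edge_paths_snoc[OF B] using pE e c' by simp
  qed
qed

lemma ucover_edgeI:
  assumes B: "B \<subseteq> {1..n}" "B \<noteq> {}" and p: "p @ [(True, V, C)] \<in> edge_paths n B"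
  shows "ucover_edge n B (path_class B p) C (path_class B (p @ [(True, V, C)]))"
proof -
  have pE: "p \<in> edge_paths n B" "path_end n B p = V" "is_edge V C" "card V = card B"
    using p unfolding edge_paths_snoc[OF B] by simp_all
  have c: "cov n B (path_class B p) = V" using path_class_images(1)[OF pE(1) B] pE(2) by simp
  show ?thesis
    unfolding ucover_edge_def c cyc_simplex_edge_iff
    using pE path_class_in[OF pE(1)] path_class_self[OF pE(1)] by (auto simp: path_class_def)
qed

lemma boundary_target_unique:
  assumes B: "B \<subseteq> {1..n}" and "B' \<subseteq> {1..n}" "B'' \<subseteq> {1..n}"
    and "\<beta> \<in> boundary_braids n B B'" "\<beta> \<in> boundary_braids n B B''"
  shows "B' = B''"
proof -
  obtain w where w: "displacement B \<beta> w" "res_image n w B = B'" using boundary_displacement[OF B assms(2,4)] by metis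
  obtain w' where w': "displacement B \<beta> w'" "res_image n w' B = B''" using boundary_displacement[OF B assms(3,5)] by metis
  have "res_image n w B = res_image n w' B"
    unfolding res_image_def by (rule image_cong[OF refl]) (simp add: displacement_unique[OF w(1) w'(1) B])
  then show ?thesis using w(2) w'(2) by simp
qed

lemma layered_braid_boundary:
  assumes w: "affine_perm B w" and B: "B \<subseteq> {1..n}"
  shows "layered_braid B w \<in> boundary_braids n B (res_image n w B)" "layered_braid B w \<in> boundary_braids_from n B"
    "bdry_vertex n B (layered_braid B w) = res_image n w B"
proof -
  show b: "layered_braid B w \<in> boundary_braids n B (res_image n w B)" by (rule displacement_boundary[OF layered_braid_bdisp[OF w B] B])
  show "layered_braid B w \<in> boundary_braids_from n B" unfolding boundary_braids_from_def using b res_image_subset by blast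
  show "bdry_vertex n B (layered_braid B w) = res_image n w B"
    unfolding bdry_vertex_def
  proof (rule the_equality)
    show "res_image n w B \<subseteq> {1..n} \<and> layered_braid B w \<in> boundary_braids n B (res_image n w B)" using b res_image_subset by blast
    show "B' = res_image n w B" if "B' \<subseteq> {1..n} \<and> layered_braid B w \<in> boundary_braids n B B'" for B'
      by (rule boundary_target_unique[OF B conjunct1[OF that] res_image_subset conjunct2[OF that] b])
  qed
qed

lemma path_move_aff:
  assumes "p \<in> edge_paths n B" "B \<subseteq> {1..n}"
  shows "affine_perm B (path_move p)" "res_image n (path_move p) B = path_end n B p"
  using path_move[OF assms(2)] assms(1) by (auto simp: edge_paths_def)

lemma path_move_snoc: "path_move (p @ [(True, V, C)]) = edge_move V C \<circ> path_move p"
  by (simp add: path_move_append)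

lemma layered_braid_edge:
  assumes p: "p \<in> edge_paths n B" and B: "B \<subseteq> {1..n}" and e: "is_edge (path_end n B p) C"
  shows "layered_braid B (edge_move (path_end n B p) C \<circ> path_move p) =
    layered_braid B (path_move p) \<otimes>\<^bsub>Braid n\<^esub> layered_braid (path_end n B p) (edge_move (path_end n B p) C)"
proof -
  note m = path_move_aff[OF p B]
  have "affine_perm (res_image n (path_move p) B) (edge_move (path_end n B p) C)"
    unfolding m(2) by (rule edge_move_aff(1)[OF e])
  from layered_braid_mult[OF m(1) this B] show ?thesis unfolding m(2) by simp
qed

text \<open>\<open>path_move\<close> is constant on homotopy classes, so its image of a class has
  exactly one element. The restriction makes the map extensional, as \<open>is_split\<close>
  demands.\<close>

definition split_fun :: "nat set \<Rightarrow> dart list set \<Rightarrow> (real \<Rightarrow> complex set) set" where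
  "split_fun B = restrict (\<lambda>W. layered_braid B (the_elem (path_move ` W))) (ucover n B)"

lemma split_fun_class:
  assumes p: "p \<in> edge_paths n B" and B: "B \<subseteq> {1..n}" "B \<noteq> {}"
  shows "split_fun B (path_class B p) = layered_braid B (path_move p)"
  using path_class_images(2)[OF p B] path_class_in[OF p] by (simp add: split_fun_def)

lemma Nil_edge_paths: "B \<subseteq> {1..n} \<Longrightarrow> B \<noteq> {} \<Longrightarrow> [] \<in> edge_paths n B"
  using cyc_simplex_vertex by (simp add: edge_paths_def)

text \<open>Edges are sent to edges because appending a forward edge multiplies the layered braid by
  that of \<open>edge_move V C\<close>, which is the dual simple braid of
  \<open>edge_part C\<close>.\<close>

lemma split_fun_is_split:
  assumes B: "B \<subseteq> {1..n}" "B \<noteq> {}"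
  shows "is_split n B (split_fun B)"
  unfolding is_split_def
proof (intro conjI ballI allI impI)
  show "split_fun B \<in> extensional (ucover n B)" by (simp add: split_fun_def)
  show "split_fun B (ucover_base n B) = \<one>\<^bsub>Braid n\<^esub>"
    using split_fun_class[OF Nil_edge_paths[OF B] B] layered_braid_id[OF B(1)]
    by (simp add: ucover_base_def path_class_def)
next
  fix W assume "W \<in> ucover n B"
  then obtain p where p: "p \<in> edge_paths n B" "W = path_class B p" by (rule ucoverE)
  note m = path_move_aff[OF p(1) B(1)] and s = split_fun_class[OF p(1) B]
  show "split_fun B W \<in> boundary_braids_from n B" unfolding p(2) s by (rule layered_braid_boundary(2)[OF m(1) B(1)])
  show "bdry_vertex n B (split_fun B W) = cov n B W"
    unfolding p(2) s layered_braid_boundary(3)[OF m(1) B(1)] m(2) path_class_images(1)[OF p(1) B] ..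
next
  fix W C W' assume "ucover_edge n B W C W'"
  with B obtain p V where p: "p \<in> edge_paths n B" "W = path_class B p" "path_end n B p = V" "is_edge V C"
    "card V = card B" "p @ [(True, V, C)] \<in> edge_paths n B" "W' = path_class B (p @ [(True, V, C)])"
    by (rule ucover_edgeE)
  have c: "cov n B W = V" unfolding p(2) path_class_images(1)[OF p(1) B] by (rule p(3))
  note ep = edge_part[OF p(4)]
  note m = path_move_snoc[of p V C]
  have s: "split_fun B W = layered_braid B (path_move p)" "split_fun B W' = layered_braid B (edge_move V C \<circ> path_move p)"
    unfolding p(2,7) split_fun_class[OF p(1) B] split_fun_class[OF p(6) B] m by (rule refl)+
  have a: "affine_perm B (edge_move V C \<circ> path_move p)" using path_move_aff(1)[OF p(6) B(1)] unfolding m .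
  show "\<exists>\<pi>. cplx_edge n B (split_fun B W) \<pi> (split_fun B W') \<and> bdry_edge (cov n B W) \<pi> = C \<and>
      \<pi> \<in> noncrossing_bdry n (cov n B W) \<and> move_part n (cov n B W) \<pi> = \<pi>"
    unfolding c
  proof (intro exI[of _ "edge_part C"] conjI ep(1,2) move_part_eq[OF p(4)])
    have "layered_braid B (edge_move V C \<circ> path_move p) = layered_braid B (path_move p) \<otimes>\<^bsub>Braid n\<^esub> dual_simple n (edge_part C)"
      unfolding edge_move(2)[OF p(4)] using layered_braid_edge[OF p(1) B(1)] p(3,4) by simp
    then show "cplx_edge n B (split_fun B W) (edge_part C) (split_fun B W')"
      unfolding cplx_edge_def s
      using layered_braid_boundary(2)[OF path_move_aff(1)[OF p(1) B(1)] B(1)] layered_braid_boundary(2)[OF a B(1)]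
        noncrossing_bdryD(1)[OF ep(1)] ep(4) by blast
  qed
qed

text \<open>Every split is determined along paths, by induction from the end. A forward edge has a
  prescribed label, hence multiplies by a known braid; a reversed edge is handled by appending the
  forward one, which cancels it, and dividing in the group.\<close>

lemma is_split_class:
  assumes B: "B \<subseteq> {1..n}" "B \<noteq> {}" and \<sigma>: "is_split n B \<sigma>" and p: "p \<in> edge_paths n B"
  shows "\<sigma> (path_class B p) = layered_braid B (path_move p)"
proof -
  have edge: "\<sigma> (path_class B (p @ [(True, V, C)])) =
      \<sigma> (path_class B p) \<otimes>\<^bsub>Braid n\<^esub> layered_braid V (edge_move V C)"
    if q: "p @ [(True, V, C)] \<in> edge_paths n B" for p V C
  proof -
    have pE: "p \<in> edge_paths n B" "path_end n B p = V" "is_edge V C"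
      using q unfolding edge_paths_snoc[OF B] by simp_all
    have c: "cov n B (path_class B p) = V" using path_class_images(1)[OF pE(1) B] pE(2) by simp
    obtain \<pi> where pi: "cplx_edge n B (\<sigma> (path_class B p)) \<pi> (\<sigma> (path_class B (p @ [(True, V, C)])))"
      "bdry_edge V \<pi> = C" "\<pi> \<in> noncrossing_bdry n V" "move_part n V \<pi> = \<pi>"
      using \<sigma> ucover_edgeI[OF B q] unfolding is_split_def c[symmetric] by blast
    \<comment> \<open>The label is its own moving part, and the moving part depends on
      \<open>C\<close> only.\<close>
    have "\<pi> = edge_part C" using move_part_eq[OF pE(3) pi(3,2)] pi(4) by simp
    then show ?thesis using pi(1) edge_move(2)[OF pE(3)] by (simp add: cplx_edge_def)
  qed
  have car: "\<sigma> (path_class B p) \<in> carrier (Braid n)" if "p \<in> edge_paths n B" for p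
    using \<sigma> path_class_in[OF that] unfolding is_split_def boundary_braids_from_def boundary_braids_def by blast
  show ?thesis using p
  proof (induction p rule: rev_induct)
    case Nil
    have "\<sigma> (ucover_base n B) = \<one>\<^bsub>Braid n\<^esub>" using \<sigma> by (simp add: is_split_def)
    then show ?case
      unfolding path_class_def ucover_base_def[symmetric] path_move.simps(1) layered_braid_id[OF B(1)] .
  next
    case (snoc e p)
    obtain s V C where e: "e = (s, V, C)" by (cases e) auto
    have p: "p \<in> edge_paths n B" "path_end n B p = dart_src n (s, V, C)" "is_edge V C" "card V = card B"
      using snoc.prems unfolding e edge_paths_snoc[OF B] by simp_all
    show ?case
    proof (cases s)
      case True
      have V: "path_end n B p = V" using p(2) True by simp
      have "layered_braid B (edge_move V C \<circ> path_move p) = layered_braid B (path_move p) \<otimes>\<^bsub>Braid n\<^esub> layered_braid V (edge_move V C)"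
        using layered_braid_edge[OF p(1) B(1)] p(3) unfolding V by simp
      then show ?thesis
        using edge[of p V C] snoc p(1) True unfolding e by (simp only: path_move_snoc)
    next
      case False
      let ?p = "p @ [(False, V, C)]"
      have ep: "p @ [e] = ?p" using e False by simp
      have q: "?p \<in> edge_paths n B" using snoc.prems unfolding ep .
      have qe: "path_end n B ?p = V" by (simp add: path_end_def)
      have q': "?p @ [(True, V, C)] \<in> edge_paths n B"
        unfolding edge_paths_snoc[OF B, of ?p] using q qe p(3,4) by simp
      have "elementary_homotopy n (card B) (p @ [(False, V, C), (\<not> False, V, C)] @ []) (p @ [])"
        by (rule elementary_homotopy.cancel)
      then have "elementary_homotopy n (card B) (?p @ [(True, V, C)]) p" by simp
      then have h: "(?p @ [(True, V, C)], p) \<in> path_homotopy n B" by (rule elementary_path_homotopy[OF q' p(1)])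
      have m: "path_move p = edge_move V C \<circ> path_move ?p"
        using homotopy_path_move(1)[OF h B] by (simp only: path_move_snoc)
      have "\<sigma> (path_class B ?p) \<otimes>\<^bsub>Braid n\<^esub> layered_braid V (edge_move V C) = layered_braid B (path_move p)"
        using edge[OF q'] path_class_eq[OF h] snoc.IH[OF p(1)] by simp
      also have "\<dots> = layered_braid B (path_move ?p) \<otimes>\<^bsub>Braid n\<^esub> layered_braid V (edge_move V C)"
        unfolding m using layered_braid_edge[OF q B(1)] p(3) unfolding qe by simp
      finally have "\<sigma> (path_class B ?p) = layered_braid B (path_move ?p)"
        using car[OF q] layered_braid_carrier[OF path_move_aff(1)[OF q B(1)] B(1)]
          layered_braid_carrier[OF edge_move_aff(1)[OF p(3)] is_edgeD(1)[OF p(3)]]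
        by simp
      then show ?thesis unfolding ep .
    qed
  qed
qed

lemma split_map_eq:
  assumes B: "B \<subseteq> {1..n}" "B \<noteq> {}"
  shows "split_map n B = split_fun B"
  unfolding split_map_def
proof (rule the_equality)
  show "is_split n B (split_fun B)" by (rule split_fun_is_split[OF B])
  fix \<sigma> assume \<sigma>: "is_split n B \<sigma>"
  show "\<sigma> = split_fun B"
  proof (rule extensionalityI)
    show "\<sigma> \<in> extensional (ucover n B)" using \<sigma> by (simp add: is_split_def)
    show "split_fun B \<in> extensional (ucover n B)" by (simp add: split_fun_def)
    fix W assume "W \<in> ucover n B"
    then obtain p where p: "p \<in> edge_paths n B" "W = path_class B p" by (rule ucoverE)
    show "\<sigma> W = split_fun B W" unfolding p(2) is_split_class[OF B \<sigma> p(1)] split_fun_class[OF p(1) B] ..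
  qed
qed

section \<open>Move braids as the braids of affine permutations\<close>

lemma move_braids_paths:
  assumes B: "B \<subseteq> {1..n}" "B \<noteq> {}"
  shows "move_braids_from n B = (\<lambda>p. layered_braid B (path_move p)) ` edge_paths n B"
proof -
  have "ucover n B = path_class B ` edge_paths n B"
    using path_class_in ucoverE by (intro equalityI subsetI) (metis imageI, blast)
  then show ?thesis
    unfolding move_braids_from_def split_map_eq[OF B] using B(2) split_fun_class[OF _ B]
    by (simp add: image_image)
qed

text \<open>All points that still have to advance take one step together; this lowers the bound
  \<open>N\<close> by one and keeps the remaining displacement monotone.\<close>

lemma path_of_small_displacement:
  assumes "V \<subseteq> {1..n}" "V \<noteq> {}" "equivariant n w" "mono_lifts V w"
    and "\<And>z. res z \<in> V \<Longrightarrow> z \<le> w z \<and> w z \<le> z + int N"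
  shows "\<exists>p. edge_path n (card V) V p \<and> (\<forall>z. res z \<in> V \<longrightarrow> path_move p z = w z)"
  using assms
proof (induction N arbitrary: V w)
  case 0
  then have "w z = z" if "res z \<in> V" for z using that by force
  then show ?case using cyc_simplex_vertex[OF 0(1,2)] by (intro exI[of _ "[]"]) simp
next
  case (Suc N)
  note V = Suc.prems(1,2) and w = Suc.prems(3,4,5)
  define C where "C = {v \<in> V. int v < w (int v)}"
  have wC: "res z \<in> C \<longleftrightarrow> z < w z" if z: "res z \<in> V" for z
    unfolding C_def using z equivariant_res(1)[OF w(1), of z] by simp
  show ?case
  proof (cases "C = {}")
    case True
    have "w z = z" if "res z \<in> V" for z using wC[OF that] w(3)[OF that] True by simp
    then show ?thesis using cyc_simplex_vertex[OF V] by (intro exI[of _ "[]"]) simp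
  next
    case False
    \<comment> \<open>If the point just ahead had already arrived, monotonicity would place
      \<open>w (int c)\<close> strictly between two consecutive integers.\<close>
    have nC: "nxt n c \<notin> V - C" if c: "c \<in> C" for c
    proof
      assume a: "nxt n c \<in> V - C"
      have cV: "c \<in> V" using c by (simp add: C_def)
      have rc: "res (int c) = c" using cV V(1) by (intro res_of_nat) blast
      have r: "res (int c + 1) = nxt n c" using nxt_res[of "int c"] rc by simp
      have "w (int c + 1) = int c + 1" using wC[of "int c + 1"] w(3)[of "int c + 1"] a unfolding r by simp
      moreover have "int c < w (int c)" using c by (simp add: C_def)
      moreover have "w (int c) < w (int c + 1)" using w(2) rc r cV a unfolding mono_lifts_def by simp
      ultimately show False by linarith
    qed
    have e: "is_edge V C" unfolding is_edge_def using V False nC by (auto simp: C_def)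
    note m = edge_move(1)[OF e] and a = edge_move_aff[OF e]
    let ?e = "edge_move V C"
    note i = affine_perm_inv[OF a(1) V(1), unfolded a(2)]
    define w' where "w' = w \<circ> inv_into UNIV ?e"
    have b: "bij ?e" by (rule affineD(2)[OF a(1)])
    have inv: "inv_into UNIV ?e (?e z) = z" for z by (rule inv_into_f_f[OF bij_is_inj[OF b] UNIV_I])
    have w'e: "w' (?e z) = w z" for z by (simp add: w'_def inv)
    have surj: "\<exists>z. res z \<in> V \<and> y = ?e z" if "res y \<in> shift n V C" for y
    proof -
      obtain z where z: "y = ?e z" using bij_is_surj[OF b] by blast
      then show ?thesis using that res_image_iff[OF a(1) V(1), of z] a(2) by auto
    qed
    have em: "?e z = (if res z \<in> C then z + 1 else z)" if "res z \<in> V" for z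
      by (rule moves_value[OF m is_edgeD(2)[OF e] that])
    have "\<exists>p. edge_path n (card (shift n V C)) (shift n V C) p \<and>
        (\<forall>z. res z \<in> shift n V C \<longrightarrow> path_move p z = w' z)"
    proof (rule Suc.IH)
      note d = dart_ends[OF e, of True]
      show "shift n V C \<subseteq> {1..n}" using d(2) by simp
      show "shift n V C \<noteq> {}" unfolding a(2)[symmetric] res_image_def using V(2) by simp
      show "equivariant n w'" using w(1) affineD(1)[OF i(1)] by (simp add: w'_def equivariant_def)
      show "mono_lifts (shift n V C) w'" unfolding w'_def
        by (rule mono_lifts_compose[OF i(1) _ affineD(3)[OF i(1)]]) (use d(2) w(2) i(2) in simp_all)
      fix y assume "res y \<in> shift n V C"
      then obtain z where z: "res z \<in> V" "y = ?e z" using surj by blast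
      have wy: "w' y = w z" unfolding z(2) by (rule w'e)
      show "y \<le> w' y \<and> w' y \<le> y + int N"
        unfolding wy unfolding z(2) em[OF z(1)] using wC[OF z(1)] w(3)[OF z(1)] by auto
    qed
    then obtain p where p: "edge_path n (card (shift n V C)) (shift n V C) p"
      "\<And>z. res z \<in> shift n V C \<Longrightarrow> path_move p z = w' z" by blast
    have c: "card (shift n V C) = card V" using dart_ends(4)[OF e, of True] by simp
    show ?thesis
    proof (intro exI[of _ "(True, V, C) # p"] conjI allI impI)
      show "edge_path n (card V) V ((True, V, C) # p)" unfolding edge_path_Cons using e p(1) c by simp
      fix z assume z: "res z \<in> V"
      have "res (?e z) \<in> shift n V C" using res_image_iff[OF a(1) V(1), of z] a(2) z by simp
      from p(2)[OF this] show "path_move ((True, V, C) # p) z = w z" using w'e by simp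
    qed
  qed
qed

text \<open>Negative displacements are compensated by full rotations traversed backwards.\<close>

lemma path_of_displacement:
  assumes "V \<subseteq> {1..n}" "V \<noteq> {}" "equivariant n w" "mono_lifts V w"
    and "\<And>z. res z \<in> V \<Longrightarrow> z - int M \<le> w z \<and> w z \<le> z + int N"
  shows "\<exists>p. edge_path n (card V) V p \<and> (\<forall>z. res z \<in> V \<longrightarrow> path_move p z = w z)"
  using assms
proof (induction M arbitrary: V w N)
  case 0
  then show ?case by (intro path_of_small_displacement) auto
next
  case (Suc M)
  note V = Suc.prems(1,2) and w = Suc.prems(3,4,5)
  \<comment> \<open>One place behind \<open>V\<close>. The edge from \<open>U\<close> along which
    all points move ends in \<open>V\<close>, so traversing it backwards turns \<open>V\<close> by
    one place; the remaining displacement has bounds smaller by one below and larger by one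
    above.\<close>
  define U where "U = (\<lambda>v. res (int v - 1)) ` V"
  have U: "U \<subseteq> {1..n}" "U \<noteq> {}" using V by (auto simp: U_def)
  have e: "is_edge U U" using U by (simp add: is_edge_def)
  note m = edge_move(1)[OF e] and a = edge_move_aff[OF e]
  let ?e = "edge_move U U"
  have sh: "shift n U U = V"
  proof -
    have "nxt n (res (int v - 1)) = v" if "v \<in> V" for v
      using nxt_res[of "int v - 1"] res_of_nat[of v] V(1) that by auto
    then show ?thesis by (simp add: shift_def U_def image_image)
  qed
  have em: "?e z = z + 1" if "res z \<in> U" for z using moves_value[OF m order_refl that] that by simp
  have b: "bij ?e" by (rule affineD(2)[OF a(1)])
  have resU: "res (?e z) \<in> V \<longleftrightarrow> res z \<in> U" for z using res_image_iff[OF a(1) U(1), of z] a(2) sh by simp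
  define w' where "w' = w \<circ> ?e"
  have "\<exists>p. edge_path n (card U) U p \<and> (\<forall>z. res z \<in> U \<longrightarrow> path_move p z = w' z)"
  proof (rule Suc.IH[OF U, where N = "Suc N"])
    show "equivariant n w'" using w(1) affineD(1)[OF a(1)] by (simp add: w'_def equivariant_def)
    show "mono_lifts U w'" unfolding w'_def
      by (rule mono_lifts_compose[OF a(1) U(1) affineD(3)[OF a(1)]]) (use a(2) sh w(2) in simp)
    fix z assume z: "res z \<in> U"
    have "res (z + 1) \<in> V" using resU[of z] z em[OF z] by simp
    from w(3)[OF this] show "z - int M \<le> w' z \<and> w' z \<le> z + int (Suc N)"
      unfolding w'_def using em[OF z] by simp
  qed
  then obtain p where p: "edge_path n (card U) U p" "\<And>z. res z \<in> U \<Longrightarrow> path_move p z = w' z" by blast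
  have c: "card U = card V" using dart_ends(4)[OF e, of True] sh by simp
  show ?case
  proof (intro exI[of _ "(False, U, U) # p"] conjI allI impI)
    show "edge_path n (card V) V ((False, U, U) # p)" unfolding edge_path_Cons using e p(1) c sh by simp
    fix z assume z: "res z \<in> V"
    obtain y where y: "z = ?e y" using bij_is_surj[OF b] by blast
    have i: "inv_into UNIV ?e z = y" unfolding y by (rule inv_into_f_f[OF bij_is_inj[OF b] UNIV_I])
    have "res y \<in> U" using z unfolding y resU .
    from p(2)[OF this] have "path_move p y = w z" by (simp only: w'_def y o_apply)
    moreover have "path_move ((False, U, U) # p) z = path_move p (inv_into UNIV ?e z)" by simp
    ultimately show "path_move ((False, U, U) # p) z = w z" unfolding i by simp
  qed
qed

text \<open>The inequalities between representatives in \<open>{1..n}\<close> amount to monotonicity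
  on all lifts of \<open>B\<close>: for lifts in different periods the second inequality is what is
  needed. The sum of the absolute displacements serves as a common bound.\<close>

lemma path_of_order:
  assumes B: "B \<subseteq> {1..n}" "B \<noteq> {}" and w: "equivariant n w"
    and ord: "\<forall>b\<in>B. \<forall>c\<in>B. b < c \<longrightarrow> w (int b) < w (int c) \<and> w (int c) < w (int b) + int n"
  obtains p where "p \<in> edge_paths n B" "\<And>b. b \<in> B \<Longrightarrow> path_move p (int b) = w (int b)"
proof -
  have "mono_lifts B w"
    unfolding mono_lifts_def
  proof (intro allI impI)
    fix y z assume y: "res y \<in> B" and z: "res z \<in> B" and yz: "y < z"
    obtain k where k: "y = int (res y) + int n * k" by (rule res_decomp)
    obtain l where l: "z = int (res z) + int n * l" by (rule res_decomp)
    have wy: "w y = w (int (res y)) + int n * k" and wz: "w z = w (int (res z)) + int n * l"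
      using equivariant_res(1)[OF w, of y] equivariant_res(1)[OF w, of z] k l by linarith+
    have rb: "1 \<le> int (res y)" "int (res z) \<le> int n" using res_bounds[of y] res_bounds[of z] by linarith+
    have "\<not> l < k"
    proof
      assume "l < k"
      then have "int n * (l + 1) \<le> int n * k" by (intro mult_left_mono) auto
      then have "int n * l + int n \<le> int n * k" by (simp add: algebra_simps)
      then show False using yz k l rb by linarith
    qed
    then consider "k = l" | "k + 1 \<le> l" by linarith
    then show "w y < w z"
    proof cases
      case 1
      have "int (res y) < int (res z)" using yz k l unfolding 1 by linarith
      then have "res y < res z" by simp
      then show ?thesis using ord y z wy wz 1 by simp
    next
      case 2
      then have "int n * (k + 1) \<le> int n * l" by (intro mult_left_mono) auto
      then have "int n * k + int n \<le> int n * l" by (simp add: algebra_simps)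
      moreover have "w (int (res y)) < w (int (res z)) + int n"
      proof (cases "res y" "res z" rule: linorder_cases)
        case less
        then show ?thesis using ord y z n_pos by (metis add_strict_increasing2 add.commute less_imp_le of_nat_0_less_iff of_nat_less_0_iff less_add_same_cancel1 less_trans)
      next
        case equal then show ?thesis using n_pos by simp
      next
        case greater then show ?thesis using ord y z by simp
      qed
      ultimately show ?thesis using wy wz by linarith
    qed
  qed
  moreover define N where "N = nat (\<Sum>b\<in>B. \<bar>w (int b) - int b\<bar>)"
  have fin: "finite B" using B(1) finite_subset by blast
  have "z - int N \<le> w z \<and> w z \<le> z + int N" if z: "res z \<in> B" for z
  proof -
    have "\<bar>w (int (res z)) - int (res z)\<bar> \<le> (\<Sum>b\<in>B. \<bar>w (int b) - int b\<bar>)"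
      by (rule member_le_sum[OF z _ fin]) simp
    then have "\<bar>w (int (res z)) - int (res z)\<bar> \<le> int N" by (simp add: N_def)
    then show ?thesis using equivariant_res(1)[OF w, of z] by linarith
  qed
  ultimately obtain p where p: "edge_path n (card B) B p" "\<forall>z. res z \<in> B \<longrightarrow> path_move p z = w z"
    using path_of_displacement[OF B w] by blast
  show ?thesis
  proof (rule that)
    show "p \<in> edge_paths n B" using p(1) by (simp add: edge_paths_def)
    fix b assume b: "b \<in> B"
    then have "res (int b) = b" using B(1) by (intro res_of_nat) blast
    then show "path_move p (int b) = w (int b)" using p(2) b by simp
  qed
qed

lemma affine_perm_order:
  assumes w: "affine_perm B w" and B: "B \<subseteq> {1..n}"
  shows "\<forall>b\<in>B. \<forall>c\<in>B. b < c \<longrightarrow> w (int b) < w (int c) \<and> w (int c) < w (int b) + int n"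
proof (intro ballI impI conjI)
  fix b c assume bc: "b \<in> B" "c \<in> B" "b < c"
  have I: "b \<in> {1..n}" "c \<in> {1..n}" using bc B by blast+
  have r: "res (int b) = b" "res (int c) = c" using I by (simp_all only: res_of_nat)
  have r': "res (int b + int n) = b" using res_shift[of "int b" 1] r by simp
  show "w (int b) < w (int c)" using affineD(3)[OF w] r bc unfolding mono_lifts_def by simp
  have "int c < int b + int n" using I by simp
  then have "w (int c) < w (int b + int n)" using affineD(3)[OF w] r r' bc unfolding mono_lifts_def by simp
  moreover have "w (int b + int n * 1) = w (int b) + int n * 1" using affineD(1)[OF w] unfolding equivariant_def by blast
  ultimately show "w (int c) < w (int b) + int n" by simp
qed

text \<open>Edge paths yield affine permutations; conversely an affine permutation has the
  displacement of some edge path, and by \<open>affine_perm_unique\<close> the two agree everywhere.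
  For empty \<open>B\<close> the normalisation leaves only the identity.\<close>

lemma move_braids_from_eq:
  assumes B: "B \<subseteq> {1..n}"
  shows "move_braids_from n B = layered_braid B ` {w. affine_perm B w}"
proof (cases "B = {}")
  case True
  have "w = id" if "affine_perm {} w" for w by (rule affine_perm_unique[OF that affine_perm_id]) simp_all
  then have "{w. affine_perm {} w} = {id}" using affine_perm_id by blast
  then show ?thesis using layered_braid_id[OF B] True by (simp add: move_braids_from_def)
next
  case False
  show ?thesis
    unfolding move_braids_paths[OF B False]
  proof (intro equalityI subsetI)
    fix \<mu> assume "\<mu> \<in> (\<lambda>p. layered_braid B (path_move p)) ` edge_paths n B"
    then show "\<mu> \<in> layered_braid B ` {w. affine_perm B w}" using path_move_aff(1)[OF _ B] by blast
  next
    fix \<mu> assume "\<mu> \<in> layered_braid B ` {w. affine_perm B w}"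
    then obtain w where w: "affine_perm B w" "\<mu> = layered_braid B w" by blast
    obtain p where p: "p \<in> edge_paths n B" "\<And>b. b \<in> B \<Longrightarrow> path_move p (int b) = w (int b)"
      using path_of_order[OF B False affineD(1)[OF w(1)] affine_perm_order[OF w(1) B]] by metis
    have "path_move p = w" by (rule affine_perm_unique[OF path_move_aff(1)[OF p(1) B] w(1) B p(2)])
    then show "\<mu> \<in> (\<lambda>p. layered_braid B (path_move p)) ` edge_paths n B" using p(1) w(2) by blast
  qed
qed

lemma move_braids_iff:
  assumes B: "B \<subseteq> {1..n}" "B' \<subseteq> {1..n}"
  shows "\<mu> \<in> move_braids n B B' \<longleftrightarrow> (\<exists>w. affine_perm B w \<and> res_image n w B = B' \<and> \<mu> = layered_braid B w)"
proof
  assume "\<mu> \<in> move_braids n B B'"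
  then obtain w where w: "affine_perm B w" "\<mu> = layered_braid B w" "\<mu> \<in> boundary_braids n B B'"
    unfolding move_braids_def move_braids_from_eq[OF B(1)] by blast
  have "res_image n w B = B'"
    by (rule boundary_target_unique[OF B(1) res_image_subset B(2) layered_braid_boundary(1)[OF w(1) B(1)] w(3)[unfolded w(2)]])
  then show "\<exists>w. affine_perm B w \<and> res_image n w B = B' \<and> \<mu> = layered_braid B w" using w by blast
next
  assume "\<exists>w. affine_perm B w \<and> res_image n w B = B' \<and> \<mu> = layered_braid B w"
  then obtain w where w: "affine_perm B w" "res_image n w B = B'" "\<mu> = layered_braid B w" by blast
  then show "\<mu> \<in> move_braids n B B'"
    unfolding move_braids_def move_braids_from_eq[OF B(1)] using layered_braid_boundary(1)[OF w(1) B(1)] by blast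
qed

lemma displacement_cong:
  "displacement B \<beta> w \<Longrightarrow> (\<And>b. b \<in> B \<Longrightarrow> w (int b) = w' (int b)) \<Longrightarrow> displacement B \<beta> w'"
  unfolding displacement_def by simp

text \<open>The extension of a displacement to the points outside of \<open>B\<close> is not given
  by a formula: it is the affine permutation of an edge path with this displacement.\<close>

lemma boundary_affine_perm:
  assumes B: "B \<subseteq> {1..n}" "B' \<subseteq> {1..n}" and \<beta>: "\<beta> \<in> boundary_braids n B B'"
  obtains w where "affine_perm B w" "displacement B \<beta> w" "res_image n w B = B'"
proof -
  obtain w where w: "equivariant n w" "displacement B \<beta> w" "res_image n w B = B'"
    "\<forall>b\<in>B. \<forall>c\<in>B. b < c \<longrightarrow> w (int b) < w (int c) \<and> w (int c) < w (int b) + int n"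
    by (rule boundary_displacement[OF B \<beta>])
  show ?thesis
  proof (cases "B = {}")
    case True
    show ?thesis
      by (rule that[OF affine_perm_id displacement_cong[OF w(2)]]) (use True w(3) in \<open>auto simp: res_image_def\<close>)
  next
    case False
    obtain p where p: "p \<in> edge_paths n B" "\<And>b. b \<in> B \<Longrightarrow> path_move p (int b) = w (int b)"
      using path_of_order[OF B(1) False w(1,4)] by metis
    have "res_image n (path_move p) B = B'"
      unfolding w(3)[symmetric] res_image_def by (rule image_cong[OF refl]) (simp add: p(2))
    then show ?thesis by (intro that[OF path_move_aff(1)[OF p(1) B(1)] displacement_cong[OF w(2)]]) (simp_all add: p(2))
  qed
qed

section \<open>The three groupoids and the semidirect product\<close>

lemma res_image_id:
  assumes "B \<subseteq> {1..n}" shows "res_image n id B = B"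
proof -
  have "res_image n id B = (\<lambda>v. v) ` B"
    unfolding res_image_def by (rule image_cong[OF refl]) (use assms res_of_nat in auto)
  then show ?thesis by simp
qed

lemma displacement_mult_aff:
  assumes "affine_perm B w" "displacement B \<beta> w" "affine_perm B' w'" "displacement B' \<beta>' w'" "res_image n w B = B'" "B \<subseteq> {1..n}"
  shows "displacement B (\<beta> \<otimes>\<^bsub>Braid n\<^esub> \<beta>') (w' \<circ> w)"
  using displacement_mult[of B \<beta> w \<beta>' w'] affineD(1)[OF assms(3)] assms by blast

lemma displacement_aff_unique:
  assumes "affine_perm B w" "affine_perm B w'" "displacement B \<beta> w" "displacement B \<beta> w'" "B \<subseteq> {1..n}"
  shows "w = w'"
  by (rule affine_perm_unique[OF assms(1,2,5)]) (rule displacement_unique[OF assms(3,4,5)])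

lemma boundary_mult:
  assumes B: "B \<subseteq> {1..n}" "B' \<subseteq> {1..n}" "B'' \<subseteq> {1..n}"
    and \<beta>: "\<beta> \<in> boundary_braids n B B'" "\<beta>' \<in> boundary_braids n B' B''"
  shows "\<beta> \<otimes>\<^bsub>Braid n\<^esub> \<beta>' \<in> boundary_braids n B B''"
proof -
  obtain w where w: "affine_perm B w" "displacement B \<beta> w" "res_image n w B = B'" using boundary_affine_perm[OF B(1,2) \<beta>(1)] by metis
  obtain w' where w': "affine_perm B' w'" "displacement B' \<beta>' w'" "res_image n w' B' = B''" using boundary_affine_perm[OF B(2,3) \<beta>(2)] by metis
  have "res_image n (w' \<circ> w) B = B''" using affine_perm_compose(2)[OF w(1) _ B(1), of w'] w(3) w'(1,3) by simp
  then show ?thesis using displacement_boundary[OF displacement_mult_aff[OF w(1,2) w'(1,2) w(3) B(1)] B(1)] by simp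
qed

lemma fix_carrier: "\<beta> \<in> fix_braids n B \<Longrightarrow> \<beta> \<in> carrier (Braid n)"
  by (simp add: fix_braids_def)

lemma boundary_carrier: "\<beta> \<in> boundary_braids n B B' \<Longrightarrow> \<beta> \<in> carrier (Braid n)"
  by (simp add: boundary_braids_def)

lemma fix_boundary: "\<beta> \<in> fix_braids n B \<Longrightarrow> B \<subseteq> {1..n} \<Longrightarrow> \<beta> \<in> boundary_braids n B B"
  using displacement_boundary[OF fix_displacement] res_image_id by metis

lemma one_fix: "B \<subseteq> {1..n} \<Longrightarrow> \<one>\<^bsub>Braid n\<^esub> \<in> fix_braids n B"
  using displacement_id_fix layered_braid_bdisp[OF affine_perm_id] layered_braid_id by metis

lemma fix_mult:
  assumes "\<beta> \<in> fix_braids n B" "\<beta>' \<in> fix_braids n B" "B \<subseteq> {1..n}"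
  shows "\<beta> \<otimes>\<^bsub>Braid n\<^esub> \<beta>' \<in> fix_braids n B"
proof (rule displacement_id_fix[OF _ assms(3)])
  have "displacement B (\<beta> \<otimes>\<^bsub>Braid n\<^esub> \<beta>') (id \<circ> id)"
    by (rule displacement_mult_aff[OF affine_perm_id fix_displacement[OF assms(1,3)] affine_perm_id fix_displacement[OF assms(2,3)]
          res_image_id[OF assms(3)] assms(3)])
  then show "displacement B (\<beta> \<otimes>\<^bsub>Braid n\<^esub> \<beta>') id" by (simp only: comp_id)
qed

text \<open>The inverse is a boundary braid, so it has some displacement; by multiplicativity this
  composes to the displacement of the unit and is therefore the identity.\<close>

lemma fix_inv:
  assumes \<beta>: "\<beta> \<in> fix_braids n B" and B: "B \<subseteq> {1..n}"
  shows "inv\<^bsub>Braid n\<^esub> \<beta> \<in> fix_braids n B"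
proof -
  obtain w where w: "affine_perm B w" "displacement B (inv\<^bsub>Braid n\<^esub> \<beta>) w"
    using boundary_affine_perm[OF B B boundary_inv[OF B B fix_boundary[OF \<beta> B]]] by metis
  have "displacement B (\<beta> \<otimes>\<^bsub>Braid n\<^esub> inv\<^bsub>Braid n\<^esub> \<beta>) (w \<circ> id)"
    by (rule displacement_mult_aff[OF affine_perm_id fix_displacement[OF \<beta> B] w res_image_id[OF B] B])
  then have "displacement B \<one>\<^bsub>Braid n\<^esub> w" using fix_carrier[OF \<beta>] by (simp add: braid.r_inv)
  then have "w = id" by (rule displacement_aff_unique[OF w(1) affine_perm_id _ fix_displacement[OF one_fix[OF B] B] B])
  then show ?thesis using displacement_id_fix[OF w(2)[unfolded \<open>w = id\<close>] B] by blast
qed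

lemma groupoid_inI:
  assumes "\<And>B B'. B \<subseteq> {1..n} \<Longrightarrow> B' \<subseteq> {1..n} \<Longrightarrow> H B B' \<subseteq> carrier (Braid n)"
    and "\<And>B. B \<subseteq> {1..n} \<Longrightarrow> \<one>\<^bsub>Braid n\<^esub> \<in> H B B"
    and "\<And>B B' B'' \<beta> \<beta>'. B \<subseteq> {1..n} \<Longrightarrow> B' \<subseteq> {1..n} \<Longrightarrow> B'' \<subseteq> {1..n} \<Longrightarrow>
      \<beta> \<in> H B B' \<Longrightarrow> \<beta>' \<in> H B' B'' \<Longrightarrow> \<beta> \<otimes>\<^bsub>Braid n\<^esub> \<beta>' \<in> H B B''"
    and "\<And>B B' \<beta>. B \<subseteq> {1..n} \<Longrightarrow> B' \<subseteq> {1..n} \<Longrightarrow> \<beta> \<in> H B B' \<Longrightarrow> inv\<^bsub>Braid n\<^esub> \<beta> \<in> H B' B"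
  shows "groupoid_in (Braid n) (Pow {1..n}) H"
proof -
  have c: "\<beta> \<in> carrier (Braid n)" if "B \<subseteq> {1..n}" "B' \<subseteq> {1..n}" "\<beta> \<in> H B B'" for B B' \<beta>
    using assms(1)[OF that(1,2)] that(3) by blast
  show ?thesis
    unfolding groupoid_in_def
  proof (intro conjI ballI; (unfold Pow_iff)?)
    fix B B' \<beta> assume B: "B \<subseteq> {1..n}" "B' \<subseteq> {1..n}" and \<beta>: "\<beta> \<in> H B B'"
    show "\<exists>h\<in>H B' B. \<beta> \<otimes>\<^bsub>Braid n\<^esub> h = \<one>\<^bsub>Braid n\<^esub> \<and> h \<otimes>\<^bsub>Braid n\<^esub> \<beta> = \<one>\<^bsub>Braid n\<^esub>"
      using assms(4)[OF B \<beta>] braid.r_inv[OF c[OF B \<beta>]] braid.l_inv[OF c[OF B \<beta>]]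
      by (intro bexI[of _ "inv\<^bsub>Braid n\<^esub> \<beta>"] conjI)
    show "\<one>\<^bsub>Braid n\<^esub> \<otimes>\<^bsub>Braid n\<^esub> \<beta> = \<beta>" "\<beta> \<otimes>\<^bsub>Braid n\<^esub> \<one>\<^bsub>Braid n\<^esub> = \<beta>" using c[OF B \<beta>] by simp_all
  next
    fix B0 B1 B2 B3 g h k
    assume "B0 \<subseteq> {1..n}" "B1 \<subseteq> {1..n}" "B2 \<subseteq> {1..n}" "B3 \<subseteq> {1..n}" "g \<in> H B0 B1" "h \<in> H B1 B2" "k \<in> H B2 B3"
    then show "g \<otimes>\<^bsub>Braid n\<^esub> h \<otimes>\<^bsub>Braid n\<^esub> k = g \<otimes>\<^bsub>Braid n\<^esub> (h \<otimes>\<^bsub>Braid n\<^esub> k)"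
      using c by (intro braid.m_assoc) blast+
  qed (use assms(1-3) in \<open>(blast intro: assms(1-3))+\<close>)
qed

lemma boundary_groupoid: "groupoid_in (Braid n) (Pow {1..n}) (boundary_braids n)"
proof (rule groupoid_inI)
  show "\<one>\<^bsub>Braid n\<^esub> \<in> boundary_braids n B B" if "B \<subseteq> {1..n}" for B by (rule fix_boundary[OF one_fix[OF that] that])
  show "boundary_braids n B B' \<subseteq> carrier (Braid n)" for B B' using boundary_carrier by blast
qed (rule boundary_mult boundary_inv; assumption)+

lemma fix_groupoid: "groupoid_in (Braid n) (Pow {1..n}) (fix_hom n)"
proof (rule groupoid_inI)
  show "fix_hom n B B' \<subseteq> carrier (Braid n)" for B B' using fix_carrier by (auto simp: fix_hom_def)
  show "\<one>\<^bsub>Braid n\<^esub> \<in> fix_hom n B B" if "B \<subseteq> {1..n}" for B using one_fix[OF that] by (simp add: fix_hom_def)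
  show "\<beta> \<otimes>\<^bsub>Braid n\<^esub> \<beta>' \<in> fix_hom n B B''"
    if "B \<subseteq> {1..n}" "\<beta> \<in> fix_hom n B B'" "\<beta>' \<in> fix_hom n B' B''" for B B' B'' \<beta> \<beta>'
    using that fix_mult by (auto simp: fix_hom_def split: if_splits)
  show "inv\<^bsub>Braid n\<^esub> \<beta> \<in> fix_hom n B' B" if "B \<subseteq> {1..n}" "\<beta> \<in> fix_hom n B B'" for B B' \<beta>
    using that fix_inv by (auto simp: fix_hom_def split: if_splits)
qed

lemma move_groupoid: "groupoid_in (Braid n) (Pow {1..n}) (move_braids n)"
proof (rule groupoid_inI)
  show "move_braids n B B' \<subseteq> carrier (Braid n)" for B B'
    using boundary_carrier by (auto simp: move_braids_def)
  show "\<one>\<^bsub>Braid n\<^esub> \<in> move_braids n B B" if B: "B \<subseteq> {1..n}" for B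
    unfolding move_braids_iff[OF B B] using affine_perm_id res_image_id[OF B] layered_braid_id[OF B] by metis
  show "\<mu> \<otimes>\<^bsub>Braid n\<^esub> \<mu>' \<in> move_braids n B B''"
    if B: "B \<subseteq> {1..n}" "B' \<subseteq> {1..n}" "B'' \<subseteq> {1..n}"
      and \<mu>: "\<mu> \<in> move_braids n B B'" "\<mu>' \<in> move_braids n B' B''" for B B' B'' \<mu> \<mu>'
  proof -
    obtain w where w: "affine_perm B w" "res_image n w B = B'" "\<mu> = layered_braid B w" using \<mu>(1) move_braids_iff[OF B(1,2)] by blast
    obtain w' where w': "affine_perm B' w'" "res_image n w' B' = B''" "\<mu>' = layered_braid B' w'"
      using \<mu>(2) move_braids_iff[OF B(2,3)] by blast
    have a: "affine_perm (res_image n w B) w'" using w(2) w'(1) by simp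
    show ?thesis
      unfolding move_braids_iff[OF B(1,3)]
    proof (intro exI[of _ "w' \<circ> w"] conjI)
      show "affine_perm B (w' \<circ> w)" by (rule affine_perm_compose(1)[OF w(1) a B(1)])
      show "res_image n (w' \<circ> w) B = B''" using affine_perm_compose(2)[OF w(1) a B(1)] w(2) w'(2) by simp
      show "\<mu> \<otimes>\<^bsub>Braid n\<^esub> \<mu>' = layered_braid B (w' \<circ> w)" using layered_braid_mult[OF w(1) a B(1)] w(2,3) w'(3) by simp
    qed
  qed
  show "inv\<^bsub>Braid n\<^esub> \<mu> \<in> move_braids n B' B"
    if B: "B \<subseteq> {1..n}" "B' \<subseteq> {1..n}" and \<mu>: "\<mu> \<in> move_braids n B B'" for B B' \<mu>
  proof -
    obtain w where w: "affine_perm B w" "res_image n w B = B'" "\<mu> = layered_braid B w" using \<mu> move_braids_iff[OF B] by blast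
    show ?thesis
      unfolding move_braids_iff[OF B(2,1)] w(3) layered_braid_inv[OF w(1) B(1)] unfolding w(2)
      using affine_perm_inv[OF w(1) B(1)] unfolding w(2) by blast
  qed
qed

text \<open>The displacement of \<open>\<beta>\<close> determines the move braid, because fix braids
  have displacement \<open>id\<close>. Dividing by it leaves a boundary braid of displacement
  \<open>id\<close>, which is a fix braid by \<open>displacement_id_fix\<close>.\<close>

lemma fix_move_decomposition:
  assumes B: "B \<subseteq> {1..n}" "B' \<subseteq> {1..n}" and \<beta>: "\<beta> \<in> boundary_braids n B B'"
  shows "\<exists>!\<phi>\<mu>. fst \<phi>\<mu> \<in> fix_braids n B \<and> snd \<phi>\<mu> \<in> move_braids n B B' \<and> \<beta> = fst \<phi>\<mu> \<otimes>\<^bsub>Braid n\<^esub> snd \<phi>\<mu>"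
proof -
  obtain w where w: "affine_perm B w" "displacement B \<beta> w" "res_image n w B = B'" by (rule boundary_affine_perm[OF B \<beta>])
  note c = boundary_carrier[OF \<beta>] and m = layered_braid_carrier[OF w(1) B(1)]
  note i = affine_perm_inv[OF w(1) B(1), unfolded w(3)]
  let ?\<mu> = "layered_braid B w"
  let ?\<phi> = "\<beta> \<otimes>\<^bsub>Braid n\<^esub> inv\<^bsub>Braid n\<^esub> ?\<mu>"
  have "displacement B ?\<phi> (inv_into UNIV w \<circ> w)"
    unfolding layered_braid_inv[OF w(1) B(1)] w(3) by (rule displacement_mult_aff[OF w(1,2) i(1) layered_braid_bdisp[OF i(1) B(2)] w(3) B(1)])
  moreover have "inv_into UNIV w \<circ> w = id" using bij_is_inj[OF affineD(2)[OF w(1)]] by simp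
  ultimately have \<phi>: "?\<phi> \<in> fix_braids n B" using displacement_id_fix[OF _ B(1)] by simp
  have eq: "\<beta> = ?\<phi> \<otimes>\<^bsub>Braid n\<^esub> ?\<mu>" using c m by (simp add: braid.m_assoc)
  show ?thesis
  proof (rule ex1I[of _ "(?\<phi>, ?\<mu>)"])
    show "fst (?\<phi>, ?\<mu>) \<in> fix_braids n B \<and> snd (?\<phi>, ?\<mu>) \<in> move_braids n B B' \<and>
        \<beta> = fst (?\<phi>, ?\<mu>) \<otimes>\<^bsub>Braid n\<^esub> snd (?\<phi>, ?\<mu>)"
      unfolding fst_conv snd_conv move_braids_iff[OF B] using \<phi> eq w(1,3) by blast
    fix \<phi>\<mu> assume a: "fst \<phi>\<mu> \<in> fix_braids n B \<and> snd \<phi>\<mu> \<in> move_braids n B B' \<and> \<beta> = fst \<phi>\<mu> \<otimes>\<^bsub>Braid n\<^esub> snd \<phi>\<mu>"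
    obtain \<phi>' \<mu>' where p: "\<phi>\<mu> = (\<phi>', \<mu>')" by (cases \<phi>\<mu>)
    have f: "\<phi>' \<in> fix_braids n B" and "\<mu>' \<in> move_braids n B B'" and e: "\<beta> = \<phi>' \<otimes>\<^bsub>Braid n\<^esub> \<mu>'"
      using a unfolding p fst_conv snd_conv by blast+
    then obtain w' where w': "affine_perm B w'" "\<mu>' = layered_braid B w'" unfolding move_braids_iff[OF B] by blast
    have "displacement B \<beta> (w' \<circ> id)"
      unfolding e w'(2)
      by (rule displacement_mult_aff[OF affine_perm_id fix_displacement[OF f B(1)] w'(1) layered_braid_bdisp[OF w'(1) B(1)] res_image_id[OF B(1)] B(1)])
    then have "displacement B \<beta> w'" by (simp only: comp_id)
    then have "w' = w" by (rule displacement_aff_unique[OF w'(1) w(1) _ w(2) B(1)])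
    then have mu: "\<mu>' = ?\<mu>" using w'(2) by simp
    have "\<phi>' = ?\<phi>" unfolding e mu using fix_carrier[OF f] m by (simp add: braid.m_assoc)
    then show "\<phi>\<mu> = (?\<phi>, ?\<mu>)" using p mu by simp
  qed
qed

text \<open>A fix braid on either side does not change the displacement, so both move braids have
  the displacement of the common product.\<close>

lemma move_braid_eqI:
  assumes B: "B \<subseteq> {1..n}" "B' \<subseteq> {1..n}" and \<mu>: "\<mu> \<in> move_braids n B B'" "\<mu>' \<in> move_braids n B B'"
    and \<phi>: "\<phi> \<in> fix_braids n B" "\<phi>' \<in> fix_braids n B'" and eq: "\<phi> \<otimes>\<^bsub>Braid n\<^esub> \<mu> = \<mu>' \<otimes>\<^bsub>Braid n\<^esub> \<phi>'"
  shows "\<mu> = \<mu>'"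
proof -
  obtain w where w: "affine_perm B w" "\<mu> = layered_braid B w" using \<mu>(1) move_braids_iff[OF B] by blast
  obtain w' where w': "affine_perm B w'" "res_image n w' B = B'" "\<mu>' = layered_braid B w'" using \<mu>(2) move_braids_iff[OF B] by blast
  have "displacement B (\<phi> \<otimes>\<^bsub>Braid n\<^esub> \<mu>) (w \<circ> id)"
    unfolding w(2)
    by (rule displacement_mult_aff[OF affine_perm_id fix_displacement[OF \<phi>(1) B(1)] w(1) layered_braid_bdisp[OF w(1) B(1)] res_image_id[OF B(1)] B(1)])
  then have "displacement B (\<phi> \<otimes>\<^bsub>Braid n\<^esub> \<mu>) w" by (simp only: comp_id)
  moreover have "displacement B (\<phi> \<otimes>\<^bsub>Braid n\<^esub> \<mu>) (id \<circ> w')"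
    unfolding eq w'(3)
    by (rule displacement_mult_aff[OF w'(1) layered_braid_bdisp[OF w'(1) B(1)] affine_perm_id fix_displacement[OF \<phi>(2) B(2)] w'(2) B(1)])
  then have "displacement B (\<phi> \<otimes>\<^bsub>Braid n\<^esub> \<mu>) w'" by (simp only: id_comp)
  ultimately have "w = w'" by (rule displacement_aff_unique[OF w(1) w'(1) _ _ B(1)])
  then show ?thesis using w(2) w'(3) by simp
qed

end

theorem theorem3:
  fixes n :: nat
  assumes "n \<ge> 3"
  shows "groupoid_in (Braid n) (Pow {1..n}) (boundary_braids n) \<and>
    subgroupoid_in (Braid n) (Pow {1..n}) (fix_hom n) (boundary_braids n) \<and>
    subgroupoid_in (Braid n) (Pow {1..n}) (move_braids n) (boundary_braids n) \<and>
    (\<forall>B B'. B \<subseteq> {1..n} \<and> B' \<subseteq> {1..n} \<and> card B = card B' \<longrightarrow>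
      (\<forall>\<beta>\<in>boundary_braids n B B'. \<exists>!\<phi>\<mu>.
         fst \<phi>\<mu> \<in> fix_braids n B \<and> snd \<phi>\<mu> \<in> move_braids n B B' \<and>
         \<beta> = fst \<phi>\<mu> \<otimes>\<^bsub>Braid n\<^esub> snd \<phi>\<mu>) \<and>
      (\<forall>\<mu>\<in>move_braids n B B'. \<forall>\<mu>'\<in>move_braids n B B'.
         \<forall>\<phi>\<in>fix_braids n B. \<forall>\<phi>'\<in>fix_braids n B'.
           \<phi> \<otimes>\<^bsub>Braid n\<^esub> \<mu> = \<mu>' \<otimes>\<^bsub>Braid n\<^esub> \<phi>' \<longrightarrow> \<mu> = \<mu>'))"
proof -
  interpret ngon n by unfold_locales (rule assms)
  have "fix_hom n B B' \<subseteq> boundary_braids n B B'" if "B \<subseteq> {1..n}" for B B'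
    using fix_boundary[OF _ that] by (auto simp: fix_hom_def)
  then have "subgroupoid_in (Braid n) (Pow {1..n}) (fix_hom n) (boundary_braids n)"
    unfolding subgroupoid_in_def using boundary_groupoid fix_groupoid by blast
  moreover have "subgroupoid_in (Braid n) (Pow {1..n}) (move_braids n) (boundary_braids n)"
    unfolding subgroupoid_in_def using boundary_groupoid move_groupoid by (auto simp: move_braids_def)
  ultimately show ?thesis
  proof (intro conjI allI impI boundary_groupoid; (elim conjE)?)
    fix B B' assume B: "B \<subseteq> {1..n}" "B' \<subseteq> {1..n}"
    show "\<forall>\<beta>\<in>boundary_braids n B B'. \<exists>!\<phi>\<mu>.
         fst \<phi>\<mu> \<in> fix_braids n B \<and> snd \<phi>\<mu> \<in> move_braids n B B' \<and>
         \<beta> = fst \<phi>\<mu> \<otimes>\<^bsub>Braid n\<^esub> snd \<phi>\<mu>"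
      using fix_move_decomposition[OF B] by (rule ballI)
    show "\<forall>\<mu>\<in>move_braids n B B'. \<forall>\<mu>'\<in>move_braids n B B'.
         \<forall>\<phi>\<in>fix_braids n B. \<forall>\<phi>'\<in>fix_braids n B'.
           \<phi> \<otimes>\<^bsub>Braid n\<^esub> \<mu> = \<mu>' \<otimes>\<^bsub>Braid n\<^esub> \<phi>' \<longrightarrow> \<mu> = \<mu>'"
      by (intro ballI impI) (rule move_braid_eqI[OF B])
  qed
qed

end
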